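(* Let $(M,\omega)$ be a near-symplectic $2n$-manifold with singular locus $Z$, let $\omega_Z=\omega|_Z$, $\epsilon=\ker(\omega_Z)\subset TZ$, let $N_Z$ be the normal bundle of $Z$, and let $K=\epsilon\oplus N_Z$ be the rank 4 bundle over $Z$ given by the kernels of $\omega$. Fix a metric $g$ on $K$ for which $\omega|_K$ is self-dual along $Z$, i.e. $\mathrm{Im}(D_K)=\Lambda_+^2K^*$, and let $X$ be a unit vector field spanning $\epsilon$. Then the endomorphism $F\colon N_Z\to N_Z$ given by the composition $$N_Z\xrightarrow{D_K}\Lambda^2_+K^*\xrightarrow{\iota_X}N_Z^*\xrightarrow{\,g\,}N_Z$$ is a self-adjoint, trace-free automorphism. With the sign convention that $F$ has two positive eigenvalues and one negative eigenvalue at each $p\in Z$ (after replacing $X$ by $-X$ if necessary), the normal bundle splits as $$N_Z\simeq L_-\oplus L_+,$$ where $L_-$ is the rank 1 subbundle given by the negative eigenspaces of $F$ and $L_+$ is the rank 2 subbundle, orthogonal to $L_-$, given by the positive eigenspaces of $F$.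
   Context: Near-symplectic forms. Let $M$ be an oriented smooth $2n$-manifold and $\omega\in\Omega^2(M)$ a closed 2-form with $\omega^n\ge 0$ everywhere. At a point $p$ let $K=K_p=\{v\in T_pM\mid \omega_p(v,\cdot)=0\}$. If $\dim K=4$, define $D_K\colon K\to\Lambda^2K^*$ by $D_K(v)=(\nabla_v\omega)_p|_{K\times K}$, the intrinsic gradient of $\omega$ at $p$ in the direction $v$, followed by restriction of 2-forms to $K$ (independent of the connection or local coordinates used to differentiate). The form $\omega$ is near-symplectic if it is closed, $\omega^n\ge0$, and at every point $p$ where $\omega^n_p=0$ the kernel $K$ is 4-dimensional and $\mathrm{Im}(D_K)$ has dimension 3. The singular locus $Z=\{p\in M\mid\omega_p^{n-1}=0\}$ (equivalently, where $\omega_p^n=0$) is a codimension 3 submanifold, and $\omega|_Z$ denotes the pullback of $\omega$ to $Z$, a form of maximal rank. Conventions. $K_p$ is oriented so that, together with the orientation of $T_pM/K_p$ given by $\omega_p^{n-2}$, it induces the orientation of $T_pM$; $\Lambda^2_+K^*$ is the bundle of self-dual 2-forms on $K$ with respect to $g$ and this orientation. $N_Z$ is identified via $g$ with the orthogonal complement of $\epsilon$ in $K$. The map $D_K\colon N_Z\to\Lambda^2_+K^*$ is the restriction of $D_K$ to $N_Z$, the map $\iota_X$ is interior multiplication $\beta\mapsto\iota_X\beta$, and $N_Z^*\to N_Z$ is the isomorphism induced by $g$. *)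

theory Defs
  imports
    "HOL-Analysis.Analysis"
    "HOL-Combinatorics.Permutations"
    "HOL-Library.Function_Algebras"
begin

text \<open>Pointwise vector space structure on functions, so that \<^const>\<open>subspace\<close> and \<^const>\<open>dim\<close>
  apply to spaces of forms.\<close>

instantiation "fun" :: (type, real_vector) real_vector
begin

definition scaleR_fun :: "real \<Rightarrow> ('a \<Rightarrow> 'b) \<Rightarrow> 'a \<Rightarrow> 'b"
  where "scaleR_fun r f = (\<lambda>x. r *\<^sub>R f x)"

instance
  by standard (auto simp: scaleR_fun_def fun_eq_iff scaleR_add_right scaleR_add_left)

end


section \<open>Multilinear algebra\<close>

definition direct_sum :: "'v::real_vector set \<Rightarrow> 'v set \<Rightarrow> 'v set \<Rightarrow> bool"
  where "direct_sum V A B \<longleftrightarrow>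
    subspace A \<and> subspace B \<and> A \<inter> B = {0} \<and> V = {a + b | a b. a \<in> A \<and> b \<in> B}"

definition linear_on_subspace :: "'v::real_vector set \<Rightarrow> ('v \<Rightarrow> 'w::real_vector) \<Rightarrow> bool"
  where "linear_on_subspace V f \<longleftrightarrow>
    (\<forall>u\<in>V. \<forall>v\<in>V. f (u + v) = f u + f v) \<and> (\<forall>r. \<forall>v\<in>V. f (r *\<^sub>R v) = r *\<^sub>R f v)"

definition bilinear_on_subspace :: "'v::real_vector set \<Rightarrow> ('v \<Rightarrow> 'v \<Rightarrow> real) \<Rightarrow> bool"
  where "bilinear_on_subspace V b \<longleftrightarrow>
    (\<forall>w\<in>V. linear_on_subspace V (\<lambda>u. b u w)) \<and> (\<forall>u\<in>V. linear_on_subspace V (b u))"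

definition inner_product_on :: "'v::real_vector set \<Rightarrow> ('v \<Rightarrow> 'v \<Rightarrow> real) \<Rightarrow> bool"
  where "inner_product_on V g \<longleftrightarrow> bilinear_on_subspace V g \<and>
    (\<forall>u\<in>V. \<forall>v\<in>V. g u v = g v u) \<and> (\<forall>v\<in>V. v \<noteq> 0 \<longrightarrow> 0 < g v v)"

text \<open>A form on a subspace \<open>V\<close> is represented by its extension by zero outside \<open>V \<times> V\<close>, which
  makes it determined by its values on \<open>V\<close>.\<close>

definition restrict_form :: "'v set \<Rightarrow> ('v \<Rightarrow> 'v \<Rightarrow> real) \<Rightarrow> 'v \<Rightarrow> 'v \<Rightarrow> real"
  where "restrict_form V b = (\<lambda>u w. if u \<in> V \<and> w \<in> V then b u w else 0)"

definition Alt2 :: "'v::real_vector set \<Rightarrow> ('v \<Rightarrow> 'v \<Rightarrow> real) set"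
  where "Alt2 V = {b. bilinear_on_subspace V b \<and> (\<forall>v\<in>V. b v v = 0) \<and> restrict_form V b = b}"

text \<open>\<open>wedge_power b k v\<close> is the value of \<open>b \<and> \<dots> \<and> b\<close> (\<open>k\<close> factors) on \<open>(v 0, \<dots>, v (2k-1))\<close>, and
  \<open>wedge2 a b v\<close> is that of \<open>a \<and> b\<close> on \<open>(v 0, \<dots>, v 3)\<close>, in the convention where
  \<open>(\<alpha> \<and> \<beta>)(u, v) = \<alpha> u * \<beta> v - \<alpha> v * \<beta> u\<close> for 1-forms.\<close>

definition wedge_power :: "('v \<Rightarrow> 'v \<Rightarrow> real) \<Rightarrow> nat \<Rightarrow> (nat \<Rightarrow> 'v) \<Rightarrow> real"
  where "wedge_power b k v =
    (\<Sum>\<sigma> | \<sigma> permutes {..<2 * k}. of_int (sign \<sigma>) * (\<Prod>i<k. b (v (\<sigma> (2 * i))) (v (\<sigma> (2 * i + 1)))))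
      / 2 ^ k"

definition wedge2 :: "('v \<Rightarrow> 'v \<Rightarrow> real) \<Rightarrow> ('v \<Rightarrow> 'v \<Rightarrow> real) \<Rightarrow> (nat \<Rightarrow> 'v) \<Rightarrow> real"
  where "wedge2 a b v =
    (\<Sum>\<sigma> | \<sigma> permutes {..<4}. of_int (sign \<sigma>) * a (v (\<sigma> 0)) (v (\<sigma> 1)) * b (v (\<sigma> 2)) (v (\<sigma> 3))) / 4"

definition orthonormal_frame :: "'v set \<Rightarrow> ('v \<Rightarrow> 'v \<Rightarrow> real) \<Rightarrow> nat \<Rightarrow> (nat \<Rightarrow> 'v) \<Rightarrow> bool"
  where "orthonormal_frame V g k e \<longleftrightarrow>
    (\<forall>i<k. e i \<in> V) \<and> (\<forall>i<k. \<forall>j<k. g (e i) (e j) = (if i = j then 1 else 0))"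

text \<open>\<open>hodge_dual V g pos b c\<close> says that \<open>c = *b\<close> on the 4-dimensional inner product space \<open>(V, g)\<close>
  whose orientation is given by the predicate \<open>pos\<close> on bases: \<open>a \<and> c = \<langle>a, b\<rangle> vol\<close> for all 2-forms \<open>a\<close>.\<close>

definition hodge_dual ::
  "'v::real_vector set \<Rightarrow> ('v \<Rightarrow> 'v \<Rightarrow> real) \<Rightarrow> ((nat \<Rightarrow> 'v) \<Rightarrow> bool) \<Rightarrow>
    ('v \<Rightarrow> 'v \<Rightarrow> real) \<Rightarrow> ('v \<Rightarrow> 'v \<Rightarrow> real) \<Rightarrow> bool"
  where "hodge_dual V g pos b c \<longleftrightarrow> b \<in> Alt2 V \<and> c \<in> Alt2 V \<and>
    (\<forall>a\<in>Alt2 V. \<forall>e. orthonormal_frame V g 4 e \<and> pos e \<longrightarrow>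
      wedge2 a c e = (\<Sum>j<4. \<Sum>i<j. a (e i) (e j) * b (e i) (e j)))"

definition self_dual_forms ::
  "'v::real_vector set \<Rightarrow> ('v \<Rightarrow> 'v \<Rightarrow> real) \<Rightarrow> ((nat \<Rightarrow> 'v) \<Rightarrow> bool) \<Rightarrow> ('v \<Rightarrow> 'v \<Rightarrow> real) set"
  where "self_dual_forms V g pos = {b. hodge_dual V g pos b b}"

definition self_adjoint_on :: "'v set \<Rightarrow> ('v \<Rightarrow> 'v \<Rightarrow> real) \<Rightarrow> ('v \<Rightarrow> 'v) \<Rightarrow> bool"
  where "self_adjoint_on V g f \<longleftrightarrow> (\<forall>v\<in>V. \<forall>w\<in>V. g (f v) w = g v (f w))"

definition automorphism_on :: "'v::real_vector set \<Rightarrow> ('v \<Rightarrow> 'v) \<Rightarrow> bool"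
  where "automorphism_on V f \<longleftrightarrow> linear_on_subspace V f \<and> bij_betw f V V"

definition trace_on :: "'v::real_vector set \<Rightarrow> ('v \<Rightarrow> 'v) \<Rightarrow> real"
  where "trace_on V f =
    (let B = (SOME B. independent B \<and> span B = V) in \<Sum>b\<in>B. representation B (f b) b)"

definition eigenspace_on :: "'v::real_vector set \<Rightarrow> ('v \<Rightarrow> 'v) \<Rightarrow> real \<Rightarrow> 'v set"
  where "eigenspace_on V f c = {v \<in> V. f v = c *\<^sub>R v}"

text \<open>Number of eigenvalues in \<open>S\<close>, counted with (geometric) multiplicity.\<close>

definition eigenvalue_count :: "'v::real_vector set \<Rightarrow> ('v \<Rightarrow> 'v) \<Rightarrow> real set \<Rightarrow> nat"
  where "eigenvalue_count V f S =
    (\<Sum>c | c \<in> S \<and> eigenspace_on V f c \<noteq> {0}. dim (eigenspace_on V f c))"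

definition positive_eigenspace :: "'v::real_vector set \<Rightarrow> ('v \<Rightarrow> 'v) \<Rightarrow> 'v set"
  where "positive_eigenspace V f = span (\<Union>c\<in>{0<..}. eigenspace_on V f c)"

definition negative_eigenspace :: "'v::real_vector set \<Rightarrow> ('v \<Rightarrow> 'v) \<Rightarrow> 'v set"
  where "negative_eigenspace V f = span (\<Union>c\<in>{..<0}. eigenspace_on V f c)"


section \<open>Oriented smooth manifolds\<close>

text \<open>\<open>C_diff k f S\<close>: \<open>f\<close> is of class \<open>C\<^sup>k\<close> on the open set \<open>S\<close>.\<close>

primrec C_diff :: "nat \<Rightarrow> ('x::euclidean_space \<Rightarrow> 'y::real_normed_vector) \<Rightarrow> 'x set \<Rightarrow> bool"
  where
    "C_diff 0 f S \<longleftrightarrow> continuous_on S f"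
  | "C_diff (Suc k) f S \<longleftrightarrow> f differentiable_on S \<and>
       (\<forall>v. C_diff k (\<lambda>x. frechet_derivative f (at x) v) S)"

definition smooth_on :: "('x::euclidean_space \<Rightarrow> 'y::real_normed_vector) \<Rightarrow> 'x set \<Rightarrow> bool"
  where "smooth_on f S \<longleftrightarrow> open S \<and> (\<forall>k. C_diff k f S)"

type_synonym ('a, 'm) chart = "'a set \<times> ('a \<Rightarrow> real^'m)"

definition chart_image :: "('a, 'm::finite) chart \<Rightarrow> (real^'m) set"
  where "chart_image c = snd c ` fst c"

definition chart_inv :: "('a, 'm::finite) chart \<Rightarrow> real^'m \<Rightarrow> 'a"
  where "chart_inv c = the_inv_into (fst c) (snd c)"

definition is_chart :: "'a topology \<Rightarrow> ('a, 'm::finite) chart \<Rightarrow> bool"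
  where "is_chart M c \<longleftrightarrow> openin M (fst c) \<and> open (chart_image c) \<and>
    homeomorphic_map (subtopology M (fst c)) (top_of_set (chart_image c)) (snd c)"

text \<open>The differential at \<open>p\<close> of the coordinate change from the chart \<open>c\<close> to the chart \<open>d\<close>.\<close>

definition coord_change :: "('a, 'm::finite) chart \<Rightarrow> ('a, 'm) chart \<Rightarrow> 'a \<Rightarrow> real^'m \<Rightarrow> real^'m"
  where "coord_change c d p = frechet_derivative (snd d \<circ> chart_inv c) (at (snd c p))"

text \<open>The orientation is the one for which all charts of the atlas are orientation preserving, where
  the coordinates of \<open>real^'m\<close> are ordered by the order of \<open>'m\<close>.\<close>

definition oriented_smooth_manifold :: "'a topology \<Rightarrow> ('a, 'm::{finite,wellorder}) chart set \<Rightarrow> bool"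
  where "oriented_smooth_manifold M A \<longleftrightarrow>
    Hausdorff_space M \<and> second_countable M \<and>
    (\<forall>c\<in>A. is_chart M c) \<and> (\<Union>c\<in>A. fst c) = topspace M \<and>
    (\<forall>c\<in>A. \<forall>d\<in>A. smooth_on (snd d \<circ> chart_inv c) (snd c ` (fst c \<inter> fst d)) \<and>
      (\<forall>p\<in>fst c \<inter> fst d. 0 < det (matrix (coord_change c d p))))"

text \<open>The tangent space at \<open>p\<close> is modelled on \<open>real^'m\<close> through the differential of an arbitrarily
  chosen chart \<open>chart_at A p\<close>; \<open>tangent_coords A c p\<close> is then the differential at \<open>p\<close> of any
  other chart \<open>c\<close>, and \<open>tangent_vector A c p\<close> is its inverse. Tensors and vector fields are families,
  indexed by \<open>p\<close>, of tensors and vectors on these tangent spaces. Since \<open>chart_at A p\<close> varies in an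
  uncontrolled way with \<open>p\<close>, smoothness always refers to the components in a fixed chart \<open>c\<close>.\<close>

definition chart_at :: "('a, 'm::finite) chart set \<Rightarrow> 'a \<Rightarrow> ('a, 'm) chart"
  where "chart_at A p = (SOME c. c \<in> A \<and> p \<in> fst c)"

definition tangent_coords ::
  "('a, 'm::finite) chart set \<Rightarrow> ('a, 'm) chart \<Rightarrow> 'a \<Rightarrow> real^'m \<Rightarrow> real^'m"
  where "tangent_coords A c p = coord_change (chart_at A p) c p"

definition tangent_vector ::
  "('a, 'm::finite) chart set \<Rightarrow> ('a, 'm) chart \<Rightarrow> 'a \<Rightarrow> real^'m \<Rightarrow> real^'m"
  where "tangent_vector A c p = coord_change c (chart_at A p) p"

text \<open>\<open>v 0, \<dots>, v (CARD('m) - 1)\<close> is a positively oriented basis of a tangent space.\<close>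

definition positive_frame :: "(nat \<Rightarrow> real^'m::{finite,wellorder}) \<Rightarrow> bool"
  where "positive_frame v \<longleftrightarrow> 0 < det (\<chi> i. v (card {j. j < i}))"

text \<open>Tangent space of a subset \<open>Z\<close> (in practice a submanifold): velocities of smooth curves in \<open>Z\<close>.\<close>

definition tangent_space ::
  "('a, 'm::finite) chart set \<Rightarrow> 'a set \<Rightarrow> 'a \<Rightarrow> (real^'m) set"
  where "tangent_space A Z p = {v. \<exists>\<gamma> \<delta>. 0 < \<delta> \<and> \<gamma> 0 = p \<and>
    \<gamma> ` {-\<delta><..<\<delta>} \<subseteq> Z \<inter> fst (chart_at A p) \<and>
    smooth_on (snd (chart_at A p) \<circ> \<gamma>) {-\<delta><..<\<delta>} \<and>
    (snd (chart_at A p) \<circ> \<gamma> has_vector_derivative v) (at (0::real))}"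

text \<open>Smoothness along an arbitrary subset \<open>S\<close> means existence of local smooth extensions; for a
  submanifold \<open>S\<close> this is smoothness on \<open>S\<close>. Vector fields along \<open>S\<close> are sections of \<open>TM|\<^sub>S\<close>.\<close>

definition smooth_function_along ::
  "('a, 'm::finite) chart set \<Rightarrow> 'a set \<Rightarrow> ('a \<Rightarrow> real) \<Rightarrow> bool"
  where "smooth_function_along A S h \<longleftrightarrow>
    (\<forall>c\<in>A. \<forall>p\<in>S \<inter> fst c. \<exists>V f. snd c p \<in> V \<and> smooth_on f V \<and>
      (\<forall>q\<in>S \<inter> fst c. snd c q \<in> V \<longrightarrow> f (snd c q) = h q))"

definition smooth_field_along ::
  "('a, 'm::finite) chart set \<Rightarrow> 'a set \<Rightarrow> ('a \<Rightarrow> real^'m) \<Rightarrow> bool"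
  where "smooth_field_along A S s \<longleftrightarrow>
    (\<forall>c\<in>A. \<forall>p\<in>S \<inter> fst c. \<exists>V f. snd c p \<in> V \<and> smooth_on f V \<and>
      (\<forall>q\<in>S \<inter> fst c. snd c q \<in> V \<longrightarrow> f (snd c q) = tangent_coords A c q (s q)))"

definition smooth_section_along ::
  "('a, 'm::finite) chart set \<Rightarrow> 'a set \<Rightarrow> ('a \<Rightarrow> (real^'m) set) \<Rightarrow> ('a \<Rightarrow> real^'m) \<Rightarrow> bool"
  where "smooth_section_along A S E s \<longleftrightarrow> smooth_field_along A S s \<and> (\<forall>q\<in>S. s q \<in> E q)"

text \<open>Smooth rank \<open>k\<close> subbundles of \<open>TM|\<^sub>Z\<close>, smooth fibre metrics and smooth bundle endomorphisms;
  the last two are tested on local smooth sections.\<close>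

definition smooth_subbundle ::
  "'a topology \<Rightarrow> ('a, 'm::finite) chart set \<Rightarrow> 'a set \<Rightarrow> nat \<Rightarrow> ('a \<Rightarrow> (real^'m) set) \<Rightarrow> bool"
  where "smooth_subbundle M A Z k E \<longleftrightarrow>
    (\<forall>p\<in>Z. subspace (E p) \<and> dim (E p) = k) \<and>
    (\<forall>p\<in>Z. \<exists>U s. openin M U \<and> p \<in> U \<and>
      (\<forall>i<k. smooth_section_along A (Z \<inter> U) E (s i)) \<and>
      (\<forall>q\<in>Z \<inter> U. span ((\<lambda>i. s i q) ` {..<k}) = E q))"

definition fibre_metric ::
  "'a topology \<Rightarrow> ('a, 'm::finite) chart set \<Rightarrow> 'a set \<Rightarrow> ('a \<Rightarrow> (real^'m) set) \<Rightarrow>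
    ('a \<Rightarrow> real^'m \<Rightarrow> real^'m \<Rightarrow> real) \<Rightarrow> bool"
  where "fibre_metric M A Z E g \<longleftrightarrow>
    (\<forall>p\<in>Z. inner_product_on (E p) (g p)) \<and>
    (\<forall>U s t. openin M U \<and> smooth_section_along A (Z \<inter> U) E s \<and> smooth_section_along A (Z \<inter> U) E t
      \<longrightarrow> smooth_function_along A (Z \<inter> U) (\<lambda>q. g q (s q) (t q)))"

definition smooth_bundle_endomorphism ::
  "'a topology \<Rightarrow> ('a, 'm::finite) chart set \<Rightarrow> 'a set \<Rightarrow> ('a \<Rightarrow> (real^'m) set) \<Rightarrow>
    ('a \<Rightarrow> real^'m \<Rightarrow> real^'m) \<Rightarrow> bool"
  where "smooth_bundle_endomorphism M A Z E F \<longleftrightarrow>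
    (\<forall>p\<in>Z. linear_on_subspace (E p) (F p) \<and> F p ` E p \<subseteq> E p) \<and>
    (\<forall>U s. openin M U \<and> smooth_section_along A (Z \<inter> U) E s
      \<longrightarrow> smooth_section_along A (Z \<inter> U) E (\<lambda>q. F q (s q)))"


section \<open>Near-symplectic forms\<close>

type_synonym ('a, 'm) form2 = "'a \<Rightarrow> real^'m \<Rightarrow> real^'m \<Rightarrow> real"

text \<open>\<open>local_form A \<omega> c x u w\<close> is the value at \<open>x\<close> of \<open>\<omega>\<close>, expressed in the chart \<open>c\<close>, on \<open>u, w\<close>.\<close>

definition local_form ::
  "('a, 'm::finite) chart set \<Rightarrow> ('a, 'm) form2 \<Rightarrow> ('a, 'm) chart \<Rightarrow>
    real^'m \<Rightarrow> real^'m \<Rightarrow> real^'m \<Rightarrow> real"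
  where "local_form A \<omega> c x u w =
    (let p = chart_inv c x in \<omega> p (tangent_vector A c p u) (tangent_vector A c p w))"

definition smooth_2form ::
  "'a topology \<Rightarrow> ('a, 'm::finite) chart set \<Rightarrow> ('a, 'm) form2 \<Rightarrow> bool"
  where "smooth_2form M A \<omega> \<longleftrightarrow>
    (\<forall>p\<in>topspace M. bilinear (\<omega> p) \<and> (\<forall>v. \<omega> p v v = 0)) \<and>
    (\<forall>c\<in>A. \<forall>u w. smooth_on (\<lambda>x. local_form A \<omega> c x u w) (chart_image c))"

text \<open>The derivative, in the chart \<open>c\<close>, of \<open>\<omega>\<close> in direction \<open>v\<close> (all vectors in \<open>c\<close>-coordinates).\<close>

definition local_deriv ::
  "('a, 'm::finite) chart set \<Rightarrow> ('a, 'm) form2 \<Rightarrow> ('a, 'm) chart \<Rightarrow>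
    real^'m \<Rightarrow> real^'m \<Rightarrow> real^'m \<Rightarrow> real^'m \<Rightarrow> real"
  where "local_deriv A \<omega> c x v u w =
    frechet_derivative (\<lambda>y. local_form A \<omega> c y u w) (at x) v"

definition closed_2form :: "('a, 'm::finite) chart set \<Rightarrow> ('a, 'm) form2 \<Rightarrow> bool"
  where "closed_2form A \<omega> \<longleftrightarrow> (\<forall>c\<in>A. \<forall>x\<in>chart_image c. \<forall>u v w.
    local_deriv A \<omega> c x u v w + local_deriv A \<omega> c x v w u + local_deriv A \<omega> c x w u v = 0)"

definition kernel_at :: "('a, 'm::finite) form2 \<Rightarrow> 'a \<Rightarrow> (real^'m) set"
  where "kernel_at \<omega> p = {v. \<forall>w. \<omega> p v w = 0}"

text \<open>The intrinsic gradient \<open>v \<mapsto> (\<nabla>\<^sub>v \<omega>)|\<^sub>K\<close>. On the kernel \<open>K\<close> it does not depend on the coordinates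
  used, so it is computed in the chart through which the tangent space at \<open>p\<close> is modelled.\<close>

definition D_K ::
  "('a, 'm::finite) chart set \<Rightarrow> ('a, 'm) form2 \<Rightarrow> 'a \<Rightarrow> real^'m \<Rightarrow> real^'m \<Rightarrow> real^'m \<Rightarrow> real"
  where "D_K A \<omega> p v = restrict_form (kernel_at \<omega> p)
    (local_deriv A \<omega> (chart_at A p) (snd (chart_at A p) p) v)"

definition near_symplectic ::
  "'a topology \<Rightarrow> ('a, 'm::{finite,wellorder}) chart set \<Rightarrow> nat \<Rightarrow> ('a, 'm) form2 \<Rightarrow> bool"
  where "near_symplectic M A n \<omega> \<longleftrightarrow> smooth_2form M A \<omega> \<and> closed_2form A \<omega> \<and>
    (\<forall>p\<in>topspace M. \<forall>v. positive_frame v \<longrightarrow> 0 \<le> wedge_power (\<omega> p) n v) \<and>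
    (\<forall>p\<in>topspace M. (\<forall>v. wedge_power (\<omega> p) n v = 0) \<longrightarrow>
      dim (kernel_at \<omega> p) = 4 \<and> dim (D_K A \<omega> p ` kernel_at \<omega> p) = 3)"

definition singular_locus :: "'a topology \<Rightarrow> nat \<Rightarrow> ('a, 'm::finite) form2 \<Rightarrow> 'a set"
  where "singular_locus M n \<omega> = {p \<in> topspace M. \<forall>v. wedge_power (\<omega> p) (n - 1) v = 0}"

text \<open>The line field \<open>\<epsilon> = ker (\<omega>|\<^sub>Z) \<subseteq> TZ\<close>.\<close>

definition epsilon_at ::
  "('a, 'm::finite) chart set \<Rightarrow> 'a set \<Rightarrow> ('a, 'm) form2 \<Rightarrow> 'a \<Rightarrow> (real^'m) set"
  where "epsilon_at A Z \<omega> p =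
    {v \<in> tangent_space A Z p. \<forall>w\<in>tangent_space A Z p. \<omega> p v w = 0}"

text \<open>Orientation of \<open>K\<close>: \<open>e 0, \<dots>, e 3\<close> is positive if, followed by vectors that are positively
  oriented in \<open>T\<^sub>pM/K\<close> for \<open>\<omega>\<^sup>n\<^sup>-\<^sup>2\<close>, it becomes a positively oriented basis of \<open>T\<^sub>pM\<close>.\<close>

definition positive_kernel_frame ::
  "nat \<Rightarrow> ('a, 'm::{finite,wellorder}) form2 \<Rightarrow> 'a \<Rightarrow> (nat \<Rightarrow> real^'m::{finite,wellorder}) \<Rightarrow> bool"
  where "positive_kernel_frame n \<omega> p e \<longleftrightarrow>
    (\<exists>u. 0 < wedge_power (\<omega> p) (n - 2) u \<and> positive_frame (\<lambda>k. if k < 4 then e k else u (k - 4)))"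

text \<open>The normal bundle of \<open>Z\<close>, identified with the orthogonal complement of \<open>\<epsilon>\<close> in \<open>K\<close>.\<close>

definition normal_at ::
  "('a, 'm::finite) chart set \<Rightarrow> 'a set \<Rightarrow> ('a, 'm) form2 \<Rightarrow> ('a, 'm) form2 \<Rightarrow> 'a \<Rightarrow> (real^'m) set"
  where "normal_at A Z \<omega> g p = {v \<in> kernel_at \<omega> p. \<forall>x\<in>epsilon_at A Z \<omega> p. g p v x = 0}"

definition unit_field_spanning ::
  "('a, 'm::finite) chart set \<Rightarrow> 'a set \<Rightarrow> ('a \<Rightarrow> (real^'m) set) \<Rightarrow> ('a, 'm) form2 \<Rightarrow>
    ('a \<Rightarrow> real^'m) \<Rightarrow> bool"
  where "unit_field_spanning A Z E g X \<longleftrightarrow> smooth_field_along A Z X \<and>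
    (\<forall>p\<in>Z. span {X p} = E p \<and> g p (X p) (X p) = 1)"

definition interior :: "'v \<Rightarrow> ('v \<Rightarrow> 'v \<Rightarrow> real) \<Rightarrow> 'v \<Rightarrow> real"
  where "interior x b = (\<lambda>w. b x w)"

text \<open>The isomorphism \<open>V\<^sup>* \<rightarrow> V\<close> induced by the inner product \<open>g\<close> on \<open>V\<close>.\<close>

definition sharp :: "'v set \<Rightarrow> ('v \<Rightarrow> 'v \<Rightarrow> real) \<Rightarrow> ('v \<Rightarrow> real) \<Rightarrow> 'v"
  where "sharp V g a = (THE v. v \<in> V \<and> (\<forall>w\<in>V. g v w = a w))"

definition normal_endo ::
  "('a, 'm::finite) chart set \<Rightarrow> 'a set \<Rightarrow> ('a, 'm) form2 \<Rightarrow> ('a, 'm) form2 \<Rightarrow>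
    ('a \<Rightarrow> real^'m) \<Rightarrow> 'a \<Rightarrow> real^'m \<Rightarrow> real^'m"
  where "normal_endo A Z \<omega> g X p v =
    sharp (normal_at A Z \<omega> g p) (g p) (interior (X p) (D_K A \<omega> p v))"

definition sign_convention :: "'a set \<Rightarrow> ('a \<Rightarrow> 'v::real_vector set) \<Rightarrow> ('a \<Rightarrow> 'v \<Rightarrow> 'v) \<Rightarrow> bool"
  where "sign_convention Z N F \<longleftrightarrow>
    (\<forall>p\<in>Z. eigenvalue_count (N p) (F p) {0<..} = 2 \<and> eigenvalue_count (N p) (F p) {..<0} = 1)"

end

theory Submission
  imports Defs
begin

text \<open>
  Near a point of \<open>Z\<close> extend a frame of \<open>K\<close> to vector fields \<open>e\<^sub>0, \<dots>, e\<^sub>3\<close> that are \<open>\<omega>\<close>-orthogonal to a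
  fixed complement. The Gram matrix \<open>\<sigma>\<close> of \<open>\<omega>\<close> in this frame vanishes exactly on \<open>Z\<close>, and
  \<open>\<omega>\<^sup>n \<ge> 0\<close> says that its Pfaffian \<open>(|\<sigma>\<^sub>+|\<^sup>2 - |\<sigma>\<^sub>-|\<^sup>2) / 4\<close> is nonnegative. Hence \<open>\<sigma> = 0\<close> is equivalent to
  \<open>\<sigma>\<^sub>+ = 0\<close>, the derivative of \<open>\<sigma>\<close> takes self-dual values in every direction, and \<open>Z\<close> is cut out
  transversally by the three components of \<open>\<sigma>\<^sub>+\<close>; so \<open>T\<^sub>pZ\<close> consists of the directions with
  \<open>(\<nabla>\<^sub>v \<omega>)|\<^sub>K = 0\<close>, and \<open>\<epsilon>\<close> is the kernel of \<open>D\<^sub>K\<close>.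

  On \<open>N\<close> one has \<open>g (F v) w = (D\<^sub>K v) X w\<close>. Since \<open>D\<^sub>K X = 0\<close>, \<open>d\<omega> = 0\<close> makes this form symmetric;
  self-duality rewrites its trace as a cyclic sum that vanishes again by \<open>d\<omega> = 0\<close>. The eigenvalues are
  therefore nonzero reals with sum zero, and \<open>X\<close> is oriented by the sign of their product, which is
  \<open>tr F\<^sup>3 / 3\<close>. The negative eigenvalue \<open>\<lambda>\<close> is a simple root of \<open>t\<^sup>3 - c t - tr F\<^sup>3 / 3\<close> with \<open>c = tr F\<^sup>2 / 2\<close>,
  hence smooth, and \<open>L\<^sub>-\<close>, \<open>L\<^sub>+\<close> are the images of \<open>F\<^sup>2 + \<lambda> F + (\<lambda>\<^sup>2 - c)\<close> and \<open>F - \<lambda>\<close>.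
\<close>

section \<open>Smooth calculus\<close>

text \<open>The hypothesis controls the gradient of \<open>\<omega>\<close> only in kernel
  directions, whereas the tangent space of Z involves all directions. The bridge is to subtract from
  a direction a kernel vector with the same self-dual gradient, available because \<open>D_K\<close>
  is onto the self-dual forms. What remains is anti-self-dual, so its Pfaffian is at most 0, with
  equality only for 0; as a limit of nonnegative quantities it is also at least 0. Smoothness meets
  two obstacles. \<open>D_K\<close> is computed at each point in an arbitrarily chosen chart, so its
  independence of the chart on K is what makes F smooth. And the two positive eigenvalues may cross,
  where they and their eigenvectors need not be smooth; therefore only power sums of the eigenvalues
  and the one simple root enter, and polynomials in F replace the spectral projections. Since F is
  trace-free and invertible, tr F^3 never vanishes, and dividing it by its absolute value settles
  the sign of X on all components of Z at once.\<close>

lemma has_derivative_frechet: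
  assumes "f differentiable_on S" "open S" "x \<in> S"
  shows "(f has_derivative frechet_derivative f (at x)) (at x)"
  using assms by (metis at_within_open differentiable_on_def frechet_derivative_works)

lemma frechet_derivative_cong:
  assumes "open S" "x \<in> S" "\<And>y. y \<in> S \<Longrightarrow> f y = g y"
  shows "frechet_derivative f (at x) = frechet_derivative g (at x)"
proof -
  have "(f has_derivative f') (at x) \<longleftrightarrow> (g has_derivative f') (at x)" for f'
    using assms has_derivative_transform_within_open[of f f' x UNIV S g]
      has_derivative_transform_within_open[of g f' x UNIV S f] by metis
  then show ?thesis
    unfolding frechet_derivative_def by simp
qed

lemma C_diff_cong:
  assumes "open S" "\<And>x. x \<in> S \<Longrightarrow> f x = g x" "C_diff k f S"
  shows "C_diff k g S"
  using assms
proof (induction k arbitrary: f g)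
  case 0
  then show ?case
    by (metis C_diff.simps(1) continuous_on_cong)
next
  case (Suc k)
  have "C_diff k (\<lambda>x. frechet_derivative g (at x) v) S" for v
    by (rule Suc.IH[of "\<lambda>x. frechet_derivative f (at x) v"])
      (use Suc.prems frechet_derivative_cong[OF Suc.prems(1) _ Suc.prems(2)] in auto)
  moreover have "g differentiable_on S"
    using Suc.prems unfolding C_diff.simps differentiable_on_def differentiable_def
    by (metis has_derivative_transform)
  ultimately show ?case by simp
qed

lemma C_diff_subset:
  "C_diff k f S \<Longrightarrow> T \<subseteq> S \<Longrightarrow> C_diff k f T"
  by (induction k arbitrary: f) (auto intro: continuous_on_subset differentiable_on_subset)

lemma C_diff_imp_continuous: "C_diff k f S \<Longrightarrow> continuous_on S f"
  by (cases k) (auto intro: differentiable_imp_continuous_on)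

lemma C_diff_Suc_imp: "C_diff (Suc k) f S \<Longrightarrow> C_diff k f S"
proof (induction k arbitrary: f)
  case 0
  then show ?case using C_diff_imp_continuous[of "Suc 0" f S] by simp
next
  case (Suc k)
  then show ?case by simp
qed

text \<open>\<open>C_diff\<close> refers to \<open>frechet_derivative\<close>, a chosen derivative;
  uniqueness of derivatives at points of an open set lets an explicit formula \<open>f'\<close> take
  its place. Most closure rules below are inductions through this rule.\<close>

lemma C_diff_SucI:
  assumes "open S" "\<And>x. x \<in> S \<Longrightarrow> (f has_derivative f' x) (at x)"
    "\<And>v. C_diff k (\<lambda>x. f' x v) S"
  shows "C_diff (Suc k) f S"
proof -
  have "frechet_derivative f (at x) = f' x" if "x \<in> S" for x
    using assms(2)[OF that] frechet_derivative_at by metis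
  then have "C_diff k (\<lambda>x. frechet_derivative f (at x) v) S" for v
    by (intro C_diff_cong[OF assms(1) _ assms(3)[of v]]) simp
  then show ?thesis
    using assms(2) by (auto simp: differentiable_on_def differentiable_def
        intro: has_derivative_at_withinI)
qed

section \<open>Closure of class C^k under products, quotients and composition\<close>

lemma C_diff_const: "open S \<Longrightarrow> C_diff k (\<lambda>x. c) S"
proof (induction k arbitrary: c)
  case (Suc k)
  show ?case by (rule C_diff_SucI[where f' = "\<lambda>x v. 0"]) (use Suc in auto)
qed auto

lemma C_diff_bounded_linear:
  assumes "bounded_linear f" "open S" shows "C_diff k f S"
proof (cases k)
  case 0
  then show ?thesis using assms(1) by (simp add: linear_continuous_on)
next
  case (Suc j)
  then show ?thesis
    using C_diff_SucI[where f' = "\<lambda>x. f"] C_diff_const assms bounded_linear_imp_has_derivative by blast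
qed

lemma C_diff_bounded_linear_comp:
  assumes "bounded_linear L" "open S" "C_diff k f S" shows "C_diff k (\<lambda>x. L (f x)) S"
  using assms(3)
proof (induction k arbitrary: f)
  case 0
  then show ?case using assms(1) by (simp add: bounded_linear.continuous_on)
next
  case (Suc k)
  show ?case
  proof (rule C_diff_SucI[where f' = "\<lambda>x v. L (frechet_derivative f (at x) v)"])
    show "((\<lambda>x. L (f x)) has_derivative (\<lambda>v. L (frechet_derivative f (at x) v))) (at x)" if "x \<in> S" for x
      using bounded_linear.has_derivative[OF assms(1) has_derivative_frechet] Suc.prems that assms(2) by auto
  qed (use Suc assms in auto)
qed

lemma C_diff_add:
  assumes "open S" "C_diff k f S" "C_diff k g S" shows "C_diff k (\<lambda>x. f x + g x) S"
  using assms(2,3)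
proof (induction k arbitrary: f g)
  case 0
  then show ?case by (simp add: continuous_on_add)
next
  case (Suc k)
  show ?case
    by (rule C_diff_SucI[OF assms(1), where f' = "\<lambda>x v. frechet_derivative f (at x) v + frechet_derivative g (at x) v"])
      (use Suc assms(1) in \<open>auto intro!: has_derivative_add has_derivative_frechet\<close>)
qed

lemma C_diff_sum:
  assumes "open S" "\<And>i. i \<in> I \<Longrightarrow> C_diff k (f i) S" shows "C_diff k (\<lambda>x. \<Sum>i\<in>I. f i x) S"
  using assms(2)
  by (induction I rule: infinite_finite_induct) (auto intro: C_diff_const C_diff_add assms(1))

text \<open>By the Leibniz rule the derivative in a fixed direction is a sum of two values of
  \<open>B\<close>, each involving one derivative, so the induction runs with \<open>f\<close> and
  \<open>g\<close> arbitrary. The product rules for scaling, multiplication and the inner product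
  are instances.\<close>

lemma C_diff_bilinear:
  assumes B: "bounded_bilinear B" and "open S" "C_diff k f S" "C_diff k g S"
  shows "C_diff k (\<lambda>x. B (f x) (g x)) S"
  using assms(3,4)
proof (induction k arbitrary: f g)
  case 0
  then show ?case using B by (simp add: bounded_bilinear.continuous_on)
next
  case (Suc k)
  have "C_diff k f S" "C_diff k g S" using Suc.prems C_diff_Suc_imp by blast+
  then show ?case
    by (intro C_diff_SucI[OF assms(2), where f' = "\<lambda>x v. B (f x) (frechet_derivative g (at x) v) + B (frechet_derivative f (at x) v) (g x)"]
        C_diff_add[OF assms(2)] Suc.IH bounded_bilinear.FDERIV[OF B] has_derivative_frechet)
      (use Suc.prems assms(2) in auto)
qed

lemmas C_diff_scaleR = C_diff_bilinear[OF bounded_bilinear_scaleR]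
lemmas C_diff_mult = C_diff_bilinear[OF bounded_bilinear_mult]
lemmas C_diff_inner = C_diff_bilinear[OF bounded_bilinear_inner]

lemma C_diff_uminus: "open S \<Longrightarrow> C_diff k f S \<Longrightarrow> C_diff k (\<lambda>x. - f x) S"
  by (rule C_diff_bounded_linear_comp[OF bounded_linear_minus[OF bounded_linear_ident]])

lemma C_diff_diff:
  "open S \<Longrightarrow> C_diff k f S \<Longrightarrow> C_diff k g S \<Longrightarrow> C_diff k (\<lambda>x. f x - g x) S"
  using C_diff_add[of S k f "\<lambda>x. - g x"] C_diff_uminus by auto

lemma C_diff_prod:
  fixes f :: "'i \<Rightarrow> 'x::euclidean_space \<Rightarrow> real"
  assumes "open S" "\<And>i. i \<in> I \<Longrightarrow> C_diff k (f i) S" shows "C_diff k (\<lambda>x. \<Prod>i\<in>I. f i x) S"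
  using assms(2)
  by (induction I rule: infinite_finite_induct) (auto intro: C_diff_const C_diff_mult assms(1))

lemma C_diff_componentwise:
  fixes f :: "'x::euclidean_space \<Rightarrow> 'y::euclidean_space"
  assumes "open S" "\<And>i. i \<in> Basis \<Longrightarrow> C_diff k (\<lambda>x. f x \<bullet> i) S"
  shows "C_diff k f S"
proof -
  have "C_diff k (\<lambda>x. \<Sum>i\<in>Basis. (f x \<bullet> i) *\<^sub>R i) S"
    by (intro C_diff_sum C_diff_scaleR C_diff_const assms)
  then show ?thesis by (simp add: euclidean_representation)
qed

text \<open>In the chain rule the direction fed to the derivative of \<open>g\<close> varies with
  \<open>x\<close>. Expanding it in the standard basis leaves derivatives in fixed directions, to
  which the induction hypothesis applies, with scalar coefficients taken from the derivative of
  \<open>f\<close>.\<close>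

lemma C_diff_compose:
  fixes f :: "'x::euclidean_space \<Rightarrow> 'y::euclidean_space" and g :: "'y \<Rightarrow> 'z::real_normed_vector"
  assumes S: "open S" and T: "open T" and "f ` S \<subseteq> T" "C_diff k f S" "C_diff k g T"
  shows "C_diff k (\<lambda>x. g (f x)) S"
  using assms(3-)
proof (induction k arbitrary: g)
  case 0
  then show ?case using continuous_on_compose2[of T g S f] by simp
next
  case (Suc k)
  let ?f' = "\<lambda>x. frechet_derivative f (at x)" and ?g' = "\<lambda>x. frechet_derivative g (at x)"
  have df: "(f has_derivative ?f' x) (at x)" if "x \<in> S" for x
    using has_derivative_frechet Suc.prems S that by auto
  have dg: "(g has_derivative ?g' x) (at x)" if "x \<in> T" for x
    using has_derivative_frechet Suc.prems T that by auto
  show ?case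
  proof (rule C_diff_SucI[OF S])
    show "((\<lambda>x. g (f x)) has_derivative (\<lambda>v. \<Sum>i\<in>Basis. (?f' x v \<bullet> i) *\<^sub>R ?g' (f x) i)) (at x)"
      if "x \<in> S" for x
    proof -
      have fx: "f x \<in> T" using that Suc.prems by auto
      have "?g' (f x) (?f' x v) = (\<Sum>i\<in>Basis. (?f' x v \<bullet> i) *\<^sub>R ?g' (f x) i)" for v
      proof -
        have lin: "linear (?g' (f x))" using dg[OF fx] has_derivative_linear by blast
        show ?thesis
          by (subst euclidean_representation[of "?f' x v", symmetric])
            (simp only: linear_sum[OF lin] linear_cmul[OF lin])
      qed
      then show ?thesis
        using has_derivative_compose[OF df[OF that] dg[OF fx]] by (simp add: o_def)
    qed
    have "C_diff k f S" using Suc.prems C_diff_Suc_imp by blast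
    then have "C_diff k (\<lambda>x. ?g' (f x) i) S" for i
      using Suc.IH[of "\<lambda>x. ?g' x i"] Suc.prems by auto
    then show "C_diff k (\<lambda>x. \<Sum>i\<in>Basis. (?f' x v \<bullet> i) *\<^sub>R ?g' (f x) i) S" for v
      using Suc.prems by (intro C_diff_sum C_diff_scaleR C_diff_inner C_diff_const S) auto
  qed
qed

text \<open>The exponent is arbitrary because differentiation lowers it by one; the exponent -1/2 is
  what later normalises vectors and extracts signs.\<close>

lemma C_diff_powr: "C_diff k (\<lambda>t::real. t powr a) {0<..}"
proof (induction k arbitrary: a)
  case 0
  then show ?case by (simp, intro continuous_intros) auto
next
  case (Suc k)
  show ?case
  proof (rule C_diff_SucI[where f' = "\<lambda>t v. a * t powr (a - 1) * v"])
    show "((\<lambda>t. t powr a) has_derivative (\<lambda>v. a * t powr (a - 1) * v)) (at t)" if "t \<in> {0<..}" for t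
      using has_real_derivative_powr[of t a] that by (simp add: has_field_derivative_def mult_commute_abs)
  qed (intro C_diff_mult C_diff_const Suc open_greaterThan)+
qed

lemma C_diff_inverse: "C_diff k (\<lambda>t::real. inverse t) (-{0})"
proof (induction k)
  case 0
  then show ?case by (simp, intro continuous_intros) auto
next
  case (Suc k)
  show ?case
  proof (rule C_diff_SucI[where f' = "\<lambda>t v. - (inverse t * v * inverse t)"])
    show "(inverse has_derivative (\<lambda>v. - (inverse t * v * inverse t))) (at t)" if "t \<in> -{0}" for t :: real
      using that by (intro has_derivative_inverse') simp
  qed (auto intro!: C_diff_mult C_diff_const C_diff_uminus Suc)
qed

lemma C_diff_divide:
  fixes f :: "'x::euclidean_space \<Rightarrow> real"
  assumes "open S" "C_diff k f S" "C_diff k g S" "\<And>x. x \<in> S \<Longrightarrow> g x \<noteq> 0"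
  shows "C_diff k (\<lambda>x. f x / g x) S"
proof -
  have "C_diff k (\<lambda>x. inverse (g x)) S"
    by (rule C_diff_compose[where T = "-{0}" and g = inverse]) (use assms C_diff_inverse in auto)
  then show ?thesis
    using C_diff_mult[OF assms(1,2)] by (simp add: divide_inverse)
qed

section \<open>Linear systems and inverse functions\<close>

lemma C_diff_det:
  fixes A :: "'x::euclidean_space \<Rightarrow> real^'n^'n"
  assumes "open S" "\<And>i j. C_diff k (\<lambda>x. A x $ i $ j) S"
  shows "C_diff k (\<lambda>x. det (A x)) S"
  unfolding det_def by (intro C_diff_sum C_diff_mult C_diff_const C_diff_prod assms)

lemma C_diff_vec_nth:
  fixes f :: "'x::euclidean_space \<Rightarrow> 'y::euclidean_space^'n"
  shows "open S \<Longrightarrow> C_diff k f S \<Longrightarrow> C_diff k (\<lambda>x. f x $ i) S"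
  by (rule C_diff_bounded_linear_comp[OF bounded_linear_vec_nth])

lemma C_diff_vec_lambda:
  fixes f :: "'x::euclidean_space \<Rightarrow> real^'n"
  assumes "open S" "\<And>i. C_diff k (\<lambda>x. f x $ i) S"
  shows "C_diff k f S"
  by (rule C_diff_componentwise) (use assms in \<open>auto simp: Basis_vec_def inner_axis\<close>)

text \<open>Cramer's rule: each coordinate of the solution is a quotient of determinants whose
  entries are of class C^k. It yields the regularity both of inverse functions and of the vector
  fields defined by linear equations in \<open>frame_near\<close>.\<close>

lemma C_diff_linear_solution:
  fixes A :: "'x::euclidean_space \<Rightarrow> real^'n \<Rightarrow> real^'n"
  assumes S: "open S" and lin: "\<And>x. x \<in> S \<Longrightarrow> linear (A x)" and inj: "\<And>x. x \<in> S \<Longrightarrow> inj (A x)"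
    and A: "\<And>v. C_diff k (\<lambda>x. A x v) S" and b: "C_diff k b S"
    and g: "\<And>x. x \<in> S \<Longrightarrow> A x (g x) = b x"
  shows "C_diff k g S"
proof (rule C_diff_vec_lambda[OF S])
  fix l
  have M: "C_diff k (\<lambda>x. matrix (A x) $ i $ j) S" for i j
    unfolding matrix_def by (simp add: C_diff_vec_nth[OF S A])
  define N where "N x = (\<chi> i j. if j = l then b x $ i else matrix (A x) $ i $ j)" for x
  have dn: "det (matrix (A x)) \<noteq> 0" if "x \<in> S" for x
    using inj[OF that] lin[OF that] by (metis det_nz_iff_inj matrix_vector_mul(2) matrix_works)
  have "g x $ l = det (N x) / det (matrix (A x))" if "x \<in> S" for x
  proof -
    have "matrix (A x) *v g x = b x" using g[OF that] lin[OF that] by (simp add: matrix_works)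
    then have "g x = (\<chi> k. det(\<chi> i j. if j=k then b x $ i else matrix (A x) $ i $ j) / det (matrix (A x)))"
      using cramer[OF dn[OF that]] by blast
    then show ?thesis by (simp add: N_def)
  qed
  moreover have "C_diff k (\<lambda>x. det (N x) / det (matrix (A x))) S"
  proof (intro C_diff_divide C_diff_det M S)
    show "C_diff k (\<lambda>x. N x $ i $ j) S" for i j
      using M C_diff_vec_nth[OF S b] by (cases "j = l") (auto simp: N_def)
  qed (use dn in auto)
  ultimately show "C_diff k (\<lambda>x. g x $ l) S"
    using C_diff_cong[OF S] by (metis (no_types, lifting))
qed

text \<open>The inverse function theorem provides a differentiable local inverse \<open>g\<close>.
  Its derivative solves a linear system whose coefficients are those of the derivative of
  \<open>f\<close> at \<open>g y\<close>, so \<open>g\<close> of class C^k makes the derivative of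
  \<open>g\<close> of class C^k, and the induction climbs one order.\<close>

lemma smooth_inverse_function:
  fixes f :: "real^'n \<Rightarrow> real^'n"
  assumes sm: "smooth_on f U" and x0: "x0 \<in> U" and inj: "inj (frechet_derivative f (at x0))"
  obtains U' V g where "open U'" "U' \<subseteq> U" "x0 \<in> U'" "open V" "f x0 \<in> V" "homeomorphism U' V f g"
    "smooth_on g V"
    "\<And>y. y \<in> V \<Longrightarrow> (g has_derivative inv (frechet_derivative f (at (g y)))) (at y)"
    "\<And>y. y \<in> V \<Longrightarrow> bij (frechet_derivative f (at (g y)))"
proof -
  have U: "open U" and C: "\<And>k. C_diff k f U" using sm by (auto simp: smooth_on_def)
  let ?f' = "\<lambda>x. frechet_derivative f (at x)"
  have df: "(f has_derivative ?f' x) (at x)" if "x \<in> U" for x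
    using has_derivative_frechet[OF _ U that] C[of 1] by auto
  \<comment> \<open>The inverse function theorem takes the derivative as a continuous map into the
    bounded linear functions; 0 off \<open>U\<close> is a default.\<close>
  define f' where "f' x = (if x \<in> U then Blinfun (?f' x) else 0)" for x
  have f': "blinfun_apply (f' x) = ?f' x" if "x \<in> U" for x
    using df[OF that] that by (auto simp: f'_def bounded_linear_Blinfun_apply has_derivative_bounded_linear)
  have cf: "continuous_on U f'"
  proof (rule continuous_on_blinfun_componentwise)
    fix i :: "real^'n"
    have "continuous_on U (\<lambda>x. ?f' x i)" using C[of 1] by simp
    then show "continuous_on U (\<lambda>x. f' x i)"
      by (rule continuous_on_eq) (simp add: f')
  qed
  have "linear (?f' x0)" using df[OF x0] has_derivative_linear by blast
  then obtain h where h: "linear h" "h \<circ> ?f' x0 = id"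
    using inj linear_injective_left_inverse by blast
  have "Blinfun h o\<^sub>L f' x0 = id_blinfun"
    by (rule blinfun_eqI)
      (use h f'[OF x0] in \<open>auto simp: bounded_linear_Blinfun_apply linear_conv_bounded_linear o_def id_def fun_eq_iff\<close>)
  from inverse_function_theorem[OF U _ cf x0 this] f' df
  obtain U' V g g' where *: "open U'" "U' \<subseteq> U" "x0 \<in> U'" "open V" "f x0 \<in> V" "homeomorphism U' V f g"
    "\<And>y. y \<in> V \<Longrightarrow> (g has_derivative (g' y)) (at y)"
    "\<And>y. y \<in> V \<Longrightarrow> g' y = inv (blinfun_apply (f'(g y)))"
    "\<And>y. y \<in> V \<Longrightarrow> bij (blinfun_apply (f'(g y)))"
    by metis
  have gU: "g y \<in> U" if "y \<in> V" for y
    using * that by (auto simp: homeomorphism_def)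
  have dg: "(g has_derivative inv (?f' (g y))) (at y)" if "y \<in> V" for y
    using *(7,8)[OF that] f'[OF gU[OF that]] by simp
  have bij: "bij (?f' (g y))" if "y \<in> V" for y
    using *(9)[OF that] f'[OF gU[OF that]] by simp
  have "C_diff k g V" for k
  proof (induction k)
    case 0
    then show ?case using *(6) by (simp add: homeomorphism_def)
  next
    case (Suc k)
    show ?case
    proof (rule C_diff_SucI[OF \<open>open V\<close> dg])
      fix v
      show "C_diff k (\<lambda>y. inv (?f' (g y)) v) V"
      proof (rule C_diff_linear_solution[where A = "\<lambda>y. ?f' (g y)" and b = "\<lambda>y. v"])
        show "C_diff k (\<lambda>y. ?f' (g y) w) V" for w
          by (rule C_diff_compose[where g = "\<lambda>x. ?f' x w", OF \<open>open V\<close> U _ Suc])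
            (use gU C[of "Suc k"] in auto)
        show "?f' (g y) (inv (?f' (g y)) v) = v" if "y \<in> V" for y
          using bij[OF that] by (simp add: bij_is_surj surj_f_inv_f)
        show "linear (?f' (g y))" if "y \<in> V" for y
          using df gU[OF that] has_derivative_linear by blast
      qed (use bij \<open>open V\<close> C_diff_const in \<open>auto simp: bij_is_inj\<close>)
    qed
  qed
  then have "smooth_on g V" using \<open>open V\<close> by (simp add: smooth_on_def)
  then show thesis using that[of U' V g] * dg bij by blast
qed

section \<open>Powers of 2-forms\<close>

definition wedge_term :: "('v \<Rightarrow> 'v \<Rightarrow> real) \<Rightarrow> nat \<Rightarrow> (nat \<Rightarrow> 'v) \<Rightarrow> (nat \<Rightarrow> nat) \<Rightarrow> real"
  where "wedge_term b k v \<sigma> =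
    of_int (sign \<sigma>) * (\<Prod>i<k. b (v (\<sigma> (2 * i))) (v (\<sigma> (2 * i + 1))))"

lemma wedge_power_eq:
  "wedge_power b k v = (\<Sum>\<sigma> | \<sigma> permutes {..<2 * k}. wedge_term b k v \<sigma>) / 2 ^ k"
  by (simp add: wedge_power_def wedge_term_def)

section \<open>Vanishing criteria for powers of a 2-form\<close>

lemma permutation_of_permutes_lessThan: "\<sigma> permutes {..<m::nat} \<Longrightarrow> permutation \<sigma>"
  using permutation_permutes by blast

lemma permutes_double_less:
  assumes "\<sigma> permutes {..<2 * k}" "i < k"
  shows "\<sigma> (2 * i) < 2 * k" "\<sigma> (2 * i + 1) < 2 * k" "\<sigma> (Suc (2 * i)) < 2 * k"
  using permutes_in_image[OF assms(1), of "2 * i"] permutes_in_image[OF assms(1), of "2 * i + 1"] assms(2)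
  by auto

text \<open>The permutations of the \<open>2 * k + 2\<close> slots are grouped by their values on
  the last two. Each group is a coset of the permutations of the first \<open>2 * k\<close> slots
  and contributes a multiple of a k-th power, which is 0. This carries the condition defining Z, on
  the power \<open>n - 1\<close>, to the condition on the power \<open>n\<close> in
  \<open>near_symplectic\<close>.\<close>

lemma wedge_power_Suc_eq_0:
  assumes "\<And>v. wedge_power b k v = 0"
  shows "wedge_power b (Suc k) v = 0"
proof -
  let ?P = "{\<sigma>. \<sigma> permutes {..<2 * Suc k}}"
  let ?l = "\<lambda>\<sigma>. (\<sigma> (2 * k), \<sigma> (2 * k + 1))"
  have fP: "finite ?P" by (simp add: finite_permutations)
  have zero: "(\<Sum>\<sigma> | \<sigma> \<in> ?P \<and> ?l \<sigma> = y. wedge_term b (Suc k) v \<sigma>) = 0" for y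
  proof (cases "\<exists>\<rho>. \<rho> \<in> ?P \<and> ?l \<rho> = y")
    case False
    then have "{\<sigma>. \<sigma> \<in> ?P \<and> ?l \<sigma> = y} = {}" by blast
    then show ?thesis by (metis sum.empty)
  next
    case True
    then obtain \<rho> where \<rho>: "\<rho> permutes {..<2 * Suc k}" "?l \<rho> = y" by auto
    have inj: "inj \<rho>" using \<rho>(1) permutes_inj by blast
    \<comment> \<open>Composing with the inverse of one member \<open>\<rho>\<close> fixes the last
      two slots, which identifies the group with a coset through \<open>\<rho>\<close>.\<close>
    have eq: "{\<sigma>. \<sigma> \<in> ?P \<and> ?l \<sigma> = y} = (\<lambda>\<tau>. \<rho> \<circ> \<tau>) ` {\<tau>. \<tau> permutes {..<2 * k}}"
    proof (intro set_eqI iffI)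
      fix \<sigma> assume "\<sigma> \<in> {\<sigma>. \<sigma> \<in> ?P \<and> ?l \<sigma> = y}"
      then have s: "\<sigma> permutes {..<2 * Suc k}" "?l \<sigma> = y" by auto
      have "inv \<rho> \<circ> \<sigma> permutes {..<2 * Suc k}"
        using s(1) \<rho>(1) by (simp add: permutes_compose permutes_inv)
      moreover have "(inv \<rho> \<circ> \<sigma>) x = x" if "x \<in> {..<2 * Suc k} - {..<2 * k}" for x
      proof -
        have "x = 2 * k \<or> x = 2 * k + 1" using that by auto
        then have "\<sigma> x = \<rho> x" using s(2) \<rho>(2) by auto
        then show ?thesis using inj by simp
      qed
      ultimately have "inv \<rho> \<circ> \<sigma> permutes {..<2 * k}"
        using permutes_superset by blast
      moreover have "\<sigma> = \<rho> \<circ> (inv \<rho> \<circ> \<sigma>)"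
        using permutes_inv_o(1)[OF \<rho>(1)] by (simp add: o_assoc)
      ultimately show "\<sigma> \<in> (\<lambda>\<tau>. \<rho> \<circ> \<tau>) ` {\<tau>. \<tau> permutes {..<2 * k}}" by blast
    next
      fix \<sigma> assume "\<sigma> \<in> (\<lambda>\<tau>. \<rho> \<circ> \<tau>) ` {\<tau>. \<tau> permutes {..<2 * k}}"
      then obtain \<tau> where \<tau>: "\<sigma> = \<rho> \<circ> \<tau>" "\<tau> permutes {..<2 * k}" by auto
      have "\<tau> permutes {..<2 * Suc k}" by (rule permutes_subset[OF \<tau>(2)]) auto
      moreover have "\<tau> (2 * k) = 2 * k" "\<tau> (2 * k + 1) = 2 * k + 1"
        using \<tau>(2) by (auto simp: permutes_def)
      ultimately show "\<sigma> \<in> {\<sigma>. \<sigma> \<in> ?P \<and> ?l \<sigma> = y}"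
        using \<tau>(1) \<rho> by (auto simp: permutes_compose)
    qed
    have injc: "inj_on (\<lambda>\<tau>. \<rho> \<circ> \<tau>) A" for A :: "(nat \<Rightarrow> nat) set"
      using inj by (auto simp: inj_on_def fun_eq_iff)
    have "wedge_term b (Suc k) v (\<rho> \<circ> \<tau>) =
        of_int (sign \<rho>) * b (v (\<rho> (2 * k))) (v (\<rho> (2 * k + 1))) * wedge_term b k (v \<circ> \<rho>) \<tau>"
      if "\<tau> permutes {..<2 * k}" for \<tau>
    proof -
      have "\<tau> (2 * k) = 2 * k" "\<tau> (2 * k + 1) = 2 * k + 1"
        using that by (auto simp: permutes_def)
      then show ?thesis
        unfolding wedge_term_def
        using sign_compose[OF permutation_of_permutes_lessThan[OF \<rho>(1)] permutation_of_permutes_lessThan[OF that]]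
        by simp
    qed
    then have "(\<Sum>\<sigma> | \<sigma> \<in> ?P \<and> ?l \<sigma> = y. wedge_term b (Suc k) v \<sigma>) =
       of_int (sign \<rho>) * b (v (\<rho> (2 * k))) (v (\<rho> (2 * k + 1))) *
        (\<Sum>\<tau> | \<tau> permutes {..<2 * k}. wedge_term b k (v \<circ> \<rho>) \<tau>)"
      unfolding eq sum.reindex[OF injc] sum_distrib_left by simp
    also have "\<dots> = 0"
      using assms[of "v \<circ> \<rho>"] by (simp add: wedge_power_eq)
    finally show ?thesis .
  qed
  have "(\<Sum>\<sigma>\<in>?P. wedge_term b (Suc k) v \<sigma>) =
      (\<Sum>y\<in>?l ` ?P. \<Sum>\<sigma> | \<sigma> \<in> ?P \<and> ?l \<sigma> = y. wedge_term b (Suc k) v \<sigma>)"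
    using sum.group[OF fP finite_imageI[OF fP] subset_refl, where g = ?l and h = "wedge_term b (Suc k) v"] by simp
  then show ?thesis by (simp only: wedge_power_eq zero sum.neutral_const)
qed

text \<open>Exchanging the two slots reverses the sign of the permutation and leaves the factors
  alone, so the sum equals its own negative.\<close>

lemma wedge_power_repeated:
  assumes "i < 2 * k" "j < 2 * k" "i \<noteq> j" "v i = v j"
  shows "wedge_power b k v = 0"
proof -
  let ?t = "Transposition.transpose i j"
  have t: "?t permutes {..<2 * k}" by (rule permutes_swap_id) (use assms in auto)
  have vt: "v (?t x) = v x" for x using assms by (auto simp: Transposition.transpose_def)
  have "wedge_term b k v (?t \<circ> \<sigma>) = - wedge_term b k v \<sigma>" if "\<sigma> permutes {..<2 * k}" for \<sigma>
    unfolding wedge_term_def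
    using sign_compose[OF permutation_of_permutes_lessThan[OF t] permutation_of_permutes_lessThan[OF that]]
    by (simp add: vt sign_swap_id assms)
  then have "(\<Sum>\<sigma> | \<sigma> permutes {..<2 * k}. wedge_term b k v \<sigma>) = - (\<Sum>\<sigma> | \<sigma> permutes {..<2 * k}. wedge_term b k v \<sigma>)"
    using setum_permutations_compose_left[OF t, of "wedge_term b k v"]
    by (simp add: sum_negf)
  then show ?thesis by (simp add: wedge_power_eq)
qed

text \<open>Slot \<open>j\<close> occurs in exactly one factor of each product, the one with index
  \<open>inv \<sigma> j div 2\<close>; there it enters linearly, and all other factors are
  constants.\<close>

lemma linear_wedge_power_slot:
  fixes b :: "'v::real_vector \<Rightarrow> 'v \<Rightarrow> real"
  assumes b: "bilinear b" and j: "j < 2 * k"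
  shows "linear (\<lambda>a. wedge_power b k (v(j := a)))"
proof -
  have "linear (\<lambda>a. wedge_term b k (v(j := a)) \<sigma>)" if s: "\<sigma> permutes {..<2 * k}" for \<sigma>
  proof -
    define p where "p = inv \<sigma> j"
    define m where "m = p div 2"
    have p: "\<sigma> p = j" using permutes_inverses(1)[OF s] by (simp add: p_def)
    have "p < 2 * k" using permutes_in_image[OF s, of p] j p by simp
    then have m: "m < k" by (auto simp: m_def)
    have eqj: "\<sigma> x = j \<longleftrightarrow> x = p" for x using p permutes_inj[OF s] by (metis injD)
    let ?f = "\<lambda>a i. b ((v(j := a)) (\<sigma> (2 * i))) ((v(j := a)) (\<sigma> (2 * i + 1)))"
    have rest: "?f a i = ?f 0 i" if "i \<noteq> m" for a i
    proof -
      have "\<sigma> (2 * i) \<noteq> j" "\<sigma> (2 * i + 1) \<noteq> j"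
        unfolding eqj using that by (auto simp: m_def)
      then show ?thesis by auto
    qed
    have "wedge_term b k (v(j := a)) \<sigma> = (of_int (sign \<sigma>) * (\<Prod>i\<in>{..<k}-{m}. ?f 0 i)) * ?f a m" for a
    proof -
      have "(\<Prod>i<k. ?f a i) = ?f a m * (\<Prod>i\<in>{..<k}-{m}. ?f a i)"
        using m by (intro prod.remove) auto
      also have "(\<Prod>i\<in>{..<k}-{m}. ?f a i) = (\<Prod>i\<in>{..<k}-{m}. ?f 0 i)"
        by (rule prod.cong[OF refl], rule rest) auto
      finally show ?thesis unfolding wedge_term_def by (simp add: mult_ac)
    qed
    moreover have "linear (\<lambda>a. ?f a m)"
    proof (cases "even p")
      case True
      then have "p = 2 * m" by (simp add: m_def)
      then have "?f = ?f" "\<sigma> (2 * m) = j" "\<sigma> (2 * m + 1) \<noteq> j" unfolding eqj by auto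
      then show ?thesis using b by (auto simp: bilinear_def)
    next
      case False
      then have "p = 2 * m + 1" by (simp add: m_def)
      then have "\<sigma> (2 * m + 1) = j" "\<sigma> (2 * m) \<noteq> j" unfolding eqj by auto
      then show ?thesis using b by (auto simp: bilinear_def)
    qed
    ultimately show ?thesis by (simp add: linear_compose_scale_right linear_iff algebra_simps)
  qed
  then have "linear (\<lambda>a. \<Sum>\<sigma> | \<sigma> permutes {..<2 * k}. wedge_term b k (v(j := a)) \<sigma>)"
    by (intro linear_compose_sum) auto
  then show ?thesis
    unfolding wedge_power_eq by (simp add: linear_iff add_divide_distrib)
qed

lemma wedge_power_kernel_slot:
  assumes b: "bilinear b" and z: "\<And>w. b z w = 0" "\<And>w. b w z = 0" and j: "j < 2 * k"
  shows "wedge_power b k (v(j := z)) = 0"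
proof -
  have "wedge_term b k (v(j := z)) \<sigma> = 0" if s: "\<sigma> permutes {..<2 * k}" for \<sigma>
  proof -
    define p where "p = inv \<sigma> j"
    have p: "\<sigma> p = j" using permutes_inverses(1)[OF s] by (simp add: p_def)
    have pk: "p < 2 * k" using permutes_in_image[OF s, of p] j p by simp
    have "p = 2 * (p div 2) \<or> p = 2 * (p div 2) + 1" by auto
    then have "b ((v(j := z)) (\<sigma> (2 * (p div 2)))) ((v(j := z)) (\<sigma> (2 * (p div 2) + 1))) = 0"
      using p z by (metis fun_upd_same)
    moreover have "p div 2 < k" using pk by auto
    ultimately have "(\<Prod>i<k. b ((v(j := z)) (\<sigma> (2 * i))) ((v(j := z)) (\<sigma> (2 * i + 1)))) = 0"
      by (intro prod_zero bexI[of _ "p div 2"]) (assumption | simp)+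
    then show ?thesis unfolding wedge_term_def by simp
  qed
  then show ?thesis by (simp add: wedge_power_eq)
qed

text \<open>There is no room for \<open>2 * k\<close> vectors independent modulo \<open>K\<close>,
  so some \<open>v j\<close> is a combination of \<open>K\<close> and earlier vectors. By linearity
  in slot \<open>j\<close> the value is a combination of values with a kernel vector or a repeated
  vector, all of them 0.\<close>

lemma wedge_power_eq_0_if_dim_kernel:
  fixes b :: "'v::euclidean_space \<Rightarrow> 'v \<Rightarrow> real"
  assumes b: "bilinear b" and z: "\<And>z w. z \<in> K \<Longrightarrow> b z w = 0" "\<And>z w. z \<in> K \<Longrightarrow> b w z = 0"
    and d: "DIM('v) < dim K + 2 * k"
  shows "wedge_power b k v = 0"
proof -
  have "\<exists>j<2 * k. v j \<in> span (K \<union> v ` {..<j})"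
  proof (rule ccontr)
    assume *: "\<not> ?thesis"
    have "dim (K \<union> v ` {..<l}) = dim K + l" if "l \<le> 2 * k" for l
      using that
    proof (induction l)
      case (Suc l)
      have "K \<union> v ` {..<Suc l} = insert (v l) (K \<union> v ` {..<l})" by (auto simp: lessThan_Suc)
      then show ?case using Suc * by (auto simp: dim_insert)
    qed simp
    then show False using d dim_subset_UNIV[of "K \<union> v ` {..<2 * k}"] by auto
  qed
  then obtain j where j: "j < 2 * k" "v j \<in> span (K \<union> v ` {..<j})" by blast
  let ?L = "\<lambda>a. wedge_power b k (v(j := a))"
  have lin: "linear ?L" by (rule linear_wedge_power_slot[OF b j(1)])
  have "?L a = 0" if "a \<in> K \<union> v ` {..<j}" for a
    using that
  proof
    assume "a \<in> K" then show ?thesis using wedge_power_kernel_slot[OF b _ _ j(1)] z by blast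
  next
    assume "a \<in> v ` {..<j}"
    then obtain i where i: "i < j" "a = v i" by auto
    show ?thesis by (rule wedge_power_repeated[of i _ j]) (use i j in auto)
  qed
  then have "?L (v j) = 0"
    using linear_eq_0_on_span[OF lin _ j(2)] by blast
  then show ?thesis by simp
qed

lemma wedge_power_cong:
  assumes "\<And>i j. i < 2 * k \<Longrightarrow> j < 2 * k \<Longrightarrow> b (v i) (v j) = b' (v' i) (v' j)"
  shows "wedge_power b k v = wedge_power b' k v'"
  unfolding wedge_power_eq wedge_term_def
  by (intro arg_cong2[where f = "(/)"] sum.cong refl arg_cong2[where f = "(*)"] prod.cong assms)
    (auto simp: permutes_double_less)

section \<open>Explicit formulas for four vectors\<close>

lemma sum_permutes_4:
  "(\<Sum>\<sigma> | \<sigma> permutes {..<4::nat}. of_int (sign \<sigma>) * f (\<sigma> 0) (\<sigma> 1) (\<sigma> 2) (\<sigma> 3)) =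
   (f 0 1 2 3 - f 0 1 3 2 - f 0 2 1 3 + f 0 2 3 1 + f 0 3 1 2 - f 0 3 2 1
    - f 1 0 2 3 + f 1 0 3 2 + f 1 2 0 3 - f 1 2 3 0 - f 1 3 0 2 + f 1 3 2 0
    + f 2 0 1 3 - f 2 0 3 1 - f 2 1 0 3 + f 2 1 3 0 + f 2 3 0 1 - f 2 3 1 0
    - f 3 0 1 2 + f 3 0 2 1 + f 3 1 0 2 - f 3 1 2 0 - f 3 2 0 1 + f 3 2 1 0 :: real)"
proof -
  have S: "{..<4::nat} = {0, 1, 2, 3}" by auto
  have f0: "finite {1::nat, 2, 3}" "0 \<notin> {1::nat, 2, 3}" by auto
  have f1: "finite {2::nat, 3}" "1 \<notin> {2::nat, 3}" by auto
  have f2: "finite {3::nat}" "2 \<notin> {3::nat}" by auto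
  show ?thesis
    unfolding S
    unfolding sum_over_permutations_insert[OF f0]
    unfolding sum_over_permutations_insert[OF f1]
    unfolding sum_over_permutations_insert[OF f2]
    unfolding permutes_sing
    by (simp add: sign_swap_id permutation_swap_id permutation_compose sign_compose sign_id Transposition.transpose_def)
qed

lemma wedge2_explicit:
  assumes "\<And>i j. i < 4 \<Longrightarrow> j < 4 \<Longrightarrow> a (e i) (e j) = - a (e j) (e i)"
    "\<And>i j. i < 4 \<Longrightarrow> j < 4 \<Longrightarrow> b (e i) (e j) = - b (e j) (e i)"
  shows "wedge2 a b e = a (e 0) (e 1) * b (e 2) (e 3) - a (e 0) (e 2) * b (e 1) (e 3) + a (e 0) (e 3) * b (e 1) (e 2)
    + a (e 2) (e 3) * b (e 0) (e 1) - a (e 1) (e 3) * b (e 0) (e 2) + a (e 1) (e 2) * b (e 0) (e 3)"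
proof -
  have "wedge2 a b e = (\<Sum>\<sigma> | \<sigma> permutes {..<4}. of_int (sign \<sigma>) *
      (a (e (\<sigma> 0)) (e (\<sigma> 1)) * b (e (\<sigma> 2)) (e (\<sigma> 3)))) / 4"
    unfolding wedge2_def by (simp add: mult_ac)
  then show ?thesis
    unfolding sum_permutes_4[of "\<lambda>i j k l. a (e i) (e j) * b (e k) (e l)"]
    using assms(1)[of 1 0] assms(1)[of 2 0] assms(1)[of 3 0] assms(1)[of 2 1] assms(1)[of 3 1] assms(1)[of 3 2]
      assms(2)[of 1 0] assms(2)[of 2 0] assms(2)[of 3 0] assms(2)[of 2 1] assms(2)[of 3 1] assms(2)[of 3 2]
    by (simp add: field_simps)
qed

text \<open>The bracket is the Pfaffian of the skew Gram matrix of \<open>b\<close> on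
  \<open>e 0, ..., e 3\<close>.\<close>

lemma wedge_power_2:
  assumes "\<And>i j. i < 4 \<Longrightarrow> j < 4 \<Longrightarrow> b (e i) (e j) = - b (e j) (e i)"
  shows "wedge_power b 2 e = 2 * (b (e 0) (e 1) * b (e 2) (e 3) - b (e 0) (e 2) * b (e 1) (e 3) + b (e 0) (e 3) * b (e 1) (e 2))"
proof -
  have "(\<Prod>i<2. f i) = f 0 * f 1" for f :: "nat \<Rightarrow> real"
    by (simp add: numeral_2_eq_2)
  then have "wedge_power b 2 e = wedge2 b b e"
    unfolding wedge_power_def wedge2_def by (simp add: mult_ac)
  then show ?thesis using wedge2_explicit[of b e b, OF assms assms] by simp
qed


text \<open>A frame whose first four vectors are \<open>b\<close>-orthogonal to the others: only those permutations
  contribute for which the \<open>i\<close> with \<open>\<sigma> (2 i) < 4\<close> form a set \<open>T\<close> of two indices, and all such \<open>T\<close>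
  contribute equally.\<close>

definition block_sum :: "('v \<Rightarrow> 'v \<Rightarrow> real) \<Rightarrow> nat \<Rightarrow> (nat \<Rightarrow> 'v) \<Rightarrow> nat set \<Rightarrow> real"
  where "block_sum b n v T =
    (\<Sum>\<sigma> | \<sigma> permutes {..<2 * n} \<and> {i. i < n \<and> \<sigma> (2 * i) < 4} = T. wedge_term b n v \<sigma>)"

lemma sum_wedge_term_eq_block_sums:
  "(\<Sum>\<sigma> | \<sigma> permutes {..<2 * n}. wedge_term b n v \<sigma>) = (\<Sum>T\<in>Pow {..<n}. block_sum b n v T)"
proof -
  let ?P = "{\<sigma>. \<sigma> permutes {..<2 * n}}"
  have "(\<Sum>T\<in>Pow {..<n}. \<Sum>\<sigma> | \<sigma> \<in> ?P \<and> {i. i < n \<and> \<sigma> (2 * i) < 4} = T. wedge_term b n v \<sigma>) =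
      (\<Sum>\<sigma>\<in>?P. wedge_term b n v \<sigma>)"
    by (rule sum.group) (auto simp: finite_permutations)
  then show ?thesis by (simp add: block_sum_def)
qed

text \<open>Exchanging the positions \<open>2 * i, 2 * i + 1\<close> with
  \<open>2 * j, 2 * j + 1\<close> takes two transpositions, so the sign is kept, and it only
  permutes the factors of the product; the index set moves by the transposition of \<open>i\<close>
  and \<open>j\<close>.\<close>

lemma block_sum_transpose:
  assumes ij: "i < n" "j < n"
  shows "block_sum b n v (Transposition.transpose i j ` T) = block_sum b n v T"
proof (cases "i = j")
  case True
  then show ?thesis by simp
next
  case False
  let ?t = "Transposition.transpose i j"
  define \<rho> where "\<rho> = Transposition.transpose (2 * i) (2 * j) \<circ> Transposition.transpose (2 * i + 1) (2 * j + 1)"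
  have r1: "\<rho> permutes {..<2 * n}"
    unfolding \<rho>_def by (intro permutes_compose permutes_swap_id) (use ij in auto)
  have r2: "\<rho> (2 * m) = 2 * ?t m" "\<rho> (2 * m + 1) = 2 * ?t m + 1" for m
  proof -
    have "2 * m + 1 \<noteq> 2 * x" "2 * x \<noteq> 2 * m + 1" for x :: nat by presburger+
    then show "\<rho> (2 * m) = 2 * ?t m" "\<rho> (2 * m + 1) = 2 * ?t m + 1"
      by (auto simp: \<rho>_def Transposition.transpose_def)
  qed
  have rr: "\<rho> \<circ> \<rho> = id"
  proof
    fix x :: nat
    have "x = 2 * (x div 2) \<or> x = 2 * (x div 2) + 1" by auto
    then show "(\<rho> \<circ> \<rho>) x = id x"
      using r2 by (metis comp_apply id_apply transpose_involutory)
  qed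
  have sr: "sign \<rho> = 1"
    unfolding \<rho>_def using False by (simp add: sign_compose permutation_swap_id sign_swap_id)
  have tinj: "inj_on ?t A" for A by (rule inj_on_subset[OF inj_transpose]) auto
  have timg: "?t ` {..<n} = {..<n}"
    using permutes_image[OF permutes_swap_id[of i "{..<n}" j]] ij by simp
  have wt: "wedge_term b n v (\<sigma> \<circ> \<rho>) = wedge_term b n v \<sigma>" if "\<sigma> permutes {..<2 * n}" for \<sigma>
  proof -
    have "(\<Prod>m<n. b (v ((\<sigma> \<circ> \<rho>) (2 * m))) (v ((\<sigma> \<circ> \<rho>) (2 * m + 1)))) =
        (\<Prod>m<n. b (v (\<sigma> (2 * ?t m))) (v (\<sigma> (2 * ?t m + 1))))"
      by (simp only: o_apply r2)
    also have "\<dots> = (\<Prod>m\<in>?t ` {..<n}. b (v (\<sigma> (2 * m))) (v (\<sigma> (2 * m + 1))))"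
      by (simp add: prod.reindex[OF tinj])
    finally show ?thesis
      unfolding wedge_term_def timg
      using sign_compose[OF permutation_of_permutes_lessThan[OF that] permutation_of_permutes_lessThan[OF r1]] sr
      by simp
  qed
  have idx: "{m. m < n \<and> (\<sigma> \<circ> \<rho>) (2 * m) < 4} = ?t ` {m. m < n \<and> \<sigma> (2 * m) < 4}" for \<sigma> :: "nat \<Rightarrow> nat"
  proof (intro set_eqI iffI)
    fix m assume m: "m \<in> {m. m < n \<and> (\<sigma> \<circ> \<rho>) (2 * m) < 4}"
    then have "?t m \<in> {m. m < n \<and> \<sigma> (2 * m) < 4}" using r2(1)[of m] timg by auto
    then show "m \<in> ?t ` {m. m < n \<and> \<sigma> (2 * m) < 4}"
      by (metis image_eqI transpose_involutory)
  next
    fix m assume "m \<in> ?t ` {m. m < n \<and> \<sigma> (2 * m) < 4}"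
    then show "m \<in> {m. m < n \<and> (\<sigma> \<circ> \<rho>) (2 * m) < 4}"
      using r2(1) timg by auto
  qed
  have "bij_betw (\<lambda>\<sigma>. \<sigma> \<circ> \<rho>) {\<sigma>. \<sigma> permutes {..<2 * n} \<and> {i. i < n \<and> \<sigma> (2 * i) < 4} = T}
     {\<sigma>. \<sigma> permutes {..<2 * n} \<and> {i. i < n \<and> \<sigma> (2 * i) < 4} = ?t ` T}"
  proof (rule bij_betw_byWitness[where f' = "\<lambda>\<sigma>. \<sigma> \<circ> \<rho>"])
    show "(\<lambda>\<sigma>. \<sigma> \<circ> \<rho>) ` {\<sigma>. \<sigma> permutes {..<2 * n} \<and> {i. i < n \<and> \<sigma> (2 * i) < 4} = T}
      \<subseteq> {\<sigma>. \<sigma> permutes {..<2 * n} \<and> {i. i < n \<and> \<sigma> (2 * i) < 4} = ?t ` T}"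
      by (rule image_subsetI) (simp only: mem_Collect_eq idx permutes_compose[OF r1] simp_thms)
    have tt: "?t ` ?t ` T = T" by (simp add: image_image)
    show "(\<lambda>\<sigma>. \<sigma> \<circ> \<rho>) ` {\<sigma>. \<sigma> permutes {..<2 * n} \<and> {i. i < n \<and> \<sigma> (2 * i) < 4} = ?t ` T}
      \<subseteq> {\<sigma>. \<sigma> permutes {..<2 * n} \<and> {i. i < n \<and> \<sigma> (2 * i) < 4} = T}"
      by (rule image_subsetI) (simp only: mem_Collect_eq idx permutes_compose[OF r1] simp_thms tt)
  qed (use rr in \<open>auto simp: o_assoc[symmetric]\<close>)
  then have "block_sum b n v (?t ` T) =
      (\<Sum>\<sigma> | \<sigma> permutes {..<2 * n} \<and> {i. i < n \<and> \<sigma> (2 * i) < 4} = T. wedge_term b n v (\<sigma> \<circ> \<rho>))"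
    unfolding block_sum_def by (rule sum.reindex_bij_betw[symmetric])
  also have "\<dots> = block_sum b n v T"
    unfolding block_sum_def by (rule sum.cong) (auto simp: wt)
  finally show ?thesis .
qed

text \<open>A two-element set is carried to \<open>{0, 1}\<close> by moving its smaller element to 0
  and then its larger one to 1.\<close>

lemma block_sum_eq:
  assumes "T \<subseteq> {..<n}" "card T = 2"
  shows "block_sum b n v T = block_sum b n v {0, 1}"
proof -
  obtain i j where ij: "T = {i, j}" "i < j" "j < n"
    using assms by (auto simp: card_2_iff) (metis insert_commute linorder_neqE_nat)
  have "Transposition.transpose i 0 ` T = {0, j}"
    using ij by (auto simp: Transposition.transpose_def)
  then have "block_sum b n v T = block_sum b n v {0, j}"
    using block_sum_transpose[of i n 0 b v T] ij by simp
  moreover have "Transposition.transpose j 1 ` {0, j} = {0, 1}"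
    using ij by (auto simp: Transposition.transpose_def)
  ultimately show ?thesis
    using block_sum_transpose[of j n 1 b v "{0, j}"] ij by (cases "n = 1") auto
qed

text \<open>A nonzero product has no factor joining the first four vectors to the others, so both
  positions of each pair land on the same side.\<close>

lemma wedge_term_block_nonzeroD:
  assumes orth: "\<And>i j. i < 4 \<Longrightarrow> 4 \<le> j \<Longrightarrow> j < 2 * n \<Longrightarrow> b (v i) (v j) = 0 \<and> b (v j) (v i) = 0"
    and s: "\<sigma> permutes {..<2 * n}" and nz: "wedge_term b n v \<sigma> \<noteq> 0" and i: "i < n"
  shows "\<sigma> (2 * i) < 4 \<longleftrightarrow> \<sigma> (2 * i + 1) < 4"
proof -
  have "b (v (\<sigma> (2 * i))) (v (\<sigma> (2 * i + 1))) \<noteq> 0"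
    using nz i unfolding wedge_term_def by auto
  then show ?thesis
    using orth[of "\<sigma> (2 * i)" "\<sigma> (2 * i + 1)"] orth[of "\<sigma> (2 * i + 1)" "\<sigma> (2 * i)"]
      permutes_double_less[OF s i] by (meson not_le)
qed

text \<open>For a contributing permutation the positions of the pairs indexed by \<open>T\<close>
  are mapped bijectively onto \<open>{..<4}\<close>, so \<open>2 * card T = 4\<close>.\<close>

lemma block_sum_eq_0:
  assumes orth: "\<And>i j. i < 4 \<Longrightarrow> 4 \<le> j \<Longrightarrow> j < 2 * n \<Longrightarrow> b (v i) (v j) = 0 \<and> b (v j) (v i) = 0"
    and n: "2 \<le> n" and T: "card T \<noteq> 2"
  shows "block_sum b n v T = 0"
  unfolding block_sum_def
proof (rule sum.neutral, rule ballI, rule ccontr)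
  fix \<sigma> assume "\<sigma> \<in> {\<sigma>. \<sigma> permutes {..<2 * n} \<and> {i. i < n \<and> \<sigma> (2 * i) < 4} = T}"
    and nz: "wedge_term b n v \<sigma> \<noteq> 0"
  then have s: "\<sigma> permutes {..<2 * n}" and TT: "T = {i. i < n \<and> \<sigma> (2 * i) < 4}" by auto
  note good = wedge_term_block_nonzeroD[OF orth s nz]
  have "\<sigma> ` ((*) 2 ` T \<union> (\<lambda>i. 2 * i + 1) ` T) = {..<4}"
  proof (intro equalityI subsetI)
    fix y assume "y \<in> {..<4::nat}"
    then have "y \<in> \<sigma> ` {..<2 * n}" using permutes_image[OF s] n by auto
    then obtain x where x: "x < 2 * n" "y = \<sigma> x" by auto
    have xx: "x = 2 * (x div 2) \<or> x = 2 * (x div 2) + 1" by auto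
    have "x div 2 < n" using x by auto
    then have "x div 2 \<in> T" using good[of "x div 2"] xx x \<open>y \<in> {..<4}\<close> by (auto simp: TT)
    then show "y \<in> \<sigma> ` ((*) 2 ` T \<union> (\<lambda>i. 2 * i + 1) ` T)"
      using xx x by (metis UnI1 UnI2 image_eqI)
  qed (use TT good in auto)
  then have "card ((*) 2 ` T \<union> (\<lambda>i. 2 * i + 1) ` T) = 4"
    using card_image[OF inj_on_subset[OF permutes_inj[OF s]]] by (metis card_lessThan subset_UNIV)
  moreover have "card ((*) 2 ` T \<union> (\<lambda>i. 2 * i + 1) ` T) = card ((*) 2 ` T) + card ((\<lambda>i. 2 * i + 1) ` T)"
  proof (rule card_Un_disjoint)
    show "(*) 2 ` T \<inter> (\<lambda>i. 2 * i + 1) ` T = {}" by (auto; presburger)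
  qed (auto simp: TT)
  moreover have "card ((*) 2 ` T) = card T" "card ((\<lambda>i. 2 * i + 1) ` T) = card T"
    by (auto intro!: card_image simp: inj_on_def)
  ultimately show False using T by simp
qed

text \<open>A permutation that contributes preserves \<open>{..<4}\<close> and its complement, hence
  is a composition of one permutation of each block. Signs and products are multiplicative, so the
  sum factors. Permutations of the second block are those of \<open>{..<2 * (n - 2)}\<close> shifted
  by 4 through \<open>map_permutation\<close>.\<close>

lemma block_sum_first:
  assumes orth: "\<And>i j. i < 4 \<Longrightarrow> 4 \<le> j \<Longrightarrow> j < 2 * n \<Longrightarrow> b (v i) (v j) = 0 \<and> b (v j) (v i) = 0"
    and n: "2 \<le> n"
  shows "block_sum b n v {0, 1} = (\<Sum>p | p permutes {..<4}. wedge_term b 2 v p) *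
    (\<Sum>q | q permutes {..<2 * (n - 2)}. wedge_term b (n - 2) (\<lambda>i. v (i + 4)) q)"
proof -
  let ?A = "{..<4::nat}" and ?B = "{4..<2 * n}" and ?C = "{..<2 * (n - 2)}"
  let ?s = "\<lambda>i::nat. i + 4"
  let ?m = "map_permutation ?C ?s"
  let ?h = "\<lambda>(p, q). p \<circ> ?m q"
  let ?R = "{\<sigma>. \<sigma> permutes {..<2 * n} \<and> {i. i < n \<and> \<sigma> (2 * i) < 4} = {0, 1}}"
  have bs: "bij_betw ?s ?C ?B"
    by (rule bij_betw_byWitness[where f' = "\<lambda>i. i - 4"]) (use n in auto)
  have bs': "bij_betw (\<lambda>i. i - 4) ?B ?C"
    by (rule bij_betw_byWitness[where f' = ?s]) (use n in auto)
  have mB: "?m q permutes ?B" if "q permutes ?C" for q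
    using map_permutation_permutes[OF bs that] .
  have ms: "?m q (i + 4) = q i + 4" if "q permutes ?C" "i < 2 * (n - 2)" for q i
    using map_permutation_apply[of ?s ?C i q] that by auto
  have hA: "(p \<circ> ?m q) x = p x" if "p permutes ?A" "q permutes ?C" "x < 4" for p q x
    using permutes_not_in[OF mB[OF that(2)], of x] that by auto
  have hB: "(p \<circ> ?m q) x = ?m q x" "4 \<le> ?m q x" if "p permutes ?A" "q permutes ?C" "4 \<le> x" for p q x
  proof -
    show "4 \<le> ?m q x"
      using permutes_in_image[OF mB[OF that(2)], of x] permutes_not_in[OF mB[OF that(2)], of x] that(3)
      by (cases "x \<in> ?B") auto
    then show "(p \<circ> ?m q) x = ?m q x" using permutes_not_in[OF that(1)] by auto
  qed
  have perm: "p \<circ> ?m q permutes {..<2 * n}" if "p permutes ?A" "q permutes ?C" for p q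
    by (intro permutes_compose permutes_subset[OF that(1)] permutes_subset[OF mB[OF that(2)]]) (use n in auto)
  have inj: "inj_on ?h ({p. p permutes ?A} \<times> {q. q permutes ?C})"
  proof (rule inj_onI, clarify)
    fix p q p' q' assume a: "p permutes ?A" "q permutes ?C" "p' permutes ?A" "q' permutes ?C"
      and eq: "p \<circ> ?m q = p' \<circ> ?m q'"
    have "p x = p' x" for x
      using hA[OF a(1,2)] hA[OF a(3,4)] eq permutes_not_in[OF a(1)] permutes_not_in[OF a(3)]
      by (cases "x < 4") auto
    moreover have "q x = q' x" for x
    proof (cases "x \<in> ?C")
      case True
      then have "?m q (x + 4) = ?m q' (x + 4)"
        using hB(1)[OF a(1,2), of "x + 4"] hB(1)[OF a(3,4), of "x + 4"] eq by (metis le_add2)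
      then show ?thesis using ms a True by simp
    qed (use permutes_not_in a in metis)
    ultimately show "p = p' \<and> q = q'" by blast
  qed
  have img: "?h ` ({p. p permutes ?A} \<times> {q. q permutes ?C}) \<subseteq> ?R"
  proof (rule subsetI)
    fix \<sigma> assume "\<sigma> \<in> ?h ` ({p. p permutes ?A} \<times> {q. q permutes ?C})"
    then obtain p q where s: "\<sigma> = p \<circ> ?m q" and pq: "p permutes ?A" "q permutes ?C" by auto
    have "\<sigma> (2 * i) < 4 \<longleftrightarrow> i \<in> {0, 1}" if "i < n" for i
    proof (cases "2 * i < 4")
      case True
      then show ?thesis
        using hA[OF pq, of "2 * i"] permutes_in_image[OF pq(1), of "2 * i"] s by auto
    next
      case False
      then show ?thesis using hB[OF pq, of "2 * i"] s by auto
    qed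
    then have "i < n \<and> \<sigma> (2 * i) < 4 \<longleftrightarrow> i \<in> {0, 1}" for i
    proof (cases "i < n")
      case False
      then have "i \<notin> {0, 1}" using n by auto
      then show ?thesis using False by blast
    qed blast
    then have "{i. i < n \<and> \<sigma> (2 * i) < 4} = {0, 1}" by blast
    then show "\<sigma> \<in> ?R" using perm[OF pq] s by auto
  qed
  have rest: "wedge_term b n v \<sigma> = 0" if s: "\<sigma> \<in> ?R - ?h ` ({p. p permutes ?A} \<times> {q. q permutes ?C})" for \<sigma>
  proof (rule ccontr)
    assume nz: "wedge_term b n v \<sigma> \<noteq> 0"
    have p: "\<sigma> permutes {..<2 * n}" and T: "{i. i < n \<and> \<sigma> (2 * i) < 4} = {0, 1}" using s by auto
    note good = wedge_term_block_nonzeroD[OF orth p nz]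
    have "0 \<in> {i. i < n \<and> \<sigma> (2 * i) < 4}" "1 \<in> {i. i < n \<and> \<sigma> (2 * i) < 4}" unfolding T by auto
    \<comment> \<open>The index set \<open>{0, 1}\<close> puts the first entries of the first two
      pairs below 4; \<open>good\<close> does the same for the second entries.\<close>
    then have lt: "\<sigma> 0 < 4" "\<sigma> 1 < 4" "\<sigma> 2 < 4" "\<sigma> 3 < 4"
      using good[of 0] good[of 1] n by auto
    have "\<sigma> ` ?A \<subseteq> ?A"
    proof
      fix y assume "y \<in> \<sigma> ` ?A"
      then obtain x where "x < 4" "y = \<sigma> x" by auto
      moreover have "x = 0 \<or> x = 1 \<or> x = 2 \<or> x = 3" using \<open>x < 4\<close> by auto
      ultimately show "y \<in> ?A" using lt by auto
    qed
    then have imA: "\<sigma> ` ?A = ?A"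
      by (rule endo_inj_surj[OF finite_lessThan]) (use permutes_inj_on[OF p] in auto)
    have imB: "\<sigma> ` ?B = ?B"
    proof -
      have "?B = {..<2 * n} - ?A" using n by auto
      then show ?thesis using imA permutes_image[OF p] image_set_diff[OF permutes_inj[OF p], of "{..<2 * n}" ?A]
        by simp
    qed
    define p1 where "p1 = restrict_id \<sigma> ?A"
    define q1 where "q1 = restrict_id \<sigma> ?B"
    have p1: "p1 permutes ?A" unfolding p1_def
      by (rule permutes_restrict_id) (use imA permutes_inj_on[OF p] in \<open>auto simp: bij_betw_def\<close>)
    have q1: "q1 permutes ?B" unfolding q1_def
      by (rule permutes_restrict_id) (use imB permutes_inj_on[OF p] in \<open>auto simp: bij_betw_def\<close>)
    define q where "q = map_permutation ?B (\<lambda>i. i - 4) q1"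
    have q: "q permutes ?C" unfolding q_def by (rule map_permutation_permutes[OF bs' q1])
    have mq: "?m q = q1" unfolding q_def
      by (rule map_permutation_compose_inv[OF bs' q1]) auto
    have "\<sigma> = p1 \<circ> ?m q"
    proof
      fix x
      show "\<sigma> x = (p1 \<circ> ?m q) x"
      proof (cases "x < 4")
        case True
        then show ?thesis using hA[OF p1 q] by (simp add: p1_def)
      next
        case False
        then have "(p1 \<circ> ?m q) x = q1 x" using hB[OF p1 q] mq by simp
        also have "\<dots> = \<sigma> x"
          using False permutes_not_in[OF p, of x] by (cases "x \<in> ?B") (auto simp: q1_def)
        finally show ?thesis by simp
      qed
    qed
    then have "\<sigma> \<in> ?h ` ({p. p permutes ?A} \<times> {q. q permutes ?C})" using p1 q by auto
    then show False using s by blast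
  qed
  have wt: "wedge_term b n v (p \<circ> ?m q) = wedge_term b 2 v p * wedge_term b (n - 2) (\<lambda>i. v (i + 4)) q"
    if pq: "p permutes ?A" "q permutes ?C" for p q
  proof -
    have "sign (p \<circ> ?m q) = sign p * sign (?m q)"
      by (rule sign_compose) (use pq mB permutation_permutes finite_lessThan finite_atLeastLessThan in blast)+
    moreover have "sign (?m q) = sign q"
      by (rule sign_map_permutation) (use pq in auto)
    moreover have "(\<Prod>i<n. b (v ((p \<circ> ?m q) (2 * i))) (v ((p \<circ> ?m q) (2 * i + 1)))) =
        (\<Prod>i<2. b (v ((p \<circ> ?m q) (2 * i))) (v ((p \<circ> ?m q) (2 * i + 1)))) *
        (\<Prod>i<n - 2. b (v ((p \<circ> ?m q) (2 * (i + 2)))) (v ((p \<circ> ?m q) (2 * (i + 2) + 1))))"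
      (is "(\<Prod>i<n. ?f i) = _")
    proof -
      have split: "(\<Prod>i<2 + m. f i) = (\<Prod>i<2. f i) * (\<Prod>i<m. f (i + 2))" for m and f :: "nat \<Rightarrow> real"
        by (induction m) (simp_all add: mult_ac)
      have "2 + (n - 2) = n" using n by simp
      from split[of ?f "n - 2", unfolded this] show ?thesis .
    qed
    moreover have "(\<Prod>i<2. b (v ((p \<circ> ?m q) (2 * i))) (v ((p \<circ> ?m q) (2 * i + 1)))) =
        (\<Prod>i<2. b (v (p (2 * i))) (v (p (2 * i + 1))))"
      by (rule prod.cong) (use hA[OF pq] in auto)
    moreover have "(\<Prod>i<n - 2. b (v ((p \<circ> ?m q) (2 * (i + 2)))) (v ((p \<circ> ?m q) (2 * (i + 2) + 1)))) =
        (\<Prod>i<n - 2. b (v (q (2 * i) + 4)) (v (q (2 * i + 1) + 4)))"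
    proof (rule prod.cong[OF refl])
      fix i assume i: "i \<in> {..<n - 2}"
      have "2 * (i + 2) = 2 * i + 4" "2 * (i + 2) + 1 = (2 * i + 1) + 4" by auto
      moreover have "(p \<circ> ?m q) (2 * i + 4) = q (2 * i) + 4" "(p \<circ> ?m q) ((2 * i + 1) + 4) = q (2 * i + 1) + 4"
        using hB(1)[OF pq, of "2 * i + 4"] hB(1)[OF pq, of "(2 * i + 1) + 4"]
          ms[OF pq(2), of "2 * i"] ms[OF pq(2), of "2 * i + 1"] i by (auto simp only: le_add2 lessThan_iff)
      ultimately show "b (v ((p \<circ> ?m q) (2 * (i + 2)))) (v ((p \<circ> ?m q) (2 * (i + 2) + 1))) =
        b (v (q (2 * i) + 4)) (v (q (2 * i + 1) + 4))" by metis
    qed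
    ultimately show ?thesis unfolding wedge_term_def by simp
  qed
  have "block_sum b n v {0, 1} = (\<Sum>\<sigma>\<in>?h ` ({p. p permutes ?A} \<times> {q. q permutes ?C}). wedge_term b n v \<sigma>)"
    unfolding block_sum_def
    by (rule sum.mono_neutral_right) (use img rest in \<open>auto simp: finite_permutations\<close>)
  also have "\<dots> = (\<Sum>(p, q)\<in>{p. p permutes ?A} \<times> {q. q permutes ?C}.
      wedge_term b 2 v p * wedge_term b (n - 2) (\<lambda>i. v (i + 4)) q)"
    unfolding sum.reindex[OF inj] by (rule sum.cong) (auto simp: wt)
  finally show ?thesis by (simp add: sum_product sum.cartesian_product)
qed

text \<open>Write the form as a + c with a living on the first four vectors and c on the others: in
  the binomial expansion of the n-th power only the term in a^2 and c^(n-2) fits the frame.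
  Combinatorially, each of the \<open>n choose 2\<close> positions of the two a-factors contributes
  the same block sum.\<close>

lemma wedge_power_block:
  assumes orth: "\<And>i j. i < 4 \<Longrightarrow> 4 \<le> j \<Longrightarrow> j < 2 * n \<Longrightarrow> b (v i) (v j) = 0 \<and> b (v j) (v i) = 0"
    and n: "2 \<le> n"
  shows "wedge_power b n v = real (n choose 2) * wedge_power b 2 v * wedge_power b (n - 2) (\<lambda>i. v (i + 4))"
proof -
  let ?W = "block_sum b n v {0, 1}"
  have "(\<Sum>T\<in>Pow {..<n}. block_sum b n v T) = (\<Sum>T\<in>{T. T \<subseteq> {..<n} \<and> card T = 2}. block_sum b n v T)"
    by (rule sum.mono_neutral_right) (use block_sum_eq_0[of n b v, OF orth n] in auto)
  also have "\<dots> = (\<Sum>T\<in>{T. T \<subseteq> {..<n} \<and> card T = 2}. ?W)"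
    using block_sum_eq by (intro sum.cong) auto
  also have "\<dots> = real (n choose 2) * ?W"
    by (simp add: n_subsets)
  finally have "wedge_power b n v = real (n choose 2) * ?W / 2 ^ n"
    by (simp only: wedge_power_eq sum_wedge_term_eq_block_sums)
  moreover have "(2::real) ^ n = 2 ^ 2 * 2 ^ (n - 2)"
    using n by (metis le_add_diff_inverse power_add)
  ultimately show ?thesis
    using block_sum_first[of n b v, OF orth n] unfolding wedge_power_eq by simp
qed

section \<open>Inner products on subspaces\<close>

text \<open>Fibre metrics are inner products on the fibre and arbitrary functions elsewhere, so the
  calculus is relative to a subspace \<open>V\<close> and its rules carry membership in
  \<open>V\<close>.\<close>

locale inner_product_subspace =
  fixes V :: "'v::euclidean_space set" and g :: "'v \<Rightarrow> 'v \<Rightarrow> real"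
  assumes subspace: "subspace V" and inner_product: "inner_product_on V g"
begin

lemma add_left: "u \<in> V \<Longrightarrow> v \<in> V \<Longrightarrow> w \<in> V \<Longrightarrow> g (u + v) w = g u w + g v w"
  and add_right: "u \<in> V \<Longrightarrow> v \<in> V \<Longrightarrow> w \<in> V \<Longrightarrow> g u (v + w) = g u v + g u w"
  and scale_left: "u \<in> V \<Longrightarrow> v \<in> V \<Longrightarrow> g (r *\<^sub>R u) v = r * g u v"
  and scale_right: "u \<in> V \<Longrightarrow> v \<in> V \<Longrightarrow> g u (r *\<^sub>R v) = r * g u v"
  and inner_commute: "u \<in> V \<Longrightarrow> v \<in> V \<Longrightarrow> g u v = g v u"
  and pos: "u \<in> V \<Longrightarrow> u \<noteq> 0 \<Longrightarrow> 0 < g u u"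
  using inner_product
  by (auto simp: inner_product_on_def bilinear_on_subspace_def linear_on_subspace_def)

lemmas mem_add = subspace_add[OF subspace] and mem_scale = subspace_scale[OF subspace]
  and mem_0 = subspace_0[OF subspace] and mem_diff = subspace_diff[OF subspace]
  and mem_sum = subspace_sum[OF subspace]

lemma zero_left: "v \<in> V \<Longrightarrow> g 0 v = 0" and zero_right: "v \<in> V \<Longrightarrow> g v 0 = 0"
  using scale_left[of 0 v 0] scale_right[of v 0 0] mem_0 by auto

lemma diff_left: "u \<in> V \<Longrightarrow> v \<in> V \<Longrightarrow> w \<in> V \<Longrightarrow> g (u - v) w = g u w - g v w"
  using add_left[of u "(-1) *\<^sub>R v" w] scale_left[of v w "-1"] mem_scale[of v "-1"] by simp

lemma sum_left: "(\<And>i. i \<in> I \<Longrightarrow> f i \<in> V) \<Longrightarrow> w \<in> V \<Longrightarrow> g (\<Sum>i\<in>I. f i) w = (\<Sum>i\<in>I. g (f i) w)"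
  by (induction I rule: infinite_finite_induct) (auto simp: zero_left add_left mem_sum)

lemma eq_0_iff: "v \<in> V \<Longrightarrow> g v v = 0 \<longleftrightarrow> v = 0"
  using pos zero_left mem_0 by (metis less_irrefl)

lemma eqI:
  assumes "u \<in> V" "v \<in> V" "\<And>w. w \<in> V \<Longrightarrow> g u w = g v w" shows "u = v"
proof -
  have "g (u - v) (u - v) = 0" using assms diff_left[of u v "u - v"] mem_diff by simp
  then show ?thesis using eq_0_iff[of "u - v"] assms mem_diff by simp
qed

section \<open>Orthonormal frames of a subspace\<close>

lemma frame_inj:
  assumes e: "orthonormal_frame V g k e"
  shows "inj_on e {..<k}"
  using e unfolding orthonormal_frame_def inj_on_def by (metis lessThan_iff zero_neq_one)

lemma frame_coeff:
  assumes e: "orthonormal_frame V g k e" and I: "I \<subseteq> {..<k}" and j: "j < k"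
  shows "g (\<Sum>i\<in>I. c i *\<^sub>R e i) (e j) = (if j \<in> I then c j else 0)"
proof -
  have fin: "finite I" using I finite_subset by blast
  have "g (\<Sum>i\<in>I. c i *\<^sub>R e i) (e j) = (\<Sum>i\<in>I. g (c i *\<^sub>R e i) (e j))"
    by (rule sum_left) (use e I j mem_scale in \<open>auto simp: orthonormal_frame_def\<close>)
  also have "\<dots> = (\<Sum>i\<in>I. if i = j then c i else 0)"
    by (rule sum.cong) (use e I j in \<open>auto simp: orthonormal_frame_def scale_left subset_iff\<close>)
  finally show ?thesis using fin by simp
qed

lemma frame_independent:
  assumes e: "orthonormal_frame V g k e"
  shows "independent (e ` {..<k})"
proof (rule independent_if_scalars_zero)
  fix c x assume s: "(\<Sum>x\<in>e ` {..<k}. c x *\<^sub>R x) = 0" and "x \<in> e ` {..<k}"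
  then obtain j where j: "j < k" "x = e j" by auto
  have "(\<Sum>i<k. c (e i) *\<^sub>R e i) = 0" using s by (simp add: sum.reindex[OF frame_inj[OF e]])
  then have "g 0 (e j) = c (e j)" using frame_coeff[OF e subset_refl j(1), of "c \<circ> e"] j(1) by simp
  then show "c x = 0" using j zero_left e by (simp add: orthonormal_frame_def)
qed simp

lemma dim_frame_span:
  assumes e: "orthonormal_frame V g k e" and I: "I \<subseteq> {..<k}"
  shows "dim (span (e ` I)) = card I"
proof -
  have "independent (e ` I)" using frame_independent[OF e] I by (meson image_mono independent_mono)
  then show ?thesis
    using card_image[OF inj_on_subset[OF frame_inj[OF e] I]] by (simp add: dim_eq_card_independent)
qed

lemma frame_length_le:
  assumes e: "orthonormal_frame V g k e" shows "k \<le> dim V"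
proof -
  have "span (e ` {..<k}) \<subseteq> V"
    by (rule span_minimal) (use e subspace in \<open>auto simp: orthonormal_frame_def\<close>)
  then have "dim (span (e ` {..<k})) \<le> dim V" by (rule dim_subset)
  then show ?thesis using dim_frame_span[OF e subset_refl] by simp
qed

lemma frame_span:
  assumes e: "orthonormal_frame V g (dim V) e" shows "span (e ` {..<dim V}) = V"
proof -
  have "e ` {..<dim V} \<subseteq> V" using e by (auto simp: orthonormal_frame_def)
  moreover have "dim V \<le> dim (e ` {..<dim V})" using dim_frame_span[OF e subset_refl] by simp
  ultimately show ?thesis using dim_eq_span span_eq_iff subspace by metis
qed

lemma frame_expand:
  assumes e: "orthonormal_frame V g (dim V) e" and v: "v \<in> V"
  shows "v = (\<Sum>i<dim V. g v (e i) *\<^sub>R e i)"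
proof -
  let ?r = "v - (\<Sum>i<dim V. g v (e i) *\<^sub>R e i)"
  have eV: "e i \<in> V" if "i < dim V" for i using e that by (auto simp: orthonormal_frame_def)
  have S: "(\<Sum>i<dim V. g v (e i) *\<^sub>R e i) \<in> V" by (intro mem_sum mem_scale eV) auto
  have r: "?r \<in> V" using S v mem_diff by blast
  have "g ?r (e j) = 0" if "j < dim V" for j
    using diff_left[OF v S eV[OF that]] frame_coeff[OF e subset_refl that, of "\<lambda>i. g v (e i)"] that by simp
  then have "e ` {..<dim V} \<subseteq> {w \<in> V. g ?r w = 0}" using eV by auto
  moreover have "subspace {w \<in> V. g ?r w = 0}"
    using r by (auto simp: subspace_def mem_0 mem_add mem_scale zero_right add_right scale_right)
  ultimately have "V \<subseteq> {w \<in> V. g ?r w = 0}" using frame_span[OF e] span_minimal by blast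
  then have "g ?r ?r = 0" using r by blast
  then show ?thesis using eq_0_iff[OF r] by simp
qed

text \<open>Writing the factor as a real power makes it a smooth function of the base point, through
  \<open>C_diff_powr\<close>, when the vector varies.\<close>

lemma normalize:
  assumes "v \<in> V" "v \<noteq> 0"
  shows "g ((g v v powr (-1/2)) *\<^sub>R v) ((g v v powr (-1/2)) *\<^sub>R v) = 1"
proof -
  have "0 < g v v" using assms pos by blast
  then have "g v v powr (-1/2) * (g v v powr (-1/2) * g v v) = 1"
    using powr_add[of "g v v" "-1/2" "-1/2"] powr_minus[of "g v v" 1] by (simp add: mult.assoc[symmetric] powr_minus_divide)
  then show ?thesis using assms by (simp add: scale_left scale_right mem_scale)
qed

lemma frame_snoc:
  assumes e: "orthonormal_frame V g k e" and v: "v \<in> V" "g v v = 1" "\<And>i. i < k \<Longrightarrow> g v (e i) = 0"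
  shows "orthonormal_frame V g (Suc k) (e(k := v))"
proof -
  have "g (e i) v = 0" if "i < k" for i
    using v(3)[OF that] inner_commute[OF v(1), of "e i"] e that by (simp add: orthonormal_frame_def)
  then show ?thesis using e v unfolding orthonormal_frame_def by (auto simp: less_Suc_eq)
qed

text \<open>One step of Gram-Schmidt: a vector outside the span of the frame minus its orthogonal
  projection.\<close>

lemma orthogonal_nonzero:
  assumes e: "orthonormal_frame V g k e" and k: "k < dim V"
  shows "\<exists>v\<in>V. v \<noteq> 0 \<and> (\<forall>i<k. g v (e i) = 0)"
proof -
  have eV: "e i \<in> V" if "i < k" for i using e that by (auto simp: orthonormal_frame_def)
  have "\<not> V \<subseteq> span (e ` {..<k})"
    using dim_frame_span[OF e subset_refl] k dim_subset[of V "span (e ` {..<k})"] by auto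
  then obtain v where v: "v \<in> V" "v \<notin> span (e ` {..<k})" by blast
  let ?s = "\<Sum>i<k. g v (e i) *\<^sub>R e i"
  have s: "?s \<in> V" "?s \<in> span (e ` {..<k})"
    by (intro mem_sum mem_scale eV, simp) (intro span_sum span_scale span_base imageI)
  have "g (v - ?s) (e j) = 0" if "j < k" for j
    using diff_left[OF v(1) s(1) eV[OF that]] frame_coeff[OF e subset_refl that, of "\<lambda>i. g v (e i)"] that by simp
  moreover have "v - ?s \<noteq> 0" using v s by auto
  ultimately show ?thesis using mem_diff[OF v(1) s(1)] by blast
qed

lemma frame_extend:
  assumes "orthonormal_frame V g k e" "k \<le> dim V"
  shows "\<exists>e'. orthonormal_frame V g (dim V) e' \<and> (\<forall>i<k. e' i = e i)"
  using assms
proof (induction "dim V - k" arbitrary: k e)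
  case 0
  then show ?case by (metis diff_is_0_eq le_antisym)
next
  case (Suc m)
  then have "k < dim V" by simp
  then obtain v where v: "v \<in> V" "v \<noteq> 0" "\<And>i. i < k \<Longrightarrow> g v (e i) = 0"
    using orthogonal_nonzero Suc by blast
  define w where "w = (g v v powr (-1/2)) *\<^sub>R v"
  have "g w (e i) = 0" if "i < k" for i
    using v that Suc.prems(1) by (simp add: w_def scale_left orthonormal_frame_def)
  then have "orthonormal_frame V g (Suc k) (e(k := w))"
    using frame_snoc[OF Suc.prems(1), of w] normalize v mem_scale by (simp add: w_def)
  moreover have "m = dim V - Suc k" using Suc.hyps(2) by simp
  ultimately obtain e' where "orthonormal_frame V g (dim V) e'" "\<forall>i<Suc k. e' i = (e(k := w)) i"
    using Suc.hyps(1)[of "Suc k" "e(k := w)"] \<open>k < dim V\<close> by (metis Suc_leI)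
  then show ?case by (intro exI[of _ e']) auto
qed

lemma frame_exists: "\<exists>e. orthonormal_frame V g (dim V) e"
  using frame_extend[of 0 undefined] by (auto simp: orthonormal_frame_def)

lemma subspaceI:
  assumes "subspace W" "W \<subseteq> V" shows "inner_product_subspace W g"
  using assms inner_product
  by unfold_locales (auto simp: inner_product_on_def bilinear_on_subspace_def linear_on_subspace_def subset_iff)

text \<open>Riesz representation in coordinates: expanding \<open>w\<close> in the frame shows that
  this vector represents \<open>a\<close>, and nondegeneracy supplies the uniqueness behind
  \<open>THE\<close> in \<open>sharp\<close>.\<close>

lemma sharp_eq:
  assumes e: "orthonormal_frame V g (dim V) e" and a: "linear_on_subspace V a"
  shows "sharp V g a = (\<Sum>i<dim V. a (e i) *\<^sub>R e i)"
proof -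
  let ?s = "\<Sum>i<dim V. a (e i) *\<^sub>R e i"
  have eV: "e i \<in> V" if "i < dim V" for i using e that by (auto simp: orthonormal_frame_def)
  have s: "?s \<in> V" by (intro mem_sum mem_scale eV) auto
  have a0: "a 0 = 0" using a mem_0 unfolding linear_on_subspace_def by (metis scaleR_zero_left)
  have asum: "a (\<Sum>i\<in>I. c i *\<^sub>R e i) = (\<Sum>i\<in>I. c i * a (e i))" if "I \<subseteq> {..<dim V}" for I c
    using that finite_subset[OF that finite_lessThan]
  proof (induction I rule: infinite_finite_induct)
    case (insert x F)
    then show ?case
      using a eV mem_scale mem_sum[of F "\<lambda>i. c i *\<^sub>R e i"]
      by (auto simp: linear_on_subspace_def subset_iff)
  qed (auto simp: a0)
  have gs: "g ?s w = a w" if w: "w \<in> V" for w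
  proof -
    have "g ?s w = (\<Sum>i<dim V. g (a (e i) *\<^sub>R e i) w)"
      by (rule sum_left) (use eV w mem_scale in auto)
    also have "\<dots> = (\<Sum>i<dim V. g w (e i) * a (e i))"
    proof (rule sum.cong[OF refl])
      fix i assume "i \<in> {..<dim V}"
      then show "g (a (e i) *\<^sub>R e i) w = g w (e i) * a (e i)"
        using eV[of i] w inner_commute[of "e i" w] by (simp add: scale_left)
    qed
    also have "\<dots> = a (\<Sum>i<dim V. g w (e i) *\<^sub>R e i)" by (simp add: asum)
    finally show ?thesis using frame_expand[OF e w] by simp
  qed
  show ?thesis
    unfolding sharp_def
  proof (rule the_equality)
    show "?s \<in> V \<and> (\<forall>w\<in>V. g ?s w = a w)" using s gs by blast
    show "v = ?s" if "v \<in> V \<and> (\<forall>w\<in>V. g v w = a w)" for v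
      by (rule eqI) (use that s gs in auto)
  qed
qed

lemma sharp:
  assumes a: "linear_on_subspace V a"
  shows "sharp V g a \<in> V" "\<And>w. w \<in> V \<Longrightarrow> g (sharp V g a) w = a w"
proof -
  obtain e where e: "orthonormal_frame V g (dim V) e" using frame_exists by blast
  have eV: "e i \<in> V" if "i < dim V" for i using e that by (auto simp: orthonormal_frame_def)
  show s: "sharp V g a \<in> V" unfolding sharp_eq[OF e a] by (intro mem_sum mem_scale eV) auto
  let ?W = "{w \<in> V. g (sharp V g a) w = a w}"
  have "a 0 = 0" using a mem_0 unfolding linear_on_subspace_def by (metis scaleR_zero_left)
  then have "Real_Vector_Spaces.subspace ?W"
    using s a by (auto simp: subspace_def mem_0 mem_add mem_scale zero_right add_right scale_right linear_on_subspace_def)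
  moreover have "e ` {..<dim V} \<subseteq> ?W"
    using eV frame_coeff[OF e subset_refl, of _ "\<lambda>i. a (e i)"] by (auto simp: sharp_eq[OF e a])
  ultimately show "g (sharp V g a) w = a w" if "w \<in> V" for w
    using frame_span[OF e] span_minimal that by blast
qed

text \<open>\<open>trace_on\<close> sums over an arbitrarily chosen basis \<open>B\<close>.
  Expanding the members of \<open>B\<close> in the frame, and the images of the frame vectors in
  \<open>B\<close>, and exchanging the two sums replaces \<open>B\<close> by the frame.\<close>

lemma trace_on_eq:
  assumes e: "orthonormal_frame V g (dim V) e" and f: "linear_on_subspace V f" "f ` V \<subseteq> V"
  shows "trace_on V f = (\<Sum>i<dim V. g (f (e i)) (e i))"
proof -
  define B where "B = (SOME B. independent B \<and> span B = V)"
  have "independent B \<and> span B = V"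
    unfolding B_def by (rule someI_ex) (use frame_independent[OF e] frame_span[OF e] in blast)
  then have B: "independent B" "span B = V" by auto
  have finB: "finite B" using B(1) independent_bound by blast
  have BV: "b \<in> V" if "b \<in> B" for b using B(2) span_base that by blast
  have eV: "e i \<in> V" if "i < dim V" for i using e that by (auto simp: orthonormal_frame_def)
  have f0: "f 0 = 0" using f(1) mem_0 unfolding linear_on_subspace_def by (metis scaleR_zero_left)
  have fsum: "f (\<Sum>i\<in>I. c i *\<^sub>R e i) = (\<Sum>i\<in>I. c i *\<^sub>R f (e i))" if "I \<subseteq> {..<dim V}" for I c
    using that finite_subset[OF that finite_lessThan]
  proof (induction I rule: infinite_finite_induct)
    case (insert x F)
    then show ?case
      using f(1) eV mem_scale mem_sum[of F "\<lambda>i. c i *\<^sub>R e i"]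
      by (auto simp: linear_on_subspace_def subset_iff)
  qed (auto simp: f0)
  have "representation B (f b) b = (\<Sum>i<dim V. g b (e i) * representation B (f (e i)) b)" if "b \<in> B" for b
  proof -
    have "f b = (\<Sum>i<dim V. g b (e i) *\<^sub>R f (e i))"
      using frame_expand[OF e BV[OF that]] fsum[OF subset_refl] by metis
    then have "representation B (f b) b = (\<Sum>i<dim V. representation B (g b (e i) *\<^sub>R f (e i)) b)"
      using f(2) eV mem_scale by (subst \<open>f b = _\<close>, subst representation_sum[OF B(1)]) (auto simp: B(2))
    also have "\<dots> = (\<Sum>i<dim V. g b (e i) * representation B (f (e i)) b)"
      by (rule sum.cong[OF refl], subst representation_scale[OF B(1)]) (use f(2) eV B(2) in auto)
    finally show ?thesis .
  qed
  then have "(\<Sum>b\<in>B. representation B (f b) b) = (\<Sum>i<dim V. \<Sum>b\<in>B. g b (e i) * representation B (f (e i)) b)"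
    by (subst sum.swap) simp
  also have "\<dots> = (\<Sum>i<dim V. g (f (e i)) (e i))"
  proof (rule sum.cong[OF refl])
    fix i assume "i \<in> {..<dim V}"
    then have i: "e i \<in> V" "f (e i) \<in> V" using eV f(2) by auto
    have "g (f (e i)) (e i) = g (\<Sum>b\<in>B. representation B (f (e i)) b *\<^sub>R b) (e i)"
      using sum_representation_eq[OF B(1) _ finB subset_refl] B(2) i by simp
    also have "\<dots> = (\<Sum>b\<in>B. g b (e i) * representation B (f (e i)) b)"
      using BV i by (subst sum_left) (auto simp: mem_scale scale_left mult.commute)
    finally show "(\<Sum>b\<in>B. g b (e i) * representation B (f (e i)) b) = g (f (e i)) (e i)" by simp
  qed
  finally show ?thesis unfolding trace_on_def B_def[symmetric] Let_def .
qed

text \<open>The Rayleigh quotient attains a minimum \<open>m\<close> on the compact unit sphere of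
  \<open>V\<close>, and a minimiser is an eigenvector because the first variation vanishes. The
  sphere is that of the ambient norm; the quotient is invariant under scaling, so the bound extends
  to all of \<open>V\<close>.\<close>

lemma eigenvector_exists:
  assumes f: "linear_on_subspace V f" "f ` V \<subseteq> V" and sa: "self_adjoint_on V g f" and ne: "V \<noteq> {0}"
  shows "\<exists>u\<in>V. \<exists>l. u \<noteq> 0 \<and> f u = l *\<^sub>R u"
proof -
  \<comment> \<open>A linear retraction onto \<open>V\<close> extends the forms, which are
    controlled on \<open>V\<close> only, to bilinear and hence continuous forms on the whole
    space.\<close>
  obtain P where P: "range P \<subseteq> V" "linear P" "\<And>v. v \<in> V \<Longrightarrow> P v = v"
    using linear_exists_left_inverse_on[of id V, OF linear_id subspace] by auto
  have Padd: "P (x + y) = P x + P y" and Pscale: "P (r *\<^sub>R x) = r *\<^sub>R P x" for x y r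
    using P(2) by (auto simp: linear_add linear_cmul)
  have PV: "P x \<in> V" for x using P(1) by auto
  have fadd: "f (x + y) = f x + f y" if "x \<in> V" "y \<in> V" for x y
    using f(1) that by (auto simp: linear_on_subspace_def)
  have fscale: "f (r *\<^sub>R x) = r *\<^sub>R f x" if "x \<in> V" for x r
    using f(1) that by (auto simp: linear_on_subspace_def)
  have fV: "f x \<in> V" if "x \<in> V" for x using f(2) that by auto
  have b1: "bilinear (\<lambda>x y. g (P x) (P y))"
    by (auto simp: bilinear_def linear_iff Padd Pscale PV add_left add_right scale_left scale_right)
  have b2: "bilinear (\<lambda>x y. g (f (P x)) (P y))"
    by (auto simp: bilinear_def linear_iff Padd Pscale PV add_left add_right scale_left scale_right fadd fscale fV)
  have cont: "continuous_on S (\<lambda>x. B x x)" if "bilinear B" for B :: "'v \<Rightarrow> 'v \<Rightarrow> real" and S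
    using bounded_bilinear.continuous_on[OF bilinear_conv_bounded_bilinear[THEN iffD1, OF that] continuous_on_id continuous_on_id]
    by simp
  let ?S = "sphere 0 1 \<inter> V"
  let ?R = "\<lambda>x. g (f (P x)) (P x) / g (P x) (P x)"
  obtain a where a: "a \<in> V" "a \<noteq> 0" using ne mem_0 by blast
  have "(1 / norm a) *\<^sub>R a \<in> ?S" using a mem_scale by auto
  then have "?S \<noteq> {}" by blast
  moreover have "compact ?S" using compact_Int_closed[OF compact_sphere closed_subspace[OF subspace]] .
  moreover have "continuous_on ?S ?R"
  proof (intro continuous_on_divide cont[OF b1] cont[OF b2] ballI)
    show "g (P x) (P x) \<noteq> 0" if "x \<in> ?S" for x
    proof -
      have "x \<in> V" "x \<noteq> 0" using that by auto
      then show ?thesis using P(3) eq_0_iff by simp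
    qed
  qed
  ultimately have "\<exists>u\<in>?S. \<forall>x\<in>?S. ?R u \<le> ?R x" by (intro continuous_attains_inf)
  then obtain u where u: "u \<in> ?S" "\<And>x. x \<in> ?S \<Longrightarrow> ?R u \<le> ?R x" by blast
  define m where "m = ?R u"
  have uV: "u \<in> V" "u \<noteq> 0" using u by auto
  have ge: "m * g x x \<le> g (f x) x" if x: "x \<in> V" for x
  proof (cases "x = 0")
    case True
    then show ?thesis using fV mem_0 zero_left zero_right by simp
  next
    case False
    let ?y = "(1 / norm x) *\<^sub>R x"
    have y: "?y \<in> ?S" using False x mem_scale by auto
    have "m \<le> g (f ?y) ?y / g ?y ?y" using u(2)[OF y] y P(3) by (simp add: m_def)
    also have "\<dots> = g (f x) x / g x x"
      using x False fV by (simp add: fscale scale_left scale_right mem_scale)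
    finally show ?thesis using pos[OF x False] by (simp add: field_simps)
  qed
  have eq: "m * g u u = g (f u) u"
    using pos[OF uV] P(3)[OF uV(1)] by (simp add: m_def)
  have "g (f u) w = g (m *\<^sub>R u) w" if w: "w \<in> V" for w
  proof -
    \<comment> \<open>The excess \<open>g (f x) x - m * g x x\<close> at \<open>x = u + t w\<close>
      is \<open>2 t b + t^2 c\<close>; being nonnegative for all \<open>t\<close>, it has no linear
      term.\<close>
    define b where "b = g (f u) w - m * g u w"
    define c where "c = g (f w) w - m * g w w"
    have q: "0 \<le> 2 * t * b + t\<^sup>2 * c" for t :: real
    proof -
      have tw: "t *\<^sub>R w \<in> V" using w mem_scale by blast
      have "m * g (u + t *\<^sub>R w) (u + t *\<^sub>R w) \<le> g (f (u + t *\<^sub>R w)) (u + t *\<^sub>R w)"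
        using ge uV w mem_add mem_scale by blast
      moreover have "g (f w) u = g (f u) w"
        using sa uV(1) w inner_commute fV unfolding self_adjoint_on_def by metis
      moreover have "g w u = g u w" using uV(1) w inner_commute by blast
      ultimately show ?thesis
        using uV(1) w tw fV eq
        by (simp add: b_def c_def add_left add_right mem_add scale_left scale_right fadd[OF uV(1) tw] fscale[OF w]
            mem_scale algebra_simps power2_eq_square)
    qed
    have "b = 0"
    proof (cases "c = 0")
      case True
      then show ?thesis using q[of 1] q[of "-1"] by simp
    next
      case False
      \<comment> \<open>At \<open>t = - b / \<bar>c\<bar>\<close> the quadratic is a negative
        multiple of \<open>b^2\<close>, whichever sign \<open>c\<close> has.\<close>
      then have "b * b \<le> 0"
        using q[of "- b / \<bar>c\<bar>"] by (cases "0 < c") (auto simp: power2_eq_square field_simps)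
      then show ?thesis using zero_le_square[of b] by (metis antisym mult_eq_0_iff)
    qed
    then show ?thesis using uV(1) w by (simp add: b_def scale_left)
  qed
  then have "f u = m *\<^sub>R u" by (intro eqI) (use uV fV mem_scale in auto)
  then show ?thesis using uV by blast
qed

text \<open>Induction on the number of eigenvectors found: self-adjointness makes their orthogonal
  complement invariant, and \<open>eigenvector_exists\<close> applies there as long as it is
  nonzero.\<close>

lemma spectral_frame:
  assumes f: "linear_on_subspace V f" "f ` V \<subseteq> V" and sa: "self_adjoint_on V g f"
  shows "\<exists>u l. orthonormal_frame V g (dim V) u \<and> (\<forall>i<dim V. f (u i) = l i *\<^sub>R u i)"
proof -
  have "\<exists>u l. orthonormal_frame V g k u \<and> (\<forall>i<k. f (u i) = l i *\<^sub>R u i)" if "k \<le> dim V" for k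
    using that
  proof (induction k)
    case 0
    then show ?case by (auto simp: orthonormal_frame_def)
  next
    case (Suc k)
    then obtain u l where u: "orthonormal_frame V g k u" "\<And>i. i < k \<Longrightarrow> f (u i) = l i *\<^sub>R u i" by auto
    have uV: "u i \<in> V" if "i < k" for i using u(1) that by (auto simp: orthonormal_frame_def)
    define W where "W = {v \<in> V. \<forall>i<k. g v (u i) = 0}"
    have sW: "Real_Vector_Spaces.subspace W"
      using uV by (auto simp: W_def subspace_def mem_0 mem_add mem_scale zero_left add_left scale_left)
    interpret W: inner_product_subspace W g by (rule subspaceI[OF sW]) (auto simp: W_def)
    have "f ` W \<subseteq> W"
    proof (rule image_subsetI)
      fix x assume x: "x \<in> W"
      then have "f x \<in> V" using f(2) by (auto simp: W_def)
      moreover have "g (f x) (u i) = 0" if "i < k" for i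
        using sa x uV[OF that] u(2)[OF that] that unfolding self_adjoint_on_def W_def
        by (simp add: scale_right)
      ultimately show "f x \<in> W" by (simp add: W_def)
    qed
    moreover have "linear_on_subspace W f" "self_adjoint_on W g f"
      using f(1) sa by (auto simp: W_def linear_on_subspace_def self_adjoint_on_def)
    moreover have "W \<noteq> {0}"
      using orthogonal_nonzero[OF u(1)] Suc.prems by (auto simp: W_def)
    ultimately obtain v m where v: "v \<in> W" "v \<noteq> 0" "f v = m *\<^sub>R v"
      using W.eigenvector_exists by blast
    define w where "w = (g v v powr (-1/2)) *\<^sub>R v"
    have w: "w \<in> W" "g w w = 1" "f w = m *\<^sub>R w"
      using v W.mem_scale W.normalize f(1) by (auto simp: w_def linear_on_subspace_def W_def)
    have "orthonormal_frame V g (Suc k) (u(k := w))"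
      by (rule frame_snoc[OF u(1)]) (use w in \<open>auto simp: W_def\<close>)
    moreover have "\<forall>i<Suc k. f ((u(k := w)) i) = (l(k := m)) i *\<^sub>R (u(k := w)) i"
      using u(2) w(3) by (auto simp: less_Suc_eq)
    ultimately show ?case by blast
  qed
  then show ?thesis by blast
qed

end

text \<open>Comparing the coefficients of \<open>f v\<close> and \<open>c *\<^sub>R v\<close> in the
  eigenframe shows that only components with eigenvalue \<open>c\<close> survive. The spans over all
  real \<open>c\<close> and the weighted count thus become statements about index sets of the frame;
  the count is the cardinality of a disjoint union of level sets of \<open>l\<close>.\<close>

lemma (in inner_product_subspace) spectral:
  assumes f: "linear_on_subspace V f"
    and u: "orthonormal_frame V g (dim V) u" "\<And>i. i < dim V \<Longrightarrow> f (u i) = l i *\<^sub>R u i"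
  shows eigenspace_on_spectral: "eigenspace_on V f c = span (u ` {i. i < dim V \<and> l i = c})"
    and positive_eigenspace_spectral: "positive_eigenspace V f = span (u ` {i. i < dim V \<and> 0 < l i})"
    and negative_eigenspace_spectral: "negative_eigenspace V f = span (u ` {i. i < dim V \<and> l i < 0})"
    and eigenvalue_count_spectral: "eigenvalue_count V f S = card {i. i < dim V \<and> l i \<in> S}"
proof -
  have uV: "u i \<in> V" if "i < dim V" for i using u(1) that by (auto simp: orthonormal_frame_def)
  have fsum: "f (\<Sum>i\<in>I. a i *\<^sub>R u i) = (\<Sum>i\<in>I. (a i * l i) *\<^sub>R u i)" if "I \<subseteq> {..<dim V}" for I a
    using that finite_subset[OF that finite_lessThan]
  proof (induction I rule: infinite_finite_induct)
    case empty
    then show ?case using f mem_0 by (metis linear_on_subspace_def scaleR_zero_left sum.empty)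
  next
    case (insert x F)
    then show ?case
      using f uV u(2) mem_scale mem_sum[of F "\<lambda>i. a i *\<^sub>R u i"]
      by (auto simp: linear_on_subspace_def subset_iff)
  qed simp
  show eig: "eigenspace_on V f c = span (u ` {i. i < dim V \<and> l i = c})" for c
  proof
    show "eigenspace_on V f c \<subseteq> span (u ` {i. i < dim V \<and> l i = c})"
    proof
      fix v assume "v \<in> eigenspace_on V f c"
      then have v: "v \<in> V" "f v = c *\<^sub>R v" by (auto simp: eigenspace_on_def)
      have fv: "f v = (\<Sum>i<dim V. (g v (u i) * l i) *\<^sub>R u i)"
        using fsum[OF subset_refl, of "\<lambda>i. g v (u i)"] frame_expand[OF u(1) v(1)] by simp
      have z: "g v (u j) = 0" if j: "j < dim V" "l j \<noteq> c" for j
      proof -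
        have "g (f v) (u j) = g v (u j) * l j"
          unfolding fv using frame_coeff[OF u(1) subset_refl j(1), of "\<lambda>i. g v (u i) * l i"] j by simp
        moreover have "g (f v) (u j) = c * g v (u j)" using v uV[OF j(1)] scale_left by simp
        ultimately show ?thesis using j(2) by simp
      qed
      have "v = (\<Sum>i<dim V. g v (u i) *\<^sub>R u i)" using frame_expand[OF u(1) v(1)] .
      also have "\<dots> = (\<Sum>i\<in>{i. i < dim V \<and> l i = c}. g v (u i) *\<^sub>R u i)"
        by (rule sum.mono_neutral_right) (use z in auto)
      also have "\<dots> \<in> span (u ` {i. i < dim V \<and> l i = c})"
        by (intro span_sum span_scale span_base) auto
      finally show "v \<in> span (u ` {i. i < dim V \<and> l i = c})" .
    qed
    have "Real_Vector_Spaces.subspace (eigenspace_on V f c)"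
      using f unfolding eigenspace_on_def linear_on_subspace_def subspace_def
      by (auto simp: mem_0 mem_add mem_scale scaleR_add_right) (metis mem_0 scaleR_zero_left)
    then show "span (u ` {i. i < dim V \<and> l i = c}) \<subseteq> eigenspace_on V f c"
      by (intro span_minimal) (use u(2) uV in \<open>auto simp: eigenspace_on_def\<close>)
  qed
  have un: "span (\<Union>c\<in>C. span (u ` {i. i < dim V \<and> l i = c})) = span (u ` {i. i < dim V \<and> l i \<in> C})" for C
  proof (rule span_unique)
    show "(\<Union>c\<in>C. span (u ` {i. i < dim V \<and> l i = c})) \<subseteq> span (u ` {i. i < dim V \<and> l i \<in> C})"
      by (intro UN_least span_mono) auto
    show "span (u ` {i. i < dim V \<and> l i \<in> C}) \<subseteq> T"
      if "(\<Union>c\<in>C. span (u ` {i. i < dim V \<and> l i = c})) \<subseteq> T" "Real_Vector_Spaces.subspace T" for T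
    proof (rule span_minimal[OF _ that(2)])
      show "u ` {i. i < dim V \<and> l i \<in> C} \<subseteq> T"
      proof (rule image_subsetI)
        fix i assume i: "i \<in> {i. i < dim V \<and> l i \<in> C}"
        then have "u i \<in> span (u ` {j. j < dim V \<and> l j = l i})" by (intro span_base) auto
        then show "u i \<in> T" using that(1) i by blast
      qed
    qed
  qed auto
  show "positive_eigenspace V f = span (u ` {i. i < dim V \<and> 0 < l i})"
    unfolding positive_eigenspace_def eig un by simp
  show "negative_eigenspace V f = span (u ` {i. i < dim V \<and> l i < 0})"
    unfolding negative_eigenspace_def eig un by simp
  let ?I = "\<lambda>c. {i. i < dim V \<and> l i = c}"
  have d: "dim (eigenspace_on V f c) = card (?I c)" for c
    unfolding eig by (rule dim_frame_span[OF u(1)]) auto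
  have ne: "eigenspace_on V f c \<noteq> {0} \<longleftrightarrow> c \<in> l ` {..<dim V}" for c
  proof -
    have "Real_Vector_Spaces.subspace (eigenspace_on V f c)" unfolding eig by simp
    then have "eigenspace_on V f c = {0} \<longleftrightarrow> card (?I c) = 0"
      using d[of c] by (metis dim_eq_0 subset_singletonD subspace_0 empty_iff order_refl)
    then show ?thesis by auto
  qed
  have "eigenvalue_count V f S = (\<Sum>c\<in>S \<inter> l ` {..<dim V}. card (?I c))"
    unfolding eigenvalue_count_def d ne by (rule sum.cong) auto
  also have "\<dots> = card (\<Union>c\<in>S \<inter> l ` {..<dim V}. ?I c)"
    by (rule card_UN_disjoint[symmetric]) auto
  also have "(\<Union>c\<in>S \<inter> l ` {..<dim V}. ?I c) = {i. i < dim V \<and> l i \<in> S}" by auto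
  finally show "eigenvalue_count V f S = card {i. i < dim V \<and> l i \<in> S}" .
qed

section \<open>Self-dual forms in dimension four\<close>

lemma orthonormal_frame_mem: "orthonormal_frame V g k e \<Longrightarrow> i < k \<Longrightarrow> e i \<in> V"
  and orthonormal_frame_inner:
    "orthonormal_frame V g k e \<Longrightarrow> i < k \<Longrightarrow> j < k \<Longrightarrow> g (e i) (e j) = (if i = j then 1 else 0)"
  unfolding orthonormal_frame_def by blast+

text \<open>Forms lie in a space of functions, where a subspace without finite basis has
  \<open>dim\<close> equal to 0; \<open>dim S \<noteq> 0\<close> therefore guarantees a finite basis
  of \<open>S\<close>, which is then pushed forward.\<close>

lemma dim_image_function_space:
  fixes S :: "'x::real_vector set" and T :: "'x \<Rightarrow> 'y::euclidean_space"
  assumes T: "linear T" and S: "subspace S" and k: "dim S \<noteq> 0"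
  shows "dim (T ` S) \<le> dim S" and "inj_on T S \<Longrightarrow> dim (T ` S) = dim S"
proof -
  obtain B where B: "B \<subseteq> S" "independent B" "S \<subseteq> span B" "card B = dim S"
    using basis_exists by blast
  have fin: "finite B" using k B(4) card.infinite by metis
  have sB: "span B = S" using B S by (meson span_minimal subset_antisym)
  have TS: "T ` S = span (T ` B)" using linear_span_image[OF T] sB by metis
  show "dim (T ` S) \<le> dim S"
    unfolding TS dim_span using dim_le_card'[OF finite_imageI[OF fin]] card_image_le[OF fin, of T] B(4)
    by (metis le_trans)
  assume inj: "inj_on T S"
  have "independent (T ` B)"
    using linear_independent_injective_image[OF T B(2)] inj sB by simp
  moreover have "card (T ` B) = dim S"
    using card_image[OF inj_on_subset[OF inj B(1)]] B(4) by simp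
  ultimately show "dim (T ` S) = dim S" unfolding TS dim_span by (simp add: dim_eq_card_independent)
qed

text \<open>Rank and nullity: a linear right inverse \<open>r\<close> of \<open>h\<close> with range
  in \<open>V\<close> splits \<open>V\<close> into the kernel of \<open>h\<close> and the range of
  \<open>r\<close>, which has the dimension of the target.\<close>

lemma dim_kernel_on:
  fixes h :: "'v::euclidean_space \<Rightarrow> 'w::euclidean_space"
  assumes h: "linear h" and V: "subspace V" and onto: "h ` V = UNIV"
  shows "dim {v \<in> V. h v = 0} + DIM('w) = dim V"
proof -
  obtain r where r: "range r \<subseteq> V" "linear r" "\<And>y. h (r y) = y"
    using linear_exists_right_inverse_on[OF h V] onto by auto
  let ?S = "{v \<in> V. h v = 0}"
  have S: "subspace ?S"
    using h V by (auto simp: subspace_def linear_0 linear_add linear_cmul)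
  have R: "subspace (range r)" using linear_subspace_image[OF r(2) subspace_UNIV] .
  have "?S \<inter> range r = {0}" using r linear_0[OF r(2)] linear_0[OF h] V subspace_0 by fastforce
  moreover have "{x + y |x y. x \<in> ?S \<and> y \<in> range r} = V"
  proof (intro equalityI subsetI)
    fix v assume v: "v \<in> V"
    have "r (h v) \<in> V" using r(1) by auto
    then have "v - r (h v) \<in> ?S" using v V h r(3) by (auto simp: subspace_diff linear_diff)
    then show "v \<in> {x + y |x y. x \<in> ?S \<and> y \<in> range r}"
      by (intro CollectI exI[of _ "v - r (h v)"] exI[of _ "r (h v)"]) auto
  qed (use r(1) V in \<open>auto simp: subspace_add subset_iff\<close>)
  moreover have "dim (range r) = DIM('w)"
    using dim_image_eq[OF r(2), of UNIV] inj_on_inverseI[of UNIV h r] r(3) by simp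
  ultimately show ?thesis using dim_sums_Int[OF S R] by simp
qed

section \<open>Alternating and self-dual forms on an inner product subspace\<close>

lemma Alt2_skew:
  assumes b: "b \<in> Alt2 V" and V: "subspace V" and "u \<in> V" "w \<in> V"
  shows "b u w = - b w u"
proof -
  have bl: "bilinear_on_subspace V b" and z: "\<And>v. v \<in> V \<Longrightarrow> b v v = 0" using b by (auto simp: Alt2_def)
  have "u + w \<in> V" using V assms subspace_add by blast
  then have "b (u + w) (u + w) = b u u + b w u + (b u w + b w w)"
    using bl assms unfolding bilinear_on_subspace_def linear_on_subspace_def by auto
  then show ?thesis using z \<open>u + w \<in> V\<close> assms by simp
qed

lemma subspace_Alt2:
  assumes V: "subspace V" shows "subspace (Alt2 V)"
  unfolding subspace_def Alt2_def bilinear_on_subspace_def linear_on_subspace_def restrict_form_def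
  by (auto simp: scaleR_fun_def plus_fun_def zero_fun_def fun_eq_iff algebra_simps)

context inner_product_subspace
begin

lemma bilinear_frame_expand:
  assumes e: "orthonormal_frame V g (dim V) e" and b: "bilinear_on_subspace V b" and "u \<in> V" "w \<in> V"
  shows "b u w = (\<Sum>i<dim V. \<Sum>j<dim V. g u (e i) * g w (e j) * b (e i) (e j))"
proof -
  have eV: "e i \<in> V" if "i < dim V" for i using orthonormal_frame_mem[OF e that] .
  have lin: "a (\<Sum>i<dim V. c i *\<^sub>R e i) = (\<Sum>i<dim V. c i * a (e i))" if a: "linear_on_subspace V a" for a :: "'v \<Rightarrow> real" and c
  proof -
    have a0: "a 0 = 0" using a mem_0 unfolding linear_on_subspace_def by (metis scaleR_zero_left)
    have "a (\<Sum>i\<in>I. c i *\<^sub>R e i) = (\<Sum>i\<in>I. c i * a (e i))" if "I \<subseteq> {..<dim V}" for I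
      using that finite_subset[OF that finite_lessThan]
    proof (induction I rule: infinite_finite_induct)
      case (insert x F)
      then show ?case
        using a eV mem_scale mem_sum[of F "\<lambda>i. c i *\<^sub>R e i"]
        by (auto simp: linear_on_subspace_def subset_iff)
    qed (auto simp: a0)
    then show ?thesis by blast
  qed
  have "b u w = (\<Sum>i<dim V. g u (e i) * b (e i) w)"
    using lin[of "\<lambda>x. b x w" "\<lambda>i. g u (e i)"] frame_expand[OF e \<open>u \<in> V\<close>] b \<open>w \<in> V\<close>
    by (simp add: bilinear_on_subspace_def)
  also have "\<dots> = (\<Sum>i<dim V. g u (e i) * (\<Sum>j<dim V. g w (e j) * b (e i) (e j)))"
  proof (rule sum.cong[OF refl])
    fix i assume "i \<in> {..<dim V}"
    then have "b (e i) w = (\<Sum>j<dim V. g w (e j) * b (e i) (e j))"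
      using lin[of "b (e i)" "\<lambda>i. g w (e i)"] frame_expand[OF e \<open>w \<in> V\<close>] b eV
      by (simp add: bilinear_on_subspace_def)
    then show "g u (e i) * b (e i) w = g u (e i) * (\<Sum>j<dim V. g w (e j) * b (e i) (e j))" by simp
  qed
  finally show ?thesis by (simp add: sum_distrib_left mult.assoc)
qed

text \<open>Skew-symmetry leaves the entries with \<open>i < j\<close>; outside \<open>V\<close>
  both forms are 0 by the normalisation \<open>restrict_form V b = b\<close>, so they agree as
  functions.\<close>

lemma Alt2_eqI:
  assumes e: "orthonormal_frame V g (dim V) e" and b: "b \<in> Alt2 V" "b' \<in> Alt2 V"
    and eq: "\<And>i j. i < j \<Longrightarrow> j < dim V \<Longrightarrow> b (e i) (e j) = b' (e i) (e j)"
  shows "b = b'"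
proof (intro ext)
  fix u w
  have eV: "e i \<in> V" if "i < dim V" for i using orthonormal_frame_mem[OF e that] .
  show "b u w = b' u w"
  proof (cases "u \<in> V \<and> w \<in> V")
    case True
    have "b (e i) (e j) = b' (e i) (e j)" if "i < dim V" "j < dim V" for i j
    proof -
      consider "i < j" | "i = j" | "j < i" by linarith
      then show ?thesis
      proof cases
        case 3
        then show ?thesis
          using eq[of j i] Alt2_skew[OF b(1) subspace, of "e i" "e j"] Alt2_skew[OF b(2) subspace, of "e i" "e j"] that eV
          by simp
      qed (use eq that b eV in \<open>auto simp: Alt2_def\<close>)
    qed
    then have "(\<Sum>i<dim V. \<Sum>j<dim V. g u (e i) * g w (e j) * b (e i) (e j)) =
        (\<Sum>i<dim V. \<Sum>j<dim V. g u (e i) * g w (e j) * b' (e i) (e j))" by simp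
    moreover have "bilinear_on_subspace V b" "bilinear_on_subspace V b'" using b by (auto simp: Alt2_def)
    ultimately show ?thesis
      using True bilinear_frame_expand[OF e, of b u w] bilinear_frame_expand[OF e, of b' u w] by metis
  next
    case False
    have "restrict_form V b = b" "restrict_form V b' = b'" using b by (auto simp: Alt2_def)
    then show ?thesis using False by (metis restrict_form_def)
  qed
qed

text \<open>The wedge product of the 1-forms dual to \<open>a\<close> and \<open>c\<close> under
  \<open>g\<close>. With frame vectors inserted for \<open>a\<close> and \<open>c\<close>, these are
  the test forms that extract single components from \<open>hodge_dual\<close>.\<close>

definition elementary_form :: "'v \<Rightarrow> 'v \<Rightarrow> 'v \<Rightarrow> 'v \<Rightarrow> real"
  where "elementary_form a c = restrict_form V (\<lambda>u w. g u a * g w c - g u c * g w a)"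

lemma elementary_form_Alt2: "a \<in> V \<Longrightarrow> c \<in> V \<Longrightarrow> elementary_form a c \<in> Alt2 V"
  unfolding Alt2_def elementary_form_def bilinear_on_subspace_def linear_on_subspace_def restrict_form_def
  by (auto simp: mem_add mem_scale add_left scale_left algebra_simps fun_eq_iff)

lemma elementary_form_frame:
  assumes "orthonormal_frame V g k f" "i < k" "j < k" "l < k" "m < k"
  shows "elementary_form (f i) (f j) (f l) (f m) =
    (if l = i \<and> m = j then 1 else 0) - (if l = j \<and> m = i then 1 else 0)"
proof -
  have "(if P then 1 else 0) * (if Q then 1 else 0) = (if P \<and> Q then 1 else 0 :: real)" for P Q by simp
  then show ?thesis
    unfolding elementary_form_def restrict_form_def
    by (simp only: orthonormal_frame_mem[OF assms(1)] orthonormal_frame_inner[OF assms(1)] assms(2-) simp_thms if_True)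
qed

lemma sum_pairs_4: "(\<Sum>j<4::nat. \<Sum>i<j. h i j) =
    h 0 1 + h 0 2 + h 1 2 + h 0 3 + h 1 3 + h 2 3" for h :: "nat \<Rightarrow> nat \<Rightarrow> real"
  by (simp add: eval_nat_numeral)

text \<open>Testing the Hodge condition with the wedge of the covectors of \<open>f 0\<close> and
  \<open>f k\<close> leaves a single term on each side: the complementary component of
  \<open>b\<close> up to sign, and the component of \<open>b\<close> itself.\<close>

lemma self_dual_components:
  assumes b: "b \<in> self_dual_forms V g P" and f: "orthonormal_frame V g 4 f" "P f"
  shows "b (f 2) (f 3) = b (f 0) (f 1)" "b (f 1) (f 3) = - b (f 0) (f 2)" "b (f 1) (f 2) = b (f 0) (f 3)"
proof -
  have bA: "b \<in> Alt2 V" and h: "\<And>a. a \<in> Alt2 V \<Longrightarrow> wedge2 a b f = (\<Sum>j<4. \<Sum>i<j. a (f i) (f j) * b (f i) (f j))"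
    using b f by (auto simp: self_dual_forms_def hodge_dual_def)
  have fV: "f i \<in> V" if "i < 4" for i using orthonormal_frame_mem[OF f(1) that] .
  have *: "wedge2 (elementary_form (f k) (f l)) b f =
      (\<Sum>j<4. \<Sum>i<j. elementary_form (f k) (f l) (f i) (f j) * b (f i) (f j))" if "k < 4" "l < 4" for k l
    by (rule h[OF elementary_form_Alt2[OF fV[OF that(1)] fV[OF that(2)]]])
  have **: "wedge2 (elementary_form (f k) (f l)) b f =
     elementary_form (f k) (f l) (f 0) (f 1) * b (f 2) (f 3) - elementary_form (f k) (f l) (f 0) (f 2) * b (f 1) (f 3) +
     elementary_form (f k) (f l) (f 0) (f 3) * b (f 1) (f 2)
    + elementary_form (f k) (f l) (f 2) (f 3) * b (f 0) (f 1) - elementary_form (f k) (f l) (f 1) (f 3) * b (f 0) (f 2) +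
    elementary_form (f k) (f l) (f 1) (f 2) * b (f 0) (f 3)" if "k < 4" "l < 4" for k l
  proof (rule wedge2_explicit)
    fix i j :: nat assume "i < 4" "j < 4"
    then have ij: "f i \<in> V" "f j \<in> V" using fV by auto
    show "elementary_form (f k) (f l) (f i) (f j) = - elementary_form (f k) (f l) (f j) (f i)"
      by (rule Alt2_skew[OF elementary_form_Alt2[OF fV[OF that(1)] fV[OF that(2)]] subspace ij])
    show "b (f i) (f j) = - b (f j) (f i)" by (rule Alt2_skew[OF bA subspace ij])
  qed
  note el = elementary_form_frame[OF f(1)]
  show "b (f 2) (f 3) = b (f 0) (f 1)"
    using *[of 0 1] **[of 0 1] by (simp add: sum_pairs_4 el)
  show "b (f 1) (f 3) = - b (f 0) (f 2)"
    using *[of 0 2] **[of 0 2] by (simp add: sum_pairs_4 el)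
  show "b (f 1) (f 2) = b (f 0) (f 3)"
    using *[of 0 3] **[of 0 3] by (simp add: sum_pairs_4 el)
qed

lemma self_dual_eq_0:
  assumes b: "b \<in> self_dual_forms V g P" and f: "orthonormal_frame V g 4 f" "P f" and d: "dim V = 4"
    and z: "b (f 0) (f 1) = 0" "b (f 0) (f 2) = 0" "b (f 0) (f 3) = 0"
  shows "b = 0"
proof (rule Alt2_eqI[of f])
  show "b \<in> Alt2 V" using b by (auto simp: self_dual_forms_def hodge_dual_def)
  show "0 \<in> Alt2 V" using subspace_0[OF subspace_Alt2[OF subspace]] .
  show "b (f i) (f j) = 0 (f i) (f j)" if "i < j" "j < dim V" for i j
  proof -
    have "(i = 0 \<and> j = 1) \<or> (i = 0 \<and> j = 2) \<or> (i = 0 \<and> j = 3) \<or> (i = 1 \<and> j = 2) \<or> (i = 1 \<and> j = 3) \<or> (i = 2 \<and> j = 3)"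
      using that d by auto
    then show ?thesis using z self_dual_components[OF b f] by auto
  qed
qed (use f d in simp)

text \<open>If no frame were positive then every form would count as self-dual, but \<open>Alt2 V\<close> has dimension six.\<close>

lemma positive_frame_exists:
  assumes D: "linear (D :: 'v \<Rightarrow> 'v \<Rightarrow> 'v \<Rightarrow> real)" and im: "D ` V = self_dual_forms V g P"
    and d3: "dim (D ` V) = 3" and d: "dim V = 4"
  shows "\<exists>f. orthonormal_frame V g 4 f \<and> P f"
proof (rule ccontr)
  assume "\<not> ?thesis"
  then have all: "self_dual_forms V g P = Alt2 V"
    unfolding self_dual_forms_def hodge_dual_def by blast
  obtain f where f: "orthonormal_frame V g 4 f" using frame_exists d by auto
  have fV: "f i \<in> V" if "i < 4" for i using orthonormal_frame_mem[OF f(1) that] .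
  \<comment> \<open>Four of the six independent components already exceed the dimension 3 of the
    image of \<open>D\<close>.\<close>
  let ?T = "\<lambda>b. (b (f 0) (f 1), b (f 0) (f 2), b (f 0) (f 3), b (f 1) (f 2)) :: real \<times> real \<times> real \<times> real"
  have T: "linear ?T" by (auto simp: linear_iff scaleR_fun_def plus_fun_def)
  have sub: "Real_Vector_Spaces.subspace (D ` V)" using linear_subspace_image[OF D subspace] .
  have "(x, y, z, w) \<in> ?T ` (D ` V)" for x y z w
  proof -
    let ?b = "x *\<^sub>R elementary_form (f 0) (f 1) + y *\<^sub>R elementary_form (f 0) (f 2)
       + z *\<^sub>R elementary_form (f 0) (f 3) + w *\<^sub>R elementary_form (f 1) (f 2)"
    have "?b \<in> Alt2 V"
      by (intro subspace_add[OF subspace_Alt2[OF subspace]] subspace_scale[OF subspace_Alt2[OF subspace]]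
          elementary_form_Alt2 fV) auto
    then have m: "?b \<in> D ` V" unfolding im all .
    have ev: "?b u v = x * elementary_form (f 0) (f 1) u v + y * elementary_form (f 0) (f 2) u v
       + z * elementary_form (f 0) (f 3) u v + w * elementary_form (f 1) (f 2) u v" for u v
      by (simp only: plus_fun_def scaleR_fun_def real_scaleR_def)
    have t: "(x, y, z, w) = ?T ?b"
      unfolding ev by (simp add: elementary_form_frame[OF f])
    show ?thesis by (rule image_eqI[where f = ?T and x = ?b]) (rule t, rule m)
  qed
  then have "?T ` (D ` V) = UNIV" by (intro equalityI subset_UNIV subsetI) auto
  then have "dim (?T ` (D ` V)) = 4" by (simp only: dim_UNIV) simp
  then show False using dim_image_function_space(1)[OF T sub] d3 by simp
qed

text \<open>The three components involving \<open>f 0\<close> are injective on self-dual forms,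
  hence bijective from the 3-dimensional image of \<open>D\<close> onto R^3. Composing with
  \<open>D\<close> and counting dimensions, 4 - 3, gives the 1-dimensional kernel.\<close>

lemma self_dual_gradient:
  assumes D: "linear (D :: 'v \<Rightarrow> 'v \<Rightarrow> 'v \<Rightarrow> real)" and im: "D ` V = self_dual_forms V g P"
    and d3: "dim (D ` V) = 3" and d: "dim V = 4" and f: "orthonormal_frame V g 4 f" "P f"
  shows "\<And>x y z. \<exists>v\<in>V. D v (f 0) (f 1) = x \<and> D v (f 0) (f 2) = y \<and> D v (f 0) (f 3) = z"
    and "dim {v \<in> V. D v = 0} = 1"
proof -
  let ?T = "\<lambda>b. (b (f 0) (f 1), b (f 0) (f 2), b (f 0) (f 3)) :: real \<times> real \<times> real"
  have T: "linear ?T" by (auto simp: linear_iff scaleR_fun_def plus_fun_def)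
  have sub: "Real_Vector_Spaces.subspace (D ` V)" using linear_subspace_image[OF D subspace] .
  have T0: "b = 0" if "b \<in> D ` V" "?T b = 0" for b
    by (rule self_dual_eq_0[where P = P and f = f, OF _ f d]) (use that im in \<open>auto simp: zero_prod_def\<close>)
  have "inj_on ?T (D ` V)"
    using linear_injective_on_subspace_0[OF T sub] T0 by blast
  then have "dim (?T ` (D ` V)) = 3" using dim_image_function_space(2)[OF T sub] d3 by simp
  moreover have "Real_Vector_Spaces.subspace (?T ` (D ` V))" using linear_subspace_image[OF T sub] .
  ultimately have onto: "?T ` (D ` V) = UNIV"
    using dim_eq_full[of "?T ` (D ` V)"] span_eq_iff[of "?T ` (D ` V)"] by simp
  show "\<exists>v\<in>V. D v (f 0) (f 1) = x \<and> D v (f 0) (f 2) = y \<and> D v (f 0) (f 3) = z" for x y z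
  proof -
    have "(x, y, z) \<in> ?T ` (D ` V)" using onto by simp
    then show ?thesis by auto
  qed
  have lin: "linear (\<lambda>v. ?T (D v))" using linear_compose[OF D T] by (simp add: o_def)
  have "dim {v \<in> V. ?T (D v) = 0} + DIM(real \<times> real \<times> real) = dim V"
    by (rule dim_kernel_on[OF lin subspace]) (use onto in \<open>simp add: image_image\<close>)
  moreover have "{v \<in> V. ?T (D v) = 0} = {v \<in> V. D v = 0}"
    using T0 by (auto simp: zero_prod_def)
  ultimately show "dim {v \<in> V. D v = 0} = 1" using d by simp
qed

text \<open>With \<open>V\<close> the kernel, \<open>f 0\<close> a unit vector spanning the kernel of \<open>D\<close> and \<open>N\<close> its orthogonal
  complement: \<open>v \<mapsto> \<iota>\<^sub>X D v\<close> is symmetric by \<open>d\<omega> = 0\<close>; self-duality turns its trace into another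
  instance of \<open>d\<omega> = 0\<close>.\<close>

lemma normal_endomorphism:
  assumes D: "linear (D :: 'v \<Rightarrow> 'v \<Rightarrow> 'v \<Rightarrow> real)" and im: "D ` V = self_dual_forms V g P"
    and d: "dim V = 4" and f: "orthonormal_frame V g 4 f" "P f"
    and closed: "\<And>u v w. u \<in> V \<Longrightarrow> v \<in> V \<Longrightarrow> w \<in> V \<Longrightarrow> D u v w + D v w u + D w u v = 0"
    and ker: "{v \<in> V. D v = 0} = span {f 0}"
  defines "N \<equiv> {v \<in> V. g v (f 0) = 0}"
  defines "F \<equiv> \<lambda>v. sharp N g (interior (f 0) (D v))"
  shows "subspace N" "dim N = 3" "orthonormal_frame N g 3 (\<lambda>i. f (Suc i))"
    and "linear_on_subspace N F" "F ` N \<subseteq> N"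
    and "\<And>v w. v \<in> N \<Longrightarrow> w \<in> N \<Longrightarrow> g (F v) w = D v (f 0) w"
    and "self_adjoint_on N g F" "trace_on N F = 0" "inj_on F N"
proof -
  have fV: "f i \<in> V" if "i < 4" for i using orthonormal_frame_mem[OF f(1) that] .
  have ff: "g (f i) (f j) = (if i = j then 1 else 0)" if "i < 4" "j < 4" for i j
    using orthonormal_frame_inner[OF f(1) that] .
  have DA: "D v \<in> Alt2 V" if "v \<in> V" for v using im that by (auto simp: self_dual_forms_def hodge_dual_def)
  have DS: "D v \<in> self_dual_forms V g P" if "v \<in> V" for v using im that by blast
  show sN: "subspace N"
    using fV[of 0] by (auto simp: N_def subspace_def mem_0 mem_add mem_scale zero_left add_left scale_left)
  have NV: "N \<subseteq> V" by (auto simp: N_def)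
  interpret N: inner_product_subspace N g by (rule subspaceI[OF sN NV])
  show fr: "orthonormal_frame N g 3 (\<lambda>i. f (Suc i))"
    using fV ff by (auto simp: orthonormal_frame_def N_def)
  have "dim N \<noteq> 4"
  proof
    assume "dim N = 4"
    then have "N = V" using subspace_dim_equal[OF sN subspace NV] d by simp
    then have "f 0 \<in> N" using fV[of 0] by simp
    then show False using ff[of 0 0] by (simp add: N_def)
  qed
  moreover have "3 \<le> dim N" using N.frame_length_le[OF fr] .
  ultimately show dN: "dim N = 3" using dim_subset[OF NV] d by simp
  have fr': "orthonormal_frame N g (dim N) (\<lambda>i. f (Suc i))" using fr dN by simp
  have lin: "linear_on_subspace N (interior (f 0) (D v))" if "v \<in> V" for v
  proof -
    have "linear_on_subspace V (D v (f 0))"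
      using DA[OF that] fV[of 0] by (simp add: Alt2_def bilinear_on_subspace_def)
    then show ?thesis using NV unfolding linear_on_subspace_def interior_def by blast
  qed
  have FN: "F v \<in> N" if "v \<in> N" for v unfolding F_def using N.sharp(1)[OF lin] NV that by blast
  then show FN': "F ` N \<subseteq> N" by blast
  show gF: "g (F v) w = D v (f 0) w" if "v \<in> N" "w \<in> N" for v w
    unfolding F_def using N.sharp(2)[OF lin, of v w] NV that by (auto simp: interior_def)
  have Dadd: "D (u + v) = D u + D v" and Dscale: "D (r *\<^sub>R v) = r *\<^sub>R D v" for u v r
    using D by (auto simp: linear_iff)
  show linF: "linear_on_subspace N F"
    unfolding linear_on_subspace_def
  proof (intro conjI ballI allI)
    show "F (u + v) = F u + F v" if "u \<in> N" "v \<in> N" for u v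
      by (rule N.eqI) (use that FN gF N.mem_add in \<open>auto simp: N.add_left Dadd plus_fun_def\<close>)
    show "F (r *\<^sub>R v) = r *\<^sub>R F v" if "v \<in> N" for r v
      by (rule N.eqI) (use that FN gF N.mem_scale in \<open>auto simp: N.scale_left Dscale scaleR_fun_def\<close>)
  qed
  have D0: "D (f 0) = 0" using ker span_base[of "f 0" "{f 0}"] by auto
  have symm: "D v (f 0) w = D w (f 0) v" if "v \<in> V" "w \<in> V" for v w
  proof -
    have "D v (f 0) w + D (f 0) w v + D w v (f 0) = 0" using closed fV[of 0] that by auto
    moreover have "D w v (f 0) = - D w (f 0) v" by (rule Alt2_skew[OF DA[OF that(2)] subspace that(1) fV]) simp
    ultimately show ?thesis using D0 by (simp add: zero_fun_def)
  qed
  show "self_adjoint_on N g F"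
    unfolding self_adjoint_on_def
  proof (intro ballI)
    fix v w assume vw: "v \<in> N" "w \<in> N"
    have "g v (F w) = g (F w) v" using vw FN N.inner_commute by blast
    moreover have "D v (f 0) w = D w (f 0) v" by (rule symm) (use vw NV in auto)
    ultimately show "g (F v) w = g v (F w)" using gF vw by simp
  qed
  have "trace_on N F = (\<Sum>i<3. g (F (f (Suc i))) (f (Suc i)))"
    using N.trace_on_eq[OF fr' linF FN'] dN by simp
  also have "\<dots> = (\<Sum>i<3. D (f (Suc i)) (f 0) (f (Suc i)))"
    by (rule sum.cong[OF refl], rule gF) (use orthonormal_frame_mem[OF fr] in auto)
  also have "\<dots> = D (f 1) (f 0) (f 1) + D (f 2) (f 0) (f 2) + D (f 3) (f 0) (f 3)"
    by (simp add: eval_nat_numeral)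
  also have "\<dots> = D (f 1) (f 2) (f 3) - D (f 2) (f 1) (f 3) + D (f 3) (f 1) (f 2)"
    using self_dual_components[where P = P and f = f, OF DS f] fV by simp
  finally show "trace_on N F = 0"
    using closed[of "f 1" "f 2" "f 3"] fV Alt2_skew[OF DA[OF fV[of 2]] subspace fV[of 1] fV[of 3]] by simp
  show "inj_on F N"
  proof (rule inj_onI)
    fix v w assume vw: "v \<in> N" "w \<in> N" and eq: "F v = F w"
    have u: "v - w \<in> N" using vw N.mem_diff by blast
    have Du: "D (v - w) = D v - D w" using linear_diff[OF D] .
    \<comment> \<open>A vector of \<open>N\<close> killed by \<open>F\<close> has vanishing
      components with \<open>f 0\<close>, so \<open>D\<close> kills it by self-duality; it is then a
      multiple of \<open>f 0\<close> and at the same time orthogonal to \<open>f 0\<close>.\<close>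
    have z: "D (v - w) (f 0) (f i) = 0" if "i \<in> {1, 2, 3}" for i
    proof -
      have "f (Suc (i - 1)) \<in> N" by (rule orthonormal_frame_mem[OF fr]) (use that in auto)
      then have "f i \<in> N" using that by (cases i) auto
      then show ?thesis using gF[OF vw(1)] gF[OF vw(2)] eq unfolding Du by (simp add: fun_diff_def)
    qed
    have "D (v - w) = 0"
      by (rule self_dual_eq_0[where P = P and f = f, OF DS f d]) (use z u NV in auto)
    then have "v - w \<in> span {f 0}" using ker u NV by blast
    then obtain c where c: "v - w = c *\<^sub>R f 0" by (auto simp: span_singleton)
    have "g (v - w) (f 0) = 0" using u by (simp add: N_def)
    then have "c = 0" using c fV[of 0] ff[of 0 0] scale_left by simp
    then show "v = w" using c by simp
  qed
qed

end

section \<open>The zero set of a family of 2-forms\<close>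

text \<open>Product rule when differentiability of \<open>B\<close> is known for fixed arguments: in
  coordinates all three factors are scalar functions. Bilinearity holds on \<open>S\<close>, so the
  derivative of the coordinate expression is transferred on that neighbourhood.\<close>

lemma has_derivative_bilinear_family:
  fixes B :: "'x::euclidean_space \<Rightarrow> 'v::euclidean_space \<Rightarrow> 'v \<Rightarrow> real"
  assumes S: "open S" "x \<in> S" and bil: "\<And>x. x \<in> S \<Longrightarrow> bilinear (B x)"
    and diff: "\<And>u w. (\<lambda>x. B x u w) differentiable (at x)"
    and a: "(a has_derivative a') (at x)" and b: "(b has_derivative b') (at x)"
  shows "((\<lambda>x. B x (a x) (b x)) has_derivative (\<lambda>v. frechet_derivative (\<lambda>y. B y (a x) (b x)) (at x) v
      + B x (a' v) (b x) + B x (a x) (b' v))) (at x)"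
proof -
  let ?D = "\<lambda>u w. frechet_derivative (\<lambda>y. B y u w) (at x)"
  have D: "((\<lambda>y. B y u w) has_derivative ?D u w) (at x)" for u w
    using diff frechet_derivative_works by blast
  have expand: "B y p q = (\<Sum>i\<in>Basis. \<Sum>j\<in>Basis. ((p \<bullet> i) * (q \<bullet> j)) * B y i j)" if "y \<in> S" for y p q
  proof -
    have "B y p q = B y (\<Sum>i\<in>Basis. (p \<bullet> i) *\<^sub>R i) (\<Sum>j\<in>Basis. (q \<bullet> j) *\<^sub>R j)"
      by (simp add: euclidean_representation)
    also have "\<dots> = (\<Sum>(i, j)\<in>Basis \<times> Basis. B y ((p \<bullet> i) *\<^sub>R i) ((q \<bullet> j) *\<^sub>R j))"
      by (rule bilinear_sum[OF bil[OF that]])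
    also have "\<dots> = (\<Sum>(i, j)\<in>Basis \<times> Basis. ((p \<bullet> i) * (q \<bullet> j)) * B y i j)"
      by (rule sum.cong) (auto simp: bilinear_lmul[OF bil[OF that]] bilinear_rmul[OF bil[OF that]])
    finally show ?thesis by (simp add: sum.cartesian_product)
  qed
  have De: "?D p q v = (\<Sum>i\<in>Basis. \<Sum>j\<in>Basis. ((p \<bullet> i) * (q \<bullet> j)) * ?D i j v)" for p q v
  proof -
    have "((\<lambda>y. \<Sum>i\<in>Basis. \<Sum>j\<in>Basis. ((p \<bullet> i) * (q \<bullet> j)) * B y i j) has_derivative
        (\<lambda>v. \<Sum>i\<in>Basis. \<Sum>j\<in>Basis. ((p \<bullet> i) * (q \<bullet> j)) * ?D i j v)) (at x)"
      by (intro has_derivative_sum has_derivative_mult_right D)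
    then have "((\<lambda>y. B y p q) has_derivative
        (\<lambda>v. \<Sum>i\<in>Basis. \<Sum>j\<in>Basis. ((p \<bullet> i) * (q \<bullet> j)) * ?D i j v)) (at x)"
      by (rule has_derivative_transform_within_open[OF _ S], intro expand[symmetric])
    from fun_cong[OF has_derivative_unique[OF D[of p q] this]] show ?thesis .
  qed
  let ?E = "\<lambda>v. \<Sum>i\<in>Basis. \<Sum>j\<in>Basis. (((a x) \<bullet> i) * ((b x) \<bullet> j)) * ?D i j v
      + ((a x \<bullet> i) * (b' v \<bullet> j) + (a' v \<bullet> i) * (b x \<bullet> j)) * B x i j"
  have "((\<lambda>x. \<Sum>i\<in>Basis. \<Sum>j\<in>Basis. ((a x \<bullet> i) * (b x \<bullet> j)) * B x i j) has_derivative ?E) (at x)"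
    by (intro has_derivative_sum has_derivative_mult D has_derivative_inner_left a b)
  then have "((\<lambda>x. B x (a x) (b x)) has_derivative ?E) (at x)"
    by (rule has_derivative_transform_within_open[OF _ S], intro expand[symmetric])
  moreover have "?E v = ?D (a x) (b x) v + B x (a' v) (b x) + B x (a x) (b' v)" for v
    unfolding De[of "a x"] expand[OF S(2), of "a' v"] expand[OF S(2), of "a x"]
    by (simp add: sum.distrib algebra_simps)
  ultimately show ?thesis by simp
qed

lemma C_diff_bilinear_family:
  fixes B :: "'x::euclidean_space \<Rightarrow> 'v::euclidean_space \<Rightarrow> 'v \<Rightarrow> real"
  assumes S: "open S" and bil: "\<And>x. x \<in> S \<Longrightarrow> bilinear (B x)"
    and B: "\<And>u w. C_diff k (\<lambda>x. B x u w) S" and a: "C_diff k a S" and b: "C_diff k b S"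
  shows "C_diff k (\<lambda>x. B x (a x) (b x)) S"
proof -
  have expand: "B y p q = (\<Sum>ij\<in>Basis \<times> Basis. ((p \<bullet> fst ij) * (q \<bullet> snd ij)) * B y (fst ij) (snd ij))" if "y \<in> S" for y p q
  proof -
    have "B y p q = B y (\<Sum>i\<in>Basis. (p \<bullet> i) *\<^sub>R i) (\<Sum>j\<in>Basis. (q \<bullet> j) *\<^sub>R j)"
      by (simp add: euclidean_representation)
    also have "\<dots> = (\<Sum>(i, j)\<in>Basis \<times> Basis. B y ((p \<bullet> i) *\<^sub>R i) ((q \<bullet> j) *\<^sub>R j))"
      by (rule bilinear_sum[OF bil[OF that]])
    also have "\<dots> = (\<Sum>(i, j)\<in>Basis \<times> Basis. ((p \<bullet> i) * (q \<bullet> j)) * B y i j)"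
      by (rule sum.cong) (auto simp: bilinear_lmul[OF bil[OF that]] bilinear_rmul[OF bil[OF that]])
    finally show ?thesis by (simp only: case_prod_unfold)
  qed
  have sm: "C_diff k (\<lambda>x. \<Sum>ij\<in>Basis \<times> Basis. ((a x \<bullet> fst ij) * (b x \<bullet> snd ij)) * B x (fst ij) (snd ij)) S"
    by (intro C_diff_sum C_diff_mult C_diff_inner C_diff_const S a b B)
  show ?thesis
  proof (rule C_diff_cong[OF S _ sm])
    fix x assume "x \<in> S"
    from expand[OF this, of "a x" "b x", symmetric]
    show "(\<Sum>ij\<in>Basis \<times> Basis. ((a x \<bullet> fst ij) * (b x \<bullet> snd ij)) * B x (fst ij) (snd ij)) = B x (a x) (b x)" .
  qed
qed

section \<open>Frames, determinants and dual bases\<close>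

lemma sum_mult_delta:
  fixes c :: "nat \<Rightarrow> real"
  assumes "finite I" "\<And>k. k \<in> I \<Longrightarrow> d k = (if k = i then 1 else 0)"
  shows "(\<Sum>k\<in>I. c k * d k) = (if i \<in> I then c i else 0)"
proof -
  have "(\<Sum>k\<in>I. c k * d k) = (\<Sum>k\<in>I. if k = i then c k else 0)"
    by (rule sum.cong) (use assms(2) in auto)
  then show ?thesis using assms(1) by simp
qed

text \<open>Numbers the ordered index type by naturals, matching the indexing of frames in
  \<open>positive_frame\<close> with the rows of a matrix.\<close>

lemma bij_betw_card_below: "bij_betw (\<lambda>i::'m::{finite,wellorder}. card {j. j < i}) UNIV {..<CARD('m)}"
proof -
  have "inj (\<lambda>i::'m. card {j. j < i})"
  proof (rule linorder_injI)
    fix x y :: 'm assume "x < y"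
    then have "{j. j < x} \<subset> {j. j < y}" by auto
    then have "card {j. j < x} < card {j. j < y}" by (rule psubset_card_mono[rotated]) simp
    then show "card {j. j < x} \<noteq> card {j. j < y}" by simp
  qed
  moreover have "(\<lambda>i::'m. card {j. j < i}) ` UNIV \<subseteq> {..<CARD('m)}"
  proof (rule image_subsetI)
    fix i :: 'm
    have "{j. j < i} \<subset> UNIV" by auto
    then show "card {j. j < i} \<in> {..<CARD('m)}" using psubset_card_mono[of "UNIV :: 'm set" "{j. j < i}"] by simp
  qed
  ultimately show ?thesis
    by (metis bij_betw_def card_image card_lessThan card_subset_eq finite_lessThan)
qed

lemma det_nonzero_frame:
  fixes v :: "nat \<Rightarrow> real^'m::{finite,wellorder}"
  assumes "det (\<chi> i. v (card {j. j < i})) \<noteq> 0"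
  shows "inj_on v {..<CARD('m)}" "independent (v ` {..<CARD('m)})" "span (v ` {..<CARD('m)}) = UNIV"
proof -
  let ?M = "\<chi> i::'m. v (card {j. j < i})"
  have r: "row i ?M = v (card {j. j < i})" for i by (simp add: row_def vec_eq_iff)
  have "inj (\<lambda>i::'m. v (card {j. j < i}))"
    using det_identical_rows[of _ _ ?M] assms unfolding r inj_on_def by metis
  then show inj: "inj_on v {..<CARD('m)}"
    using inj_on_imageI[of v "\<lambda>i::'m. card {j. j < i}" UNIV]
      bij_betw_imp_surj_on[OF bij_betw_card_below[where 'm = 'm]] by (simp add: o_def)
  have "rows ?M = v ` (\<lambda>i::'m. card {j. j < i}) ` UNIV" unfolding rows_def r by auto
  then have "rows ?M = v ` {..<CARD('m)}"
    unfolding bij_betw_imp_surj_on[OF bij_betw_card_below[where 'm = 'm]] .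
  then show ind: "independent (v ` {..<CARD('m)})"
    using det_dependent_rows[of ?M] assms by (auto simp: dependent_vec_eq)
  have "dim (v ` {..<CARD('m)}) = DIM(real^'m::{finite,wellorder})"
    using dim_eq_card_independent[OF ind] card_image[OF inj] by simp
  then show "span (v ` {..<CARD('m)}) = UNIV" using dim_eq_full[of "v ` {..<CARD('m)}"] by simp
qed

lemma dual_basis:
  fixes b :: "nat \<Rightarrow> 'v::euclidean_space"
  assumes inj: "inj_on b {..<k}" and ind: "independent (b ` {..<k})"
  obtains \<phi> :: "nat \<Rightarrow> 'v \<Rightarrow> real" where "\<And>i. linear (\<phi> i)"
    "\<And>i j. i < k \<Longrightarrow> j < k \<Longrightarrow> \<phi> i (b j) = (if i = j then 1 else 0)"
proof -
  have "\<exists>h. linear h \<and> (\<forall>x\<in>b ` {..<k}. h x = (if x = b i then 1 else 0 :: real))" for i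
    by (rule linear_independent_extend[OF ind])
  then have "\<exists>\<phi>. \<forall>i. linear (\<phi> i) \<and> (\<forall>x\<in>b ` {..<k}. \<phi> i x = (if x = b i then 1 else 0 :: real))"
    by (intro choice allI)
  then obtain \<phi> where \<phi>: "\<And>i. linear (\<phi> i)" "\<And>i x. x \<in> b ` {..<k} \<Longrightarrow> \<phi> i x = (if x = b i then 1 else 0 :: real)"
    by blast
  show thesis
  proof (rule that[of \<phi>])
    show "\<phi> i (b j) = (if i = j then 1 else 0)" if "i < k" "j < k" for i j
      using \<phi>(2)[of "b j" i] inj that by (auto simp: inj_on_def)
  qed (rule \<phi>(1))
qed

text \<open>The situation near a point of Z in one chart, freed from the metric: \<open>B\<close> is
  the coordinate expression of \<open>\<omega>\<close>, \<open>f\<close> a positive orthonormal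
  frame of the kernel at \<open>x0\<close>, and \<open>u\<close> represents a frame of the quotient
  oriented by the power \<open>n - 2\<close> of \<open>B x0\<close>. The last two conditions express
  that the gradient maps the kernel onto the self-dual forms.\<close>

locale degenerate_family =
  fixes S :: "(real^'m::{finite,wellorder}) set" and B :: "real^'m::{finite,wellorder} \<Rightarrow> real^'m::{finite,wellorder} \<Rightarrow> real^'m::{finite,wellorder} \<Rightarrow> real"
    and n :: nat and x0 :: "real^'m::{finite,wellorder}" and f u :: "nat \<Rightarrow> real^'m::{finite,wellorder}"
  assumes S: "open S" "x0 \<in> S" and card: "CARD('m) = 2 * n" and n: "2 \<le> n"
    and bil: "\<And>x. x \<in> S \<Longrightarrow> bilinear (B x)" and alt: "\<And>x v. x \<in> S \<Longrightarrow> B x v v = 0"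
    and smooth: "\<And>k v w. C_diff k (\<lambda>x. B x v w) S"
    and nonneg: "\<And>x v. x \<in> S \<Longrightarrow> positive_frame v \<Longrightarrow> 0 \<le> wedge_power (B x) n v"
    and dim_ker: "\<And>x. x \<in> S \<Longrightarrow> \<forall>v. wedge_power (B x) (n - 1) v = 0 \<Longrightarrow> dim {v. \<forall>w. B x v w = 0} = 4"
    and degenerate: "\<forall>v. wedge_power (B x0) (n - 1) v = 0"
    and f: "\<And>i w. i < 4 \<Longrightarrow> B x0 (f i) w = 0"
    and u: "0 < wedge_power (B x0) (n - 2) u" "positive_frame (\<lambda>k. if k < 4 then f k else u (k - 4))"
    and self_dual: "\<And>v. \<forall>w. B x0 v w = 0 \<Longrightarrow>
      frechet_derivative (\<lambda>x. B x (f 2) (f 3)) (at x0) v = frechet_derivative (\<lambda>x. B x (f 0) (f 1)) (at x0) v \<and>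
      frechet_derivative (\<lambda>x. B x (f 1) (f 3)) (at x0) v = - frechet_derivative (\<lambda>x. B x (f 0) (f 2)) (at x0) v \<and>
      frechet_derivative (\<lambda>x. B x (f 1) (f 2)) (at x0) v = frechet_derivative (\<lambda>x. B x (f 0) (f 3)) (at x0) v"
    and onto: "\<And>a b c. \<exists>v. (\<forall>w. B x0 v w = 0) \<and>
      frechet_derivative (\<lambda>x. B x (f 0) (f 1)) (at x0) v = a \<and>
      frechet_derivative (\<lambda>x. B x (f 0) (f 2)) (at x0) v = b \<and>
      frechet_derivative (\<lambda>x. B x (f 0) (f 3)) (at x0) v = c"
begin

definition "Z = {x \<in> S. \<forall>v. wedge_power (B x) (n - 1) v = 0}"

lemma skew: "x \<in> S \<Longrightarrow> B x v w = - B x w v"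
  using alt[of x "v + w"] alt[of x v] alt[of x w] bil[of x]
  by (simp add: bilinear_ladd bilinear_radd)

text \<open>Each field is the solution of the linear equation \<open>T x (e i x) = f i\<close>. Its
  components along the \<open>f k\<close> say that \<open>e i x\<close> has the same
  \<open>f\<close>-coordinates as \<open>f i\<close>, and those along the \<open>u j\<close> that it
  is \<open>B x\<close>-orthogonal to \<open>u j\<close>; so \<open>e i x\<close> is
  \<open>f i\<close> corrected within the span of the \<open>u j\<close>. Invertibility of
  \<open>T x0\<close> persists nearby, and Cramer's rule gives smoothness.\<close>

lemma frame_near:
  obtains V e where "open V" "x0 \<in> V" "V \<subseteq> S" "\<And>i k. i < 4 \<Longrightarrow> C_diff k (e i) V"
    "\<And>i. i < 4 \<Longrightarrow> e i x0 = f i"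
    "\<And>x i j. x \<in> V \<Longrightarrow> i < 4 \<Longrightarrow> j < 2 * n - 4 \<Longrightarrow> B x (e i x) (u j) = 0"
    "\<And>x. x \<in> V \<Longrightarrow> positive_frame (\<lambda>k. if k < 4 then e k x else u (k - 4))"
    "\<And>x. x \<in> V \<Longrightarrow> 0 < wedge_power (B x) (n - 2) u"
    "\<And>x. x \<in> V \<Longrightarrow> x \<in> Z \<Longrightarrow> span ((\<lambda>i. e i x) ` {..<4}) = {v. \<forall>w. B x v w = 0}"
proof -
  define b where "b k = (if k < 4 then f k else u (k - 4))" for k
  have "det (\<chi> i::'m. b (card {j. j < i})) \<noteq> 0" using u(2) by (simp add: positive_frame_def b_def)
  note b = det_nonzero_frame[OF this, unfolded card]
  obtain \<phi> :: "nat \<Rightarrow> real^'m::{finite,wellorder} \<Rightarrow> real" where \<phi>: "\<And>i. linear (\<phi> i)"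
    "\<And>i j. i < 2 * n \<Longrightarrow> j < 2 * n \<Longrightarrow> \<phi> i (b j) = (if i = j then 1 else 0)"
    using dual_basis[OF b(1,2)] by blast
  have bf: "b i = f i" if "i < 4" for i using that by (simp add: b_def)
  have bu: "b (j + 4) = u j" for j by (simp add: b_def)
  define T where "T x e = (\<Sum>i<4. \<phi> i e *\<^sub>R f i) + (\<Sum>j<2 * n - 4. B x e (u j) *\<^sub>R u j)" for x e
  have \<phi>f: "\<phi> i (f j) = (if i = j then 1 else 0)" if "i < 4" "j < 4" for i j
    using \<phi>(2)[of i j] that n bf by simp
  have \<phi>u: "\<phi> i (u j) = 0" if "i < 4" "j < 2 * n - 4" for i j
    using \<phi>(2)[of i "j + 4"] that n bu by simp
  have \<phi>u': "\<phi> (i + 4) (u j) = (if i = j then 1 else 0)" if "i < 2 * n - 4" "j < 2 * n - 4" for i j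
    using \<phi>(2)[of "i + 4" "j + 4"] that n bu by simp
  have \<phi>f': "\<phi> (i + 4) (f j) = 0" if "i < 2 * n - 4" "j < 4" for i j
    using \<phi>(2)[of "i + 4" j] that n bf by simp
  have hT: "h (T x e) = (\<Sum>k<4. \<phi> k e * h (f k)) + (\<Sum>j<2 * n - 4. B x e (u j) * h (u j))"
    if "linear h" for h :: "real^'m::{finite,wellorder} \<Rightarrow> real" and x e
    unfolding T_def by (simp add: linear_add[OF that] linear_sum[OF that] linear_cmul[OF that])
  have \<phi>T: "\<phi> i (T x e) = \<phi> i e" if "i < 4" for i x e
  proof -
    have "(\<Sum>k<4. \<phi> k e * \<phi> i (f k)) = \<phi> i e"
      by (subst sum_mult_delta[where i = i]) (use \<phi>f that in auto)
    moreover have "(\<Sum>j<2 * n - 4. B x e (u j) * \<phi> i (u j)) = 0"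
      by (rule sum.neutral) (use \<phi>u that in auto)
    ultimately show ?thesis unfolding hT[OF \<phi>(1)] by simp
  qed
  have \<phi>T': "\<phi> (j + 4) (T x e) = B x e (u j)" if "j < 2 * n - 4" for j x e
  proof -
    have "(\<Sum>k<4. \<phi> k e * \<phi> (j + 4) (f k)) = 0"
      by (rule sum.neutral) (use \<phi>f' that in auto)
    moreover have "(\<Sum>k<2 * n - 4. B x e (u k) * \<phi> (j + 4) (u k)) = B x e (u j)"
      by (subst sum_mult_delta[where i = j]) (use \<phi>u' that in auto)
    ultimately show ?thesis unfolding hT[OF \<phi>(1)] by simp
  qed
  have linT: "linear (T x)" if "x \<in> S" for x
    unfolding T_def using bil[OF that] \<phi>(1)
    by (auto simp: linear_iff bilinear_ladd bilinear_lmul sum.distrib scaleR_add_left scaleR_add_right scaleR_sum_right)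
  have smT: "C_diff k (\<lambda>x. T x e) S" for k e
    unfolding T_def by (intro C_diff_add C_diff_sum C_diff_const C_diff_scaleR S smooth)
  have spanb: "\<forall>w. B x v w = 0" if x: "x \<in> S" and "\<And>i. i < 2 * n \<Longrightarrow> B x v (b' i) = 0" "span (b' ` {..<2 * n}) = UNIV" for x v b'
  proof
    fix w
    have "linear (B x v)" using bil[OF x] by (simp add: bilinear_def)
    then show "B x v w = 0" using linear_eq_0_on_span[of "B x v" "b' ` {..<2 * n}" w] that by auto
  qed
  \<comment> \<open>A vector killed by \<open>T x0\<close> is \<open>B x0\<close>-orthogonal to the
    whole basis, hence lies in the 4-dimensional kernel spanned by the \<open>f i\<close>, where its
    coordinates \<open>\<phi> i\<close> are 0.\<close>
  have inj0: "inj (T x0)"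
  proof (subst linear_injective_0[OF linT[OF S(2)]], intro allI impI)
    fix e assume e: "T x0 e = 0"
    have p0: "\<phi> i e = 0" if "i < 4" for i using \<phi>T[OF that, of x0 e] e linear_0[OF \<phi>(1)] by simp
    have "B x0 e (u j) = 0" if "j < 2 * n - 4" for j using \<phi>T'[OF that, of x0 e] e linear_0[OF \<phi>(1)] by simp
    moreover have "B x0 e (f i) = 0" if "i < 4" for i using f[OF that, of e] skew[OF S(2), of e "f i"] by simp
    ultimately have "B x0 e (b i) = 0" if "i < 2 * n" for i using that by (simp add: b_def)
    then have ker: "\<forall>w. B x0 e w = 0" using spanb[OF S(2) _ b(3)] by blast
    have "dim {v. \<forall>w. B x0 v w = 0} = 4" using dim_ker[OF S(2) degenerate] .
    moreover have fi: "inj_on f {..<4}" "independent (f ` {..<4})"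
    proof -
      have "inj_on b {..<4}" by (rule inj_on_subset[OF b(1)]) (use n in auto)
      then show "inj_on f {..<4}" by (rule inj_on_cong[THEN iffD1, rotated]) (simp add: bf)
      have "f ` {..<4} = b ` {..<4}" by (rule image_cong) (auto simp: bf)
      then show "independent (f ` {..<4})" using n by (auto intro!: independent_mono[OF b(2)])
    qed
    moreover have "f ` {..<4} \<subseteq> {v. \<forall>w. B x0 v w = 0}" using f by auto
    moreover have "card (f ` {..<4}) = 4" using card_image[OF fi(1)] by simp
    ultimately have "{v. \<forall>w. B x0 v w = 0} \<subseteq> span (f ` {..<4})"
      using card_eq_dim[of "f ` {..<4}" "{v. \<forall>w. B x0 v w = 0}"] by simp
    then have "e \<in> span (f ` {..<4})" using ker by blast
    then obtain c where c: "e = (\<Sum>v\<in>f ` {..<4}. c v *\<^sub>R v)" using span_finite[of "f ` {..<4}"] by auto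
    have c': "e = (\<Sum>i<4. c (f i) *\<^sub>R f i)" unfolding c by (rule sum.reindex[OF fi(1), unfolded o_def])
    have "c (f i) = \<phi> i e" if "i < 4" for i
    proof -
      have "\<phi> i e = (\<Sum>k<4. c (f k) * \<phi> i (f k))"
        unfolding c' by (simp add: linear_sum[OF \<phi>(1)] linear_cmul[OF \<phi>(1)])
      also have "\<dots> = c (f i)"
        by (subst sum_mult_delta[where i = i]) (use \<phi>f that in auto)
      finally show ?thesis by simp
    qed
    then have "c (f i) = 0" if "i < 4" for i using p0 that by metis
    then show "e = 0" by (subst c') simp
  qed
  define dT where "dT x = det (matrix (T x))" for x
  have cdT: "continuous_on S dT"
  proof -
    have "C_diff 0 dT S" unfolding dT_def
      by (intro C_diff_det S) (simp add: matrix_def C_diff_vec_nth[OF S(1) smT, simplified])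
    then show ?thesis by simp
  qed
  define V1 where "V1 = {x \<in> S. dT x \<noteq> 0}"
  have "V1 = S \<inter> dT -` (- {0})" by (auto simp: V1_def)
  then have V1: "open V1" using continuous_open_preimage[OF cdT S(1), of "- {0}"] by (simp add: open_Compl)
  have injT: "inj (T x)" "surj (T x)" "x \<in> S" if "x \<in> V1" for x
  proof -
    show x: "x \<in> S" using that by (simp add: V1_def)
    show "inj (T x)" using that det_nz_iff_inj[OF linT[OF x]] by (simp add: V1_def dT_def)
    then show "surj (T x)" using linear_injective_imp_surjective[OF linT[OF x]] by blast
  qed
  have x0V1: "x0 \<in> V1"
    using inj0 det_nz_iff_inj[OF linT[OF S(2)]] S(2) by (simp add: V1_def dT_def)
  define e where "e i x = inv (T x) (f i)" for i x
  have Te: "T x (e i x) = f i" if "x \<in> V1" for x i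
    using injT[OF that] by (simp add: e_def surj_f_inv_f)
  have V1S: "V1 \<subseteq> S" by (auto simp: V1_def)
  have sme: "C_diff k (e i) V1" for k i
    by (rule C_diff_linear_solution[where A = T and b = "\<lambda>x. f i"])
      (use V1 V1S injT linT Te C_diff_const C_diff_subset[OF smT] in auto)
  have e0: "e i x0 = f i" if "i < 4" for i
  proof -
    have "(\<Sum>k<4. \<phi> k (f i) *\<^sub>R f k) = (\<Sum>k<4. if k = i then f k else 0)"
      by (rule sum.cong) (use \<phi>f that in auto)
    then have "T x0 (f i) = f i" unfolding T_def using that by (simp add: f)
    then show ?thesis using injT(1)[OF x0V1] by (metis e_def inv_f_f)
  qed
  have eu: "B x (e i x) (u j) = 0" if "x \<in> V1" "i < 4" "j < 2 * n - 4" for x i j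
    using \<phi>T'[OF that(3), of x "e i x"] Te[OF that(1)] \<phi>f'[OF that(3,2)] by simp
  define d where "d x = det (\<chi> i::'m. if card {j. j < i} < 4 then e (card {j. j < i}) x else u (card {j. j < i} - 4))" for x
  have "C_diff 0 d V1"
    unfolding d_def
  proof (intro C_diff_det V1)
    fix i j :: 'm
    show "C_diff 0 (\<lambda>x. (\<chi> i::'m. if card {j. j < i} < 4 then e (card {j. j < i}) x else u (card {j. j < i} - 4)) $ i $ j) V1"
      using C_diff_vec_nth[OF V1 sme[of 0]] C_diff_const[OF V1, of 0] by (cases "card {j. j < i} < 4") auto
  qed
  then have cd: "continuous_on V1 d" by simp
  define w where "w x = wedge_power (B x) (n - 2) u" for x
  have "C_diff 0 w S"
    unfolding w_def wedge_power_eq wedge_term_def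
    by (intro C_diff_divide C_diff_sum C_diff_mult C_diff_prod C_diff_const S smooth) simp
  then have cw: "continuous_on V1 w" using continuous_on_subset[of S w V1] V1_def by auto
  \<comment> \<open>Invertibility of \<open>T\<close>, positivity of the frame and positivity of the
    power on \<open>u\<close> are open conditions on continuous functions of
    \<open>x\<close>.\<close>
  define V where "V = V1 \<inter> d -` {0<..} \<inter> (V1 \<inter> w -` {0<..})"
  have "open V"
    unfolding V_def by (intro open_Int continuous_open_preimage[OF cd V1] continuous_open_preimage[OF cw V1]) auto
  moreover have "x0 \<in> V"
  proof -
    have "d x0 = det (\<chi> i::'m. if card {j. j < i} < 4 then f (card {j. j < i}) else u (card {j. j < i} - 4))"
      unfolding d_def by (rule arg_cong[where f = det]) (simp add: vec_eq_iff e0)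
    then show ?thesis using u x0V1 by (simp add: V_def w_def positive_frame_def)
  qed
  moreover have "V \<subseteq> S" by (auto simp: V_def V1_def)
  \<comment> \<open>Kernel vectors are determined by their four \<open>\<phi>\<close>-coordinates,
    so the kernel lies in the span; its dimension is 4 because \<open>x\<close> is in
    \<open>Z\<close>, and the span has dimension at most 4.\<close>
  moreover have "span ((\<lambda>i. e i x) ` {..<4}) = {v. \<forall>w. B x v w = 0}" if "x \<in> V" "x \<in> Z" for x
  proof (rule sym, rule subspace_dim_equal)
    have x: "x \<in> V1" "x \<in> S" using that by (auto simp: V_def V1_def)
    show "subspace {v. \<forall>w. B x v w = 0}"
      using bil[OF x(2)] by (auto simp: subspace_def bilinear_lzero bilinear_ladd bilinear_lmul)
    show "{v. \<forall>w. B x v w = 0} \<subseteq> span ((\<lambda>i. e i x) ` {..<4})"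
    proof
      fix v assume "v \<in> {v. \<forall>w. B x v w = 0}"
      then have "T x v = (\<Sum>i<4. \<phi> i v *\<^sub>R f i)" by (simp add: T_def)
      also have "\<dots> = T x (\<Sum>i<4. \<phi> i v *\<^sub>R e i x)"
        by (simp add: linear_sum[OF linT[OF x(2)]] linear_cmul[OF linT[OF x(2)]] Te[OF x(1)])
      finally have v: "v = (\<Sum>i<4. \<phi> i v *\<^sub>R e i x)" using injT(1)[OF x(1)] by (simp add: inj_def)
      show "v \<in> span ((\<lambda>i. e i x) ` {..<4})"
        by (subst v, intro span_sum span_scale span_base imageI)
    qed
    have "dim {v. \<forall>w. B x v w = 0} = 4" using that dim_ker[OF x(2)] by (simp add: Z_def)
    moreover have "dim (span ((\<lambda>i. e i x) ` {..<4})) \<le> 4"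
      using dim_le_card'[of "(\<lambda>i. e i x) ` {..<4}"] card_image_le[of "{..<4}" "\<lambda>i. e i x"] by simp
    ultimately show "dim (span ((\<lambda>i. e i x) ` {..<4})) \<le> dim {v. \<forall>w. B x v w = 0}" by simp
  qed simp
  moreover have "positive_frame (\<lambda>k. if k < 4 then e k x else u (k - 4))" "0 < wedge_power (B x) (n - 2) u"
    if "x \<in> V" for x
    using that by (simp_all add: V_def d_def w_def positive_frame_def)
  moreover have VV1: "V \<subseteq> V1" by (auto simp: V_def)
  moreover have "B x (e i x) (u j) = 0" if "x \<in> V" "i < 4" "j < 2 * n - 4" for x i j
    using eu that VV1 by blast
  ultimately show thesis
    by (intro that[of V e] C_diff_subset[OF sme] e0)
qed

end

context degenerate_family
begin

text \<open>The gradient at \<open>x0\<close> in the frame \<open>f\<close>. For \<open>v\<close> in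
  the kernel this is the matrix of \<open>D_K\<close>; here \<open>v\<close> is an arbitrary
  direction.\<close>

definition d :: "real^'m::{finite,wellorder} \<Rightarrow> nat \<Rightarrow> nat \<Rightarrow> real"
  where "d v i j = frechet_derivative (\<lambda>x. B x (f i) (f j)) (at x0) v"

lemma has_derivative_B: "((\<lambda>x. B x p q) has_derivative frechet_derivative (\<lambda>x. B x p q) (at x0)) (at x0)"
  by (rule has_derivative_frechet[OF _ S]) (use smooth[of 1 p q] in simp)

lemma linear_d: "linear (\<lambda>v. d v i j)"
  using has_derivative_linear[OF has_derivative_B] unfolding d_def .

lemma zero_le_mult_pos: "0 \<le> c * x \<Longrightarrow> 0 < c \<Longrightarrow> 0 \<le> x" for c x :: real
  by (simp add: zero_le_mult_iff)

text \<open>Polarisation of the three products, arranged so that the positive squares are the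
  self-dual combinations and the negative squares the anti-self-dual ones.\<close>

lemma pfaffian_expand:
  fixes a b c a' b' c' :: real
  shows "a * a' - b * b' + c * c' = ((a + a')\<^sup>2 + (b - b')\<^sup>2 + (c + c')\<^sup>2 - (a - a')\<^sup>2 - (b + b')\<^sup>2 - (c - c')\<^sup>2) / 4"
  by (simp add: power2_eq_square field_simps)

text \<open>Near \<open>x0\<close> the Gram matrix \<open>\<sigma>\<close> of \<open>B x\<close> in the local frame has nonnegative Pfaffian, hence its
  anti-self-dual part is dominated by its self-dual part, whose three components cut out \<open>Z\<close>
  transversally.\<close>

lemma zero_set_submersion:
  obtains V s where "open V" "x0 \<in> V" "V \<subseteq> S" "\<And>k l. C_diff k (s l) V"
    "\<And>x. x \<in> V \<Longrightarrow> x \<in> Z \<longleftrightarrow> s 1 x = 0 \<and> s 2 x = 0 \<and> s 3 x = 0"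
    "\<And>l. l \<in> {1, 2, 3} \<Longrightarrow> (s l has_derivative (\<lambda>v. 2 * d v 0 l)) (at x0)"
    "\<And>v i j. d v 0 1 = 0 \<Longrightarrow> d v 0 2 = 0 \<Longrightarrow> d v 0 3 = 0 \<Longrightarrow> i < 4 \<Longrightarrow> j < 4 \<Longrightarrow> d v i j = 0"
proof -
  obtain V e where V: "open V" "x0 \<in> V" "V \<subseteq> S" and e: "\<And>i k. i < 4 \<Longrightarrow> C_diff k (e i) V"
    and e0: "\<And>i. i < 4 \<Longrightarrow> e i x0 = f i"
    and eu: "\<And>x i j. x \<in> V \<Longrightarrow> i < 4 \<Longrightarrow> j < 2 * n - 4 \<Longrightarrow> B x (e i x) (u j) = 0"
    and pf: "\<And>x. x \<in> V \<Longrightarrow> positive_frame (\<lambda>k. if k < 4 then e k x else u (k - 4))"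
    and w: "\<And>x. x \<in> V \<Longrightarrow> 0 < wedge_power (B x) (n - 2) u"
    and ker: "\<And>x. x \<in> V \<Longrightarrow> x \<in> Z \<Longrightarrow> span ((\<lambda>i. e i x) ` {..<4}) = {v. \<forall>w. B x v w = 0}"
    by (rule frame_near) (rule that; assumption)
  define \<sigma> where "\<sigma> i j x = B x (e i x) (e j x)" for i j x
  have bilV: "bilinear (B x)" if "x \<in> V" for x using bil V that by blast
  have smV: "C_diff k (\<lambda>x. B x p q) V" for k p q by (rule C_diff_subset[OF smooth V(3)])
  have sm\<sigma>: "C_diff k (\<sigma> i j) V" if "i < 4" "j < 4" for k i j
    unfolding \<sigma>_def by (rule C_diff_bilinear_family[OF V(1) bilV smV e e]) (use that in auto)
  have sk\<sigma>: "\<sigma> i j x = - \<sigma> j i x" if "x \<in> V" for i j x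
    unfolding \<sigma>_def by (rule skew) (use that V in auto)
  have de: "(e i has_derivative frechet_derivative (e i) (at x0)) (at x0)" if "i < 4" for i
    by (rule has_derivative_frechet[OF _ V(1,2)]) (use e[OF that, of 1] in simp)
  have fz: "B x0 p (f i) = 0" if "i < 4" for p i using f[OF that, of p] skew[OF S(2), of p "f i"] by simp
  \<comment> \<open>The derivatives of the frame fields drop out, since at \<open>x0\<close> they
    are paired with kernel vectors.\<close>
  have d\<sigma>: "(\<sigma> i j has_derivative (\<lambda>v. d v i j)) (at x0)" if ij: "i < 4" "j < 4" for i j
  proof -
    have "((\<lambda>x. B x (e i x) (e j x)) has_derivative (\<lambda>v. frechet_derivative (\<lambda>y. B y (e i x0) (e j x0)) (at x0) v
      + B x0 (frechet_derivative (e i) (at x0) v) (e j x0) + B x0 (e i x0) (frechet_derivative (e j) (at x0) v))) (at x0)"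
      by (rule has_derivative_bilinear_family[OF S bil])
        (use has_derivative_B de ij in \<open>auto simp: differentiable_def\<close>)
    then show ?thesis unfolding \<sigma>_def[abs_def] by (simp add: e0 ij fz f d_def)
  qed
  have \<sigma>0: "\<sigma> i j x0 = 0" if "i < 4" "j < 4" for i j unfolding \<sigma>_def by (simp add: e0 that f)
  \<comment> \<open>In the adapted frame the n-th power of \<open>B x\<close> is the product of a
    binomial factor, the square on the \<open>e i x\<close> and the power on \<open>u\<close>. The
    first and the last are positive, so the sign passes to the Pfaffian.\<close>
  have Pf: "0 \<le> \<sigma> 0 1 x * \<sigma> 2 3 x - \<sigma> 0 2 x * \<sigma> 1 3 x + \<sigma> 0 3 x * \<sigma> 1 2 x" if x: "x \<in> V" for x
  proof -
    let ?v = "\<lambda>k. if k < 4 then e k x else u (k - 4)"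
    have xS: "x \<in> S" using x V by blast
    have orth: "B x (?v i) (?v j) = 0 \<and> B x (?v j) (?v i) = 0" if "i < 4" "4 \<le> j" "j < 2 * n" for i j
      using eu[OF x that(1), of "j - 4"] skew[OF xS, of "u (j - 4)" "e i x"] that by simp
    have "0 \<le> wedge_power (B x) n ?v" using nonneg[OF xS pf[OF x]] .
    also have "\<dots> = real (n choose 2) * wedge_power (B x) 2 ?v * wedge_power (B x) (n - 2) (\<lambda>i. ?v (i + 4))"
      by (rule wedge_power_block[of n "B x" ?v, OF orth n])
    also have "(\<lambda>i. ?v (i + 4)) = u" by auto
    finally have "0 \<le> (real (n choose 2) * wedge_power (B x) (n - 2) u) * wedge_power (B x) 2 ?v" by (simp add: mult_ac)
    moreover have "0 < real (n choose 2) * wedge_power (B x) (n - 2) u"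
      using w[OF x] n by (simp add: zero_less_binomial)
    ultimately have "0 \<le> wedge_power (B x) 2 ?v" by (rule zero_le_mult_pos)
    moreover have "wedge_power (B x) 2 ?v = 2 * (\<sigma> 0 1 x * \<sigma> 2 3 x - \<sigma> 0 2 x * \<sigma> 1 3 x + \<sigma> 0 3 x * \<sigma> 1 2 x)"
    proof -
      have "wedge_power (B x) 2 ?v = 2 * (B x (?v 0) (?v 1) * B x (?v 2) (?v 3) -
          B x (?v 0) (?v 2) * B x (?v 1) (?v 3) + B x (?v 0) (?v 3) * B x (?v 1) (?v 2))"
        by (rule wedge_power_2) (rule skew[OF xS])
      then show ?thesis by (simp add: \<sigma>_def)
    qed
    ultimately show ?thesis by simp
  qed
  \<comment> \<open>A vanishing Gram matrix puts all four frame vectors into the kernel, and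
    \<open>4 + 2 * (n - 1)\<close> exceeds the dimension \<open>2 * n\<close>.\<close>
  have toZ: "x \<in> Z" if x: "x \<in> V" and z: "\<And>i j. i < 4 \<Longrightarrow> j < 4 \<Longrightarrow> \<sigma> i j x = 0" for x
  proof -
    let ?v = "\<lambda>k. if k < 4 then e k x else u (k - 4)"
    have xS: "x \<in> S" using x V by blast
    have "det (\<chi> i::'m. ?v (card {j. j < i})) \<noteq> 0" using pf[OF x] by (simp add: positive_frame_def)
    note b = det_nonzero_frame[OF this, unfolded card]
    let ?K = "(\<lambda>i. e i x) ` {..<4}"
    have im: "?K = ?v ` {..<4}" by (rule image_cong) auto
    have "independent ?K" unfolding im using n by (intro independent_mono[OF b(2)] image_mono) auto
    moreover have "card ?K = 4"
      unfolding im using n by (subst card_image[OF inj_on_subset[OF b(1)]]) auto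
    ultimately have "dim ?K = 4" by (simp add: dim_eq_card_independent)
    have K: "B x z q = 0" if "z \<in> ?K" for z q
    proof -
      obtain i where i: "i < 4" "z = e i x" using \<open>z \<in> ?K\<close> by auto
      have lin: "linear (B x z)" using bil[OF xS] by (simp add: bilinear_def)
      have "B x z p = 0" if p: "p \<in> ?v ` {..<2 * n}" for p
      proof -
        obtain k where k: "k < 2 * n" "p = ?v k" using p unfolding image_iff by (auto simp only: lessThan_iff)
        show ?thesis
        proof (cases "k < 4")
          case True
          then show ?thesis using z[OF i(1) True] k i by (simp add: \<sigma>_def)
        next
          case False
          then show ?thesis using eu[OF x i(1), of "k - 4"] k i by simp
        qed
      qed
      then show ?thesis using linear_eq_0_on_span[OF lin, of "?v ` {..<2 * n}" q] b(3) by auto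
    qed
    have "wedge_power (B x) (n - 1) v = 0" for v
    proof (rule wedge_power_eq_0_if_dim_kernel[OF bil[OF xS], of ?K])
      show "B x z q = 0" if "z \<in> ?K" for z q using K[OF that] .
      show "B x q z = 0" if "z \<in> ?K" for z q using K[OF that, of q] skew[OF xS, of q z] by simp
      show "DIM(real^'m::{finite,wellorder}) < dim ?K + 2 * (n - 1)" using \<open>dim ?K = 4\<close> card n by simp
    qed
    then show ?thesis using xS by (simp add: Z_def)
  qed
  have fromZ: "\<sigma> i j x = 0" if "x \<in> V" "x \<in> Z" "i < 4" "j < 4" for i j x
  proof -
    have "e i x \<in> {v. \<forall>w. B x v w = 0}"
      unfolding ker[OF that(1,2), symmetric] using that(3) by (intro span_base) auto
    then show ?thesis by (simp add: \<sigma>_def)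
  qed
  \<comment> \<open>The self-dual part of \<open>\<sigma>\<close> up to a factor. Indices other than
    1 and 2 share the third formula, so every \<open>s l\<close> is smooth.\<close>
  define s where "s l x = (if l = 1 then \<sigma> 0 1 x + \<sigma> 2 3 x else if l = 2 then \<sigma> 0 2 x - \<sigma> 1 3 x else \<sigma> 0 3 x + \<sigma> 1 2 x)"
    for l :: nat and x
  have sms: "C_diff k (s l) V" for k l
  proof -
    have "C_diff k (\<lambda>x. \<sigma> 0 1 x + \<sigma> 2 3 x) V" "C_diff k (\<lambda>x. \<sigma> 0 2 x - \<sigma> 1 3 x) V" "C_diff k (\<lambda>x. \<sigma> 0 3 x + \<sigma> 1 2 x) V"
      by (intro C_diff_add C_diff_diff V(1) sm\<sigma>; simp)+
    then show ?thesis unfolding s_def by (cases "l = 1"; cases "l = 2") simp_all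
  qed
  have sZ: "x \<in> Z \<longleftrightarrow> s 1 x = 0 \<and> s 2 x = 0 \<and> s 3 x = 0" if x: "x \<in> V" for x
  proof
    assume "x \<in> Z"
    then show "s 1 x = 0 \<and> s 2 x = 0 \<and> s 3 x = 0" using fromZ[OF x] by (simp add: s_def)
  next
    assume a: "s 1 x = 0 \<and> s 2 x = 0 \<and> s 3 x = 0"
    \<comment> \<open>With vanishing self-dual part, the nonnegative Pfaffian is minus a quarter of
      the sum of squares of the anti-self-dual part.\<close>
    then have b: "(\<sigma> 0 1 x - \<sigma> 2 3 x)\<^sup>2 + (\<sigma> 0 2 x + \<sigma> 1 3 x)\<^sup>2 + (\<sigma> 0 3 x - \<sigma> 1 2 x)\<^sup>2 \<le> 0"
      using Pf[OF x] unfolding pfaffian_expand by (simp add: s_def)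
    have "\<sigma> 0 1 x - \<sigma> 2 3 x = 0" "\<sigma> 0 2 x + \<sigma> 1 3 x = 0" "\<sigma> 0 3 x - \<sigma> 1 2 x = 0"
      using b zero_le_power2[of "\<sigma> 0 1 x - \<sigma> 2 3 x"] zero_le_power2[of "\<sigma> 0 2 x + \<sigma> 1 3 x"] zero_le_power2[of "\<sigma> 0 3 x - \<sigma> 1 2 x"]
      by (smt (verit) power2_less_0 zero_eq_power2)+
    then have z: "\<sigma> 0 1 x = 0" "\<sigma> 2 3 x = 0" "\<sigma> 0 2 x = 0" "\<sigma> 1 3 x = 0" "\<sigma> 0 3 x = 0" "\<sigma> 1 2 x = 0"
      using a by (auto simp: s_def)
    have "\<sigma> i j x = 0" if "i < 4" "j < 4" for i j
    proof -
      have "i = 0 \<or> i = 1 \<or> i = 2 \<or> i = 3" "j = 0 \<or> j = 1 \<or> j = 2 \<or> j = 3" using that by auto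
      moreover have "\<sigma> i i x = 0" for i using sk\<sigma>[OF x, of i i] by simp
      ultimately show ?thesis
        using z sk\<sigma>[OF x, of 1 0] sk\<sigma>[OF x, of 2 0] sk\<sigma>[OF x, of 3 0] sk\<sigma>[OF x, of 2 1] sk\<sigma>[OF x, of 3 1] sk\<sigma>[OF x, of 3 2]
        by auto
    qed
    then show "x \<in> Z" using toZ[OF x] by blast
  qed
  \<comment> \<open>Since \<open>\<sigma>\<close> vanishes at \<open>x0\<close>, the Pfaffian at
    \<open>x0 + t v\<close> divided by \<open>t^2\<close> tends to the Pfaffian of the gradient,
    which inherits the sign.\<close>
  have Pfd: "0 \<le> d v 0 1 * d v 2 3 - d v 0 2 * d v 1 3 + d v 0 3 * d v 1 2" for v
  proof -
    have lim: "((\<lambda>t. \<sigma> i j (x0 + t *\<^sub>R v) / t) \<longlongrightarrow> d v i j) (at 0)" if "i < 4" "j < 4" for i j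
    proof -
      have "((\<lambda>t. x0 + t *\<^sub>R v) has_derivative (\<lambda>t. t *\<^sub>R v)) (at 0)"
        by (auto intro!: derivative_eq_intros)
      then have "((\<lambda>t. \<sigma> i j (x0 + t *\<^sub>R v)) has_derivative (\<lambda>t. d (t *\<^sub>R v) i j)) (at 0)"
        using has_derivative_compose[of "\<lambda>t. x0 + t *\<^sub>R v" _ 0 UNIV "\<sigma> i j"] d\<sigma>[OF that] by simp
      then have "((\<lambda>t. \<sigma> i j (x0 + t *\<^sub>R v)) has_field_derivative d v i j) (at 0)"
        by (simp add: has_field_derivative_def linear_cmul[OF linear_d] mult.commute[of _ "d v i j"] mult_commute_abs)
      then show ?thesis using \<sigma>0[OF that] by (simp add: DERIV_def)
    qed
    have "((\<lambda>t. \<sigma> 0 1 (x0 + t *\<^sub>R v) / t * (\<sigma> 2 3 (x0 + t *\<^sub>R v) / t) - \<sigma> 0 2 (x0 + t *\<^sub>R v) / t * (\<sigma> 1 3 (x0 + t *\<^sub>R v) / t)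
        + \<sigma> 0 3 (x0 + t *\<^sub>R v) / t * (\<sigma> 1 2 (x0 + t *\<^sub>R v) / t)) \<longlongrightarrow>
        d v 0 1 * d v 2 3 - d v 0 2 * d v 1 3 + d v 0 3 * d v 1 2) (at 0)"
      by (intro tendsto_intros lim) auto
    moreover have "\<forall>\<^sub>F t in at 0. 0 \<le> \<sigma> 0 1 (x0 + t *\<^sub>R v) / t * (\<sigma> 2 3 (x0 + t *\<^sub>R v) / t) - \<sigma> 0 2 (x0 + t *\<^sub>R v) / t * (\<sigma> 1 3 (x0 + t *\<^sub>R v) / t)
        + \<sigma> 0 3 (x0 + t *\<^sub>R v) / t * (\<sigma> 1 2 (x0 + t *\<^sub>R v) / t)"
    proof -
      have "((\<lambda>t. x0 + t *\<^sub>R v) \<longlongrightarrow> x0 + 0 *\<^sub>R v) (at 0)" by (intro tendsto_intros)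
      then have "\<forall>\<^sub>F t in at 0. x0 + t *\<^sub>R v \<in> V" using V topological_tendstoD by fastforce
      then show ?thesis
      proof (rule eventually_mono)
        fix t assume "x0 + t *\<^sub>R v \<in> V"
        from divide_nonneg_nonneg[OF Pf[OF this] zero_le_square[of t]]
        show "0 \<le> \<sigma> 0 1 (x0 + t *\<^sub>R v) / t * (\<sigma> 2 3 (x0 + t *\<^sub>R v) / t) - \<sigma> 0 2 (x0 + t *\<^sub>R v) / t * (\<sigma> 1 3 (x0 + t *\<^sub>R v) / t)
          + \<sigma> 0 3 (x0 + t *\<^sub>R v) / t * (\<sigma> 1 2 (x0 + t *\<^sub>R v) / t)"
          by (simp add: diff_divide_distrib add_divide_distrib)
      qed
    qed
    ultimately show ?thesis by (intro tendsto_lowerbound[OF _ _ trivial_limit_at])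
  qed
  \<comment> \<open>The kernel vector \<open>k\<close> is chosen so that its gradient is the
    self-dual part of the gradient of \<open>v\<close>. Then the gradient of \<open>v - k\<close> is
    anti-self-dual, and its Pfaffian is both at most 0 and at least 0.\<close>
  have sd: "d v 2 3 = d v 0 1" "d v 1 3 = - d v 0 2" "d v 1 2 = d v 0 3" for v
  proof -
    obtain k where k: "\<forall>w. B x0 k w = 0" "d k 0 1 = (d v 0 1 + d v 2 3) / 2"
      "d k 0 2 = (d v 0 2 - d v 1 3) / 2" "d k 0 3 = (d v 0 3 + d v 1 2) / 2"
      using onto[of "(d v 0 1 + d v 2 3) / 2" "(d v 0 2 - d v 1 3) / 2" "(d v 0 3 + d v 1 2) / 2"] unfolding d_def by blast
    have k': "d k 2 3 = d k 0 1" "d k 1 3 = - d k 0 2" "d k 1 2 = d k 0 3"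
      using self_dual[OF k(1)] unfolding d_def by auto
    have diff: "d (v - k) i j = d v i j - d k i j" for i j using linear_diff[OF linear_d] .
    have eq: "d (v - k) 2 3 = - d (v - k) 0 1" "d (v - k) 1 3 = d (v - k) 0 2" "d (v - k) 1 2 = - d (v - k) 0 3"
      unfolding diff k' k by (simp_all add: field_simps)
    have "(d (v - k) 0 1)\<^sup>2 + (d (v - k) 0 2)\<^sup>2 + (d (v - k) 0 3)\<^sup>2 \<le> 0"
      using Pfd[of "v - k"] unfolding eq by (simp add: power2_eq_square)
    then have z: "d (v - k) 0 1 = 0" "d (v - k) 0 2 = 0" "d (v - k) 0 3 = 0"
      using zero_le_power2[of "d (v - k) 0 1"] zero_le_power2[of "d (v - k) 0 2"] zero_le_power2[of "d (v - k) 0 3"]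
      by (smt (verit) power2_less_0 zero_eq_power2)+
    show "d v 2 3 = d v 0 1" "d v 1 3 = - d v 0 2" "d v 1 2 = d v 0 3"
      using z eq k' unfolding diff by auto
  qed
  have ds: "(s l has_derivative (\<lambda>v. 2 * d v 0 l)) (at x0)" if l: "l \<in> {1, 2, 3}" for l
  proof -
    consider "l = 1" | "l = 2" | "l = 3" using l by blast
    then show ?thesis
    proof cases
      case 1
      have "((\<lambda>x. \<sigma> 0 1 x + \<sigma> 2 3 x) has_derivative (\<lambda>v. d v 0 1 + d v 2 3)) (at x0)" by (intro has_derivative_add d\<sigma>) auto
      moreover have "(\<lambda>v. d v 0 1 + d v 2 3) = (\<lambda>v. 2 * d v 0 1)" by (rule ext) (simp only: sd diff_minus_eq_add mult_2)
      ultimately show ?thesis by (simp add: s_def[abs_def] 1)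
    next
      case 2
      have "((\<lambda>x. \<sigma> 0 2 x - \<sigma> 1 3 x) has_derivative (\<lambda>v. d v 0 2 - d v 1 3)) (at x0)" by (intro has_derivative_diff d\<sigma>) auto
      moreover have "(\<lambda>v. d v 0 2 - d v 1 3) = (\<lambda>v. 2 * d v 0 2)" by (rule ext) (simp only: sd diff_minus_eq_add mult_2)
      ultimately show ?thesis by (simp add: s_def[abs_def] 2)
    next
      case 3
      have "((\<lambda>x. \<sigma> 0 3 x + \<sigma> 1 2 x) has_derivative (\<lambda>v. d v 0 3 + d v 1 2)) (at x0)" by (intro has_derivative_add d\<sigma>) auto
      moreover have "(\<lambda>v. d v 0 3 + d v 1 2) = (\<lambda>v. 2 * d v 0 3)" by (rule ext) (simp only: sd diff_minus_eq_add mult_2)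
      ultimately show ?thesis by (simp add: s_def[abs_def] 3)
    qed
  qed
  have dsk: "d v i j = - d v j i" if "i < 4" "j < 4" for v i j
  proof -
    have "(\<sigma> i j has_derivative (\<lambda>v. - d v j i)) (at x0)"
      by (rule has_derivative_transform_within_open[OF has_derivative_minus[OF d\<sigma>[OF that(2,1)]] V(1,2)])
        (simp add: sk\<sigma>[of _ i j])
    from fun_cong[OF has_derivative_unique[OF d\<sigma>[OF that] this]] show ?thesis .
  qed
  have all0: "d v i j = 0" if z: "d v 0 1 = 0" "d v 0 2 = 0" "d v 0 3 = 0" and "i < 4" "j < 4" for v i j
  proof -
    have "i = 0 \<or> i = 1 \<or> i = 2 \<or> i = 3" "j = 0 \<or> j = 1 \<or> j = 2 \<or> j = 3" using that by auto
    moreover have "d v i i = 0" if "i < 4" for i using dsk[OF that that, of v] by simp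
    ultimately show ?thesis
      using z sd[of v] dsk[of 1 0 v] dsk[of 2 0 v] dsk[of 3 0 v] dsk[of 2 1 v] dsk[of 3 1 v] dsk[of 3 2 v] by auto
  qed
  show thesis by (rule that[OF V sms sZ ds all0])
qed

text \<open>A local diffeomorphism \<open>H\<close> straightens the zero set: it turns the functions
  \<open>s l / 2\<close> into the linear functionals \<open>d _ 0 l\<close> and has the identity as
  derivative at \<open>x0\<close>. The curve is the preimage of the line
  \<open>x0 + t v\<close>.\<close>

lemma curve_in_zero_set:
  assumes v: "d v 0 1 = 0" "d v 0 2 = 0" "d v 0 3 = 0"
  shows "\<exists>\<gamma> \<delta>. 0 < \<delta> \<and> \<gamma> 0 = x0 \<and> \<gamma> ` {-\<delta><..<\<delta>} \<subseteq> Z \<and> smooth_on \<gamma> {-\<delta><..<\<delta>} \<and>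
    (\<gamma> has_vector_derivative v) (at (0::real))"
proof -
  obtain V s where V: "open V" "x0 \<in> V" "V \<subseteq> S" and sm: "\<And>k l. C_diff k (s l) V"
    and sZ: "\<And>x. x \<in> V \<Longrightarrow> x \<in> Z \<longleftrightarrow> s 1 x = 0 \<and> s 2 x = 0 \<and> s 3 x = 0"
    and ds: "\<And>l. l \<in> {1, 2, 3} \<Longrightarrow> (s l has_derivative (\<lambda>v. 2 * d v 0 l)) (at x0)"
    by (rule zero_set_submersion) (rule that; assumption)
  have x0Z: "x0 \<in> Z" using S(2) degenerate by (simp add: Z_def)
  have s0: "s l x0 = 0" if "l \<in> {1, 2, 3}" for l using sZ[OF V(2)] x0Z that by auto
  \<comment> \<open>Surjectivity of the gradient provides vectors dual to the functionals
    \<open>d _ 0 l\<close>.\<close>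
  have "\<exists>\<kappa>. \<forall>l\<in>{1, 2, 3}. d \<kappa> 0 l = (if l = j then 1 else 0)" for j :: nat
    using onto[of "if 1 = j then 1 else 0" "if 2 = j then 1 else 0" "if 3 = j then 1 else 0"]
    unfolding d_def by auto
  then have "\<exists>\<kappa>. \<forall>j::nat. \<forall>l\<in>{1, 2, 3}. d (\<kappa> j) 0 l = (if l = j then 1 else 0)" by (intro choice allI)
  then obtain \<kappa> where \<kappa>: "\<And>j l. l \<in> {1, 2, 3::nat} \<Longrightarrow> d (\<kappa> j) 0 l = (if l = j then 1 else 0)" by blast
  \<comment> \<open>The correction replaces the coordinate \<open>d (x - x0) 0 l\<close> by
    \<open>s l x / 2\<close>. Both have the same derivative at \<open>x0\<close>, which is why the
    derivative of \<open>H\<close> there is the identity.\<close>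
  define H where "H x = x + (\<Sum>l\<in>{1, 2, 3}. (s l x / 2 - d (x - x0) 0 l) *\<^sub>R \<kappa> l)" for x
  have bl: "bounded_linear (\<lambda>v. d v i j)" for i j using linear_d linear_conv_bounded_linear by blast
  have dlin: "C_diff k (\<lambda>x. d (x - x0) 0 l) V" for k l
    by (rule C_diff_bounded_linear_comp[OF bl V(1)])
      (intro C_diff_diff[OF V(1)] C_diff_const[OF V(1)] C_diff_bounded_linear[OF bounded_linear_ident V(1)])
  have smH: "smooth_on H V"
    unfolding smooth_on_def H_def
    by (intro conjI allI V C_diff_add C_diff_sum C_diff_scaleR C_diff_diff C_diff_divide C_diff_const dlin sm
        C_diff_bounded_linear[OF bounded_linear_ident]) simp
  have "(H has_derivative (\<lambda>v. v + (\<Sum>l\<in>{1, 2, 3}. ((2 * d v 0 l) / 2 - d (v - 0) 0 l) *\<^sub>R \<kappa> l))) (at x0)"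
    unfolding H_def
    by (intro has_derivative_add has_derivative_sum has_derivative_scaleR_left has_derivative_diff
        has_derivative_divide' ds has_derivative_ident bounded_linear.has_derivative[OF bl] has_derivative_const
        bounded_linear.has_derivative[OF bounded_linear_divide])
  then have dH: "(H has_derivative id) (at x0)" by (simp add: id_def)
  then have fd: "frechet_derivative H (at x0) = id" using frechet_derivative_at by metis
  have injH: "inj (frechet_derivative H (at x0))" by (simp add: fd)
  obtain U' V' G where G: "open U'" "U' \<subseteq> V" "x0 \<in> U'" "open V'" "H x0 \<in> V'" "homeomorphism U' V' H G" "smooth_on G V'"
    and dG: "\<And>y. y \<in> V' \<Longrightarrow> (G has_derivative inv (frechet_derivative H (at (G y)))) (at y)"
    by (rule smooth_inverse_function[OF smH V(2) injH]) (rule that; assumption)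
  have H0: "H x0 = x0" unfolding H_def by (simp add: s0 linear_0[OF linear_d])
  have x0V': "x0 \<in> V'" using G(5) H0 by simp
  have Gx0: "G x0 = x0" using homeomorphism_apply1[OF G(6,3)] H0 by simp
  have dG0: "(G has_derivative id) (at x0)" using dG[OF x0V'] by (simp add: Gx0 fd)
  have dH': "d (H x - x0) 0 l = s l x / 2" if "l \<in> {1, 2, 3}" for l x
  proof -
    have "H x - x0 = (x - x0) + (\<Sum>j\<in>{1, 2, 3}. (s j x / 2 - d (x - x0) 0 j) *\<^sub>R \<kappa> j)" by (simp add: H_def)
    then have "d (H x - x0) 0 l = d (x - x0) 0 l + (\<Sum>j\<in>{1, 2, 3}. (s j x / 2 - d (x - x0) 0 j) * d (\<kappa> j) 0 l)"
      by (simp only: linear_add[OF linear_d] linear_sum[OF linear_d] linear_cmul[OF linear_d] real_scaleR_def)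
    also have "(\<Sum>j\<in>{1, 2, 3}. (s j x / 2 - d (x - x0) 0 j) * d (\<kappa> j) 0 l) = s l x / 2 - d (x - x0) 0 l"
      by (subst sum_mult_delta[where i = l]) (use \<kappa>[OF that] that in auto)
    finally show ?thesis by simp
  qed
  have "\<exists>\<delta>>0. \<forall>t\<in>{-\<delta><..<\<delta>}. x0 + t *\<^sub>R v \<in> V'"
  proof -
    obtain r where r: "0 < r" "ball x0 r \<subseteq> V'" using G(4) x0V' open_contains_ball by blast
    \<comment> \<open>Adding 1 keeps the denominator positive when \<open>v\<close> is 0.\<close>
    define \<delta> where "\<delta> = r / (norm v + 1)"
    have nv: "0 < norm v + 1" by (simp add: add_nonneg_pos)
    have "x0 + t *\<^sub>R v \<in> V'" if "t \<in> {-\<delta><..<\<delta>}" for t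
    proof -
      have t: "\<bar>t\<bar> < \<delta>" using that by auto
      have "norm (t *\<^sub>R v) \<le> \<bar>t\<bar> * (norm v + 1)" by (simp add: mult_left_mono)
      also have "\<dots> < \<delta> * (norm v + 1)" using t nv by (simp add: mult_strict_right_mono)
      also have "\<dots> = r" using nv by (simp add: \<delta>_def)
      finally have "x0 + t *\<^sub>R v \<in> ball x0 r" by (simp add: dist_norm)
      then show ?thesis using r by blast
    qed
    moreover have "0 < \<delta>" using r nv by (simp add: \<delta>_def)
    ultimately show ?thesis by blast
  qed
  then obtain \<delta> where \<delta>: "0 < \<delta>" "\<And>t. t \<in> {-\<delta><..<\<delta>} \<Longrightarrow> x0 + t *\<^sub>R v \<in> V'" by blast
  define \<gamma> where "\<gamma> t = G (x0 + t *\<^sub>R v)" for t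
  have "\<gamma> t \<in> Z" if t: "t \<in> {-\<delta><..<\<delta>}" for t
  proof -
    have y: "x0 + t *\<^sub>R v \<in> V'" using \<delta>(2)[OF t] .
    have Gy: "H (\<gamma> t) = x0 + t *\<^sub>R v" unfolding \<gamma>_def using homeomorphism_apply2[OF G(6) y] .
    have "\<gamma> t \<in> U'" unfolding \<gamma>_def using G(6) y by (auto simp: homeomorphism_def)
    then have gV: "\<gamma> t \<in> V" using G(2) by blast
    have "s l (\<gamma> t) = 0" if "l \<in> {1, 2, 3}" for l
      using dH'[OF that, of "\<gamma> t"] v that unfolding Gy by (auto simp: linear_cmul[OF linear_d])
    then show ?thesis using sZ[OF gV] by blast
  qed
  moreover have "smooth_on \<gamma> {-\<delta><..<\<delta>}"
    unfolding smooth_on_def \<gamma>_def[abs_def]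
  proof (intro conjI allI)
    fix k
    show "C_diff k (\<lambda>t. G (x0 + t *\<^sub>R v)) {-\<delta><..<\<delta>}"
    proof (rule C_diff_compose[where T = V' and f = "\<lambda>t. x0 + t *\<^sub>R v"])
      show "C_diff k (\<lambda>t. x0 + t *\<^sub>R v) {-\<delta><..<\<delta>}"
        by (intro C_diff_add C_diff_const C_diff_bounded_linear bounded_linear_scaleR_left) auto
    qed (use G \<delta> in \<open>auto simp: smooth_on_def\<close>)
  qed simp
  moreover have "(\<gamma> has_vector_derivative v) (at 0)"
  proof -
    have "((\<lambda>t. x0 + t *\<^sub>R v) has_derivative (\<lambda>t. t *\<^sub>R v)) (at 0)"
      by (auto intro!: derivative_eq_intros)
    then have "((\<lambda>t. G (x0 + t *\<^sub>R v)) has_derivative (\<lambda>t. id (t *\<^sub>R v))) (at 0)"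
      using has_derivative_compose[of "\<lambda>t. x0 + t *\<^sub>R v" _ 0 UNIV G id] dG0 by simp
    then show ?thesis by (simp add: has_vector_derivative_def \<gamma>_def[abs_def])
  qed
  moreover have "\<gamma> 0 = x0" by (simp add: \<gamma>_def Gx0)
  ultimately show ?thesis using \<delta>(1) by blast
qed

text \<open>The defining functions vanish along the curve, so by the chain rule its velocity
  annihilates the three self-dual components, and with them the whole gradient.\<close>

lemma velocity_of_curve_in_zero_set:
  assumes \<delta>: "0 < \<delta>" and "\<gamma> 0 = x0" "\<gamma> ` {-\<delta><..<\<delta>} \<subseteq> Z" "(\<gamma> has_vector_derivative v) (at (0::real))"
    and ij: "i < 4" "j < 4"
  shows "d v i j = 0"
proof -
  obtain V s where V: "open V" "x0 \<in> V" "V \<subseteq> S"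
    and sZ: "\<And>x. x \<in> V \<Longrightarrow> x \<in> Z \<longleftrightarrow> s 1 x = 0 \<and> s 2 x = 0 \<and> s 3 x = 0"
    and ds: "\<And>l. l \<in> {1, 2, 3} \<Longrightarrow> (s l has_derivative (\<lambda>v. 2 * d v 0 l)) (at x0)"
    and all0: "\<And>v i j. d v 0 1 = 0 \<Longrightarrow> d v 0 2 = 0 \<Longrightarrow> d v 0 3 = 0 \<Longrightarrow> i < 4 \<Longrightarrow> j < 4 \<Longrightarrow> d v i j = 0"
    by (rule zero_set_submersion) (rule that; assumption)
  have dg: "(\<gamma> has_derivative (\<lambda>t. t *\<^sub>R v)) (at 0)" using assms(4) by (simp add: has_vector_derivative_def)
  have "isCont \<gamma> 0" using dg has_derivative_continuous by blast
  then have "\<forall>\<^sub>F t in nhds 0. \<gamma> t \<in> V"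
    using topological_tendstoD[OF tendsto_at_iff_tendsto_nhds[THEN iffD1] V(1)] V(2) assms(2)
    by (auto simp: isCont_def)
  then have "\<forall>\<^sub>F t in nhds 0. t \<in> {-\<delta><..<\<delta>} \<and> \<gamma> t \<in> V"
    using \<delta> by (intro eventually_conj eventually_nhds_in_open) auto
  then have ev: "\<forall>\<^sub>F t in nhds 0. \<gamma> t \<in> V \<and> \<gamma> t \<in> Z"
    by eventually_elim (use assms(3) in auto)
  have "d v 0 l = 0" if l: "l \<in> {1, 2, 3}" for l
  proof -
    have z: "\<forall>\<^sub>F t in nhds 0. s l (\<gamma> t) = 0" using ev by eventually_elim (use sZ l in auto)
    obtain T where T: "open T" "0 \<in> T" "\<And>t. t \<in> T \<Longrightarrow> s l (\<gamma> t) = 0" using z unfolding eventually_nhds by blast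
    have "(s l has_derivative (\<lambda>v. 2 * d v 0 l)) (at (\<gamma> 0))" using ds[OF l] assms(2) by simp
    from has_derivative_compose[OF dg this]
    have A: "((\<lambda>t. s l (\<gamma> t)) has_derivative (\<lambda>t. 2 * d (t *\<^sub>R v) 0 l)) (at 0)" .
    have B: "((\<lambda>t. s l (\<gamma> t)) has_derivative (\<lambda>t. 0)) (at 0)"
      by (rule has_derivative_transform_within_open[OF has_derivative_const T(1,2)]) (simp add: T(3))
    from fun_cong[OF has_derivative_unique[OF A B], of 1] have "2 * d (1 *\<^sub>R v) 0 l = 0" .
    then show ?thesis by simp
  qed
  then show ?thesis using all0[of v i j] ij by blast
qed

text \<open>The three functionals are jointly onto R^3, already on the kernel of
  \<open>B x0\<close>; this is the codimension 3 of the singular locus.\<close>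

lemma dim_directions: "dim {v. d v 0 1 = 0 \<and> d v 0 2 = 0 \<and> d v 0 3 = 0} + 3 = 2 * n"
proof -
  let ?h = "\<lambda>v. (d v 0 1, d v 0 2, d v 0 3) :: real \<times> real \<times> real"
  have lin: "linear ?h" using linear_d by (simp add: linear_iff)
  have "(a, b, c) \<in> range ?h" for a b c
    using onto[of a b c] unfolding d_def by auto
  then have "range ?h = UNIV" by auto
  from dim_kernel_on[OF lin subspace_UNIV this] show ?thesis
    by (simp add: card zero_prod_def)
qed

end

section \<open>Calculus on a manifold\<close>

text \<open>\<open>C_diff\<close> controls derivatives in fixed directions; a moving direction
  \<open>h y\<close> is expanded in the basis. Vector fields are pushed forward by coordinate
  changes in this way.\<close>

lemma C_diff_frechet_apply:
  fixes \<phi> :: "'x::euclidean_space \<Rightarrow> 'y::real_normed_vector" and g :: "'z::euclidean_space \<Rightarrow> 'x"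
  assumes W: "open W" and T: "open T" "\<And>k. C_diff k \<phi> T" and g: "g ` W \<subseteq> T" "C_diff k g W" and h: "C_diff k h W"
  shows "C_diff k (\<lambda>y. frechet_derivative \<phi> (at (g y)) (h y)) W"
proof (rule C_diff_cong[OF W])
  show "C_diff k (\<lambda>y. \<Sum>i\<in>Basis. (h y \<bullet> i) *\<^sub>R frechet_derivative \<phi> (at (g y)) i) W"
  proof (intro C_diff_sum C_diff_scaleR C_diff_inner C_diff_const W h)
    fix i :: 'x
    have "C_diff k (\<lambda>x. frechet_derivative \<phi> (at x) i) T" using T(2)[of "Suc k"] by simp
    then show "C_diff k (\<lambda>y. frechet_derivative \<phi> (at (g y)) i) W" by (rule C_diff_compose[OF W T(1) g])
  qed
  show "(\<Sum>i\<in>Basis. (h y \<bullet> i) *\<^sub>R frechet_derivative \<phi> (at (g y)) i) = frechet_derivative \<phi> (at (g y)) (h y)"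
    if "y \<in> W" for y
  proof -
    have "\<phi> differentiable_on T" using T(2)[of 1] by simp
    moreover have "g y \<in> T" using that g by auto
    ultimately have lin: "linear (frechet_derivative \<phi> (at (g y)))"
      using has_derivative_frechet[OF _ T(1)] has_derivative_linear by blast
    have "frechet_derivative \<phi> (at (g y)) (h y) = frechet_derivative \<phi> (at (g y)) (\<Sum>i\<in>Basis. (h y \<bullet> i) *\<^sub>R i)"
      by (simp only: euclidean_representation)
    then show ?thesis by (simp only: linear_sum[OF lin] linear_cmul[OF lin])
  qed
qed

text \<open>The clause common to \<open>smooth_function_along\<close> and
  \<open>smooth_field_along\<close>, at one point in one chart, for values in an arbitrary normed
  space so that both are instances.\<close>

definition smooth_extension ::
  "('a, 'm::finite) chart \<Rightarrow> 'a set \<Rightarrow> 'a \<Rightarrow> ('a \<Rightarrow> 'b::real_normed_vector) \<Rightarrow> bool"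
  where "smooth_extension c S p h \<longleftrightarrow> (\<exists>V f. snd c p \<in> V \<and> smooth_on f V \<and>
      (\<forall>q\<in>S \<inter> fst c. snd c q \<in> V \<longrightarrow> f (snd c q) = h q))"

section \<open>Smoothness along a subset through local extensions\<close>

lemma smooth_function_along_iff:
  "smooth_function_along A S h \<longleftrightarrow> (\<forall>c\<in>A. \<forall>p\<in>S \<inter> fst c. smooth_extension c S p h)"
  by (simp add: smooth_function_along_def smooth_extension_def)

lemma smooth_field_along_iff:
  "smooth_field_along A S s \<longleftrightarrow> (\<forall>c\<in>A. \<forall>p\<in>S \<inter> fst c. smooth_extension c S p (\<lambda>q. tangent_coords A c q (s q)))"
  by (simp add: smooth_field_along_def smooth_extension_def)

lemma smooth_on_subset: "smooth_on f V \<Longrightarrow> open W \<Longrightarrow> W \<subseteq> V \<Longrightarrow> smooth_on f W"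
  by (auto simp: smooth_on_def intro: C_diff_subset)

lemma smooth_extension_mono: "smooth_extension c S p h \<Longrightarrow> S' \<subseteq> S \<Longrightarrow> smooth_extension c S' p h"
  unfolding smooth_extension_def by blast

lemma smooth_extension_cong:
  "smooth_extension c S p h \<Longrightarrow> (\<And>q. q \<in> S \<Longrightarrow> q \<in> fst c \<Longrightarrow> h q = h' q) \<Longrightarrow> smooth_extension c S p h'"
  unfolding smooth_extension_def by fastforce

lemma smooth_extension_const: "smooth_extension c S p (\<lambda>q. a)"
  unfolding smooth_extension_def smooth_on_def
  by (intro exI[of _ UNIV] exI[of _ "\<lambda>x. a"]) (simp add: C_diff_const)

lemma smooth_extension_bilinear:
  assumes B: "bounded_bilinear B" and "smooth_extension c S p h" "smooth_extension c S p h'"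
  shows "smooth_extension c S p (\<lambda>q. B (h q) (h' q))"
proof -
  obtain V f where V: "snd c p \<in> V" "smooth_on f V" "\<forall>q\<in>S \<inter> fst c. snd c q \<in> V \<longrightarrow> f (snd c q) = h q"
    using assms(2) unfolding smooth_extension_def by blast
  obtain V' f' where V': "snd c p \<in> V'" "smooth_on f' V'" "\<forall>q\<in>S \<inter> fst c. snd c q \<in> V' \<longrightarrow> f' (snd c q) = h' q"
    using assms(3) unfolding smooth_extension_def by blast
  have o: "open (V \<inter> V')" using V(2) V'(2) by (auto simp: smooth_on_def)
  have "smooth_on (\<lambda>x. B (f x) (f' x)) (V \<inter> V')"
    unfolding smooth_on_def
    by (intro conjI allI o, rule C_diff_bilinear[OF B o C_diff_subset[of _ f V] C_diff_subset[of _ f' V']])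
      (use V(2) V'(2) in \<open>auto simp: smooth_on_def\<close>)
  then show ?thesis unfolding smooth_extension_def
    using V V' by (intro exI[of _ "V \<inter> V'"] exI[of _ "\<lambda>x. B (f x) (f' x)"]) simp
qed

lemmas smooth_extension_mult = smooth_extension_bilinear[OF bounded_bilinear_mult]
  and smooth_extension_scaleR = smooth_extension_bilinear[OF bounded_bilinear_scaleR]

lemma smooth_extension_add:
  assumes "smooth_extension c S p h" "smooth_extension c S p h'"
  shows "smooth_extension c S p (\<lambda>q. h q + h' q)"
proof -
  obtain V f where V: "snd c p \<in> V" "smooth_on f V" "\<forall>q\<in>S \<inter> fst c. snd c q \<in> V \<longrightarrow> f (snd c q) = h q"
    using assms(1) unfolding smooth_extension_def by blast
  obtain V' f' where V': "snd c p \<in> V'" "smooth_on f' V'" "\<forall>q\<in>S \<inter> fst c. snd c q \<in> V' \<longrightarrow> f' (snd c q) = h' q"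
    using assms(2) unfolding smooth_extension_def by blast
  have o: "open (V \<inter> V')" using V(2) V'(2) by (auto simp: smooth_on_def)
  have "smooth_on (\<lambda>x. f x + f' x) (V \<inter> V')"
    unfolding smooth_on_def
    by (intro conjI allI o, rule C_diff_add[OF o C_diff_subset[of _ f V] C_diff_subset[of _ f' V']])
      (use V(2) V'(2) in \<open>auto simp: smooth_on_def\<close>)
  then show ?thesis unfolding smooth_extension_def
    using V V' by (intro exI[of _ "V \<inter> V'"] exI[of _ "\<lambda>x. f x + f' x"]) simp
qed

text \<open>The extension is restricted to the preimage of the domain of \<open>\<phi>\<close>; the
  point lies in \<open>S\<close>, so the extension has the value \<open>h p\<close> there and
  \<open>p\<close> stays in the smaller domain.\<close>

lemma smooth_extension_compose:
  fixes h :: "'a \<Rightarrow> 'y::euclidean_space" and c :: "('a, 'm::finite) chart"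
  assumes "smooth_extension c S p h" and p: "p \<in> S" "p \<in> fst c" and \<phi>: "smooth_on \<phi> T" "h p \<in> T"
  shows "smooth_extension c S p (\<lambda>q. \<phi> (h q))"
proof -
  obtain V f where V: "snd c p \<in> V" "smooth_on f V" "\<forall>q\<in>S \<inter> fst c. snd c q \<in> V \<longrightarrow> f (snd c q) = h q"
    using assms(1) unfolding smooth_extension_def by blast
  have oV: "open V" and Cf: "\<And>k. C_diff k f V" and oT: "open T" and C\<phi>: "\<And>k. C_diff k \<phi> T"
    using V(2) \<phi>(1) by (auto simp: smooth_on_def)
  have o: "open (V \<inter> f -` T)"
    by (rule continuous_open_preimage[OF C_diff_imp_continuous[OF Cf[of 0]] oV oT])
  have "smooth_on (\<lambda>x. \<phi> (f x)) (V \<inter> f -` T)"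
    unfolding smooth_on_def
  proof (intro conjI allI o)
    show "C_diff k (\<lambda>x. \<phi> (f x)) (V \<inter> f -` T)" for k
      by (rule C_diff_compose[OF o oT _ C_diff_subset[OF Cf] C\<phi>]) auto
  qed
  moreover have "snd c p \<in> V \<inter> f -` T" using V p \<phi>(2) by auto
  ultimately show ?thesis unfolding smooth_extension_def
    using V(3) by (intro exI[of _ "V \<inter> f -` T"] exI[of _ "\<lambda>x. \<phi> (f x)"]) auto
qed

locale oriented_atlas =
  fixes M :: "'a topology" and A :: "('a, 'm::{finite,wellorder}) chart set"
  assumes mfd: "oriented_smooth_manifold M A"
begin

section \<open>Charts, transition maps and tangent coordinates\<close>

lemma is_chart: "c \<in> A \<Longrightarrow> is_chart M c" and cover: "(\<Union>c\<in>A. fst c) = topspace M"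
  and transition_smooth: "c \<in> A \<Longrightarrow> d \<in> A \<Longrightarrow> smooth_on (snd d \<circ> chart_inv c) (snd c ` (fst c \<inter> fst d))"
  and transition_positive: "c \<in> A \<Longrightarrow> d \<in> A \<Longrightarrow> p \<in> fst c \<Longrightarrow> p \<in> fst d \<Longrightarrow> 0 < det (matrix (coord_change c d p))"
  using mfd unfolding oriented_smooth_manifold_def by blast+

lemma domain_open: "c \<in> A \<Longrightarrow> openin M (fst c)" and image_open: "c \<in> A \<Longrightarrow> open (chart_image c)"
  and homeo: "c \<in> A \<Longrightarrow> homeomorphic_map (subtopology M (fst c)) (top_of_set (chart_image c)) (snd c)"
  using is_chart unfolding is_chart_def by blast+

lemma domain_subset: "c \<in> A \<Longrightarrow> fst c \<subseteq> topspace M"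
  using domain_open openin_subset by blast

lemma chart_inj: "c \<in> A \<Longrightarrow> inj_on (snd c) (fst c)"
  using homeomorphic_imp_injective_map[OF homeo] domain_subset by (metis inf.absorb_iff2 topspace_subtopology)

lemma chart_inv_left: "c \<in> A \<Longrightarrow> p \<in> fst c \<Longrightarrow> chart_inv c (snd c p) = p"
  unfolding chart_inv_def using chart_inj the_inv_into_f_f by metis

lemma chart_inv_right:
  assumes "c \<in> A" "x \<in> chart_image c" shows "chart_inv c x \<in> fst c" "snd c (chart_inv c x) = x"
proof -
  obtain p where "p \<in> fst c" "x = snd c p" using assms by (auto simp: chart_image_def)
  then show "chart_inv c x \<in> fst c" "snd c (chart_inv c x) = x" using chart_inv_left assms by auto
qed

lemma chart_image_mem: "p \<in> fst c \<Longrightarrow> snd c p \<in> chart_image c" for c :: "('a, 'm) chart"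
  by (simp add: chart_image_def)

lemma open_image:
  assumes c: "c \<in> A" and U: "openin M U" shows "open (snd c ` (U \<inter> fst c))"
proof -
  have "openin (subtopology M (fst c)) (U \<inter> fst c)" using U by (auto simp: openin_subtopology)
  moreover have "U \<inter> fst c \<subseteq> topspace (subtopology M (fst c))" using domain_subset[OF c] by auto
  ultimately have "openin (top_of_set (chart_image c)) (snd c ` (U \<inter> fst c))"
    using homeomorphic_map_openness[OF homeo[OF c]] by blast
  then show ?thesis using openin_open_eq[OF image_open[OF c]] by blast
qed

lemma open_preimage:
  assumes c: "c \<in> A" and V: "open V" shows "openin M {q \<in> fst c. snd c q \<in> V}"
proof -
  have ts: "topspace (subtopology M (fst c)) = fst c" using domain_subset[OF c] by auto
  have "continuous_map (subtopology M (fst c)) (top_of_set (chart_image c)) (snd c)"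
    using homeomorphic_imp_continuous_map[OF homeo[OF c]] .
  moreover have "openin (top_of_set (chart_image c)) (chart_image c \<inter> V)" using V by (simp add: openin_open_Int)
  ultimately have "openin (subtopology M (fst c)) {q \<in> topspace (subtopology M (fst c)). snd c q \<in> chart_image c \<inter> V}"
    by (rule openin_continuous_map_preimage)
  moreover have "{q \<in> topspace (subtopology M (fst c)). snd c q \<in> chart_image c \<inter> V} = {q \<in> fst c. snd c q \<in> V}"
    unfolding ts by (auto simp: chart_image_def)
  ultimately show ?thesis using openin_open_subtopology[OF domain_open[OF c]] by simp
qed

lemma chart_at: assumes "p \<in> topspace M" shows "chart_at A p \<in> A" "p \<in> fst (chart_at A p)"
proof -
  have "\<exists>c. c \<in> A \<and> p \<in> fst c" using cover assms by blast
  from someI_ex[OF this] show "chart_at A p \<in> A" "p \<in> fst (chart_at A p)" unfolding chart_at_def by auto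
qed

lemma transition_open: "c \<in> A \<Longrightarrow> d \<in> A \<Longrightarrow> open (snd c ` (fst c \<inter> fst d))"
  using transition_smooth by (auto simp: smooth_on_def)

lemma transition_C_diff: "c \<in> A \<Longrightarrow> d \<in> A \<Longrightarrow> C_diff k (snd d \<circ> chart_inv c) (snd c ` (fst c \<inter> fst d))"
  using transition_smooth by (auto simp: smooth_on_def)

lemma transition_derivative:
  assumes "c \<in> A" "d \<in> A" "p \<in> fst c" "p \<in> fst d"
  shows "((snd d \<circ> chart_inv c) has_derivative coord_change c d p) (at (snd c p))"
  unfolding coord_change_def
  by (rule has_derivative_frechet[OF _ transition_open[OF assms(1,2)]])
    (use transition_C_diff[OF assms(1,2), of 1] assms in auto)

lemma linear_coord_change:
  "c \<in> A \<Longrightarrow> d \<in> A \<Longrightarrow> p \<in> fst c \<Longrightarrow> p \<in> fst d \<Longrightarrow> linear (coord_change c d p)"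
  using transition_derivative has_derivative_linear by blast

lemma coord_change_self:
  assumes "c \<in> A" "p \<in> fst c" shows "coord_change c c p = id"
proof -
  have "((snd c \<circ> chart_inv c) has_derivative id) (at (snd c p))"
    by (rule has_derivative_transform_within_open[OF has_derivative_id image_open[OF assms(1)] chart_image_mem[OF assms(2)]])
      (simp add: chart_inv_right assms)
  from has_derivative_unique[OF transition_derivative[OF assms(1,1,2,2)] this] show ?thesis .
qed

text \<open>Chain rule for transition maps. With \<open>chart_at\<close> as one of the charts it
  makes \<open>tangent_coords\<close> and \<open>tangent_vector\<close> inverse to each other and
  compatible with coordinate changes.\<close>

lemma coord_change_comp:
  assumes A: "b \<in> A" "c \<in> A" "d \<in> A" and p: "p \<in> fst b" "p \<in> fst c" "p \<in> fst d"
  shows "coord_change c d p (coord_change b c p v) = coord_change b d p v"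
proof -
  have "(snd c \<circ> chart_inv b) (snd b p) = snd c p" using chart_inv_left A p by simp
  then have "((\<lambda>x. (snd d \<circ> chart_inv c) ((snd c \<circ> chart_inv b) x)) has_derivative
      (\<lambda>v. coord_change c d p (coord_change b c p v))) (at (snd b p))"
    using has_derivative_compose[OF transition_derivative[OF A(1,2) p(1,2)], of "snd d \<circ> chart_inv c"]
      transition_derivative[OF A(2,3) p(2,3)] by simp
  then have "((snd d \<circ> chart_inv b) has_derivative (\<lambda>v. coord_change c d p (coord_change b c p v))) (at (snd b p))"
  proof (rule has_derivative_transform_within_open)
    show "open (snd b ` (fst c \<inter> fst b))" by (rule open_image[OF A(1) domain_open[OF A(2)]])
  qed (use p chart_inv_left[OF A(1)] chart_inv_left[OF A(2)] in auto)
  from fun_cong[OF has_derivative_unique[OF this transition_derivative[OF A(1,3) p(1,3)]]] show ?thesis .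
qed

lemma tangent_coords_change:
  assumes "c \<in> A" "d \<in> A" "p \<in> fst c" "p \<in> fst d"
  shows "tangent_coords A d p v = coord_change c d p (tangent_coords A c p v)"
proof -
  have "p \<in> topspace M" using assms domain_subset by blast
  then show ?thesis unfolding tangent_coords_def using coord_change_comp[OF chart_at(1) assms(1,2) chart_at(2) assms(3,4)] by simp
qed

lemma tangent_vector_coords:
  assumes "c \<in> A" "p \<in> fst c"
  shows "tangent_vector A c p (tangent_coords A c p v) = v" "tangent_coords A c p (tangent_vector A c p v) = v"
    "linear (tangent_coords A c p)" "linear (tangent_vector A c p)"
proof -
  have p: "p \<in> topspace M" using assms domain_subset by blast
  note ca = chart_at[OF p]
  show "tangent_vector A c p (tangent_coords A c p v) = v" "tangent_coords A c p (tangent_vector A c p v) = v"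
    unfolding tangent_coords_def tangent_vector_def
    using coord_change_comp[OF ca(1) assms(1) ca(1) ca(2) assms(2) ca(2)]
      coord_change_comp[OF assms(1) ca(1) assms(1) assms(2) ca(2) assms(2)]
      coord_change_self[OF ca] coord_change_self[OF assms] by simp_all
  show "linear (tangent_coords A c p)" "linear (tangent_vector A c p)"
    unfolding tangent_coords_def tangent_vector_def using linear_coord_change ca assms by blast+
qed

lemma tangent_chart_at:
  assumes "p \<in> topspace M"
  shows "tangent_coords A (chart_at A p) p = id" "tangent_vector A (chart_at A p) p = id"
  unfolding tangent_coords_def tangent_vector_def using coord_change_self chart_at[OF assms] by blast+

text \<open>The extension is cut down to the chart image of \<open>U\<close>, and injectivity of the
  chart ensures that the points tested there belong to \<open>U\<close>.\<close>

lemma smooth_extension_local: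
  assumes c: "c \<in> A" "p \<in> fst c" and U: "openin M U" "p \<in> U" and h: "smooth_extension c (S \<inter> U) p h"
  shows "smooth_extension c S p h"
proof -
  obtain V f where V: "snd c p \<in> V" "smooth_on f V" "\<forall>q\<in>S \<inter> U \<inter> fst c. snd c q \<in> V \<longrightarrow> f (snd c q) = h q"
    using h unfolding smooth_extension_def by blast
  let ?W = "V \<inter> snd c ` (U \<inter> fst c)"
  have "open ?W" using V(2) open_image[OF c(1) U(1)] by (auto simp: smooth_on_def)
  then have "smooth_on f ?W" by (rule smooth_on_subset[OF V(2)]) auto
  moreover have "f (snd c q) = h q" if q: "q \<in> S \<inter> fst c" "snd c q \<in> ?W" for q
  proof -
    obtain q' where "q' \<in> U" "q' \<in> fst c" "snd c q = snd c q'" using q(2) by blast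
    then have "q \<in> U" using chart_inj[OF c(1)] q(1) by (auto simp: inj_on_def)
    then show ?thesis using V(3) q by blast
  qed
  ultimately show ?thesis unfolding smooth_extension_def
    using V(1) c U by (intro exI[of _ ?W] exI[of _ f]) auto
qed

text \<open>A function is extended by composing with the transition map; a field is moreover
  transformed by the derivative of the opposite transition. Smoothness can therefore be checked in a
  single chart around each point.\<close>

lemma smooth_extension_change_chart:
  assumes c: "c \<in> A" "p \<in> fst c" and d: "d \<in> A" "p \<in> fst d"
  shows "smooth_extension c S p h \<Longrightarrow> smooth_extension d S p h"
    and "smooth_extension c S p (\<lambda>q. tangent_coords A c q (s q)) \<Longrightarrow> smooth_extension d S p (\<lambda>q. tangent_coords A d q (s q))"
proof -
  let ?\<tau> = "snd c \<circ> chart_inv d" and ?W = "snd d ` (fst d \<inter> fst c)"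
  have o: "open (?W \<inter> ?\<tau> -` V)" if "open V" for V
    by (rule continuous_open_preimage[OF C_diff_imp_continuous[OF transition_C_diff[OF d(1) c(1), of 0]] transition_open[OF d(1) c(1)] that])
  have sm: "C_diff k ?\<tau> (?W \<inter> ?\<tau> -` V)" for k V
    by (rule C_diff_subset[OF transition_C_diff[OF d(1) c(1)]]) auto
  have \<tau>p: "?\<tau> (snd d q) = snd c q" if "q \<in> fst d" for q using chart_inv_left[OF d(1) that] by simp
  have mem: "q \<in> fst c" if "q \<in> fst d" "snd d q \<in> ?W" for q
    using that chart_inj[OF d(1)] by (auto simp: inj_on_def)
  have pW: "snd d p \<in> ?W" using c d by auto
  {
    fix h :: "'a \<Rightarrow> 'c::real_normed_vector"
    assume h: "smooth_extension c S p h"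
    then obtain V f where V: "snd c p \<in> V" "smooth_on f V" "\<forall>q\<in>S \<inter> fst c. snd c q \<in> V \<longrightarrow> f (snd c q) = h q"
      unfolding smooth_extension_def by blast
    have oV: "open V" and Cf: "\<And>k. C_diff k f V" using V(2) by (auto simp: smooth_on_def)
    have "smooth_on (\<lambda>y. f (?\<tau> y)) (?W \<inter> ?\<tau> -` V)"
      unfolding smooth_on_def
      by (intro conjI allI o oV) (rule C_diff_compose[OF o[OF oV] oV _ sm Cf], auto)
    moreover have "snd d p \<in> ?W \<inter> ?\<tau> -` V" using pW V(1) \<tau>p[OF d(2)] by simp
    moreover have "f (?\<tau> (snd d q)) = h q" if "q \<in> S \<inter> fst d" "snd d q \<in> ?W \<inter> ?\<tau> -` V" for q
      using that mem[of q] V(3) \<tau>p[of q] by simp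
    ultimately show "smooth_extension d S p h" unfolding smooth_extension_def
      by (intro exI[of _ "?W \<inter> ?\<tau> -` V"] exI[of _ "\<lambda>y. f (?\<tau> y)"]) blast
  }
  assume h: "smooth_extension c S p (\<lambda>q. tangent_coords A c q (s q))"
  then obtain V f where V: "snd c p \<in> V" "smooth_on f V" "\<forall>q\<in>S \<inter> fst c. snd c q \<in> V \<longrightarrow> f (snd c q) = tangent_coords A c q (s q)"
    unfolding smooth_extension_def by blast
  have oV: "open V" and Cf: "\<And>k. C_diff k f V" using V(2) by (auto simp: smooth_on_def)
  let ?\<rho> = "snd d \<circ> chart_inv c"
  let ?F = "\<lambda>y. frechet_derivative ?\<rho> (at (?\<tau> y)) (f (?\<tau> y))"
  have "smooth_on ?F (?W \<inter> ?\<tau> -` V)"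
    unfolding smooth_on_def
  proof (intro conjI allI o oV)
    fix k
    show "C_diff k ?F (?W \<inter> ?\<tau> -` V)"
    proof (rule C_diff_frechet_apply[OF o[OF oV] transition_open[OF c(1) d(1)] transition_C_diff[OF c(1) d(1)] _ sm])
      show "C_diff k (\<lambda>y. f (?\<tau> y)) (?W \<inter> ?\<tau> -` V)"
        by (rule C_diff_compose[OF o[OF oV] oV _ sm Cf]) auto
      show "?\<tau> ` (?W \<inter> ?\<tau> -` V) \<subseteq> snd c ` (fst c \<inter> fst d)" using \<tau>p by auto
    qed
  qed
  moreover have "snd d p \<in> ?W \<inter> ?\<tau> -` V" using pW V(1) \<tau>p[OF d(2)] by simp
  moreover have "?F (snd d q) = tangent_coords A d q (s q)" if "q \<in> S \<inter> fst d" "snd d q \<in> ?W \<inter> ?\<tau> -` V" for q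
  proof -
    have q: "q \<in> fst c" "q \<in> fst d" "snd c q \<in> V" using that mem[of q] \<tau>p[of q] by auto
    have "?F (snd d q) = coord_change c d q (tangent_coords A c q (s q))"
      unfolding \<tau>p[OF q(2)] coord_change_def using V(3) q that by simp
    then show ?thesis using tangent_coords_change[OF c(1) d(1) q(1,2)] by simp
  qed
  ultimately show "smooth_extension d S p (\<lambda>q. tangent_coords A d q (s q))" unfolding smooth_extension_def
    by (intro exI[of _ "?W \<inter> ?\<tau> -` V"] exI[of _ ?F]) blast
qed

lemma smooth_field_alongI:
  assumes "\<And>p. p \<in> S \<Longrightarrow> \<exists>c\<in>A. p \<in> fst c \<and> smooth_extension c S p (\<lambda>q. tangent_coords A c q (s q))"
  shows "smooth_field_along A S s"
  unfolding smooth_field_along_iff using assms smooth_extension_change_chart(2) by blast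

lemma smooth_function_along_continuous:
  assumes h: "smooth_function_along A S h" and S: "S \<subseteq> topspace M"
  shows "continuous_map (subtopology M S) euclideanreal h"
  unfolding continuous_map_def
proof (intro conjI allI impI)
  fix T :: "real set" assume "openin euclideanreal T"
  then have T: "open T" by simp
  show "openin (subtopology M S) {p \<in> topspace (subtopology M S). h p \<in> T}"
  proof (subst openin_subopen, intro ballI)
    fix p assume "p \<in> {p \<in> topspace (subtopology M S). h p \<in> T}"
    then have p: "p \<in> S" "p \<in> topspace M" "h p \<in> T" by auto
    define c where "c = chart_at A p"
    have c: "c \<in> A" "p \<in> fst c" using chart_at[OF p(2)] by (auto simp: c_def)
    obtain V f where V: "snd c p \<in> V" "smooth_on f V" "\<forall>q\<in>S \<inter> fst c. snd c q \<in> V \<longrightarrow> f (snd c q) = h q"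
      using h p c unfolding smooth_function_along_iff smooth_extension_def by blast
    have oV: "open V" and cf: "continuous_on V f"
      using V(2) C_diff_imp_continuous[of 0 f V] by (auto simp: smooth_on_def)
    have o: "open (V \<inter> f -` T)" by (rule continuous_open_preimage[OF cf oV T])
    let ?U = "{q \<in> fst c. snd c q \<in> V \<inter> f -` T}"
    have "openin (subtopology M S) (S \<inter> ?U)"
      using open_preimage[OF c(1) o] by (metis openin_subtopology_Int2)
    moreover have "p \<in> S \<inter> ?U" using p c V by auto
    moreover have "S \<inter> ?U \<subseteq> {p \<in> topspace (subtopology M S). h p \<in> T}" using V(3) S by auto
    ultimately show "\<exists>T'. openin (subtopology M S) T' \<and> p \<in> T' \<and> T' \<subseteq> {p \<in> topspace (subtopology M S). h p \<in> T}" by blast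
  qed
qed simp

end

section \<open>The singular locus\<close>

text \<open>Converse to \<open>det_nonzero_frame\<close>: rows that span make the matrix left
  invertible.\<close>

lemma det_rows_eq_0_iff:
  fixes v :: "nat \<Rightarrow> real^'m::{finite,wellorder}"
  assumes "span (v ` {..<CARD('m)}) = UNIV"
  shows "det (\<chi> i. v (card {j. j < i})) \<noteq> 0"
proof -
  let ?M = "\<chi> i::'m. v (card {j. j < i})"
  have "rows ?M = v ` (\<lambda>i::'m. card {j. j < i}) ` UNIV" unfolding rows_def by (auto simp: row_def vec_eq_iff image_iff)
  then have "rows ?M = v ` {..<CARD('m)}"
    unfolding bij_betw_imp_surj_on[OF bij_betw_card_below[where 'm = 'm]] .
  then have "\<exists>B. B ** ?M = mat 1" using assms matrix_left_invertible_span_rows[of ?M] by simp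
  then show ?thesis using invertible_left_inverse invertible_det_nz by blast
qed

text \<open>Applying \<open>L\<close> to every row is right multiplication by the transpose of its
  matrix.\<close>

lemma det_linear_frame:
  fixes L :: "real^'m::{finite,wellorder} \<Rightarrow> real^'m::{finite,wellorder}"
  assumes L: "linear L"
  shows "det (\<chi> i::'m. L (v (card {j. j < i}))) = det (\<chi> i::'m. v (card {j. j < i})) * det (matrix L)"
proof -
  have "(\<chi> i::'m. L (v (card {j. j < i}))) = (\<chi> i::'m. v (card {j. j < i})) ** Finite_Cartesian_Product.transpose (matrix L)"
  proof -
    have "matrix L *v x = L x" for x using L by (simp add: matrix_works)
    then have "L x $ j = (\<Sum>k\<in>UNIV. x $ k * matrix L $ j $ k)" for x j
      by (simp add: matrix_vector_mult_def vec_eq_iff mult.commute)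
    then show ?thesis by (simp add: vec_eq_iff matrix_matrix_mult_def transpose_def)
  qed
  then show ?thesis by (simp add: det_mul det_transpose)
qed

text \<open>The hypotheses on form, metric and \<open>X\<close> are bundled so that all results can
  be instantiated a second time with \<open>X\<close> replaced by its reoriented version.\<close>

locale near_symplectic_setting = oriented_atlas M A
  for M :: "'a topology" and A :: "('a, 'm::{finite,wellorder}) chart set" +
  fixes n :: nat and \<omega> g :: "('a, 'm) form2" and X :: "'a \<Rightarrow> real^'m::{finite,wellorder}"
  assumes dimension: "CARD('m) = 2 * n"
    and near_symplectic: "near_symplectic M A n \<omega>"
    and metric: "fibre_metric M A (singular_locus M n \<omega>) (kernel_at \<omega>) g"
    and self_dual: "\<forall>p\<in>singular_locus M n \<omega>. D_K A \<omega> p ` kernel_at \<omega> p =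
      self_dual_forms (kernel_at \<omega> p) (g p) (positive_kernel_frame n \<omega> p)"
    and unit_field: "unit_field_spanning A (singular_locus M n \<omega>) (epsilon_at A (singular_locus M n \<omega>) \<omega>) g X"
begin

abbreviation "Z \<equiv> singular_locus M n \<omega>"
abbreviation "K \<equiv> kernel_at \<omega>"
abbreviation "N \<equiv> normal_at A Z \<omega> g"
abbreviation "F \<equiv> normal_endo A Z \<omega> g X"
abbreviation "\<Omega> \<equiv> local_form A \<omega>"

section \<open>The form in charts and its kernel along Z\<close>

lemma Z_subset: "Z \<subseteq> topspace M" by (auto simp: singular_locus_def)

lemma form: "p \<in> topspace M \<Longrightarrow> bilinear (\<omega> p)" "p \<in> topspace M \<Longrightarrow> \<omega> p v v = 0"
  using near_symplectic by (auto simp: near_symplectic_def smooth_2form_def)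

lemma form_skew: "p \<in> topspace M \<Longrightarrow> \<omega> p v w = - \<omega> p w v"
  using form(2)[of p "v + w"] form(2)[of p v] form(2)[of p w] form(1)[of p]
  by (simp add: bilinear_ladd bilinear_radd)

lemma local_form_at:
  assumes "c \<in> A" "p \<in> fst c"
  shows "\<Omega> c (snd c p) u w = \<omega> p (tangent_vector A c p u) (tangent_vector A c p w)"
  unfolding local_form_def Let_def chart_inv_left[OF assms] ..

lemma local_form_smooth: "c \<in> A \<Longrightarrow> C_diff k (\<lambda>x. \<Omega> c x u w) (chart_image c)"
  using near_symplectic by (auto simp: near_symplectic_def smooth_2form_def smooth_on_def)

lemma local_form_bilinear:
  assumes "c \<in> A" "x \<in> chart_image c" shows "bilinear (\<Omega> c x)" "\<Omega> c x v v = 0"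
proof -
  note q = chart_inv_right[OF assms]
  have t: "chart_inv c x \<in> topspace M" using q(1) assms domain_subset by blast
  have e: "\<Omega> c x = (\<lambda>u w. \<omega> (chart_inv c x) (tangent_vector A c (chart_inv c x) u) (tangent_vector A c (chart_inv c x) w))"
    by (intro ext) (simp add: local_form_def Let_def)
  note lin = tangent_vector_coords(4)[OF assms(1) q(1)] and b = form(1)[OF t]
  show "bilinear (\<Omega> c x)"
    unfolding bilinear_def linear_iff e
    by (simp add: linear_add[OF lin] linear_cmul[OF lin] bilinear_ladd[OF b] bilinear_radd[OF b]
        bilinear_lmul[OF b] bilinear_rmul[OF b])
  show "\<Omega> c x v v = 0" unfolding e using form(2)[OF t] .
qed

lemma wedge_power_local_form:
  assumes "c \<in> A" "p \<in> fst c"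
  shows "wedge_power (\<Omega> c (snd c p)) k v = wedge_power (\<omega> p) k (\<lambda>i. tangent_vector A c p (v i))"
  by (rule wedge_power_cong) (simp add: local_form_at[OF assms])

text \<open>The condition quantifies over all tuples of vectors, so the linear isomorphism between
  tangent vectors and coordinates carries one side to the other.\<close>

lemma in_Z_iff:
  assumes "c \<in> A" "x \<in> chart_image c"
  shows "chart_inv c x \<in> Z \<longleftrightarrow> (\<forall>v. wedge_power (\<Omega> c x) (n - 1) v = 0)"
proof -
  note q = chart_inv_right[OF assms]
  have t: "chart_inv c x \<in> topspace M" using q(1) assms domain_subset by blast
  have w: "wedge_power (\<Omega> c x) (n - 1) v = wedge_power (\<omega> (chart_inv c x)) (n - 1) (\<lambda>i. tangent_vector A c (chart_inv c x) (v i))" for v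
    using wedge_power_local_form[OF assms(1) q(1)] q(2) by simp
  have "wedge_power (\<omega> (chart_inv c x)) (n - 1) v = wedge_power (\<Omega> c x) (n - 1) (\<lambda>i. tangent_coords A c (chart_inv c x) (v i))" for v
    unfolding w tangent_vector_coords(1)[OF assms(1) q(1)] ..
  then show ?thesis using w t by (auto simp: singular_locus_def)
qed

lemma kernel_local_form:
  assumes "c \<in> A" "p \<in> fst c"
  shows "(\<forall>w. \<Omega> c (snd c p) v w = 0) \<longleftrightarrow> tangent_vector A c p v \<in> K p"
  unfolding local_form_at[OF assms] kernel_at_def mem_Collect_eq
  using tangent_vector_coords(1)[OF assms] by metis

lemma subspace_K: "p \<in> topspace M \<Longrightarrow> subspace (K p)"
  using form(1)[of p] by (auto simp: kernel_at_def subspace_def bilinear_lzero bilinear_ladd bilinear_lmul)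

lemma at_Z:
  assumes p: "p \<in> Z" shows "2 \<le> n" "dim (K p) = 4" "dim (D_K A \<omega> p ` K p) = 3"
proof -
  have t: "p \<in> topspace M" and w: "\<And>v. wedge_power (\<omega> p) (n - 1) v = 0" using p by (auto simp: singular_locus_def)
  have n0: "n \<noteq> 0" using dimension zero_less_card_finite[where 'a = 'm] by linarith
  \<comment> \<open>The 0-th power of a form is the constant 1, so \<open>n = 1\<close> would
    contradict \<open>p \<in> Z\<close>.\<close>
  have "n - 1 \<noteq> 0"
  proof
    assume "n - 1 = 0"
    then show False using w[of undefined] by (simp add: wedge_power_def permutes_empty)
  qed
  then show "2 \<le> n" by simp
  have "wedge_power (\<omega> p) n v = 0" for v
    using wedge_power_Suc_eq_0[of "\<omega> p" "n - 1", OF w] n0 by simp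
  then show "dim (K p) = 4" "dim (D_K A \<omega> p ` K p) = 3"
    using near_symplectic t unfolding near_symplectic_def by blast+
qed

lemma K_inner_product: "p \<in> Z \<Longrightarrow> inner_product_subspace (K p) (g p)"
  using metric subspace_K Z_subset unfolding fibre_metric_def by unfold_locales auto

lemma has_derivative_local_form:
  assumes "c \<in> A" "x \<in> chart_image c"
  shows "((\<lambda>y. \<Omega> c y u w) has_derivative (\<lambda>v. local_deriv A \<omega> c x v u w)) (at x)"
  unfolding local_deriv_def
  by (rule has_derivative_frechet[OF _ image_open[OF assms(1)] assms(2)])
    (use local_form_smooth[OF assms(1), of 1] in simp)

lemma linear_local_deriv:
  assumes "c \<in> A" "x \<in> chart_image c"
  shows "linear (\<lambda>v. local_deriv A \<omega> c x v u w)"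
  using has_derivative_linear[OF has_derivative_local_form[OF assms]] .

lemma linear_D_K:
  assumes t: "p \<in> topspace M" shows "linear (D_K A \<omega> p)"
proof -
  have "linear (\<lambda>v. local_deriv A \<omega> (chart_at A p) (snd (chart_at A p) p) v u w)" for u w
    by (rule linear_local_deriv[OF chart_at(1)[OF t] chart_image_mem[OF chart_at(2)[OF t]]])
  then show ?thesis
    by (simp add: linear_iff D_K_def restrict_form_def fun_eq_iff plus_fun_def scaleR_fun_def)
qed

lemma D_K_closed:
  assumes p: "p \<in> topspace M" and "u \<in> K p" "v \<in> K p" "w \<in> K p"
  shows "D_K A \<omega> p u v w + D_K A \<omega> p v w u + D_K A \<omega> p w u v = 0"
  using near_symplectic chart_at(1)[OF p] chart_image_mem[OF chart_at(2)[OF p]] assms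
  by (simp add: near_symplectic_def closed_2form_def D_K_def restrict_form_def)

lemma positive_frame_tangent_vector:
  assumes c: "c \<in> A" "p \<in> fst c" and v: "positive_frame v"
  shows "positive_frame (\<lambda>i. tangent_vector A c p (v i))"
proof -
  have t: "p \<in> topspace M" using c domain_subset by blast
  have "0 < det (matrix (tangent_vector A c p))"
    unfolding tangent_vector_def by (rule transition_positive[OF c(1) chart_at(1)[OF t] c(2) chart_at(2)[OF t]])
  then show ?thesis using v unfolding positive_frame_def det_linear_frame[OF tangent_vector_coords(4)[OF c]] by simp
qed

text \<open>In the chart \<open>chart_at A p\<close> itself tangent vectors at \<open>p\<close>
  equal their coordinates, so \<open>\<Omega>\<close> at that point is \<open>\<omega> p\<close> and
  the frame \<open>f\<close> can be used unchanged. At other points of the chart, kernels and powers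
  are transported by \<open>tangent_coords\<close> and \<open>tangent_vector\<close>.\<close>

lemma degenerate_family_at:
  assumes p: "p \<in> Z" and f: "orthonormal_frame (K p) (g p) 4 f" and pos: "positive_kernel_frame n \<omega> p f"
  shows "\<exists>u. degenerate_family (chart_image (chart_at A p)) (\<Omega> (chart_at A p)) n (snd (chart_at A p) p) f u"
proof -
  define c where "c = chart_at A p"
  have t: "p \<in> topspace M" using p Z_subset by blast
  have c: "c \<in> A" "p \<in> fst c" using chart_at[OF t] by (auto simp: c_def)
  interpret Kp: inner_product_subspace "K p" "g p" by (rule K_inner_product[OF p])
  have lf: "\<Omega> c (snd c p) = \<omega> p"
    by (intro ext) (simp add: local_form_at[OF c] tangent_chart_at[OF t, folded c_def])
  have fK: "f i \<in> K p" if "i < 4" for i using orthonormal_frame_mem[OF f that] .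
  have D: "D_K A \<omega> p v (f i) (f j) = frechet_derivative (\<lambda>x. \<Omega> c x (f i) (f j)) (at (snd c p)) v"
    if "i < 4" "j < 4" for v i j
    using fK that by (simp add: D_K_def restrict_form_def local_deriv_def c_def)
  have sd: "D_K A \<omega> p ` K p = self_dual_forms (K p) (g p) (positive_kernel_frame n \<omega> p)" using self_dual p by blast
  obtain u where u: "0 < wedge_power (\<omega> p) (n - 2) u" "positive_frame (\<lambda>k. if k < 4 then f k else u (k - 4))"
    using pos unfolding positive_kernel_frame_def by blast
  have "degenerate_family (chart_image c) (\<Omega> c) n (snd c p) f u"
  proof
    show "open (chart_image c)" "snd c p \<in> chart_image c" using image_open c chart_image_mem by auto
    show "CARD('m) = 2 * n" "2 \<le> n" using dimension at_Z[OF p] by auto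
    show "bilinear (\<Omega> c x)" "\<Omega> c x v v = 0" if "x \<in> chart_image c" for x v
      using local_form_bilinear[OF c(1) that] by auto
    show "C_diff k (\<lambda>x. \<Omega> c x v w) (chart_image c)" for k v w using local_form_smooth c by blast
    show "0 \<le> wedge_power (\<Omega> c x) n v" if x: "x \<in> chart_image c" and v: "positive_frame v" for x v
    proof -
      note q = chart_inv_right[OF c(1) x]
      have "chart_inv c x \<in> topspace M" using q(1) c(1) domain_subset by blast
      then show ?thesis
        using near_symplectic positive_frame_tangent_vector[OF c(1) q(1) v] wedge_power_local_form[OF c(1) q(1), of n v] q(2)
        by (simp add: near_symplectic_def)
    qed
    show "dim {v. \<forall>w. \<Omega> c x v w = 0} = 4"
      if x: "x \<in> chart_image c" and z: "\<forall>v. wedge_power (\<Omega> c x) (n - 1) v = 0" for x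
    proof -
      note q = chart_inv_right[OF c(1) x]
      have "chart_inv c x \<in> Z" using in_Z_iff[OF c(1) x] z by blast
      then have d: "dim (K (chart_inv c x)) = 4" using at_Z by blast
      note tc = tangent_vector_coords[OF c(1) q(1)]
      have "{v. \<forall>w. \<Omega> c x v w = 0} = tangent_coords A c (chart_inv c x) ` K (chart_inv c x)"
      proof (intro equalityI subsetI)
        fix v assume "v \<in> {v. \<forall>w. \<Omega> c x v w = 0}"
        then have "tangent_vector A c (chart_inv c x) v \<in> K (chart_inv c x)"
          using kernel_local_form[OF c(1) q(1), of v] q(2) by simp
        then show "v \<in> tangent_coords A c (chart_inv c x) ` K (chart_inv c x)"
          by (rule rev_image_eqI) (simp add: tc(2))
      next
        fix v assume "v \<in> tangent_coords A c (chart_inv c x) ` K (chart_inv c x)"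
        then have "tangent_vector A c (chart_inv c x) v \<in> K (chart_inv c x)" using tc(1) by auto
        then show "v \<in> {v. \<forall>w. \<Omega> c x v w = 0}" using kernel_local_form[OF c(1) q(1), of v] q(2) by simp
      qed
      moreover have "inj_on (tangent_coords A c (chart_inv c x)) (span (K (chart_inv c x)))"
        by (rule inj_on_inverseI[of _ "tangent_vector A c (chart_inv c x)"]) (rule tc(1))
      ultimately show ?thesis using dim_image_eq[OF tc(3)] d by simp
    qed
    show "\<forall>v. wedge_power (\<Omega> c (snd c p)) (n - 1) v = 0" unfolding lf using p by (simp add: singular_locus_def)
    show "\<Omega> c (snd c p) (f i) w = 0" if "i < 4" for i w unfolding lf using fK[OF that] by (simp add: kernel_at_def)
    show "0 < wedge_power (\<Omega> c (snd c p)) (n - 2) u" unfolding lf using u(1) .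
    show "positive_frame (\<lambda>k. if k < 4 then f k else u (k - 4))" using u(2) .
    show "frechet_derivative (\<lambda>x. \<Omega> c x (f 2) (f 3)) (at (snd c p)) v = frechet_derivative (\<lambda>x. \<Omega> c x (f 0) (f 1)) (at (snd c p)) v \<and>
      frechet_derivative (\<lambda>x. \<Omega> c x (f 1) (f 3)) (at (snd c p)) v = - frechet_derivative (\<lambda>x. \<Omega> c x (f 0) (f 2)) (at (snd c p)) v \<and>
      frechet_derivative (\<lambda>x. \<Omega> c x (f 1) (f 2)) (at (snd c p)) v = frechet_derivative (\<lambda>x. \<Omega> c x (f 0) (f 3)) (at (snd c p)) v"
      if v: "\<forall>w. \<Omega> c (snd c p) v w = 0" for v
    proof -
      have "v \<in> K p" using v unfolding lf by (simp add: kernel_at_def)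
      then have "D_K A \<omega> p v \<in> self_dual_forms (K p) (g p) (positive_kernel_frame n \<omega> p)" using sd by blast
      from Kp.self_dual_components[where P = "positive_kernel_frame n \<omega> p" and f = f, OF this f pos] show ?thesis by (simp add: D[symmetric])
    qed
    show "\<exists>v. (\<forall>w. \<Omega> c (snd c p) v w = 0) \<and> frechet_derivative (\<lambda>x. \<Omega> c x (f 0) (f 1)) (at (snd c p)) v = a \<and>
      frechet_derivative (\<lambda>x. \<Omega> c x (f 0) (f 2)) (at (snd c p)) v = b \<and>
      frechet_derivative (\<lambda>x. \<Omega> c x (f 0) (f 3)) (at (snd c p)) v = e" for a b e
    proof -
      obtain v where "v \<in> K p" "D_K A \<omega> p v (f 0) (f 1) = a" "D_K A \<omega> p v (f 0) (f 2) = b" "D_K A \<omega> p v (f 0) (f 3) = e"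
        using Kp.self_dual_gradient(1)[where P = "positive_kernel_frame n \<omega> p" and f = f and x = a and y = b and z = e,
            OF linear_D_K[OF t] sd at_Z(3)[OF p] at_Z(2)[OF p] f pos] by blast
      then show ?thesis unfolding lf by (intro exI[of _ v]) (simp add: D kernel_at_def)
    qed
  qed
  then show ?thesis unfolding c_def by blast
qed

text \<open>Curves in Z and curves in the zero set of the chart expression correspond under the
  chart, which reduces the two inclusions to \<open>velocity_of_curve_in_zero_set\<close> and
  \<open>curve_in_zero_set\<close>.\<close>

lemma tangent_space_Z:
  assumes p: "p \<in> Z" and f: "orthonormal_frame (K p) (g p) 4 f" and pos: "positive_kernel_frame n \<omega> p f"
  shows "tangent_space A Z p = {v. local_deriv A \<omega> (chart_at A p) (snd (chart_at A p) p) v (f 0) (f 1) = 0 \<and>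
      local_deriv A \<omega> (chart_at A p) (snd (chart_at A p) p) v (f 0) (f 2) = 0 \<and>
      local_deriv A \<omega> (chart_at A p) (snd (chart_at A p) p) v (f 0) (f 3) = 0}" (is "_ = ?T")
    and "dim (tangent_space A Z p) + 3 = 2 * n" "subspace (tangent_space A Z p)"
proof -
  define c where "c = chart_at A p"
  have t: "p \<in> topspace M" using p Z_subset by blast
  have c: "c \<in> A" "p \<in> fst c" using chart_at[OF t] by (auto simp: c_def)
  obtain u where u: "degenerate_family (chart_image c) (\<Omega> c) n (snd c p) f u"
    using degenerate_family_at[OF assms] unfolding c_def by blast
  interpret G: degenerate_family "chart_image c" "\<Omega> c" n "snd c p" f u by (rule u)
  have d: "local_deriv A \<omega> (chart_at A p) (snd (chart_at A p) p) v (f i) (f j) = G.d v i j" for v i j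
    by (simp only: G.d_def local_deriv_def c_def[symmetric])
  have GZ: "x \<in> G.Z \<longleftrightarrow> x \<in> chart_image c \<and> chart_inv c x \<in> Z" for x
    using in_Z_iff[OF c(1)] by (auto simp: G.Z_def)
  show eq: "tangent_space A Z p = ?T"
    unfolding d
  proof (intro equalityI subsetI CollectI)
    fix v assume "v \<in> tangent_space A Z p"
    then obtain \<gamma> \<delta> where \<gamma>: "0 < \<delta>" "\<gamma> 0 = p" "\<gamma> ` {-\<delta><..<\<delta>} \<subseteq> Z \<inter> fst c"
      "(snd c \<circ> \<gamma> has_vector_derivative v) (at 0)"
      unfolding tangent_space_def c_def by blast
    have "(snd c \<circ> \<gamma>) ` {-\<delta><..<\<delta>} \<subseteq> G.Z"
    proof (rule image_subsetI)
      fix s assume "s \<in> {-\<delta><..<\<delta>}"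
      then have "\<gamma> s \<in> Z" "\<gamma> s \<in> fst c" using \<gamma>(3) by auto
      then show "(snd c \<circ> \<gamma>) s \<in> G.Z" unfolding GZ using chart_image_mem chart_inv_left[OF c(1)] by simp
    qed
    then have "G.d v i j = 0" if "i < 4" "j < 4" for i j
      using G.velocity_of_curve_in_zero_set[OF \<gamma>(1) _ _ \<gamma>(4) that] \<gamma>(2) by simp
    then show "G.d v 0 1 = 0 \<and> G.d v 0 2 = 0 \<and> G.d v 0 3 = 0" by simp
  next
    fix v assume "v \<in> {v. G.d v 0 1 = 0 \<and> G.d v 0 2 = 0 \<and> G.d v 0 3 = 0}"
    then obtain \<gamma> \<delta> where \<gamma>: "0 < \<delta>" "\<gamma> 0 = snd c p" "\<gamma> ` {-\<delta><..<\<delta>} \<subseteq> G.Z"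
      "smooth_on \<gamma> {-\<delta><..<\<delta>}" "(\<gamma> has_vector_derivative v) (at 0)"
      using G.curve_in_zero_set by blast
    have r: "snd c (chart_inv c (\<gamma> s)) = \<gamma> s" "chart_inv c (\<gamma> s) \<in> Z \<inter> fst c" if "s \<in> {-\<delta><..<\<delta>}" for s
    proof -
      have "\<gamma> s \<in> G.Z" using \<gamma>(3) that by blast
      then show "snd c (chart_inv c (\<gamma> s)) = \<gamma> s" "chart_inv c (\<gamma> s) \<in> Z \<inter> fst c"
        using chart_inv_right[OF c(1)] unfolding GZ by auto
    qed
    have sm: "smooth_on (snd c \<circ> (chart_inv c \<circ> \<gamma>)) {-\<delta><..<\<delta>}"
      unfolding smooth_on_def
    proof (intro conjI allI)
      fix k
      show "C_diff k (snd c \<circ> (chart_inv c \<circ> \<gamma>)) {-\<delta><..<\<delta>}"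
        by (rule C_diff_cong[of _ \<gamma>]) (use \<gamma>(4) r in \<open>auto simp: smooth_on_def\<close>)
    qed simp
    have vd: "(snd c \<circ> (chart_inv c \<circ> \<gamma>) has_vector_derivative v) (at 0)"
      unfolding has_vector_derivative_def
      by (rule has_derivative_transform_within_open[of \<gamma> _ _ _ "{-\<delta><..<\<delta>}"])
        (use \<gamma> r in \<open>auto simp: has_vector_derivative_def\<close>)
    show "v \<in> tangent_space A Z p"
      unfolding tangent_space_def c_def[symmetric]
      by (intro CollectI exI[of _ "chart_inv c \<circ> \<gamma>"] exI[of _ \<delta>] conjI sm vd \<gamma>(1))
        (use r \<gamma>(2) chart_inv_left[OF c] in auto)
  qed
  show "dim (tangent_space A Z p) + 3 = 2 * n" using G.dim_directions unfolding eq d .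
  show "subspace (tangent_space A Z p)"
    unfolding eq d subspace_def
    by (simp add: linear_0[OF G.linear_d] linear_add[OF G.linear_d] linear_cmul[OF G.linear_d])
qed

text \<open>Completed by the same \<open>u\<close>, the frame \<open>e\<close> spans as
  \<open>f\<close> does, so its determinant is nonzero, and changing the sign of one vector reverses
  the sign of the determinant. Vector 1 is changed because vector 0 is to remain
  \<open>X p\<close>.\<close>

lemma positive_kernel_frame_flip:
  assumes p: "p \<in> Z" and f: "orthonormal_frame (K p) (g p) 4 f" "positive_kernel_frame n \<omega> p f"
    and e: "orthonormal_frame (K p) (g p) 4 e"
  shows "positive_kernel_frame n \<omega> p e \<or> positive_kernel_frame n \<omega> p (e(1 := - e 1))"
proof -
  interpret Kp: inner_product_subspace "K p" "g p" by (rule K_inner_product[OF p])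
  obtain u where u: "0 < wedge_power (\<omega> p) (n - 2) u" "positive_frame (\<lambda>k. if k < 4 then f k else u (k - 4))"
    using f(2) unfolding positive_kernel_frame_def by blast
  let ?vf = "\<lambda>k. if k < 4 then f k else u (k - 4)" and ?ve = "\<lambda>k. if k < 4 then e k else u (k - 4)"
  have n: "2 \<le> n" using at_Z[OF p] by simp
  have "det (\<chi> i::'m. ?vf (card {j. j < i})) \<noteq> 0" using u(2) by (simp add: positive_frame_def)
  note sp = det_nonzero_frame(3)[OF this, unfolded dimension]
  have "?vf ` {..<2 * n} \<subseteq> span (?ve ` {..<2 * n})"
  proof (rule image_subsetI)
    fix k assume k: "k \<in> {..<2 * n}"
    show "?vf k \<in> span (?ve ` {..<2 * n})"
    proof (cases "k < 4")
      case True
      have "f k \<in> K p" using orthonormal_frame_mem[OF f(1) True] .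
      also have "K p = span (e ` {..<4})" using Kp.frame_span e at_Z(2)[OF p] by simp
      also have "e ` {..<4} = ?ve ` {..<4}" by (rule image_cong) auto
      also have "span (?ve ` {..<4}) \<subseteq> span (?ve ` {..<2 * n})" using n by (intro span_mono image_mono) auto
      finally show ?thesis using True by simp
    next
      case False
      have "?ve k \<in> span (?ve ` {..<2 * n})" using k by (intro span_base imageI)
      then show ?thesis using False by simp
    qed
  qed
  from span_minimal[OF this subspace_span] have "span (?ve ` {..<2 * n}) = UNIV"
    unfolding sp by (rule top.extremum_uniqueI)
  then have nz: "det (\<chi> i::'m. ?ve (card {j. j < i})) \<noteq> 0" by (intro det_rows_eq_0_iff) (simp only: dimension)
  \<comment> \<open>The index of the matrix row that holds the frame vector with number 1.\<close>
  obtain i1 :: 'm where i1: "card {j. j < i1} = 1"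
  proof -
    have "1 \<in> (\<lambda>i::'m. card {j. j < i}) ` UNIV"
      unfolding bij_betw_imp_surj_on[OF bij_betw_card_below[where 'm = 'm]] dimension using n by auto
    then obtain i :: 'm where "1 = card {j. j < i}" by (rule imageE)
    from this[symmetric] show thesis by (rule that)
  qed
  have i1': "card {j. j < i} = 1 \<longleftrightarrow> i = i1" for i :: 'm
    using i1 inj_onD[OF bij_betw_imp_inj_on[OF bij_betw_card_below[where 'm = 'm]], of i i1] by auto
  let ?e' = "e(1 := - e 1)"
  have "(\<chi> i::'m. (if card {j. j < i} < 4 then ?e' (card {j. j < i}) else u (card {j. j < i} - 4))) =
      (\<chi> i. (if i = i1 then -1 else 1) *s ?ve (card {j. j < i}))"
    unfolding vec_eq_iff by (auto simp: i1'[symmetric])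
  from arg_cong[OF this, of det]
  have "det (\<chi> i::'m. (if card {j. j < i} < 4 then ?e' (card {j. j < i}) else u (card {j. j < i} - 4))) =
      det (\<chi> i. (if i = i1 then -1 else 1) *s ?ve (card {j. j < i}))" .
  also have "\<dots> = prod (\<lambda>i. if i = i1 then -1 else 1) UNIV * det (\<chi> i::'m. ?ve (card {j. j < i}))"
    by (rule det_rows_mul)
  also have "prod (\<lambda>i. if i = i1 then -1 else 1 :: real) UNIV = -1"
    by (subst prod.delta) auto
  finally have fl: "det (\<chi> i::'m. (if card {j. j < i} < 4 then ?e' (card {j. j < i}) else u (card {j. j < i} - 4))) =
      - det (\<chi> i::'m. ?ve (card {j. j < i}))" by simp
  consider "0 < det (\<chi> i::'m. ?ve (card {j. j < i}))" | "0 < - det (\<chi> i::'m. ?ve (card {j. j < i}))"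
    using nz by linarith
  then show ?thesis
  proof cases
    case 1
    then show ?thesis unfolding positive_kernel_frame_def positive_frame_def using u(1) by blast
  next
    case 2
    then show ?thesis unfolding positive_kernel_frame_def positive_frame_def fl[symmetric] using u(1) by blast
  qed
qed

text \<open>The kernel of the gradient on \<open>K p\<close> has dimension 1 and equals the
  intersection of \<open>K p\<close> with the tangent space of Z, whose members lie in
  \<open>\<epsilon>\<close> because \<open>\<omega>\<close> pairs them to 0 with everything. As
  \<open>\<epsilon>\<close> is spanned by \<open>X p\<close>, the inclusion is an equality. An
  orthonormal frame starting with \<open>X p\<close> then becomes positive after at most one change
  of sign.\<close>

lemma adapted_frame:
  assumes p: "p \<in> Z"
  obtains f where "orthonormal_frame (K p) (g p) 4 f" "positive_kernel_frame n \<omega> p f" "f 0 = X p"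
    "{v \<in> K p. D_K A \<omega> p v = 0} = span {f 0}" "epsilon_at A Z \<omega> p = span {f 0}" "tangent_space A Z p \<inter> K p = span {f 0}"
proof -
  have t: "p \<in> topspace M" using p Z_subset by blast
  interpret Kp: inner_product_subspace "K p" "g p" by (rule K_inner_product[OF p])
  have sd: "D_K A \<omega> p ` K p = self_dual_forms (K p) (g p) (positive_kernel_frame n \<omega> p)" using self_dual p by blast
  obtain f where f: "orthonormal_frame (K p) (g p) 4 f" "positive_kernel_frame n \<omega> p f"
    using Kp.positive_frame_exists[OF linear_D_K[OF t] sd at_Z(3)[OF p] at_Z(2)[OF p]] by blast
  let ?L = "{v \<in> K p. D_K A \<omega> p v = 0}"
  have dL: "dim ?L = 1"
    using Kp.self_dual_gradient(2)[where P = "positive_kernel_frame n \<omega> p" and f = f,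
        OF linear_D_K[OF t] sd at_Z(3)[OF p] at_Z(2)[OF p] f] .
  have sL: "subspace ?L"
    using linear_D_K[OF t] Kp.subspace by (auto simp: subspace_def linear_0 linear_add linear_cmul)
  have D: "D_K A \<omega> p v (f i) (f j) = local_deriv A \<omega> (chart_at A p) (snd (chart_at A p) p) v (f i) (f j)"
    if "i < 4" "j < 4" for v i j
    using orthonormal_frame_mem[OF f(1)] that by (simp add: D_K_def restrict_form_def)
  have TK: "tangent_space A Z p \<inter> K p = ?L"
  proof (intro equalityI subsetI)
    fix v assume v: "v \<in> tangent_space A Z p \<inter> K p"
    then have "D_K A \<omega> p v \<in> self_dual_forms (K p) (g p) (positive_kernel_frame n \<omega> p)" using sd by blast
    then have "D_K A \<omega> p v = 0"
      by (rule Kp.self_dual_eq_0[where P = "positive_kernel_frame n \<omega> p" and f = f, OF _ f at_Z(2)[OF p]]) (use v in \<open>auto simp: tangent_space_Z(1)[OF p f] D\<close>)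
    then show "v \<in> ?L" using v by blast
  next
    fix v assume "v \<in> ?L"
    then show "v \<in> tangent_space A Z p \<inter> K p"
      using D[of 0 1 v] D[of 0 2 v] D[of 0 3 v] by (auto simp: tangent_space_Z(1)[OF p f])
  qed
  have X: "span {X p} = epsilon_at A Z \<omega> p" "g p (X p) (X p) = 1"
    using unit_field p unfolding unit_field_spanning_def by blast+
  have "?L \<subseteq> epsilon_at A Z \<omega> p"
    unfolding TK[symmetric] by (auto simp: epsilon_at_def kernel_at_def)
  moreover have "dim (epsilon_at A Z \<omega> p) \<le> 1"
    unfolding X(1)[symmetric] using dim_le_card'[of "{X p}"] by simp
  ultimately have L: "?L = epsilon_at A Z \<omega> p"
    using subspace_dim_equal[OF sL, of "epsilon_at A Z \<omega> p"] dL X(1) subspace_span[of "{X p}"] by simp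
  have XK: "X p \<in> K p" using L X(1) span_base[of "X p" "{X p}"] by auto
  have "orthonormal_frame (K p) (g p) 1 (\<lambda>_. X p)" using XK X(2) by (simp add: orthonormal_frame_def)
  then obtain e where e: "orthonormal_frame (K p) (g p) 4 e" "e 0 = X p"
    using Kp.frame_extend[of 1 "\<lambda>_. X p"] at_Z(2)[OF p] by auto
  have e': "orthonormal_frame (K p) (g p) 4 (e(1 := - e 1))"
  proof -
    have mK: "- x \<in> K p" if "x \<in> K p" for x using Kp.mem_scale[OF that, of "-1"] by simp
    have m: "g p (- x) y = - g p x y" "g p y (- x) = - g p y x" if "x \<in> K p" "y \<in> K p" for x y
      using Kp.scale_left[of x y "-1"] Kp.scale_right[of y x "-1"] that by auto
    have eK: "e i \<in> K p" if "i < 4" for i using orthonormal_frame_mem[OF e(1) that] .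
    show ?thesis
      unfolding orthonormal_frame_def
      using m mK eK orthonormal_frame_inner[OF e(1)] by (auto simp: fun_upd_def)
  qed
  obtain h where h: "orthonormal_frame (K p) (g p) 4 h" "positive_kernel_frame n \<omega> p h" "h 0 = X p"
    using positive_kernel_frame_flip[OF p f e(1)] e e' by (metis fun_upd_other zero_neq_one)
  show thesis by (rule that[OF h]) (use L TK X(1) h(3) in auto)
qed

end

section \<open>Smooth sections along the singular locus\<close>

context oriented_atlas
begin

lemma function_const: "smooth_function_along A S (\<lambda>q. a)"
  unfolding smooth_function_along_iff by (simp add: smooth_extension_const)

lemma function_add: "smooth_function_along A S h \<Longrightarrow> smooth_function_along A S k \<Longrightarrow> smooth_function_along A S (\<lambda>q. h q + k q)"
  by (simp add: smooth_function_along_iff smooth_extension_add)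

lemma function_mult: "smooth_function_along A S h \<Longrightarrow> smooth_function_along A S k \<Longrightarrow> smooth_function_along A S (\<lambda>q. h q * k q)"
  by (simp add: smooth_function_along_iff smooth_extension_mult)

lemma function_sum:
  "(\<And>i. i \<in> I \<Longrightarrow> smooth_function_along A S (h i)) \<Longrightarrow> smooth_function_along A S (\<lambda>q. \<Sum>i\<in>I. h i q)"
  by (induction I rule: infinite_finite_induct) (auto intro: function_const function_add)

lemma function_powr:
  assumes "smooth_function_along A S h" "\<And>q. q \<in> S \<Longrightarrow> 0 < h q"
  shows "smooth_function_along A S (\<lambda>q. h q powr a)"
  unfolding smooth_function_along_iff
proof (intro ballI)
  fix c p assume c: "c \<in> A" and p: "p \<in> S \<inter> fst c"
  have "smooth_on (\<lambda>t::real. t powr a) {0<..}" by (simp add: smooth_on_def C_diff_powr)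
  then show "smooth_extension c S p (\<lambda>q. h q powr a)"
    using smooth_extension_compose[of c S p h "\<lambda>t. t powr a" "{0<..}"] assms c p
    by (auto simp: smooth_function_along_iff)
qed

lemma function_cong: "smooth_function_along A S h \<Longrightarrow> (\<And>q. q \<in> S \<Longrightarrow> h q = k q) \<Longrightarrow> smooth_function_along A S k"
  unfolding smooth_function_along_iff by (intro ballI, rule smooth_extension_cong[of _ _ _ h]) auto

lemma field_cong: "smooth_field_along A S s \<Longrightarrow> (\<And>q. q \<in> S \<Longrightarrow> s q = t q) \<Longrightarrow> smooth_field_along A S t"
  unfolding smooth_field_along_iff
  by (intro ballI, rule smooth_extension_cong[of _ _ _ "\<lambda>q. tangent_coords A _ q (s q)"]) auto

lemma function_mono: "smooth_function_along A S h \<Longrightarrow> S' \<subseteq> S \<Longrightarrow> smooth_function_along A S' h"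
  unfolding smooth_function_along_iff by (intro ballI, rule smooth_extension_mono[of _ S]) auto

lemma field_mono: "smooth_field_along A S s \<Longrightarrow> S' \<subseteq> S \<Longrightarrow> smooth_field_along A S' s"
  unfolding smooth_field_along_iff by (intro ballI, rule smooth_extension_mono[of _ S]) auto

lemma function_local:
  assumes "\<And>p. p \<in> S \<Longrightarrow> \<exists>U. openin M U \<and> p \<in> U \<and> smooth_function_along A (S \<inter> U) h"
  shows "smooth_function_along A S h"
  unfolding smooth_function_along_iff
proof (intro ballI)
  fix c p assume c: "c \<in> A" and p: "p \<in> S \<inter> fst c"
  obtain U where U: "openin M U" "p \<in> U" "smooth_function_along A (S \<inter> U) h" using assms p by blast
  show "smooth_extension c S p h"
    by (rule smooth_extension_local[OF c _ U(1,2)]) (use U c p in \<open>auto simp: smooth_function_along_iff\<close>)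
qed

lemma field_local:
  assumes "\<And>p. p \<in> S \<Longrightarrow> \<exists>U. openin M U \<and> p \<in> U \<and> smooth_field_along A (S \<inter> U) s"
  shows "smooth_field_along A S s"
  unfolding smooth_field_along_iff
proof (intro ballI)
  fix c p assume c: "c \<in> A" and p: "p \<in> S \<inter> fst c"
  obtain U where U: "openin M U" "p \<in> U" "smooth_field_along A (S \<inter> U) s" using assms p by blast
  show "smooth_extension c S p (\<lambda>q. tangent_coords A c q (s q))"
    by (rule smooth_extension_local[OF c _ U(1,2)]) (use U c p in \<open>auto simp: smooth_field_along_iff\<close>)
qed

lemma field_add:
  assumes "smooth_field_along A S s" "smooth_field_along A S t"
  shows "smooth_field_along A S (\<lambda>q. s q + t q)"
  unfolding smooth_field_along_iff
proof (intro ballI)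
  fix c p assume c: "c \<in> A" and p: "p \<in> S \<inter> fst c"
  have "smooth_extension c S p (\<lambda>q. tangent_coords A c q (s q) + tangent_coords A c q (t q))"
    using assms c p unfolding smooth_field_along_iff by (intro smooth_extension_add) auto
  then show "smooth_extension c S p (\<lambda>q. tangent_coords A c q (s q + t q))"
    by (rule smooth_extension_cong) (simp add: linear_add[OF tangent_vector_coords(3)[OF c]])
qed

lemma field_scaleR:
  assumes "smooth_function_along A S h" "smooth_field_along A S s"
  shows "smooth_field_along A S (\<lambda>q. h q *\<^sub>R s q)"
  unfolding smooth_field_along_iff
proof (intro ballI)
  fix c p assume c: "c \<in> A" and p: "p \<in> S \<inter> fst c"
  have "smooth_extension c S p (\<lambda>q. h q *\<^sub>R tangent_coords A c q (s q))"
    using assms c p unfolding smooth_field_along_iff smooth_function_along_iff by (intro smooth_extension_scaleR) auto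
  then show "smooth_extension c S p (\<lambda>q. tangent_coords A c q (h q *\<^sub>R s q))"
    by (rule smooth_extension_cong) (simp add: linear_cmul[OF tangent_vector_coords(3)[OF c]])
qed

lemma field_sum:
  assumes "\<And>i. i \<in> I \<Longrightarrow> smooth_field_along A S (s i)" "I \<noteq> {}" "finite I"
  shows "smooth_field_along A S (\<lambda>q. \<Sum>i\<in>I. s i q)"
  using assms(3,2,1) by (induction I rule: finite_ne_induct) (auto intro: field_add)

text \<open>Smooth functions along \<open>S\<close> are continuous for the subspace topology; this
  supplies the shrinking of neighbourhoods in \<open>gram_schmidt\<close>.\<close>

lemma positive_near:
  assumes U: "openin M U" "p \<in> U" "p \<in> S" "S \<subseteq> topspace M" and h: "smooth_function_along A (S \<inter> U) h" "0 < h p"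
  shows "\<exists>U'. openin M U' \<and> p \<in> U' \<and> U' \<subseteq> U \<and> (\<forall>q\<in>S \<inter> U'. 0 < h q)"
proof -
  have "continuous_map (subtopology M (S \<inter> U)) euclideanreal h"
    by (rule smooth_function_along_continuous[OF h(1)]) (use U in auto)
  then have "openin (subtopology M (S \<inter> U)) {q \<in> topspace (subtopology M (S \<inter> U)). h q \<in> {0<..}}"
    by (rule openin_continuous_map_preimage) simp
  then obtain W where W: "openin M W" "{q \<in> topspace (subtopology M (S \<inter> U)). h q \<in> {0<..}} = W \<inter> (S \<inter> U)"
    unfolding openin_subtopology by blast
  have ts: "topspace (subtopology M (S \<inter> U)) = S \<inter> U" using U by auto
  have "p \<in> W" using W(2) U h(2) unfolding ts by blast
  moreover have "0 < h q" if "q \<in> S \<inter> (W \<inter> U)" for q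
  proof -
    have "q \<in> W \<inter> (S \<inter> U)" using that by blast
    then show ?thesis unfolding W(2)[symmetric] by simp
  qed
  ultimately show ?thesis using W(1) U by (intro exI[of _ "W \<inter> U"]) auto
qed

end

context near_symplectic_setting
begin

section \<open>Chart independence and smoothness of the gradient\<close>

lemma local_form_change:
  assumes A: "c \<in> A" "d \<in> A" and p: "p \<in> fst c" "p \<in> fst d"
  shows "\<Omega> c (snd c p) u w = \<Omega> d (snd d p) (coord_change c d p u) (coord_change c d p w)"
proof -
  have t: "p \<in> topspace M" using A p domain_subset by blast
  note ca = chart_at[OF t]
  have "tangent_vector A d p (coord_change c d p v) = tangent_vector A c p v" for v
    unfolding tangent_vector_def by (rule coord_change_comp[OF A ca(1) p ca(2)])
  then show ?thesis unfolding local_form_at[OF A(1) p(1)] local_form_at[OF A(2) p(2)] by simp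
qed

text \<open>The second derivatives of the coordinate change only enter through terms with a kernel vector
  in the other slot, so the gradient restricted to the kernel can be computed in any chart.\<close>

lemma local_deriv_change:
  assumes A: "c \<in> A" "d \<in> A" and p: "p \<in> fst c" "p \<in> fst d"
    and ker: "tangent_vector A c p u \<in> K p" "tangent_vector A c p w \<in> K p"
  shows "local_deriv A \<omega> c (snd c p) v u w =
    local_deriv A \<omega> d (snd d p) (coord_change c d p v) (coord_change c d p u) (coord_change c d p w)"
proof -
  let ?\<tau> = "snd d \<circ> chart_inv c" and ?W = "snd c ` (fst c \<inter> fst d)" and ?x = "snd c p"
  let ?T = "\<lambda>x. frechet_derivative ?\<tau> (at x)"
  let ?B = "\<lambda>x. \<Omega> d (?\<tau> x)"
  have W: "open ?W" "?x \<in> ?W" using transition_open[OF A] p by auto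
  have \<tau>q: "?\<tau> (snd c q) = snd d q" if "q \<in> fst c" for q using chart_inv_left[OF A(1) that] by simp
  have \<tau>p: "?\<tau> ?x = snd d p" by (rule \<tau>q[OF p(1)])
  have d\<tau>: "(?\<tau> has_derivative coord_change c d p) (at ?x)" by (rule transition_derivative[OF A p])
  have eq: "\<Omega> c x u w = ?B x (?T x u) (?T x w)" if x: "x \<in> ?W" for x u w
  proof -
    obtain q where q: "q \<in> fst c" "q \<in> fst d" "x = snd c q" using x by blast
    show ?thesis using local_form_change[OF A q(1,2), of u w] \<tau>q[OF q(1)] unfolding q(3) coord_change_def by simp
  qed
  have bil: "bilinear (?B x)" if x: "x \<in> ?W" for x
  proof -
    obtain q where q: "q \<in> fst c" "q \<in> fst d" "x = snd c q" using x by blast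
    show ?thesis unfolding q(3) \<tau>q[OF q(1)] by (rule local_form_bilinear(1)[OF A(2) chart_image_mem[OF q(2)]])
  qed
  have "(\<lambda>y. \<Omega> d y a b) differentiable at (snd d p)" for a b
    using has_derivative_local_form[OF A(2) chart_image_mem[OF p(2)]] by (auto simp: differentiable_def)
  have dB: "((\<lambda>x. ?B x a b) has_derivative (\<lambda>v. local_deriv A \<omega> d (snd d p) (coord_change c d p v) a b)) (at ?x)" for a b
  proof -
    have "((\<lambda>y. \<Omega> d y a b) has_derivative (\<lambda>v. local_deriv A \<omega> d (snd d p) v a b)) (at (?\<tau> ?x))"
      unfolding \<tau>p by (rule has_derivative_local_form[OF A(2) chart_image_mem[OF p(2)]])
    from has_derivative_compose[OF d\<tau> this] show ?thesis .
  qed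
  have dT: "((\<lambda>x. ?T x a) has_derivative frechet_derivative (\<lambda>x. ?T x a) (at ?x)) (at ?x)" for a
    by (rule has_derivative_frechet[OF _ W]) (use transition_C_diff[OF A, of "Suc (Suc 0)"] in simp)
  have "((\<lambda>x. ?B x (?T x u) (?T x w)) has_derivative (\<lambda>v. frechet_derivative (\<lambda>y. ?B y (?T ?x u) (?T ?x w)) (at ?x) v
      + ?B ?x (frechet_derivative (\<lambda>x. ?T x u) (at ?x) v) (?T ?x w) + ?B ?x (?T ?x u) (frechet_derivative (\<lambda>x. ?T x w) (at ?x) v))) (at ?x)"
    by (rule has_derivative_bilinear_family[OF W bil _ dT dT]) (use dB in \<open>auto simp: differentiable_def\<close>)
  moreover have "?B ?x a (?T ?x w) = 0" "?B ?x (?T ?x u) a = 0" for a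
  proof -
    have tv: "tangent_vector A d p (coord_change c d p z) = tangent_vector A c p z" for z
    proof -
      have t: "p \<in> topspace M" using A p domain_subset by blast
      show ?thesis unfolding tangent_vector_def by (rule coord_change_comp[OF A chart_at(1)[OF t] p chart_at(2)[OF t]])
    qed
    have t: "p \<in> topspace M" using A p domain_subset by blast
    show "?B ?x (?T ?x u) a = 0" "?B ?x a (?T ?x w) = 0"
      using ker form_skew[OF t, of "tangent_vector A d p a" "tangent_vector A c p w"]
      unfolding \<tau>p coord_change_def[symmetric] local_form_at[OF A(2) p(2)] tv by (simp_all add: kernel_at_def)
  qed
  moreover have "frechet_derivative (\<lambda>y. ?B y (?T ?x u) (?T ?x w)) (at ?x) =
      (\<lambda>v. local_deriv A \<omega> d (snd d p) (coord_change c d p v) (coord_change c d p u) (coord_change c d p w))"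
    using frechet_derivative_at[OF dB] unfolding coord_change_def[symmetric] by simp
  ultimately have "((\<lambda>x. ?B x (?T x u) (?T x w)) has_derivative
      (\<lambda>v. local_deriv A \<omega> d (snd d p) (coord_change c d p v) (coord_change c d p u) (coord_change c d p w))) (at ?x)"
    by simp
  then have "((\<lambda>x. \<Omega> c x u w) has_derivative
      (\<lambda>v. local_deriv A \<omega> d (snd d p) (coord_change c d p v) (coord_change c d p u) (coord_change c d p w))) (at ?x)"
    by (rule has_derivative_transform_within_open[OF _ W], intro eq[symmetric])
  from fun_cong[OF has_derivative_unique[OF has_derivative_local_form[OF A(1) chart_image_mem[OF p(1)]] this]]
  show ?thesis .
qed

text \<open>\<open>D_K\<close> is defined at each point through a chart chosen for that point; here
  one chart \<open>c\<close> serves all its points, as smoothness in the point demands.\<close>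

lemma D_K_chart:
  assumes c: "c \<in> A" "p \<in> fst c" and uw: "u \<in> K p" "w \<in> K p"
  shows "D_K A \<omega> p v u w =
    local_deriv A \<omega> c (snd c p) (tangent_coords A c p v) (tangent_coords A c p u) (tangent_coords A c p w)"
proof -
  have t: "p \<in> topspace M" using c domain_subset by blast
  have "D_K A \<omega> p v u w = local_deriv A \<omega> (chart_at A p) (snd (chart_at A p) p) v u w"
    using uw by (simp add: D_K_def restrict_form_def)
  also have "\<dots> = local_deriv A \<omega> c (snd c p) (coord_change (chart_at A p) c p v)
      (coord_change (chart_at A p) c p u) (coord_change (chart_at A p) c p w)"
    by (rule local_deriv_change[OF chart_at(1)[OF t] c(1) chart_at(2)[OF t] c(2)])
      (use uw in \<open>simp_all add: tangent_chart_at[OF t]\<close>)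
  finally show ?thesis by (simp add: tangent_coords_def)
qed

text \<open>The three fields are replaced by extensions off \<open>S\<close> in a chart, and the
  gradient by the chart derivative of \<open>\<omega>\<close>, which makes sense off Z as well; on
  \<open>S\<close> the result is identified by \<open>D_K_chart\<close>.\<close>

lemma D_K_smooth:
  assumes S: "S \<subseteq> Z" and s: "smooth_field_along A S s" and x: "smooth_section_along A S K x" and b: "smooth_section_along A S K b"
  shows "smooth_function_along A S (\<lambda>q. D_K A \<omega> q (s q) (x q) (b q))"
  unfolding smooth_function_along_iff
proof (intro ballI)
  fix c p assume c: "c \<in> A" and p: "p \<in> S \<inter> fst c"
  obtain V1 f1 where 1: "snd c p \<in> V1" "smooth_on f1 V1" "\<forall>q\<in>S \<inter> fst c. snd c q \<in> V1 \<longrightarrow> f1 (snd c q) = tangent_coords A c q (s q)"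
    using s c p unfolding smooth_field_along_def by blast
  obtain V2 f2 where 2: "snd c p \<in> V2" "smooth_on f2 V2" "\<forall>q\<in>S \<inter> fst c. snd c q \<in> V2 \<longrightarrow> f2 (snd c q) = tangent_coords A c q (x q)"
    using x c p unfolding smooth_section_along_def smooth_field_along_def by blast
  obtain V3 f3 where 3: "snd c p \<in> V3" "smooth_on f3 V3" "\<forall>q\<in>S \<inter> fst c. snd c q \<in> V3 \<longrightarrow> f3 (snd c q) = tangent_coords A c q (b q)"
    using b c p unfolding smooth_section_along_def smooth_field_along_def by blast
  let ?V = "V1 \<inter> V2 \<inter> V3 \<inter> chart_image c"
  have o: "open ?V" using 1(2) 2(2) 3(2) image_open[OF c] by (auto simp: smooth_on_def)
  have f: "C_diff k f1 ?V" "C_diff k f2 ?V" "C_diff k f3 ?V" for k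
    using C_diff_subset[of k f1 V1 ?V] C_diff_subset[of k f2 V2 ?V] C_diff_subset[of k f3 V3 ?V] 1(2) 2(2) 3(2)
    by (auto simp: smooth_on_def)
  let ?G = "\<lambda>y. \<Sum>i\<in>Basis. (f1 y \<bullet> i) * local_deriv A \<omega> c y i (f2 y) (f3 y)"
  \<comment> \<open>The derivative of a family of bilinear forms is again bilinear in the two form
    arguments, by uniqueness of derivatives.\<close>
  have bil: "bilinear (\<lambda>u w. local_deriv A \<omega> c y i u w)" if y: "y \<in> chart_image c" for y i
  proof -
    note D = has_derivative_local_form[OF c y]
    have e: "local_deriv A \<omega> c y i u w = r"
      if r: "((\<lambda>z. \<Omega> c z u w) has_derivative r') (at y)" "r' i = r" for u w r r'
      using fun_cong[OF has_derivative_unique[OF D r(1)], of i] r(2) by simp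
    note L = local_form_bilinear(1)[OF c]
    show ?thesis
      unfolding bilinear_def linear_iff
    proof (intro conjI allI)
      fix u u' w r
      show "local_deriv A \<omega> c y i u (w + u') = local_deriv A \<omega> c y i u w + local_deriv A \<omega> c y i u u'"
        by (rule e[OF has_derivative_transform_within_open[OF has_derivative_add[OF D[of u w] D[of u u']] image_open[OF c] y]])
          (simp_all add: bilinear_radd[OF L])
      show "local_deriv A \<omega> c y i u (r *\<^sub>R w) = r *\<^sub>R local_deriv A \<omega> c y i u w"
        by (rule e[OF has_derivative_transform_within_open[OF has_derivative_mult_right[OF D[of u w], of r] image_open[OF c] y]])
          (simp_all add: bilinear_rmul[OF L])
      show "local_deriv A \<omega> c y i (u + u') w = local_deriv A \<omega> c y i u w + local_deriv A \<omega> c y i u' w"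
        by (rule e[OF has_derivative_transform_within_open[OF has_derivative_add[OF D[of u w] D[of u' w]] image_open[OF c] y]])
          (simp_all add: bilinear_ladd[OF L])
      show "local_deriv A \<omega> c y i (r *\<^sub>R u) w = r *\<^sub>R local_deriv A \<omega> c y i u w"
        by (rule e[OF has_derivative_transform_within_open[OF has_derivative_mult_right[OF D[of u w], of r] image_open[OF c] y]])
          (simp_all add: bilinear_lmul[OF L])
    qed
  qed
  have smd: "C_diff k (\<lambda>y. local_deriv A \<omega> c y i u w) ?V" for k i u w
    using C_diff_subset[of k "\<lambda>y. local_deriv A \<omega> c y i u w" "chart_image c" ?V] local_form_smooth[OF c, of "Suc k" u w]
    by (simp add: local_deriv_def)
  have "C_diff k (\<lambda>y. local_deriv A \<omega> c y i (f2 y) (f3 y)) ?V" for k i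
    by (rule C_diff_bilinear_family[where B = "\<lambda>y. local_deriv A \<omega> c y i" and a = f2 and b = f3, OF o bil smd f(2) f(3)]) blast
  then have "smooth_on ?G ?V"
    unfolding smooth_on_def by (intro conjI allI o C_diff_sum C_diff_mult C_diff_inner C_diff_const f)
  moreover have "?G (snd c q) = D_K A \<omega> q (s q) (x q) (b q)" if q: "q \<in> S \<inter> fst c" "snd c q \<in> ?V" for q
  proof -
    have xb: "x q \<in> K q" "b q \<in> K q" using x b q unfolding smooth_section_along_def by blast+
    have ff: "f1 (snd c q) = tangent_coords A c q (s q)" "f2 (snd c q) = tangent_coords A c q (x q)" "f3 (snd c q) = tangent_coords A c q (b q)"
      using 1(3) 2(3) 3(3) q by blast+
    have lin: "linear (\<lambda>v. local_deriv A \<omega> c (snd c q) v u w)" for u w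
      by (rule linear_local_deriv[OF c chart_image_mem]) (use q in blast)
    have "local_deriv A \<omega> c (snd c q) v u w = (\<Sum>i\<in>Basis. (v \<bullet> i) * local_deriv A \<omega> c (snd c q) i u w)" for v u w
    proof -
      have "local_deriv A \<omega> c (snd c q) v u w = local_deriv A \<omega> c (snd c q) (\<Sum>i\<in>Basis. (v \<bullet> i) *\<^sub>R i) u w"
        by (simp only: euclidean_representation)
      then show ?thesis by (simp only: linear_sum[OF lin] linear_cmul[OF lin] real_scaleR_def)
    qed
    from this[of "f1 (snd c q)"] show ?thesis
      using D_K_chart[OF c _ xb, of "s q"] q unfolding ff by simp
  qed
  moreover have "snd c p \<in> ?V" using 1 2 3 p chart_image_mem by blast
  ultimately show "smooth_extension c S p (\<lambda>q. D_K A \<omega> q (s q) (x q) (b q))"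
    unfolding smooth_extension_def by (intro exI[of _ ?V] exI[of _ ?G]) blast
qed

lemma metric_smooth:
  assumes U: "openin M U" and s: "smooth_section_along A (Z \<inter> U) K s" and t: "smooth_section_along A (Z \<inter> U) K t"
  shows "smooth_function_along A (Z \<inter> U) (\<lambda>q. g q (s q) (t q))"
  using metric assms unfolding fibre_metric_def by blast

text \<open>Gram-Schmidt on sections. Orthonormality at \<open>p\<close> has two effects: no
  corrected section vanishes near \<open>p\<close>, so normalisation is smooth after shrinking
  \<open>U\<close>, and the process leaves the values at \<open>p\<close> unchanged. Local frames of
  a subbundle \<open>E\<close> thus arise from sections that are orthonormal at one point.\<close>

lemma gram_schmidt:
  assumes p: "p \<in> Z" and U: "openin M U" "p \<in> U" and E: "\<And>q. q \<in> Z \<Longrightarrow> subspace (E q) \<and> E q \<subseteq> K q"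
    and k: "\<And>i. i < m \<Longrightarrow> smooth_section_along A (Z \<inter> U) E (k i)" and o: "orthonormal_frame (K p) (g p) m (\<lambda>i. k i p)"
  shows "\<exists>U' b. openin M U' \<and> p \<in> U' \<and> U' \<subseteq> U \<and> (\<forall>i<m. smooth_section_along A (Z \<inter> U') E (b i) \<and> b i p = k i p) \<and>
    (\<forall>q\<in>Z \<inter> U'. orthonormal_frame (E q) (g q) m (\<lambda>i. b i q))"
  using k o
proof (induction m)
  case 0
  then show ?case using U by (intro exI[of _ U]) (simp add: orthonormal_frame_def)
next
  case (Suc m)
  have "orthonormal_frame (K p) (g p) m (\<lambda>i. k i p)" using Suc.prems(2) by (simp add: orthonormal_frame_def)
  then obtain U1 b where U1: "openin M U1" "p \<in> U1" "U1 \<subseteq> U" and b: "\<And>i. i < m \<Longrightarrow> smooth_section_along A (Z \<inter> U1) E (b i)"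
    and bp: "\<And>i. i < m \<Longrightarrow> b i p = k i p" and bo: "\<And>q. q \<in> Z \<inter> U1 \<Longrightarrow> orthonormal_frame (E q) (g q) m (\<lambda>i. b i q)"
    using Suc.IH Suc.prems(1) by (metis less_Suc_eq)
  let ?S = "Z \<inter> U1"
  have toK: "smooth_section_along A ?S K t" if "smooth_section_along A ?S E t" for t
    using that E unfolding smooth_section_along_def by blast
  have km: "smooth_section_along A ?S E (k m)"
    using Suc.prems(1)[of m] field_mono[of "Z \<inter> U" "k m" ?S] U1(3) unfolding smooth_section_along_def by auto
  define r where "r q = k m q + (\<Sum>i<m. (- g q (k m q) (b i q)) *\<^sub>R b i q)" for q
  have gf: "smooth_function_along A ?S (\<lambda>q. - g q (k m q) (b i q))" if "i < m" for i
    using function_mult[OF function_const[of _ "-1"] metric_smooth[OF U1(1) toK[OF km] toK[OF b[OF that]]]] by simp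
  have rE: "r q \<in> E q" if q: "q \<in> ?S" for q
  proof -
    have "subspace (E q)" "k m q \<in> E q" "\<And>i. i < m \<Longrightarrow> b i q \<in> E q"
      using E q km b unfolding smooth_section_along_def by blast+
    then show ?thesis unfolding r_def by (intro subspace_add subspace_sum subspace_scale) auto
  qed
  have r: "smooth_section_along A ?S E r"
  proof -
    have "smooth_field_along A ?S r"
    proof (cases "m = 0")
      case True
      then show ?thesis using km unfolding r_def smooth_section_along_def by simp
    next
      case False
      then show ?thesis
        unfolding r_def using km b gf unfolding smooth_section_along_def
        by (intro field_add field_sum field_scaleR) auto
    qed
    then show ?thesis using rE unfolding smooth_section_along_def by blast
  qed
  interpret P: inner_product_subspace "K p" "g p" by (rule K_inner_product[OF p])
  have rp: "r p = k m p"
  proof -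
    have "g p (k m p) (b i p) = 0" if "i < m" for i
      using Suc.prems(2) bp[OF that] that unfolding orthonormal_frame_def by auto
    then show ?thesis unfolding r_def by simp
  qed
  have h1: "g p (r p) (r p) = 1" unfolding rp using Suc.prems(2) unfolding orthonormal_frame_def by auto
  have h: "smooth_function_along A ?S (\<lambda>q. g q (r q) (r q))" by (rule metric_smooth[OF U1(1) toK[OF r] toK[OF r]])
  obtain U2 where U2: "openin M U2" "p \<in> U2" "U2 \<subseteq> U1" "\<And>q. q \<in> Z \<inter> U2 \<Longrightarrow> 0 < g q (r q) (r q)"
    using positive_near[OF U1(1,2) p Z_subset h] h1 by auto
  have S2: "Z \<inter> U2 \<subseteq> ?S" using U2 by blast
  define bm where "bm q = (g q (r q) (r q) powr (-1/2)) *\<^sub>R r q" for q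
  have bmE: "smooth_section_along A (Z \<inter> U2) E bm"
    unfolding smooth_section_along_def bm_def
  proof (intro conjI ballI)
    show "smooth_field_along A (Z \<inter> U2) (\<lambda>q. (g q (r q) (r q) powr (-1/2)) *\<^sub>R r q)"
      by (intro field_scaleR function_powr function_mono[OF h S2] U2(4) field_mono[OF _ S2])
        (use r in \<open>auto simp: smooth_section_along_def\<close>)
    show "(g q (r q) (r q) powr (-1/2)) *\<^sub>R r q \<in> E q" if "q \<in> Z \<inter> U2" for q
      using E rE S2 that by (intro subspace_scale) blast+
  qed
  have fr: "orthonormal_frame (E q) (g q) (Suc m) (\<lambda>i. (b(m := bm)) i q)" if q: "q \<in> Z \<inter> U2" for q
  proof -
    have qZ: "q \<in> Z" "q \<in> ?S" using q S2 by auto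
    interpret Q: inner_product_subspace "K q" "g q" by (rule K_inner_product[OF qZ(1)])
    interpret E: inner_product_subspace "E q" "g q" by (rule Q.subspaceI) (use E qZ in auto)
    note o = bo[OF qZ(2)]
    have kE: "k m q \<in> E q" "r q \<in> E q" using km rE qZ unfolding smooth_section_along_def by blast+
    have bE: "b i q \<in> E q" if "i < m" for i using orthonormal_frame_mem[OF o that] .
    have "g q (r q) (b j q) = 0" if j: "j < m" for j
    proof -
      have "g q (r q) (b j q) = g q (k m q) (b j q) + g q (\<Sum>i<m. (- g q (k m q) (b i q)) *\<^sub>R b i q) (b j q)"
        unfolding r_def by (rule E.add_left[OF kE(1) E.mem_sum[OF E.mem_scale[OF bE]] bE[OF j]]) simp
      also have "g q (\<Sum>i<m. (- g q (k m q) (b i q)) *\<^sub>R b i q) (b j q) = - g q (k m q) (b j q)"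
        by (subst E.frame_coeff[OF o subset_refl j]) (use j in simp)
      finally show ?thesis by simp
    qed
    then have "g q (bm q) (b j q) = 0" if "j < m" for j
      unfolding bm_def using E.scale_left[OF kE(2) bE[OF that]] that by simp
    moreover have "r q \<noteq> 0" using U2(4)[OF q] E.zero_left[OF E.mem_0] by auto
    then have "g q (bm q) (bm q) = 1" unfolding bm_def by (rule E.normalize[OF kE(2)])
    moreover have "bm q \<in> E q" unfolding bm_def using kE by (intro E.mem_scale)
    ultimately have "orthonormal_frame (E q) (g q) (Suc m) ((\<lambda>i. b i q)(m := bm q))"
      by (intro E.frame_snoc[OF o])
    moreover have "(\<lambda>i. b i q)(m := bm q) = (\<lambda>i. (b(m := bm)) i q)" by auto
    ultimately show ?thesis by simp
  qed
  have sec: "smooth_section_along A (Z \<inter> U2) E ((b(m := bm)) i) \<and> (b(m := bm)) i p = k i p" if i: "i < Suc m" for i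
  proof (cases "i = m")
    case True
    have "bm p = k m p" unfolding bm_def h1 using rp by simp
    then show ?thesis using bmE True by simp
  next
    case False
    then have "i < m" using i by simp
    then show ?thesis using b[of i] bp[of i] field_mono[of ?S "b i" "Z \<inter> U2"] S2 False
      unfolding smooth_section_along_def by auto
  qed
  show ?case
    by (rule exI[of _ U2], rule exI[of _ "b(m := bm)"]) (use U2(1-3) U1(3) sec fr in blast)
qed

end

section \<open>The eigenbundles\<close>

lemma card_less_3: "card {i::nat. i < 3 \<and> P i} = (if P 0 then 1 else 0) + (if P 1 then 1 else 0) + (if P 2 then 1 else 0)"
proof -
  have "card ({..<3} \<inter> {i. P i}) = (\<Sum>i<3. if P i then 1 else 0::nat)" by (subst sum.If_cases) simp_all
  moreover have "{..<3} \<inter> {i. P i} = {i. i < 3 \<and> P i}" by auto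
  ultimately show ?thesis by (simp add: eval_nat_numeral)
qed

lemma less_3_cases: "i < 3 \<Longrightarrow> i = 0 \<or> i = 1 \<or> i = 2" for i :: nat by auto

text \<open>A negative product means one or three negative factors, and three are excluded by the
  vanishing sum.\<close>

lemma sign_counts:
  fixes m :: "nat \<Rightarrow> real"
  assumes "m 0 + m 1 + m 2 = 0" "m 0 * m 1 * m 2 < 0"
  shows "card {i. i < 3 \<and> m i \<in> {0<..}} = 2" "card {i. i < 3 \<and> m i \<in> {..<0}} = 1"
  using assms unfolding card_less_3 by (auto simp: mult_less_0_iff zero_less_mult_iff)

lemma one_negative:
  fixes m :: "nat \<Rightarrow> real"
  assumes "card {i. i < 3 \<and> m i \<in> {0<..}} = 2" "card {i. i < 3 \<and> m i \<in> {..<0}} = 1"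
  shows "\<exists>j<3. m j < 0 \<and> (\<forall>i<3. i \<noteq> j \<longrightarrow> 0 < m i)"
proof -
  have "(m 0 < 0 \<and> 0 < m 1 \<and> 0 < m 2) \<or> (m 1 < 0 \<and> 0 < m 0 \<and> 0 < m 2) \<or> (m 2 < 0 \<and> 0 < m 0 \<and> 0 < m 1)"
    using assms unfolding card_less_3
    by (cases "0 < m 0"; cases "0 < m 1"; cases "0 < m 2"; cases "m 0 < 0"; cases "m 1 < 0"; cases "m 2 < 0") simp_all
  then show ?thesis
  proof (elim disjE)
    assume a: "m 0 < 0 \<and> 0 < m 1 \<and> 0 < m 2"
    show ?thesis by (rule exI[of _ 0]) (use a in \<open>auto dest!: less_3_cases\<close>)
  next
    assume a: "m 1 < 0 \<and> 0 < m 0 \<and> 0 < m 2"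
    show ?thesis by (rule exI[of _ 1]) (use a in \<open>auto dest!: less_3_cases\<close>)
  next
    assume a: "m 2 < 0 \<and> 0 < m 0 \<and> 0 < m 1"
    show ?thesis by (rule exI[of _ 2]) (use a in \<open>auto dest!: less_3_cases\<close>)
  qed
qed

text \<open>Newton's identities: when the sum is 0, the second elementary symmetric function is
  minus half the sum of squares and the third is a third of the sum of cubes. So this is the
  characteristic polynomial in terms of traces of powers.\<close>

lemma cubic_factor:
  fixes a b c t :: real
  assumes "a + b + c = 0"
  shows "t * t * t - (a * a + b * b + c * c) / 2 * t - (a * a * a + b * b * b + c * c * c) / 3 = (t - a) * (t - b) * (t - c)"
proof -
  have c: "c = - a - b" using assms by simp
  show ?thesis unfolding c by (simp add: field_simps)
qed

text \<open>Pairs are encoded in \<open>real^2\<close> because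
  \<open>smooth_inverse_function\<close> is stated for \<open>real^'n\<close>.\<close>

definition pair2 :: "real \<Rightarrow> real \<Rightarrow> real^2"
  where "pair2 a b = a *\<^sub>R axis 1 1 + b *\<^sub>R axis 2 1"

lemma pair2_nth [simp]: "pair2 a b $ 1 = a" "pair2 a b $ 2 = b"
  by (simp_all add: pair2_def axis_def)

text \<open>The inverse function theorem is applied to the map
  \<open>(c, t) \<mapsto> (c, t^3 - c t)\<close>. Its Jacobian determinant is
  \<open>3 t^2 - c\<close>, nonzero at a simple root, and the second component of the local inverse
  is the root as a function of the coefficients.\<close>

lemma smooth_simple_root:
  fixes c0 t0 :: real
  assumes nz: "3 * t0 * t0 - c0 \<noteq> 0"
  obtains T G where "pair2 c0 (t0 * t0 * t0 - c0 * t0) \<in> T" "smooth_on G T" "G (pair2 c0 (t0 * t0 * t0 - c0 * t0)) = t0"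
    "\<And>c e. pair2 c e \<in> T \<Longrightarrow> G (pair2 c e) * G (pair2 c e) * G (pair2 c e) - c * G (pair2 c e) - e = 0"
proof -
  define \<Psi> where "\<Psi> x = pair2 (x $ 1) (x $ 2 * x $ 2 * x $ 2 - x $ 1 * x $ 2)" for x :: "real^2"
  let ?x0 = "pair2 c0 t0"
  have co: "C_diff k (\<lambda>x::real^2. x $ i) UNIV" for k i
    by (rule C_diff_bounded_linear[OF bounded_linear_vec_nth open_UNIV])
  have sm: "smooth_on \<Psi> UNIV"
    unfolding smooth_on_def \<Psi>_def pair2_def
    by (intro conjI allI C_diff_add C_diff_scaleR C_diff_const C_diff_diff C_diff_mult co open_UNIV)
  let ?D = "\<lambda>h::real^2. pair2 (h $ 1) (((t0 * t0) * h $ 2 + (t0 * h $ 2 + h $ 2 * t0) * t0) - (c0 * h $ 2 + h $ 1 * t0))"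
  have dc: "((\<lambda>x::real^2. x $ i) has_derivative (\<lambda>h. h $ i)) (at x)" for i x
    by (rule bounded_linear_imp_has_derivative[OF bounded_linear_vec_nth])
  have dm: "((\<lambda>x::real^2. f x * k x) has_derivative (\<lambda>h. a * k' h + f' h * b)) (at x)"
    if "(f has_derivative f') (at x)" "(k has_derivative k') (at x)" "a = f x" "b = k x" for f k f' k' :: "real^2 \<Rightarrow> real" and a b x
    using has_derivative_mult[OF that(1,2)] that(3,4) by simp
  have d\<Psi>: "(\<Psi> has_derivative ?D) (at ?x0)"
    unfolding \<Psi>_def[abs_def] pair2_def
    by (intro has_derivative_add has_derivative_scaleR_left has_derivative_diff dm dc)
      (simp_all add: axis_def)
  have fd: "frechet_derivative \<Psi> (at ?x0) = ?D" by (rule frechet_derivative_at[OF d\<Psi>, symmetric])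
  have lin: "linear (frechet_derivative \<Psi> (at ?x0))"
    unfolding fd by (rule has_derivative_linear[OF d\<Psi>])
  have inj: "inj (frechet_derivative \<Psi> (at ?x0))"
  proof (subst linear_injective_0[OF lin], intro allI impI)
    fix h assume "frechet_derivative \<Psi> (at ?x0) h = 0"
    then have "?D h $ 1 = 0" "?D h $ 2 = 0" unfolding fd by simp_all
    then have "h $ 1 = 0" "(3 * t0 * t0 - c0) * h $ 2 = 0" by (simp_all add: algebra_simps)
    then show "h = 0" using nz by (simp add: vec_eq_iff forall_2)
  qed
  obtain U' V H where H: "?x0 \<in> U'" "open V" "\<Psi> ?x0 \<in> V" "homeomorphism U' V \<Psi> H" "smooth_on H V"
    by (rule smooth_inverse_function[OF sm UNIV_I inj]) (rule that; assumption)
  have \<Psi>0: "\<Psi> ?x0 = pair2 c0 (t0 * t0 * t0 - c0 * t0)" by (simp add: \<Psi>_def)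
  show thesis
  proof (rule that[of V "\<lambda>y. H y $ 2"])
    show "pair2 c0 (t0 * t0 * t0 - c0 * t0) \<in> V" using H(3) \<Psi>0 by simp
    show "smooth_on (\<lambda>y. H y $ 2) V" using H(5) C_diff_vec_nth unfolding smooth_on_def by blast
    show "H (pair2 c0 (t0 * t0 * t0 - c0 * t0)) $ 2 = t0"
      using homeomorphism_apply1[OF H(4,1)] \<Psi>0 by simp
    fix c e assume m: "pair2 c e \<in> V"
    have e: "\<Psi> (H (pair2 c e)) = pair2 c e" by (rule homeomorphism_apply2[OF H(4) m])
    have "H (pair2 c e) $ 1 = c" using arg_cong[OF e, of "\<lambda>x. x $ 1"] by (simp add: \<Psi>_def)
    moreover have "H (pair2 c e) $ 2 * H (pair2 c e) $ 2 * H (pair2 c e) $ 2 - H (pair2 c e) $ 1 * H (pair2 c e) $ 2 = e"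
      using arg_cong[OF e, of "\<lambda>x. x $ 2"] by (simp add: \<Psi>_def)
    ultimately show "H (pair2 c e) $ 2 * H (pair2 c e) $ 2 * H (pair2 c e) $ 2 - c * H (pair2 c e) $ 2 - e = 0" by simp
  qed
qed

lemma (in inner_product_subspace) spectral_expand:
  assumes f: "linear_on_subspace V f"
    and u: "orthonormal_frame V g (dim V) u" "\<And>i. i < dim V \<Longrightarrow> f (u i) = l i *\<^sub>R u i" and v: "v \<in> V"
  shows "f v = (\<Sum>i<dim V. (g v (u i) * l i) *\<^sub>R u i)"
proof -
  have uV: "u i \<in> V" if "i < dim V" for i using orthonormal_frame_mem[OF u(1) that] .
  have "f (\<Sum>i\<in>I. a i *\<^sub>R u i) = (\<Sum>i\<in>I. (a i * l i) *\<^sub>R u i)" if "I \<subseteq> {..<dim V}" for I a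
    using that finite_subset[OF that finite_lessThan]
  proof (induction I rule: infinite_finite_induct)
    case empty
    then show ?case using f mem_0 by (metis linear_on_subspace_def scaleR_zero_left sum.empty)
  next
    case (insert x F)
    then show ?case
      using f uV u(2) mem_scale mem_sum[of F "\<lambda>i. a i *\<^sub>R u i"]
      by (auto simp: linear_on_subspace_def subset_iff)
  qed simp
  from this[OF subset_refl, of "\<lambda>i. g v (u i)"] show ?thesis using frame_expand[OF u(1) v] by simp
qed

context near_symplectic_setting
begin

text \<open>The facts at one point of Z, translated from an adapted frame with
  \<open>f 0 = X p\<close>; there the orthogonal complement of \<open>\<epsilon>\<close> is that of
  the single vector \<open>f 0\<close>.\<close>

lemma normal_at_Z:
  assumes p: "p \<in> Z"
  shows "subspace (N p)" "dim (N p) = 3" "N p \<subseteq> K p" "inner_product_subspace (N p) (g p)"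
    and "linear_on_subspace (N p) (F p)" "F p ` N p \<subseteq> N p"
    and "\<And>v w. v \<in> N p \<Longrightarrow> w \<in> N p \<Longrightarrow> g p (F p v) w = D_K A \<omega> p v (X p) w"
    and "self_adjoint_on (N p) (g p) (F p)" "trace_on (N p) (F p) = 0" "inj_on (F p) (N p)"
    and "X p \<in> K p" "g p (X p) (X p) = 1" "N p = {v \<in> K p. g p v (X p) = 0}"
    and "epsilon_at A Z \<omega> p = span {X p}" "tangent_space A Z p \<inter> K p = span {X p}"
    and "subspace (tangent_space A Z p)" "dim (tangent_space A Z p) + 3 = 2 * n"
    and "\<exists>f. orthonormal_frame (K p) (g p) 4 f \<and> positive_kernel_frame n \<omega> p f \<and> f 0 = X p"
proof -
  have t: "p \<in> topspace M" using p Z_subset by blast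
  obtain f where f: "orthonormal_frame (K p) (g p) 4 f" "positive_kernel_frame n \<omega> p f" "f 0 = X p"
    and L: "{v \<in> K p. D_K A \<omega> p v = 0} = span {f 0}" and e: "epsilon_at A Z \<omega> p = span {f 0}"
    and T: "tangent_space A Z p \<inter> K p = span {f 0}"
    by (rule adapted_frame[OF p]) (rule that; assumption)
  interpret Kp: inner_product_subspace "K p" "g p" by (rule K_inner_product[OF p])
  have sd: "D_K A \<omega> p ` K p = self_dual_forms (K p) (g p) (positive_kernel_frame n \<omega> p)" using self_dual p by blast
  have f0: "f 0 \<in> K p" "g p (f 0) (f 0) = 1"
    using orthonormal_frame_mem[OF f(1), of 0] orthonormal_frame_inner[OF f(1), of 0 0] by auto
  have Neq: "N p = {v \<in> K p. g p v (f 0) = 0}"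
    unfolding normal_at_def e span_singleton using Kp.scale_right[OF _ f0(1)]
    by (auto intro!: exI[of _ 1])
  have Feq: "F p = (\<lambda>v. sharp {v \<in> K p. g p v (f 0) = 0} (g p) (Defs.interior (f 0) (D_K A \<omega> p v)))"
    by (rule ext) (simp add: normal_endo_def Neq f(3))
  note NE = Kp.normal_endomorphism[where P = "positive_kernel_frame n \<omega> p" and f = f,
      OF linear_D_K[OF t] sd at_Z(2)[OF p] f(1,2) D_K_closed[OF t] L]
  show sN: "subspace (N p)" unfolding Neq by (rule NE(1))
  show "dim (N p) = 3" unfolding Neq by (rule NE(2))
  show "linear_on_subspace (N p) (F p)" unfolding Feq Neq by (rule NE(4))
  show "F p ` N p \<subseteq> N p" unfolding Feq Neq by (rule NE(5))
  show "g p (F p v) w = D_K A \<omega> p v (X p) w" if "v \<in> N p" "w \<in> N p" for v w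
    unfolding Feq f(3)[symmetric] by (rule NE(6)) (use that in \<open>simp_all only: Neq\<close>)
  show "self_adjoint_on (N p) (g p) (F p)" unfolding Feq Neq by (rule NE(7))
  show "trace_on (N p) (F p) = 0" unfolding Feq Neq by (rule NE(8))
  show "inj_on (F p) (N p)" unfolding Feq Neq by (rule NE(9))
  show NK: "N p \<subseteq> K p" by (auto simp: Neq)
  show "inner_product_subspace (N p) (g p)" by (rule Kp.subspaceI[OF sN NK])
  show "X p \<in> K p" "g p (X p) (X p) = 1" "N p = {v \<in> K p. g p v (X p) = 0}"
    "epsilon_at A Z \<omega> p = span {X p}" "tangent_space A Z p \<inter> K p = span {X p}"
    using f0 f(3) e T Neq by simp_all
  show "subspace (tangent_space A Z p)" "dim (tangent_space A Z p) + 3 = 2 * n"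
    using tangent_space_Z(2,3)[OF p f(1,2)] by blast+
  show "\<exists>f. orthonormal_frame (K p) (g p) 4 f \<and> positive_kernel_frame n \<omega> p f \<and> f 0 = X p" using f by blast
qed

text \<open>A vector of \<open>N p\<close> tangent to Z lies in \<open>K p\<close>, hence in the
  line of \<open>X p\<close>, to which it is orthogonal; the dimensions \<open>2 n - 3\<close> and 3
  then fill the tangent space. Within \<open>K p\<close> the splitting is orthogonal projection
  along \<open>X p\<close>.\<close>

lemma direct_sums:
  assumes p: "p \<in> Z"
  shows "direct_sum UNIV (tangent_space A Z p) (N p)" "direct_sum (K p) (epsilon_at A Z \<omega> p) (N p)"
proof -
  note n = normal_at_Z[OF p]
  interpret Kp: inner_product_subspace "K p" "g p" by (rule K_inner_product[OF p])
  have sX: "span {X p} \<subseteq> K p" using span_minimal[OF _ Kp.subspace] n(11) by blast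
  have i: "v = 0" if v: "v \<in> span {X p}" "v \<in> N p" for v
  proof -
    obtain c where c: "v = c *\<^sub>R X p" using v(1) by (auto simp: span_singleton)
    have "g p v (X p) = c" unfolding c using Kp.scale_left[OF n(11,11)] n(12) by simp
    then show ?thesis using v(2) c unfolding n(13) by simp
  qed
  have I: "span {X p} \<inter> N p = {0}" using i subspace_0[OF n(1)] span_zero by blast
  show "direct_sum (K p) (epsilon_at A Z \<omega> p) (N p)"
    unfolding direct_sum_def n(14)
  proof (intro conjI subspace_span n(1) I equalityI subsetI)
    fix v assume v: "v \<in> K p"
    let ?a = "g p v (X p) *\<^sub>R X p"
    have a: "?a \<in> K p" using Kp.mem_scale n(11) by blast
    have "g p (v - ?a) (X p) = 0" using Kp.diff_left[OF v a n(11)] Kp.scale_left[OF n(11,11)] n(12) by simp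
    then have "v - ?a \<in> N p" using Kp.mem_diff[OF v a] unfolding n(13) by simp
    moreover have "?a \<in> span {X p}" by (simp add: span_scale span_base)
    ultimately show "v \<in> {a + b |a b. a \<in> span {X p} \<and> b \<in> N p}"
      by (intro CollectI exI[of _ ?a] exI[of _ "v - ?a"]) simp
  next
    fix v assume "v \<in> {a + b |a b. a \<in> span {X p} \<and> b \<in> N p}"
    then show "v \<in> K p" using sX n(3) Kp.mem_add by blast
  qed
  have TN: "tangent_space A Z p \<inter> N p = {0}" using I n(15,3) subspace_0[OF n(16)] subspace_0[OF n(1)] by blast
  let ?S = "{a + b |a b. a \<in> tangent_space A Z p \<and> b \<in> N p}"
  have "dim ?S = 2 * n" using dim_sums_Int[OF n(16,1)] n(2,17) unfolding TN by simp
  then have "span ?S = UNIV" using dim_eq_full[of ?S] dimension by simp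
  then have "?S = UNIV" using span_eq_iff[of ?S] subspace_sums[OF n(16,1)] by simp
  then show "direct_sum UNIV (tangent_space A Z p) (N p)"
    unfolding direct_sum_def using n(16,1) TN by simp
qed

text \<open>Injectivity of \<open>F\<close> excludes the eigenvalue 0, and the vanishing trace is
  the sum of the eigenvalues.\<close>

lemma spectral_at:
  assumes p: "p \<in> Z"
  obtains u l where "orthonormal_frame (N p) (g p) 3 u" "\<And>i. i < 3 \<Longrightarrow> F p (u i) = l i *\<^sub>R u i"
    "\<And>i. i < 3 \<Longrightarrow> l i \<noteq> 0" "l 0 + l 1 + l 2 = 0"
proof -
  note n = normal_at_Z[OF p]
  interpret Np: inner_product_subspace "N p" "g p" by (rule n(4))
  obtain u l where u: "orthonormal_frame (N p) (g p) 3 u" "\<And>i. i < 3 \<Longrightarrow> F p (u i) = l i *\<^sub>R u i"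
    using Np.spectral_frame[OF n(5,6,8)] unfolding n(2) by blast
  have uN: "u i \<in> N p" if "i < 3" for i using orthonormal_frame_mem[OF u(1) that] .
  have gu: "g p (F p (u i)) (u i) = l i" if "i < 3" for i
    unfolding u(2)[OF that] using Np.scale_left[OF uN[OF that] uN[OF that]] orthonormal_frame_inner[OF u(1) that that] by simp
  have "l i \<noteq> 0" if "i < 3" for i
  proof
    assume "l i = 0"
    then have "F p (u i) = 0" using u(2)[OF that] by simp
    moreover have "F p 0 = 0" using n(5) Np.mem_0 unfolding linear_on_subspace_def by (metis scaleR_zero_left)
    ultimately have "u i = 0" using inj_onD[OF n(10)] uN[OF that] Np.mem_0 by metis
    then show False using orthonormal_frame_inner[OF u(1) that that] Np.zero_left[OF Np.mem_0] by simp
  qed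
  moreover have "trace_on (N p) (F p) = (\<Sum>i<3. g p (F p (u i)) (u i))"
    using Np.trace_on_eq[of u, OF _ n(5,6)] u(1) unfolding n(2) by blast
  then have "(\<Sum>i<3. l i) = 0" using n(9) gu by simp
  then have "l 0 + l 1 + l 2 = 0" by (simp add: eval_nat_numeral)
  ultimately show thesis using that[OF u] by blast
qed

lemma automorphism_F:
  assumes p: "p \<in> Z" shows "automorphism_on (N p) (F p)"
proof -
  note n = normal_at_Z[OF p]
  interpret Np: inner_product_subspace "N p" "g p" by (rule n(4))
  obtain u l where u: "orthonormal_frame (N p) (g p) 3 u" "\<And>i. i < 3 \<Longrightarrow> F p (u i) = l i *\<^sub>R u i"
    and l: "\<And>i. i < 3 \<Longrightarrow> l i \<noteq> 0"
    by (rule spectral_at[OF p]) (rule that; assumption)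
  have u3: "orthonormal_frame (N p) (g p) (dim (N p)) u" using u(1) n(2) by simp
  have uN: "u i \<in> N p" if "i < 3" for i using orthonormal_frame_mem[OF u(1) that] .
  have "N p \<subseteq> F p ` N p"
  proof
    fix v assume v: "v \<in> N p"
    \<comment> \<open>The preimage under \<open>F\<close>: coordinates in the eigenframe divided by
      the eigenvalues.\<close>
    let ?w = "\<Sum>i<3. (g p v (u i) / l i) *\<^sub>R u i"
    have w: "?w \<in> N p" by (intro Np.mem_sum Np.mem_scale uN) auto
    have "F p ?w = (\<Sum>i<dim (N p). (g p ?w (u i) * l i) *\<^sub>R u i)"
      by (rule Np.spectral_expand[OF n(5) u3 _ w]) (use u(2) n(2) in simp)
    also have "\<dots> = (\<Sum>i<3. g p v (u i) *\<^sub>R u i)"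
      unfolding n(2)
    proof (rule sum.cong[OF refl])
      fix i :: nat assume "i \<in> {..<3}"
      then have i: "i < 3" by simp
      have "g p ?w (u i) = g p v (u i) / l i" using Np.frame_coeff[OF u(1) subset_refl i] i by simp
      then show "(g p ?w (u i) * l i) *\<^sub>R u i = g p v (u i) *\<^sub>R u i" using l[OF i] by simp
    qed
    also have "\<dots> = v" using Np.frame_expand[OF u3 v] unfolding n(2) by simp
    finally have Fw: "F p ?w = v" .
    show "v \<in> F p ` N p" by (rule image_eqI[where x = ?w], rule Fw[symmetric], rule w)
  qed
  then show ?thesis unfolding automorphism_on_def bij_betw_def using n(5,6,10) by blast
qed

section \<open>Smooth frames of the normal bundle and smoothness of F\<close>

lemma X_section: "smooth_section_along A Z K X"
  using unit_field normal_at_Z(11) unfolding smooth_section_along_def unit_field_spanning_def by blast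

lemma section_mono: "smooth_section_along A S E s \<Longrightarrow> S' \<subseteq> S \<Longrightarrow> smooth_section_along A S' E s"
  unfolding smooth_section_along_def using field_mono by blast

lemma section_N_K: "smooth_section_along A S N s \<Longrightarrow> S \<subseteq> Z \<Longrightarrow> smooth_section_along A S K s"
  unfolding smooth_section_along_def using normal_at_Z(3) by blast

text \<open>The coordinate fields of \<open>frame_near\<close> are carried back to the manifold;
  along Z they lie in the kernel, as sections of \<open>K\<close> over Z must.\<close>

lemma kernel_frame:
  assumes p: "p \<in> Z" and f: "orthonormal_frame (K p) (g p) 4 f" "positive_kernel_frame n \<omega> p f"
  shows "\<exists>U k. openin M U \<and> p \<in> U \<and> (\<forall>i<4. smooth_section_along A (Z \<inter> U) K (k i) \<and> k i p = f i)"
proof -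
  define c where "c = chart_at A p"
  have t: "p \<in> topspace M" using p Z_subset by blast
  have c: "c \<in> A" "p \<in> fst c" using chart_at[OF t] by (auto simp: c_def)
  obtain u where u: "degenerate_family (chart_image c) (\<Omega> c) n (snd c p) f u"
    using degenerate_family_at[OF p f] unfolding c_def by blast
  interpret G: degenerate_family "chart_image c" "\<Omega> c" n "snd c p" f u by (rule u)
  obtain V e where V: "open V" "snd c p \<in> V" "V \<subseteq> chart_image c" and e: "\<And>i k. i < 4 \<Longrightarrow> C_diff k (e i) V"
    and e0: "\<And>i. i < 4 \<Longrightarrow> e i (snd c p) = f i"
    and ker: "\<And>x. x \<in> V \<Longrightarrow> x \<in> G.Z \<Longrightarrow> span ((\<lambda>i. e i x) ` {..<4}) = {v. \<forall>w. \<Omega> c x v w = 0}"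
    by (rule G.frame_near) (rule that; assumption)
  define U where "U = {q \<in> fst c. snd c q \<in> V}"
  define k where "k i q = tangent_vector A c q (e i (snd c q))" for i q
  have "smooth_section_along A (Z \<inter> U) K (k i)" if i: "i < 4" for i
    unfolding smooth_section_along_def
  proof (intro conjI ballI smooth_field_alongI)
    fix q assume q: "q \<in> Z \<inter> U"
    then have qc: "q \<in> fst c" "snd c q \<in> V" by (auto simp: U_def)
    have "smooth_extension c (Z \<inter> U) q (\<lambda>q. tangent_coords A c q (k i q))"
      unfolding smooth_extension_def smooth_on_def
      by (rule exI[of _ V], rule exI[of _ "e i"])
        (use V e[OF i] qc in \<open>simp add: k_def tangent_vector_coords(2)[OF c(1)]\<close>)
    then show "\<exists>c\<in>A. q \<in> fst c \<and> smooth_extension c (Z \<inter> U) q (\<lambda>q. tangent_coords A c q (k i q))"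
      using c(1) qc(1) by blast
    have xi: "snd c q \<in> chart_image c" using chart_image_mem[OF qc(1)] .
    have qG: "snd c q \<in> G.Z"
      using q xi in_Z_iff[OF c(1) xi] chart_inv_left[OF c(1) qc(1)] by (simp add: G.Z_def)
    have "e i (snd c q) \<in> {v. \<forall>w. \<Omega> c (snd c q) v w = 0}"
      unfolding ker[OF qc(2) qG, symmetric] using i by (intro span_base) auto
    then show "k i q \<in> K q" using kernel_local_form[OF c(1) qc(1)] unfolding k_def by blast
  qed
  moreover have "k i p = f i" if "i < 4" for i
    unfolding k_def e0[OF that] using tangent_chart_at(2)[OF t] by (simp add: c_def)
  moreover have "openin M U" unfolding U_def by (rule open_preimage[OF c(1) V(1)])
  moreover have "p \<in> U" using c V by (simp add: U_def)
  ultimately show ?thesis by blast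
qed

text \<open>The kernel frame has the value \<open>X p\<close> at index 0. Subtracting the
  \<open>X\<close>-component from the other three fields gives sections of \<open>N\<close> that
  still have the values \<open>f 1\<close>, \<open>f 2\<close>, \<open>f 3\<close> at
  \<open>p\<close>, as \<open>gram_schmidt\<close> requires.\<close>

lemma normal_frame:
  assumes p: "p \<in> Z"
  obtains U b where "openin M U" "p \<in> U" "\<And>i. i < 3 \<Longrightarrow> smooth_section_along A (Z \<inter> U) N (b i)"
    "\<And>q. q \<in> Z \<inter> U \<Longrightarrow> orthonormal_frame (N q) (g q) 3 (\<lambda>i. b i q)"
proof -
  note n = normal_at_Z[OF p]
  obtain f where f: "orthonormal_frame (K p) (g p) 4 f" "positive_kernel_frame n \<omega> p f" "f 0 = X p" using n(18) by blast
  obtain U k where U: "openin M U" "p \<in> U" and k: "\<And>i. i < 4 \<Longrightarrow> smooth_section_along A (Z \<inter> U) K (k i)"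
    and kp: "\<And>i. i < 4 \<Longrightarrow> k i p = f i"
    using kernel_frame[OF p f(1,2)] by blast
  let ?S = "Z \<inter> U"
  define h where "h i q = k (Suc i) q + (- g q (k (Suc i) q) (X q)) *\<^sub>R X q" for i q
  have XS: "smooth_section_along A ?S K X" by (rule section_mono[OF X_section]) blast
  have hs: "smooth_section_along A ?S N (h i)" if i: "i < 3" for i
    unfolding smooth_section_along_def
  proof (intro conjI ballI)
    have ki: "smooth_section_along A ?S K (k (Suc i))" using k i by simp
    have "smooth_function_along A ?S (\<lambda>q. -1 * g q (k (Suc i) q) (X q))"
      by (rule function_mult[OF function_const metric_smooth[OF U(1) ki XS]])
    then show "smooth_field_along A ?S (h i)"
      unfolding h_def using ki XS unfolding smooth_section_along_def
      by (intro field_add field_scaleR) auto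
    fix q assume q: "q \<in> ?S"
    then have qZ: "q \<in> Z" by blast
    note m = normal_at_Z[OF qZ]
    interpret Kq: inner_product_subspace "K q" "g q" by (rule K_inner_product[OF qZ])
    have kq: "k (Suc i) q \<in> K q" using ki q unfolding smooth_section_along_def by blast
    have xs: "(- g q (k (Suc i) q) (X q)) *\<^sub>R X q \<in> K q" by (rule Kq.mem_scale[OF m(11)])
    have "g q (h i q) (X q) = 0"
      unfolding h_def Kq.add_left[OF kq xs m(11)] Kq.scale_left[OF m(11,11)] m(12) by simp
    then show "h i q \<in> N q" unfolding m(13) h_def using Kq.mem_add[OF kq xs] by simp
  qed
  have hp: "h i p = f (Suc i)" if "i < 3" for i
    unfolding h_def using kp[of "Suc i"] that orthonormal_frame_inner[OF f(1), of "Suc i" 0] f(3) by simp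
  have "orthonormal_frame (K p) (g p) 3 (\<lambda>i. h i p)"
    unfolding orthonormal_frame_def using hp orthonormal_frame_mem[OF f(1)] orthonormal_frame_inner[OF f(1)] by simp
  from gram_schmidt[of p U N 3 h, OF p U _ hs this] normal_at_Z(1,3)
  obtain U' b where "openin M U'" "p \<in> U'" "\<forall>i<3. smooth_section_along A (Z \<inter> U') N (b i)"
    "\<forall>q\<in>Z \<inter> U'. orthonormal_frame (N q) (g q) 3 (\<lambda>i. b i q)" by blast
  then show thesis by (intro that[of U' b]) auto
qed

text \<open>Near each point the image is expanded in a smooth orthonormal frame of \<open>N\<close>;
  the coefficients, values of the gradient on \<open>X\<close> and the frame, are smooth by
  \<open>D_K_smooth\<close>, and the metric isomorphism is absorbed in the expansion.\<close>

lemma F_section: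
  assumes U: "openin M U" and s: "smooth_section_along A (Z \<inter> U) N s"
  shows "smooth_section_along A (Z \<inter> U) N (\<lambda>q. F q (s q))"
  unfolding smooth_section_along_def
proof (intro conjI ballI field_local)
  fix p assume p: "p \<in> Z \<inter> U"
  then have pZ: "p \<in> Z" by blast
  obtain W b where W: "openin M W" "p \<in> W" and b: "\<And>i. i < 3 \<Longrightarrow> smooth_section_along A (Z \<inter> W) N (b i)"
    and bo: "\<And>q. q \<in> Z \<inter> W \<Longrightarrow> orthonormal_frame (N q) (g q) 3 (\<lambda>i. b i q)"
    by (rule normal_frame[OF pZ]) (rule that; assumption)
  let ?S = "Z \<inter> U \<inter> W"
  have sS: "smooth_field_along A ?S s" using field_mono[of "Z \<inter> U" s ?S] s unfolding smooth_section_along_def by blast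
  have XS: "smooth_section_along A ?S K X" by (rule section_mono[OF X_section]) blast
  have bS: "smooth_section_along A ?S N (b i)" if "i < 3" for i by (rule section_mono[OF b[OF that]]) blast
  have bK: "smooth_section_along A ?S K (b i)" if "i < 3" for i by (rule section_N_K[OF bS[OF that]]) blast
  have "smooth_field_along A ?S (\<lambda>q. \<Sum>i<3. D_K A \<omega> q (s q) (X q) (b i q) *\<^sub>R b i q)"
  proof (intro field_sum field_scaleR)
    fix i :: nat assume "i \<in> {..<3}"
    then have i: "i < 3" by simp
    show "smooth_function_along A ?S (\<lambda>q. D_K A \<omega> q (s q) (X q) (b i q))"
      by (rule D_K_smooth[OF _ sS XS bK[OF i]]) blast
    show "smooth_field_along A ?S (b i)" using bS[OF i] unfolding smooth_section_along_def by blast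
  qed (auto simp: lessThan_empty_iff)
  then have "smooth_field_along A ?S (\<lambda>q. F q (s q))"
  proof (rule field_cong)
    fix q assume q: "q \<in> ?S"
    then have qZ: "q \<in> Z" by blast
    note m = normal_at_Z[OF qZ]
    interpret Nq: inner_product_subspace "N q" "g q" by (rule m(4))
    have sq: "s q \<in> N q" using s q unfolding smooth_section_along_def by blast
    then have Fq: "F q (s q) \<in> N q" using m(6) by blast
    have o: "orthonormal_frame (N q) (g q) 3 (\<lambda>i. b i q)" using bo q by blast
    have "F q (s q) = (\<Sum>i<3. g q (F q (s q)) (b i q) *\<^sub>R b i q)"
      using Nq.frame_expand[of "\<lambda>i. b i q", OF _ Fq] o unfolding m(2) by blast
    also have "\<dots> = (\<Sum>i<3. D_K A \<omega> q (s q) (X q) (b i q) *\<^sub>R b i q)"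
      using m(7)[OF sq orthonormal_frame_mem[OF o]] by (intro sum.cong) auto
    finally show "(\<Sum>i<3. D_K A \<omega> q (s q) (X q) (b i q) *\<^sub>R b i q) = F q (s q)" by simp
  qed
  then show "\<exists>W. openin M W \<and> p \<in> W \<and> smooth_field_along A (Z \<inter> U \<inter> W) (\<lambda>q. F q (s q))" using W by blast
next
  fix q assume "q \<in> Z \<inter> U"
  then show "F q (s q) \<in> N q" using s normal_at_Z(6)[of q] unfolding smooth_section_along_def by blast
qed

text \<open>Power sums of the eigenvalues written as traces, hence smooth without following
  individual eigenvalues.\<close>

definition "tr2 q = trace_on (N q) (\<lambda>v. F q (F q v))"
definition "tr3 q = trace_on (N q) (\<lambda>v. F q (F q (F q v)))"

lemma F_powers:
  assumes q: "q \<in> Z"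
  shows "linear_on_subspace (N q) (\<lambda>v. F q (F q v))" "(\<lambda>v. F q (F q v)) ` N q \<subseteq> N q"
    "linear_on_subspace (N q) (\<lambda>v. F q (F q (F q v)))" "(\<lambda>v. F q (F q (F q v))) ` N q \<subseteq> N q"
proof -
  note m = normal_at_Z[OF q]
  have FN: "F q v \<in> N q" if "v \<in> N q" for v using m(6) that by blast
  then show "(\<lambda>v. F q (F q v)) ` N q \<subseteq> N q" "(\<lambda>v. F q (F q (F q v))) ` N q \<subseteq> N q" by blast+
  show "linear_on_subspace (N q) (\<lambda>v. F q (F q v))" "linear_on_subspace (N q) (\<lambda>v. F q (F q (F q v)))"
    using m(5) FN unfolding linear_on_subspace_def by simp_all
qed

lemma traces_spectral:
  assumes q: "q \<in> Z" and u: "orthonormal_frame (N q) (g q) 3 u" "\<And>i. i < 3 \<Longrightarrow> F q (u i) = l i *\<^sub>R u i"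
  shows "tr2 q = l 0 * l 0 + l 1 * l 1 + l 2 * l 2" "tr3 q = l 0 * l 0 * l 0 + l 1 * l 1 * l 1 + l 2 * l 2 * l 2"
proof -
  note m = normal_at_Z[OF q]
  interpret Nq: inner_product_subspace "N q" "g q" by (rule m(4))
  have u3: "orthonormal_frame (N q) (g q) (dim (N q)) u" using u(1) m(2) by simp
  have uN: "u i \<in> N q" if "i < 3" for i using orthonormal_frame_mem[OF u(1) that] .
  have Fs: "F q (c *\<^sub>R u i) = (c * l i) *\<^sub>R u i" if "i < 3" for c i
    using m(5) uN[OF that] u(2)[OF that] unfolding linear_on_subspace_def by simp
  have g: "g q (c *\<^sub>R u i) (u i) = c" if "i < 3" for c i
    using Nq.scale_left[OF uN[OF that] uN[OF that]] orthonormal_frame_inner[OF u(1) that that] by simp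
  have "tr2 q = (\<Sum>i<3. g q (F q (F q (u i))) (u i))"
    unfolding tr2_def Nq.trace_on_eq[OF u3 F_powers(1,2)[OF q]] m(2) ..
  also have "\<dots> = (\<Sum>i<3. l i * l i)" using u(2) Fs g by (intro sum.cong) auto
  finally show "tr2 q = l 0 * l 0 + l 1 * l 1 + l 2 * l 2" by (simp add: eval_nat_numeral)
  have "tr3 q = (\<Sum>i<3. g q (F q (F q (F q (u i)))) (u i))"
    unfolding tr3_def Nq.trace_on_eq[OF u3 F_powers(3,4)[OF q]] m(2) ..
  also have "\<dots> = (\<Sum>i<3. l i * l i * l i)" using u(2) Fs g by (intro sum.cong) auto
  finally show "tr3 q = l 0 * l 0 * l 0 + l 1 * l 1 * l 1 + l 2 * l 2 * l 2" by (simp add: eval_nat_numeral)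
qed

lemma traces_smooth: "smooth_function_along A Z tr2" "smooth_function_along A Z tr3"
proof -
  have *: "\<exists>U. openin M U \<and> p \<in> U \<and> smooth_function_along A (Z \<inter> U) tr2 \<and> smooth_function_along A (Z \<inter> U) tr3" if p: "p \<in> Z" for p
  proof -
    obtain U b where U: "openin M U" "p \<in> U" and b: "\<And>i. i < 3 \<Longrightarrow> smooth_section_along A (Z \<inter> U) N (b i)"
      and bo: "\<And>q. q \<in> Z \<inter> U \<Longrightarrow> orthonormal_frame (N q) (g q) 3 (\<lambda>i. b i q)"
      by (rule normal_frame[OF p]) (rule that; assumption)
    have toK: "smooth_section_along A (Z \<inter> U) K s" if "smooth_section_along A (Z \<inter> U) N s" for s
      by (rule section_N_K[OF that]) blast
    have bo': "orthonormal_frame (N q) (g q) (dim (N q)) (\<lambda>i. b i q)" if "q \<in> Z \<inter> U" for q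
      using bo[OF that] normal_at_Z(2) that by auto
    have "smooth_function_along A (Z \<inter> U) (\<lambda>q. \<Sum>i<3. g q (F q (F q (b i q))) (b i q))"
      by (intro function_sum metric_smooth[OF U(1)] toK F_section[OF U(1)] b) auto
    then have 2: "smooth_function_along A (Z \<inter> U) tr2"
    proof (rule function_cong)
      fix q assume q: "q \<in> Z \<inter> U"
      then have qZ: "q \<in> Z" by blast
      show "(\<Sum>i<3. g q (F q (F q (b i q))) (b i q)) = tr2 q"
        unfolding tr2_def inner_product_subspace.trace_on_eq[OF normal_at_Z(4)[OF qZ] bo'[OF q] F_powers(1,2)[OF qZ]] normal_at_Z(2)[OF qZ] ..
    qed
    have "smooth_function_along A (Z \<inter> U) (\<lambda>q. \<Sum>i<3. g q (F q (F q (F q (b i q)))) (b i q))"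
      by (intro function_sum metric_smooth[OF U(1)] toK F_section[OF U(1)] b) auto
    then have 3: "smooth_function_along A (Z \<inter> U) tr3"
    proof (rule function_cong)
      fix q assume q: "q \<in> Z \<inter> U"
      then have qZ: "q \<in> Z" by blast
      show "(\<Sum>i<3. g q (F q (F q (F q (b i q)))) (b i q)) = tr3 q"
        unfolding tr3_def inner_product_subspace.trace_on_eq[OF normal_at_Z(4)[OF qZ] bo'[OF q] F_powers(3,4)[OF qZ]] normal_at_Z(2)[OF qZ] ..
    qed
    show ?thesis using U 2 3 by blast
  qed
  show "smooth_function_along A Z tr2" "smooth_function_along A Z tr3"
    by (rule function_local, use * in blast)+
qed

end

text \<open>The sign of \<open>t\<close> in terms of products and a real power, a form in which its
  smoothness away from 0 is visible.\<close>

lemma mult_powr_eq_sgn: "t \<noteq> 0 \<Longrightarrow> t * (t * t) powr (-1/2) = sgn t" for t :: real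
proof -
  assume t: "t \<noteq> 0"
  have "(t * t) powr (-1/2) = inverse ((t * t) powr (1/2))" using powr_minus[of "t * t" "1/2"] by simp
  also have "(t * t) powr (1/2) = \<bar>t\<bar>" using powr_half_sqrt[of "t * t"] by simp
  finally show ?thesis using t by (cases "0 < t") (auto simp: sgn_real_def)
qed

lemma (in inner_product_subspace) frame_span_orthogonal:
  assumes e: "orthonormal_frame V g k e" and IJ: "I \<subseteq> {..<k}" "J \<subseteq> {..<k}" "I \<inter> J = {}"
    and v: "v \<in> span (e ` I)" and w: "w \<in> span (e ` J)"
  shows "v \<in> V" "w \<in> V" "g v w = 0"
proof -
  have eV: "e i \<in> V" if "i < k" for i using orthonormal_frame_mem[OF e that] .
  have sV: "span (e ` H) \<subseteq> V" if "H \<subseteq> {..<k}" for H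
    by (rule span_minimal[OF _ subspace]) (use eV that in auto)
  show vV: "v \<in> V" and wV: "w \<in> V" using sV[OF IJ(1)] sV[OF IJ(2)] v w by blast+
  have 1: "g v (e j) = 0" if j: "j \<in> J" for j
  proof -
    have jk: "j < k" using IJ j by auto
    have sub: "Real_Vector_Spaces.subspace {x \<in> V. g x (e j) = 0}"
      using eV[OF jk] by (auto simp: subspace_def mem_0 mem_add mem_scale zero_left add_left scale_left)
    have "e ` I \<subseteq> {x \<in> V. g x (e j) = 0}"
    proof (rule image_subsetI)
      fix i assume i: "i \<in> I"
      then have "i < k" "i \<noteq> j" using IJ j by auto
      then show "e i \<in> {x \<in> V. g x (e j) = 0}" using eV orthonormal_frame_inner[OF e _ jk] by simp
    qed
    then show ?thesis using span_minimal[OF _ sub] v by blast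
  qed
  have sub: "Real_Vector_Spaces.subspace {x \<in> V. g v x = 0}"
    using vV by (auto simp: subspace_def mem_0 mem_add mem_scale zero_right add_right scale_right)
  have "e ` J \<subseteq> {x \<in> V. g v x = 0}" using 1 eV IJ by auto
  then show "g v w = 0" using span_minimal[OF _ sub] w by blast
qed

context near_symplectic_setting
begin

text \<open>For three numbers with sum 0 the sum of cubes is three times the product, so
  \<open>tr3\<close> is three times the determinant of \<open>F\<close>.\<close>

lemma tr3_nonzero:
  assumes q: "q \<in> Z" and u: "orthonormal_frame (N q) (g q) 3 u" "\<And>i. i < 3 \<Longrightarrow> F q (u i) = l i *\<^sub>R u i"
    and l: "\<And>i. i < 3 \<Longrightarrow> l i \<noteq> 0" "l 0 + l 1 + l 2 = 0"
  shows "tr3 q = 3 * (l 0 * l 1 * l 2)" "tr3 q \<noteq> 0"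
proof -
  have c: "l 2 = - l 0 - l 1" using l(2) by simp
  have "tr3 q = l 0 * l 0 * l 0 + l 1 * l 1 * l 1 + l 2 * l 2 * l 2" by (rule traces_spectral(2)[OF q u])
  also have "\<dots> = 3 * (l 0 * l 1 * l 2)" unfolding c by (simp add: algebra_simps)
  finally show "tr3 q = 3 * (l 0 * l 1 * l 2)" .
  then show "tr3 q \<noteq> 0" using l(1)[of 0] l(1)[of 1] l(1)[of 2] by simp
qed

text \<open>Minus the sign of \<open>tr3\<close>. Replacing \<open>X\<close> by \<open>s X\<close>
  with \<open>s\<close> equal to 1 or -1 multiplies the determinant of \<open>F\<close> by
  \<open>s\<close>, and two positive eigenvalues and one negative one require a negative
  determinant.\<close>

definition "orient q = - (tr3 q * (tr3 q * tr3 q) powr (-1/2))"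

lemma orient_at:
  assumes q: "q \<in> Z"
  shows "orient q = 1 \<or> orient q = -1" "orient q * tr3 q < 0" "tr3 q \<noteq> 0"
proof -
  obtain u l where u: "orthonormal_frame (N q) (g q) 3 u" "\<And>i. i < 3 \<Longrightarrow> F q (u i) = l i *\<^sub>R u i"
    "\<And>i. i < 3 \<Longrightarrow> l i \<noteq> 0" "l 0 + l 1 + l 2 = 0"
    by (rule spectral_at[OF q]) (rule that; assumption)
  show nz: "tr3 q \<noteq> 0" by (rule tr3_nonzero(2)[OF q u])
  have e: "orient q = - sgn (tr3 q)" unfolding orient_def mult_powr_eq_sgn[OF nz] ..
  show "orient q = 1 \<or> orient q = -1" "orient q * tr3 q < 0"
    unfolding e using nz by (auto simp: sgn_real_def)
qed

lemma orient_smooth: "smooth_function_along A Z orient"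
proof -
  have sq: "smooth_function_along A Z (\<lambda>q. tr3 q * tr3 q)" by (rule function_mult[OF traces_smooth(2,2)])
  have "0 < tr3 q * tr3 q" if "q \<in> Z" for q using orient_at(3)[OF that] by (metis not_square_less_zero linorder_neqE_linordered_idom mult_eq_0_iff)
  then have "smooth_function_along A Z (\<lambda>q. -1 * (tr3 q * (tr3 q * tr3 q) powr (-1/2)))"
    by (intro function_mult[OF function_const] function_mult[OF traces_smooth(2)] function_powr[OF sq])
  then show ?thesis by (rule function_cong) (simp add: orient_def)
qed

lemma oriented_unit_field:
  "unit_field_spanning A Z (epsilon_at A Z \<omega>) g (\<lambda>p. orient p *\<^sub>R X p)"
  unfolding unit_field_spanning_def
proof (intro conjI ballI)
  show "smooth_field_along A Z (\<lambda>p. orient p *\<^sub>R X p)"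
    by (rule field_scaleR[OF orient_smooth]) (use X_section in \<open>simp add: smooth_section_along_def\<close>)
  fix p assume p: "p \<in> Z"
  note m = normal_at_Z[OF p]
  interpret Kp: inner_product_subspace "K p" "g p" by (rule K_inner_product[OF p])
  have "span {- X p} = span {X p}"
  proof (rule subset_antisym)
    show "span {- X p} \<subseteq> span {X p}" by (rule span_minimal) (auto intro: span_neg span_base)
    have "- (- X p) \<in> span {- X p}" by (intro span_neg span_base) simp
    then show "span {X p} \<subseteq> span {- X p}" by (intro span_minimal) auto
  qed
  then show "span {orient p *\<^sub>R X p} = epsilon_at A Z \<omega> p" using orient_at(1)[OF p] m(14) by auto
  have "g p (orient p *\<^sub>R X p) (orient p *\<^sub>R X p) = orient p * (orient p * g p (X p) (X p))"
    using Kp.scale_left[OF m(11) Kp.mem_scale[OF m(11)]] Kp.scale_right[OF m(11,11)] by simp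
  then show "g p (orient p *\<^sub>R X p) (orient p *\<^sub>R X p) = 1" using orient_at(1)[OF p] m(12) by auto
qed

text \<open>The locale is instantiated again with the reoriented field. \<open>N\<close> is built
  from the line \<open>\<epsilon>\<close>, so it stays the same, and the new endomorphism is
  \<open>orient q\<close> times the old one, with the same eigenframe.\<close>

lemma oriented_sign_convention: "sign_convention Z N (normal_endo A Z \<omega> g (\<lambda>p. orient p *\<^sub>R X p))"
proof -
  interpret S: near_symplectic_setting M A n \<omega> g "\<lambda>p. orient p *\<^sub>R X p"
    by unfold_locales (rule dimension near_symplectic metric self_dual oriented_unit_field)+
  show ?thesis
    unfolding sign_convention_def
  proof (rule ballI)
    fix q assume q: "q \<in> Z"
    note m = normal_at_Z[OF q] and m' = S.normal_at_Z[OF q]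
    interpret Nq: inner_product_subspace "N q" "g q" by (rule m(4))
    obtain u l where u: "orthonormal_frame (N q) (g q) 3 u" "\<And>i. i < 3 \<Longrightarrow> F q (u i) = l i *\<^sub>R u i"
      and l: "\<And>i. i < 3 \<Longrightarrow> l i \<noteq> 0" "l 0 + l 1 + l 2 = 0"
      by (rule spectral_at[OF q]) (rule that; assumption)
    let ?l = "\<lambda>i. orient q * l i"
    have uN: "u i \<in> N q" if "i < 3" for i using orthonormal_frame_mem[OF u(1) that] .
    have DA: "bilinear_on_subspace (K q) (D_K A \<omega> q v)" if "v \<in> K q" for v
    proof -
      have "D_K A \<omega> q v \<in> self_dual_forms (K q) (g q) (positive_kernel_frame n \<omega> q)" using self_dual q that by blast
      then show ?thesis by (auto simp: self_dual_forms_def hodge_dual_def Alt2_def)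
    qed
    have F': "S.F q v = orient q *\<^sub>R F q v" if v: "v \<in> N q" for v
    proof (rule Nq.eqI)
      show "S.F q v \<in> N q" using m'(6) v by blast
      have Fv: "F q v \<in> N q" using m(6) v by blast
      then show "orient q *\<^sub>R F q v \<in> N q" by (rule Nq.mem_scale)
      fix w assume w: "w \<in> N q"
      have K: "v \<in> K q" "w \<in> K q" using v w m(3) by auto
      have "g q (S.F q v) w = D_K A \<omega> q v (orient q *\<^sub>R X q) w" by (rule m'(7)[OF v w])
      also have "\<dots> = orient q * D_K A \<omega> q v (X q) w"
        using DA[OF K(1)] K(2) m(11) unfolding bilinear_on_subspace_def linear_on_subspace_def by simp
      also have "\<dots> = g q (orient q *\<^sub>R F q v) w" using Nq.scale_left[OF Fv w] m(7)[OF v w] by simp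
      finally show "g q (S.F q v) w = g q (orient q *\<^sub>R F q v) w" .
    qed
    have S: "S.F q (u i) = ?l i *\<^sub>R u i" if "i < dim (N q)" for i
      using F'[OF uN] u(2) that unfolding m(2) by simp
    have u3: "orthonormal_frame (N q) (g q) (dim (N q)) u" using u(1) m(2) by simp
    have s: "?l 0 + ?l 1 + ?l 2 = 0" using l(2) by (simp add: distrib_left[symmetric])
    have "?l 0 * ?l 1 * ?l 2 = orient q * orient q * (orient q * (l 0 * l 1 * l 2))" by simp
    also have "\<dots> < 0"
    proof -
      have t3: "tr3 q = 3 * (l 0 * l 1 * l 2)" by (rule tr3_nonzero(1)[OF q u l]; assumption)
      have "orient q * (3 * (l 0 * l 1 * l 2)) < 0" using orient_at(2)[OF q] by (simp only: t3)
      moreover have "orient q * (3 * (l 0 * l 1 * l 2)) = 3 * (orient q * (l 0 * l 1 * l 2))" by (rule mult.left_commute)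
      ultimately have "orient q * (l 0 * l 1 * l 2) < 0" by linarith
      moreover have "orient q * orient q = 1" using orient_at(1)[OF q] by auto
      ultimately show ?thesis by simp
    qed
    finally have pr: "?l 0 * ?l 1 * ?l 2 < 0" .
    note c = sign_counts[of ?l, OF s pr]
    show "eigenvalue_count (N q) (S.F q) {0<..} = 2 \<and> eigenvalue_count (N q) (S.F q) {..<0} = 1"
      using Nq.eigenvalue_count_spectral[OF m'(5) u3 S] c unfolding m(2) by simp
  qed
qed

text \<open>Local sections of \<open>E\<close> orthonormal at a single point suffice:
  \<open>gram_schmidt\<close> makes them an orthonormal frame nearby, which spans \<open>E\<close>
  for reasons of dimension.\<close>

lemma smooth_subbundleI:
  assumes E: "\<And>q. q \<in> Z \<Longrightarrow> subspace (E q) \<and> E q \<subseteq> K q" and d: "\<And>q. q \<in> Z \<Longrightarrow> dim (E q) = m"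
    and loc: "\<And>p. p \<in> Z \<Longrightarrow> \<exists>U k. openin M U \<and> p \<in> U \<and> (\<forall>i<m. smooth_section_along A (Z \<inter> U) E (k i)) \<and>
      orthonormal_frame (K p) (g p) m (\<lambda>i. k i p)"
  shows "smooth_subbundle M A Z m E"
  unfolding smooth_subbundle_def
proof (intro conjI ballI)
  show "subspace (E p)" "dim (E p) = m" if "p \<in> Z" for p using E d that by blast+
  fix p assume p: "p \<in> Z"
  obtain U k where U: "openin M U" "p \<in> U" and k: "\<And>i. i < m \<Longrightarrow> smooth_section_along A (Z \<inter> U) E (k i)"
    and o: "orthonormal_frame (K p) (g p) m (\<lambda>i. k i p)" using loc[OF p] by blast
  obtain U' b where b: "openin M U'" "p \<in> U'" "\<forall>i<m. smooth_section_along A (Z \<inter> U') E (b i) \<and> b i p = k i p"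
    "\<forall>q\<in>Z \<inter> U'. orthonormal_frame (E q) (g q) m (\<lambda>i. b i q)"
    using gram_schmidt[of p U E m k, OF p U E k o] by blast
  have "span ((\<lambda>i. b i q) ` {..<m}) = E q" if q: "q \<in> Z \<inter> U'" for q
  proof -
    have qZ: "q \<in> Z" using q by blast
    interpret Kq: inner_product_subspace "K q" "g q" by (rule K_inner_product[OF qZ])
    interpret Eq: inner_product_subspace "E q" "g q" by (rule Kq.subspaceI) (use E[OF qZ] in auto)
    show ?thesis using Eq.frame_span[of "\<lambda>i. b i q"] b(4) q unfolding d[OF qZ] by blast
  qed
  then show "\<exists>U s. openin M U \<and> p \<in> U \<and> (\<forall>i<m. smooth_section_along A (Z \<inter> U) E (s i)) \<and>
      (\<forall>q\<in>Z \<inter> U. span ((\<lambda>i. s i q) ` {..<m}) = E q)" using b(1-3) by blast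
qed

text \<open>Constant coefficients in a local frame. One neighbourhood serves all \<open>w\<close>,
  so that several sections can be used together.\<close>

lemma section_through:
  assumes p: "p \<in> Z"
  shows "\<exists>U. openin M U \<and> p \<in> U \<and> (\<forall>w\<in>N p. \<exists>t. smooth_section_along A (Z \<inter> U) N t \<and> t p = w)"
proof -
  note m = normal_at_Z[OF p]
  interpret Np: inner_product_subspace "N p" "g p" by (rule m(4))
  obtain U b where U: "openin M U" "p \<in> U" and b: "\<And>i. i < 3 \<Longrightarrow> smooth_section_along A (Z \<inter> U) N (b i)"
    and bo: "\<And>q. q \<in> Z \<inter> U \<Longrightarrow> orthonormal_frame (N q) (g q) 3 (\<lambda>i. b i q)"
    by (rule normal_frame[OF p]) (rule that; assumption)
  have "\<exists>t. smooth_section_along A (Z \<inter> U) N t \<and> t p = w" if w: "w \<in> N p" for w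
  proof -
    define t where "t q = (\<Sum>i<3. g p w (b i p) *\<^sub>R b i q)" for q
    have "smooth_field_along A (Z \<inter> U) t"
      unfolding t_def
      by (intro field_sum field_scaleR function_const) (use b in \<open>auto simp: smooth_section_along_def lessThan_empty_iff\<close>)
    moreover have "t q \<in> N q" if q: "q \<in> Z \<inter> U" for q
    proof -
      have qZ: "q \<in> Z" using q by blast
      show ?thesis unfolding t_def
        by (intro subspace_sum subspace_scale normal_at_Z(1)[OF qZ])
          (use b q in \<open>auto simp: smooth_section_along_def\<close>)
    qed
    moreover have "t p = w"
      using Np.frame_expand[of "\<lambda>i. b i p", OF _ w] bo[of p] p U unfolding m(2) t_def by simp
    ultimately show ?thesis unfolding smooth_section_along_def by blast
  qed
  then show ?thesis using U by blast
qed

text \<open>The negative eigenvalue, as a root of the characteristic polynomial of \<open>F\<close>.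
  Under the sign convention exactly one root is negative, so \<open>SOME\<close> has a determined
  value.\<close>

definition "lam q = (SOME t. t < 0 \<and> t * t * t - tr2 q / 2 * t - tr3 q / 3 = 0)"

context
  assumes sc: "sign_convention Z N F"
begin

lemma split_at:
  assumes q: "q \<in> Z"
  obtains u l j where "orthonormal_frame (N q) (g q) 3 u" "\<And>i. i < 3 \<Longrightarrow> F q (u i) = l i *\<^sub>R u i"
    "j < 3" "l j < 0" "\<And>i. i < 3 \<Longrightarrow> i \<noteq> j \<Longrightarrow> 0 < l i" "lam q = l j"
    "\<And>t. t < 0 \<Longrightarrow> t * t * t - tr2 q / 2 * t - tr3 q / 3 = 0 \<Longrightarrow> t = l j"
    "\<And>t. t * t * t - tr2 q / 2 * t - tr3 q / 3 = (t - l 0) * (t - l 1) * (t - l 2)"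
    "l 0 + l 1 + l 2 = 0" "tr2 q = l 0 * l 0 + l 1 * l 1 + l 2 * l 2"
    "positive_eigenspace (N q) (F q) = span (u ` {i. i < 3 \<and> 0 < l i})"
    "negative_eigenspace (N q) (F q) = span (u ` {i. i < 3 \<and> l i < 0})"
    "card {i. i < 3 \<and> 0 < l i} = 2" "card {i. i < 3 \<and> l i < 0} = 1"
proof -
  note m = normal_at_Z[OF q]
  interpret Nq: inner_product_subspace "N q" "g q" by (rule m(4))
  obtain u l where u: "orthonormal_frame (N q) (g q) 3 u" "\<And>i. i < 3 \<Longrightarrow> F q (u i) = l i *\<^sub>R u i"
    and l: "\<And>i. i < 3 \<Longrightarrow> l i \<noteq> 0" "l 0 + l 1 + l 2 = 0"
    by (rule spectral_at[OF q]) (rule that; assumption)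
  have u3: "orthonormal_frame (N q) (g q) (dim (N q)) u" using u(1) m(2) by simp
  have Fu: "F q (u i) = l i *\<^sub>R u i" if "i < dim (N q)" for i using u(2) that m(2) by simp
  have c: "card {i. i < 3 \<and> l i \<in> {0<..}} = 2" "card {i. i < 3 \<and> l i \<in> {..<0}} = 1"
    using sc q Nq.eigenvalue_count_spectral[OF m(5) u3 Fu] unfolding sign_convention_def m(2) by auto
  obtain j where j: "j < 3" "l j < 0" "\<And>i. i < 3 \<Longrightarrow> i \<noteq> j \<Longrightarrow> 0 < l i"
    using one_negative[of l, OF c] by blast
  have tr: "tr2 q = l 0 * l 0 + l 1 * l 1 + l 2 * l 2" "tr3 q = l 0 * l 0 * l 0 + l 1 * l 1 * l 1 + l 2 * l 2 * l 2"
    by (rule traces_spectral[OF q u]; assumption)+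
  have poly: "t * t * t - tr2 q / 2 * t - tr3 q / 3 = (t - l 0) * (t - l 1) * (t - l 2)" for t
    by (simp only: tr cubic_factor[OF l(2)])
  have root: "t * t * t - tr2 q / 2 * t - tr3 q / 3 = 0" if "t = l j" for t
  proof -
    have "j = 0 \<or> j = 1 \<or> j = 2" using j(1) by auto
    then show ?thesis unfolding poly that by auto
  qed
  have uniq: "t = l j" if t: "t < 0" "t * t * t - tr2 q / 2 * t - tr3 q / 3 = 0" for t
  proof -
    have "t = l 0 \<or> t = l 1 \<or> t = l 2" using t(2) unfolding poly by simp
    then show ?thesis using j(3)[of 0] j(3)[of 1] j(3)[of 2] t(1) by fastforce
  qed
  have lam: "lam q = l j"
    unfolding lam_def
  proof (rule some_equality)
    show "l j < 0 \<and> l j * l j * l j - tr2 q / 2 * l j - tr3 q / 3 = 0" using root[OF refl] j(2) by blast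
    show "t = l j" if "t < 0 \<and> t * t * t - tr2 q / 2 * t - tr3 q / 3 = 0" for t using uniq that by blast
  qed
  have sp: "positive_eigenspace (N q) (F q) = span (u ` {i. i < 3 \<and> 0 < l i})"
    "negative_eigenspace (N q) (F q) = span (u ` {i. i < 3 \<and> l i < 0})"
    using Nq.positive_eigenspace_spectral[OF m(5) u3 Fu] Nq.negative_eigenspace_spectral[OF m(5) u3 Fu] unfolding m(2) by blast+
  have c': "card {i. i < 3 \<and> 0 < l i} = 2" "card {i. i < 3 \<and> l i < 0} = 1" using c by simp_all
  show thesis by (rule that[OF u j lam uniq poly l(2) tr(1) sp c'])
qed

text \<open>\<open>smooth_simple_root\<close> continues the root at \<open>p\<close> smoothly; near
  \<open>p\<close> the continuation stays negative, and the only negative root is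
  \<open>lam\<close>.\<close>

lemma lam_smooth: "smooth_function_along A Z lam"
  unfolding smooth_function_along_iff
proof (intro ballI)
  fix c p assume c: "c \<in> A" and p: "p \<in> Z \<inter> fst c"
  then have pZ: "p \<in> Z" by blast
  obtain l :: "nat \<Rightarrow> real" and j :: nat where j: "j < 3" "l j < 0" "\<And>i. i < 3 \<Longrightarrow> i \<noteq> j \<Longrightarrow> 0 < l i" and lam: "lam p = l j"
    and poly: "\<And>t. t * t * t - tr2 p / 2 * t - tr3 p / 3 = (t - l 0) * (t - l 1) * (t - l 2)"
    and l0: "l 0 + l 1 + l 2 = 0" and t2: "tr2 p = l 0 * l 0 + l 1 * l 1 + l 2 * l 2"
    by (rule split_at[OF pZ]) (rule that; assumption)
  let ?c = "tr2 p / 2" and ?t = "l j"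
  have j3: "j = 0 \<or> j = 1 \<or> j = 2" using j(1) by auto
  \<comment> \<open>The derivative of the cubic at a root is the product of its differences to the
    other two roots, which are positive while this one is negative.\<close>
  have nz: "3 * ?t * ?t - ?c \<noteq> 0"
  proof -
    have "3 * l 0 * l 0 - ?c = (l 0 - l 1) * (l 0 - l 2)" "3 * l 1 * l 1 - ?c = (l 1 - l 0) * (l 1 - l 2)"
      "3 * l 2 * l 2 - ?c = (l 2 - l 0) * (l 2 - l 1)"
    proof -
      have e: "l 2 = - l 0 - l 1" using l0 by simp
      show "3 * l 0 * l 0 - ?c = (l 0 - l 1) * (l 0 - l 2)" "3 * l 1 * l 1 - ?c = (l 1 - l 0) * (l 1 - l 2)"
        "3 * l 2 * l 2 - ?c = (l 2 - l 0) * (l 2 - l 1)"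
        unfolding t2 e by (simp_all add: field_simps)
    qed
    moreover have "l j \<noteq> l i" if "i < 3" "i \<noteq> j" for i using j(2) j(3)[OF that] by simp
    ultimately show ?thesis using j3 by (elim disjE) simp_all
  qed
  have e3: "tr3 p / 3 = ?t * ?t * ?t - ?c * ?t" using poly[of ?t] j3 by auto
  obtain T G where T: "pair2 ?c (?t * ?t * ?t - ?c * ?t) \<in> T" and G: "smooth_on G T"
    and G0: "G (pair2 ?c (?t * ?t * ?t - ?c * ?t)) = ?t"
    and root: "\<And>c e. pair2 c e \<in> T \<Longrightarrow> G (pair2 c e) * G (pair2 c e) * G (pair2 c e) - c * G (pair2 c e) - e = 0"
    by (rule smooth_simple_root[OF nz]) (rule that; assumption)
  define h where "h q = pair2 (tr2 q / 2) (tr3 q / 3)" for q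
  have "smooth_extension c Z p tr2" "smooth_extension c Z p tr3"
    using traces_smooth c p unfolding smooth_function_along_iff by blast+
  then have "smooth_extension c Z p (\<lambda>q. (tr2 q * (1 / 2)) *\<^sub>R axis 1 1 + (tr3 q * (1 / 3)) *\<^sub>R (axis 2 1 :: real^2))"
    by (intro smooth_extension_add smooth_extension_scaleR smooth_extension_mult smooth_extension_const)
  then have "smooth_extension c Z p h"
    by (rule smooth_extension_cong) (simp add: h_def pair2_def)
  then obtain V f where V: "snd c p \<in> V" "smooth_on f V" "\<forall>q\<in>Z \<inter> fst c. snd c q \<in> V \<longrightarrow> f (snd c q) = h q"
    unfolding smooth_extension_def by blast
  have oV: "open V" and Cf: "\<And>k. C_diff k f V" and oT: "open T" and CG: "\<And>k. C_diff k G T"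
    using V(2) G by (auto simp: smooth_on_def)
  let ?V2 = "V \<inter> f -` T"
  have o2: "open ?V2" by (rule continuous_open_preimage[OF C_diff_imp_continuous[OF Cf[of 0]] oV oT])
  have CGf: "C_diff k (\<lambda>x. G (f x)) ?V2" for k
    by (rule C_diff_compose[OF o2 oT _ C_diff_subset[OF Cf] CG]) auto
  let ?V3 = "?V2 \<inter> (\<lambda>x. G (f x)) -` {..<0}"
  have o3: "open ?V3" by (rule continuous_open_preimage[OF C_diff_imp_continuous[OF CGf[of 0]] o2]) simp
  have "smooth_on (\<lambda>x. G (f x)) ?V3"
    unfolding smooth_on_def by (intro conjI allI o3 C_diff_subset[OF CGf]) blast
  moreover have "snd c p \<in> ?V3"
  proof -
    have "f (snd c p) = h p" using V(1,3) p by blast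
    then show ?thesis using V(1) T G0 j(2) by (simp add: h_def e3)
  qed
  moreover have "G (f (snd c q)) = lam q" if q: "q \<in> Z \<inter> fst c" "snd c q \<in> ?V3" for q
  proof -
    have fq: "f (snd c q) = h q" using V(3) q by blast
    have hT: "h q \<in> T" and neg: "G (h q) < 0" using q(2) unfolding fq[symmetric] by auto
    have qZ: "q \<in> Z" using q by blast
    obtain l' :: "nat \<Rightarrow> real" and j' :: nat where "lam q = l' j'" "\<And>t. t < 0 \<Longrightarrow> t * t * t - tr2 q / 2 * t - tr3 q / 3 = 0 \<Longrightarrow> t = l' j'"
      by (rule split_at[OF qZ]) (rule that; assumption)
    then show ?thesis using neg root[OF hT[unfolded h_def]] unfolding fq h_def by simp
  qed
  ultimately show "smooth_extension c Z p lam"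
    unfolding smooth_extension_def by (intro exI[of _ ?V3] exI[of _ "\<lambda>x. G (f x)"]) blast
qed

text \<open>\<open>F - \<lambda>\<close> kills the negative eigenvector. The quadratic
  \<open>t^2 + \<lambda> t + (\<lambda>^2 - c)\<close> with \<open>c = tr2 / 2\<close> is the
  characteristic polynomial divided by \<open>t - \<lambda>\<close>, so it vanishes at both positive
  eigenvalues.\<close>

lemma eigen_projections:
  assumes q: "q \<in> Z" and v: "v \<in> N q"
  shows "F q v + (- lam q) *\<^sub>R v \<in> positive_eigenspace (N q) (F q)"
    and "F q (F q v) + (lam q *\<^sub>R F q v + (lam q * lam q - tr2 q / 2) *\<^sub>R v) \<in> negative_eigenspace (N q) (F q)"
proof -
  note m = normal_at_Z[OF q]
  interpret Nq: inner_product_subspace "N q" "g q" by (rule m(4))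
  obtain u l j where u: "orthonormal_frame (N q) (g q) 3 u" "\<And>i. i < 3 \<Longrightarrow> F q (u i) = l i *\<^sub>R u i"
    and j: "j < 3" "l j < 0" "\<And>i. i < 3 \<Longrightarrow> i \<noteq> j \<Longrightarrow> 0 < l i" and lam: "lam q = l j"
    and l0: "l 0 + l 1 + l 2 = 0" and t2: "tr2 q = l 0 * l 0 + l 1 * l 1 + l 2 * l 2"
    and sp: "positive_eigenspace (N q) (F q) = span (u ` {i. i < 3 \<and> 0 < l i})"
      "negative_eigenspace (N q) (F q) = span (u ` {i. i < 3 \<and> l i < 0})"
    by (rule split_at[OF q]) (rule that; assumption)
  have u3: "orthonormal_frame (N q) (g q) (dim (N q)) u" using u(1) m(2) by simp
  have Fu: "F q (u i) = l i *\<^sub>R u i" if "i < dim (N q)" for i using u(2) that m(2) by simp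
  have Fx: "F q x = (\<Sum>i<3. (g q x (u i) * l i) *\<^sub>R u i)" if "x \<in> N q" for x
    using Nq.spectral_expand[OF m(5) u3 Fu that] unfolding m(2) .
  have ve: "v = (\<Sum>i<3. g q v (u i) *\<^sub>R u i)" using Nq.frame_expand[OF u3 v] unfolding m(2) .
  have gF: "g q (F q v) (u i) = g q v (u i) * l i" if "i < 3" for i
    unfolding Fx[OF v] using Nq.frame_coeff[OF u(1) subset_refl that, of "\<lambda>i. g q v (u i) * l i"] that by simp
  have FF: "F q (F q v) = (\<Sum>i<3. (g q v (u i) * l i * l i) *\<^sub>R u i)"
  proof -
    have "F q v \<in> N q" using m(6) v by blast
    from Fx[OF this] show ?thesis using gF by simp
  qed
  have sv: "a *\<^sub>R v = (\<Sum>i<3. (a * g q v (u i)) *\<^sub>R u i)" for a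
    by (subst ve) (simp add: scaleR_sum_right)
  have "F q v + (- lam q) *\<^sub>R v = (\<Sum>i<3. (g q v (u i) * (l i - l j)) *\<^sub>R u i)"
    unfolding Fx[OF v] sv lam sum.distrib[symmetric] by (rule sum.cong) (simp_all add: algebra_simps flip: scaleR_add_left)
  also have "\<dots> \<in> span (u ` {i. i < 3 \<and> 0 < l i})"
  proof (rule span_sum)
    fix i :: nat assume "i \<in> {..<3}"
    then show "(g q v (u i) * (l i - l j)) *\<^sub>R u i \<in> span (u ` {i. i < 3 \<and> 0 < l i})"
      using j(3)[of i] by (cases "i = j") (auto intro: span_scale span_base span_zero)
  qed
  finally show "F q v + (- lam q) *\<^sub>R v \<in> positive_eigenspace (N q) (F q)" unfolding sp .
  have j3: "j = 0 \<or> j = 1 \<or> j = 2" using j(1) by auto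
  have van: "l i * l i + l j * l i + (l j * l j - tr2 q / 2) = 0" if "i < 3" "i \<noteq> j" for i
  proof -
    have e: "l 2 = - l 0 - l 1" using l0 by simp
    have "i = 0 \<or> i = 1 \<or> i = 2" using that by auto
    then show ?thesis using j3 that(2) unfolding t2
      by (elim disjE) (simp_all add: e field_simps)
  qed
  have "F q (F q v) + (lam q *\<^sub>R F q v + (lam q * lam q - tr2 q / 2) *\<^sub>R v) =
      (\<Sum>i<3. (g q v (u i) * (l i * l i + l j * l i + (l j * l j - tr2 q / 2))) *\<^sub>R u i)"
    unfolding FF unfolding Fx[OF v] sv lam scaleR_sum_right sum.distrib[symmetric]
    by (rule sum.cong) (simp_all add: algebra_simps flip: scaleR_add_left scaleR_diff_left)
  also have "\<dots> \<in> span (u ` {i. i < 3 \<and> l i < 0})"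
  proof (rule span_sum)
    fix i :: nat assume "i \<in> {..<3}"
    then show "(g q v (u i) * (l i * l i + l j * l i + (l j * l j - tr2 q / 2))) *\<^sub>R u i \<in> span (u ` {i. i < 3 \<and> l i < 0})"
      using van[of i] j(2) by (cases "i = j") (auto intro: span_scale span_base span_zero)
  qed
  finally show "F q (F q v) + (lam q *\<^sub>R F q v + (lam q * lam q - tr2 q / 2) *\<^sub>R v) \<in> negative_eigenspace (N q) (F q)"
    unfolding sp .
qed

lemma eigenspaces_at:
  assumes q: "q \<in> Z"
  shows "subspace (negative_eigenspace (N q) (F q))" "subspace (positive_eigenspace (N q) (F q))"
    "negative_eigenspace (N q) (F q) \<subseteq> N q" "positive_eigenspace (N q) (F q) \<subseteq> N q"
    "dim (negative_eigenspace (N q) (F q)) = 1" "dim (positive_eigenspace (N q) (F q)) = 2"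
    "\<And>v w. v \<in> negative_eigenspace (N q) (F q) \<Longrightarrow> w \<in> positive_eigenspace (N q) (F q) \<Longrightarrow> g q v w = 0"
    "direct_sum (N q) (negative_eigenspace (N q) (F q)) (positive_eigenspace (N q) (F q))"
proof -
  note m = normal_at_Z[OF q]
  interpret Nq: inner_product_subspace "N q" "g q" by (rule m(4))
  obtain u and l :: "nat \<Rightarrow> real" and j :: nat where u: "orthonormal_frame (N q) (g q) 3 u"
    and j: "j < 3" "l j < 0" "\<And>i. i < 3 \<Longrightarrow> i \<noteq> j \<Longrightarrow> 0 < l i"
    and sp: "positive_eigenspace (N q) (F q) = span (u ` {i. i < 3 \<and> 0 < l i})"
      "negative_eigenspace (N q) (F q) = span (u ` {i. i < 3 \<and> l i < 0})"
    and c: "card {i. i < 3 \<and> 0 < l i} = 2" "card {i. i < 3 \<and> l i < 0} = 1"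
    by (rule split_at[OF q]) (rule that; assumption)
  let ?I = "{i. i < 3 \<and> l i < 0}" and ?J = "{i. i < 3 \<and> 0 < l i}"
  have IJ: "?I \<subseteq> {..<3}" "?J \<subseteq> {..<3}" "?I \<inter> ?J = {}" by auto
  note so = Nq.frame_span_orthogonal[OF u IJ]
  show sub: "subspace (negative_eigenspace (N q) (F q))" "subspace (positive_eigenspace (N q) (F q))"
    unfolding sp by simp_all
  show NN: "negative_eigenspace (N q) (F q) \<subseteq> N q" "positive_eigenspace (N q) (F q) \<subseteq> N q"
    unfolding sp using so(1)[OF _ span_zero] so(2)[OF span_zero] by blast+
  show "dim (negative_eigenspace (N q) (F q)) = 1" "dim (positive_eigenspace (N q) (F q)) = 2"
    unfolding sp using Nq.dim_frame_span[OF u IJ(1)] Nq.dim_frame_span[OF u IJ(2)] c by simp_all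
  show orth: "g q v w = 0" if "v \<in> negative_eigenspace (N q) (F q)" "w \<in> positive_eigenspace (N q) (F q)" for v w
    using so(3) that unfolding sp by blast
  have "v = 0" if "v \<in> negative_eigenspace (N q) (F q)" "v \<in> positive_eigenspace (N q) (F q)" for v
    using orth[OF that] Nq.eq_0_iff[of v] NN(1) that(1) by blast
  then have "negative_eigenspace (N q) (F q) \<inter> positive_eigenspace (N q) (F q) = {0}"
    using subspace_0[OF sub(1)] subspace_0[OF sub(2)] by blast
  moreover have "N q = {a + b |a b. a \<in> negative_eigenspace (N q) (F q) \<and> b \<in> positive_eigenspace (N q) (F q)}"
  proof (intro equalityI subsetI)
    fix v assume v: "v \<in> N q"
    have u3: "orthonormal_frame (N q) (g q) (dim (N q)) u" using u(1) m(2) by simp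
    have "{..<3} = ?I \<union> ?J"
    proof (intro equalityI subsetI)
      fix i :: nat assume "i \<in> {..<3}"
      then show "i \<in> ?I \<union> ?J" using j(2) j(3)[of i] by (cases "i = j") auto
    qed auto
    then have "v = (\<Sum>i\<in>?I \<union> ?J. g q v (u i) *\<^sub>R u i)" using Nq.frame_expand[OF u3 v] unfolding m(2) by simp
    also have "\<dots> = (\<Sum>i\<in>?I. g q v (u i) *\<^sub>R u i) + (\<Sum>i\<in>?J. g q v (u i) *\<^sub>R u i)"
      by (rule sum.union_disjoint) (use IJ in auto)
    finally have ve: "v = (\<Sum>i\<in>?I. g q v (u i) *\<^sub>R u i) + (\<Sum>i\<in>?J. g q v (u i) *\<^sub>R u i)" .
    show "v \<in> {a + b |a b. a \<in> negative_eigenspace (N q) (F q) \<and> b \<in> positive_eigenspace (N q) (F q)}"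
      unfolding sp by (intro CollectI exI conjI, rule ve) (intro span_sum span_scale span_base imageI, assumption)+
  next
    fix v assume "v \<in> {a + b |a b. a \<in> negative_eigenspace (N q) (F q) \<and> b \<in> positive_eigenspace (N q) (F q)}"
    then show "v \<in> N q" using NN Nq.mem_add by blast
  qed
  ultimately show "direct_sum (N q) (negative_eigenspace (N q) (F q)) (positive_eigenspace (N q) (F q))"
    unfolding direct_sum_def using sub by blast
qed

text \<open>The quadratic polynomial of \<open>eigen_projections\<close> is applied to a smooth
  section passing through the negative eigenvector at \<open>p\<close>.\<close>

lemma negative_subbundle: "smooth_subbundle M A Z 1 (\<lambda>p. negative_eigenspace (N p) (F p))"
proof (rule smooth_subbundleI)
  show "subspace (negative_eigenspace (N q) (F q)) \<and> negative_eigenspace (N q) (F q) \<subseteq> K q"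
    "dim (negative_eigenspace (N q) (F q)) = 1" if "q \<in> Z" for q
    using eigenspaces_at[OF that] normal_at_Z(3)[OF that] by auto
  fix p assume p: "p \<in> Z"
  note m = normal_at_Z[OF p]
  interpret Np: inner_product_subspace "N p" "g p" by (rule m(4))
  obtain u l j where u: "orthonormal_frame (N p) (g p) 3 u" "\<And>i. i < 3 \<Longrightarrow> F p (u i) = l i *\<^sub>R u i"
    and j: "j < 3" "l j < 0" "\<And>i. i < 3 \<Longrightarrow> i \<noteq> j \<Longrightarrow> 0 < l i" and lam: "lam p = l j"
    and l0: "l 0 + l 1 + l 2 = 0" and t2: "tr2 p = l 0 * l 0 + l 1 * l 1 + l 2 * l 2"
    by (rule split_at[OF p]) (rule that; assumption)
  have uN: "u i \<in> N p" if "i < 3" for i using orthonormal_frame_mem[OF u(1) that] .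
  obtain U where U: "openin M U" "p \<in> U" and th: "\<And>w. w \<in> N p \<Longrightarrow> \<exists>t. smooth_section_along A (Z \<inter> U) N t \<and> t p = w"
    using section_through[OF p] by blast
  obtain t where t: "smooth_section_along A (Z \<inter> U) N t" "t p = u j" using th[OF uN[OF j(1)]] by blast
  \<comment> \<open>The value of the quadratic at \<open>\<lambda>\<close> itself, that is
    \<open>3 \<lambda>^2 - c\<close>, the derivative of the cubic; it is nonzero because
    \<open>\<lambda>\<close> is a simple root. Dividing by it gives the section the value
    \<open>u j\<close> at \<open>p\<close>.\<close>
  define \<kappa> where "\<kappa> = l j * l j + l j * l j + (l j * l j - tr2 p / 2)"
  have "\<kappa> \<noteq> 0"
  proof -
    have e: "l 2 = - l 0 - l 1" using l0 by simp
    have j3: "j = 0 \<or> j = 1 \<or> j = 2" using j(1) by auto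
    have "\<kappa> = (l 0 - l 1) * (l 0 - l 2) \<and> j = 0 \<or> \<kappa> = (l 1 - l 0) * (l 1 - l 2) \<and> j = 1 \<or> \<kappa> = (l 2 - l 0) * (l 2 - l 1) \<and> j = 2"
      using j3 unfolding \<kappa>_def t2 by (elim disjE) (simp_all add: e field_simps)
    moreover have "l j \<noteq> l i" if "i < 3" "i \<noteq> j" for i using j(2) j(3)[OF that] by simp
    ultimately show ?thesis by auto
  qed
  define k where "k q = (1 / \<kappa>) *\<^sub>R (F q (F q (t q)) + (lam q *\<^sub>R F q (t q) + (lam q * lam q - tr2 q / 2) *\<^sub>R t q))" for q
  have fl: "smooth_function_along A (Z \<inter> U) lam" "smooth_function_along A (Z \<inter> U) tr2"
    using function_mono[OF lam_smooth] function_mono[OF traces_smooth(1)] by blast+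
  have "smooth_function_along A (Z \<inter> U) (\<lambda>q. lam q * lam q + (- 1 / 2) * tr2 q)"
    by (intro function_add function_mult function_const fl)
  then have fd: "smooth_function_along A (Z \<inter> U) (\<lambda>q. lam q * lam q - tr2 q / 2)"
    by (rule function_cong) simp
  have st: "smooth_field_along A (Z \<inter> U) s" if "smooth_section_along A (Z \<inter> U) N s" for s
    using that by (simp add: smooth_section_along_def)
  have "smooth_section_along A (Z \<inter> U) (\<lambda>p. negative_eigenspace (N p) (F p)) k"
    unfolding smooth_section_along_def
  proof (intro conjI ballI)
    show "smooth_field_along A (Z \<inter> U) k"
      unfolding k_def by (intro field_scaleR field_add function_const fl fd st F_section U(1) t(1))
    fix q assume q: "q \<in> Z \<inter> U"
    then have qZ: "q \<in> Z" and tq: "t q \<in> N q" using t(1) by (auto simp: smooth_section_along_def)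
    show "k q \<in> negative_eigenspace (N q) (F q)"
      unfolding k_def by (rule subspace_scale[OF eigenspaces_at(1)[OF qZ] eigen_projections(2)[OF qZ tq]])
  qed
  moreover have "k p = u j"
  proof -
    have Fc: "F p (c *\<^sub>R u j) = (c * l j) *\<^sub>R u j" for c
      using m(5) uN[OF j(1)] u(2)[OF j(1)] unfolding linear_on_subspace_def by simp
    have "k p = (1 / \<kappa>) *\<^sub>R (\<kappa> *\<^sub>R u j)"
      unfolding k_def t(2) lam u(2)[OF j(1)] Fc
      by (simp only: \<kappa>_def scaleR_add_left add.assoc scaleR_scaleR)
    then show ?thesis using \<open>\<kappa> \<noteq> 0\<close> by simp
  qed
  moreover have "u j \<in> K p" "g p (u j) (u j) = 1"
    using uN[OF j(1)] m(3) orthonormal_frame_inner[OF u(1) j(1) j(1)] by auto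
  ultimately show "\<exists>U k. openin M U \<and> p \<in> U \<and> (\<forall>i<1. smooth_section_along A (Z \<inter> U) (\<lambda>p. negative_eigenspace (N p) (F p)) (k i)) \<and>
      orthonormal_frame (K p) (g p) 1 (\<lambda>i. k i p)"
    using U by (intro exI[of _ U] exI[of _ "\<lambda>_. k"]) (simp add: orthonormal_frame_def)
qed

text \<open>Sections through the two positive eigenvectors at \<open>p\<close> are pushed into the
  bundle by \<open>F - \<lambda>\<close> and divided by \<open>l (x i) - l j\<close>, so that at
  \<open>p\<close> they are those eigenvectors again.\<close>

lemma positive_subbundle: "smooth_subbundle M A Z 2 (\<lambda>p. positive_eigenspace (N p) (F p))"
proof (rule smooth_subbundleI)
  show "subspace (positive_eigenspace (N q) (F q)) \<and> positive_eigenspace (N q) (F q) \<subseteq> K q"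
    "dim (positive_eigenspace (N q) (F q)) = 2" if "q \<in> Z" for q
    using eigenspaces_at[OF that] normal_at_Z(3)[OF that] by auto
  fix p assume p: "p \<in> Z"
  note m = normal_at_Z[OF p]
  obtain u l j where u: "orthonormal_frame (N p) (g p) 3 u" "\<And>i. i < 3 \<Longrightarrow> F p (u i) = l i *\<^sub>R u i"
    and j: "j < 3" "l j < 0" "\<And>i. i < 3 \<Longrightarrow> i \<noteq> j \<Longrightarrow> 0 < l i" and lam: "lam p = l j"
    by (rule split_at[OF p]) (rule that; assumption)
  have uN: "u i \<in> N p" if "i < 3" for i using orthonormal_frame_mem[OF u(1) that] .
  obtain U where U: "openin M U" "p \<in> U" and th: "\<And>w. w \<in> N p \<Longrightarrow> \<exists>t. smooth_section_along A (Z \<inter> U) N t \<and> t p = w"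
    using section_through[OF p] by blast
  \<comment> \<open>The values at 0 and 1 enumerate the two indices different from
    \<open>j\<close>.\<close>
  define x :: "nat \<Rightarrow> nat" where "x i = (if i = 0 then (if j = 0 then 1 else 0) else if j = 2 then 1 else 2)" for i
  have x: "x i < 3" "x i \<noteq> j" for i using j(1) by (auto simp: x_def)
  have x01: "x 0 \<noteq> x 1" using j(1) by (auto simp: x_def)
  have "\<forall>i. \<exists>t. smooth_section_along A (Z \<inter> U) N t \<and> t p = u (x i)" using th uN x(1) by blast
  then have "\<exists>t. \<forall>i. smooth_section_along A (Z \<inter> U) N (t i) \<and> t i p = u (x i)" by (rule choice)
  then obtain t where t: "\<And>i. smooth_section_along A (Z \<inter> U) N (t i)" "\<And>i. t i p = u (x i)" by blast
  define k where "k i q = (1 / (l (x i) - l j)) *\<^sub>R (F q (t i q) + (- lam q) *\<^sub>R t i q)" for i q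
  have fl: "smooth_function_along A (Z \<inter> U) lam" using function_mono[OF lam_smooth] by blast
  have "smooth_function_along A (Z \<inter> U) (\<lambda>q. -1 * lam q)" by (intro function_mult function_const fl)
  then have fm: "smooth_function_along A (Z \<inter> U) (\<lambda>q. - lam q)" by simp
  have st: "smooth_field_along A (Z \<inter> U) s" if "smooth_section_along A (Z \<inter> U) N s" for s
    using that by (simp add: smooth_section_along_def)
  have "smooth_section_along A (Z \<inter> U) (\<lambda>p. positive_eigenspace (N p) (F p)) (k i)" for i
    unfolding smooth_section_along_def
  proof (intro conjI ballI)
    show "smooth_field_along A (Z \<inter> U) (k i)"
      unfolding k_def by (intro field_scaleR field_add function_const fm st F_section U(1) t(1))
    fix q assume q: "q \<in> Z \<inter> U"
    then have qZ: "q \<in> Z" and tq: "t i q \<in> N q" using t(1)[of i] by (auto simp: smooth_section_along_def)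
    show "k i q \<in> positive_eigenspace (N q) (F q)"
      unfolding k_def by (rule subspace_scale[OF eigenspaces_at(2)[OF qZ] eigen_projections(1)[OF qZ tq]])
  qed
  moreover have kp: "k i p = u (x i)" for i
  proof -
    have "l (x i) - l j \<noteq> 0" using j(2) j(3)[OF x(1) x(2), of i] by simp
    moreover have "k i p = (1 / (l (x i) - l j)) *\<^sub>R ((l (x i) - l j) *\<^sub>R u (x i))"
      unfolding k_def t(2) lam u(2)[OF x(1)] by (simp add: scaleR_diff_left)
    ultimately show ?thesis by simp
  qed
  moreover have "orthonormal_frame (K p) (g p) 2 (\<lambda>i. k i p)"
    unfolding orthonormal_frame_def kp
  proof (intro conjI allI impI)
    show "u (x i) \<in> K p" for i using uN[OF x(1)] m(3) by blast
    show "g p (u (x i)) (u (x i')) = (if i = i' then 1 else 0)" if "i < 2" "i' < 2" for i i'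
    proof -
      have "x i = x i' \<longleftrightarrow> i = i'" using x01 x01[symmetric] that by (auto simp: less_2_cases_iff)
      then show ?thesis using orthonormal_frame_inner[OF u(1) x(1) x(1), of i i'] by simp
    qed
  qed
  ultimately show "\<exists>U k. openin M U \<and> p \<in> U \<and> (\<forall>i<2. smooth_section_along A (Z \<inter> U) (\<lambda>p. positive_eigenspace (N p) (F p)) (k i)) \<and>
      orthonormal_frame (K p) (g p) 2 (\<lambda>i. k i p)"
    using U by blast
qed

end

end

section \<open>The splitting of the normal bundle\<close>

theorem mainTheorem5:
  fixes M :: "'a topology"
    and A :: "('a, 'm::{finite,wellorder}) chart set"
    and n :: nat
    and \<omega> g :: "('a, 'm) form2"
    and X :: "'a \<Rightarrow> real^'m::{finite,wellorder}"
  defines "Z \<equiv> singular_locus M n \<omega>"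
  defines "K \<equiv> kernel_at \<omega>"
  defines "N \<equiv> normal_at A Z \<omega> g"
  defines "F \<equiv> normal_endo A Z \<omega> g X"
  assumes dimension: "CARD('m) = 2 * n"
    and orient_manifold: "oriented_smooth_manifold M A"
    and near_symplectic: "near_symplectic M A n \<omega>"
    and metric: "fibre_metric M A Z K g"
    and self_dual: "\<forall>p\<in>Z. D_K A \<omega> p ` K p = self_dual_forms (K p) (g p) (positive_kernel_frame n \<omega> p)"
    and unit_field: "unit_field_spanning A Z (epsilon_at A Z \<omega>) g X"
  shows
    "(\<forall>p\<in>Z. direct_sum UNIV (tangent_space A Z p) (N p)) \<and>
     (\<forall>p\<in>Z. direct_sum (K p) (epsilon_at A Z \<omega> p) (N p)) \<and>
     smooth_bundle_endomorphism M A Z N F \<and>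
     (\<forall>p\<in>Z. self_adjoint_on (N p) (g p) (F p) \<and> trace_on (N p) (F p) = 0 \<and>
             automorphism_on (N p) (F p)) \<and>
     (\<exists>s. continuous_map (subtopology M Z) euclideanreal s \<and> (\<forall>p\<in>Z. s p = 1 \<or> s p = -1) \<and>
          unit_field_spanning A Z (epsilon_at A Z \<omega>) g (\<lambda>p. s p *\<^sub>R X p) \<and>
          sign_convention Z N (normal_endo A Z \<omega> g (\<lambda>p. s p *\<^sub>R X p))) \<and>
     (sign_convention Z N F \<longrightarrow>
        smooth_subbundle M A Z 1 (\<lambda>p. negative_eigenspace (N p) (F p)) \<and>
        smooth_subbundle M A Z 2 (\<lambda>p. positive_eigenspace (N p) (F p)) \<and>
        (\<forall>p\<in>Z. direct_sum (N p) (negative_eigenspace (N p) (F p)) (positive_eigenspace (N p) (F p)) \<and>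
               (\<forall>v\<in>negative_eigenspace (N p) (F p). \<forall>w\<in>positive_eigenspace (N p) (F p). g p v w = 0)))"
proof -
  note defs = Z_def K_def N_def F_def
  interpret M: oriented_atlas M A by unfold_locales (rule orient_manifold)
  interpret S: near_symplectic_setting M A n \<omega> g X
    by unfold_locales (use dimension near_symplectic metric self_dual unit_field in \<open>simp_all only: defs\<close>)
  have ZM: "Z \<subseteq> topspace M" unfolding Z_def by (rule S.Z_subset)
  have 1: "\<forall>p\<in>Z. direct_sum UNIV (tangent_space A Z p) (N p)"
    and 2: "\<forall>p\<in>Z. direct_sum (K p) (epsilon_at A Z \<omega> p) (N p)"
    unfolding defs using S.direct_sums by blast+
  have 3: "smooth_bundle_endomorphism M A Z N F"
    unfolding smooth_bundle_endomorphism_def defs using S.normal_at_Z(5,6) S.F_section by blast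
  have 4: "\<forall>p\<in>Z. self_adjoint_on (N p) (g p) (F p) \<and> trace_on (N p) (F p) = 0 \<and> automorphism_on (N p) (F p)"
    unfolding defs using S.normal_at_Z(8,9) S.automorphism_F by blast
  \<comment> \<open>A smooth function along Z is continuous; with values 1 and -1 it is a locally
    constant change of sign.\<close>
  have "continuous_map (subtopology M Z) euclideanreal S.orient"
    by (rule M.smooth_function_along_continuous[OF _ ZM]) (unfold Z_def, rule S.orient_smooth)
  moreover have "\<forall>p\<in>Z. S.orient p = 1 \<or> S.orient p = -1"
    unfolding Z_def using S.orient_at(1) by blast
  ultimately have 5: "\<exists>s. continuous_map (subtopology M Z) euclideanreal s \<and> (\<forall>p\<in>Z. s p = 1 \<or> s p = -1) \<and>
          unit_field_spanning A Z (epsilon_at A Z \<omega>) g (\<lambda>p. s p *\<^sub>R X p) \<and>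
          sign_convention Z N (normal_endo A Z \<omega> g (\<lambda>p. s p *\<^sub>R X p))"
    using S.oriented_unit_field S.oriented_sign_convention unfolding Z_def N_def by (intro exI[of _ S.orient]) simp
  have 6: "smooth_subbundle M A Z 1 (\<lambda>p. negative_eigenspace (N p) (F p)) \<and>
        smooth_subbundle M A Z 2 (\<lambda>p. positive_eigenspace (N p) (F p)) \<and>
        (\<forall>p\<in>Z. direct_sum (N p) (negative_eigenspace (N p) (F p)) (positive_eigenspace (N p) (F p)) \<and>
               (\<forall>v\<in>negative_eigenspace (N p) (F p). \<forall>w\<in>positive_eigenspace (N p) (F p). g p v w = 0))"
    if "sign_convention Z N F"
    using S.negative_subbundle[OF that[unfolded defs]] S.positive_subbundle[OF that[unfolded defs]]
      S.eigenspaces_at(7,8)[OF that[unfolded defs]] unfolding defs by blast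
  show ?thesis using 1 2 3 4 5 6 by blast
qed

end
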